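(* Let $G$ be a locally compact group and $1<p<\infty$. Then the Herz algebra $A_p(G)$ is Arens regular if and only if $G$ is a discrete group and for each countable subgroup $H$ of $G$, $A_p(H)$ is Arens regular.
   Context: For a locally compact group $G$ with left Haar measure and $1<p<\infty$, $\frac1p+\frac1q=1$, $A_p(G)$ is the space of functions $u=\sum_{i=1}^\infty g_i*f_i^{\vee}$ with $f_i\in L_p(G)$, $g_i\in L_q(G)$, $\sum_i\|f_i\|_p\|g_i\|_q<\infty$, where $f^{\vee}(x)=f(x^{-1})$; with pointwise multiplication and norm $\|u\|_{A_p(G)}=\inf\{\sum_i\|f_i\|_p\|g_i\|_q\}$ over all such representations it is a commutative Banach algebra (the Herz algebra). A Banach algebra $A$ is Arens regular if the two Arens products on $A^{**}$ coincide; equivalently, for all sequences $(a_n),(b_m)$ in the closed unit ball of $A$ and all $T\in A^*$, the iterated limits $\lim_n\lim_m T(a_nb_m)$ and $\lim_m\lim_n T(a_nb_m)$ are equal whenever both exist. *)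

theory Defs
  imports "HOL-Analysis.Analysis" "HOL-Algebra.Group"
begin

definition lc_group :: "('a, 'b) monoid_scheme \<Rightarrow> 'a topology \<Rightarrow> bool" where
  "lc_group G T \<longleftrightarrow> group G \<and> topspace T = carrier G \<and> Hausdorff_space T
     \<and> locally_compact_space T
     \<and> continuous_map (prod_topology T T) T (\<lambda>(x, y). x \<otimes>\<^bsub>G\<^esub> y)
     \<and> continuous_map T T (\<lambda>x. inv\<^bsub>G\<^esub> x)"

definition left_haar :: "('a, 'b) monoid_scheme \<Rightarrow> 'a topology \<Rightarrow> 'a measure \<Rightarrow> bool" where
  "left_haar G T M \<longleftrightarrow>
     space M = carrier G
   \<and> sets M = sigma_sets (topspace T) {U. openin T U}
   \<and> emeasure M (carrier G) \<noteq> 0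
   \<and> (\<forall>K. compactin T K \<longrightarrow> emeasure M K < \<infinity>)
   \<and> (\<forall>A \<in> sets M. emeasure M A = (INF U \<in> {U. openin T U \<and> A \<subseteq> U}. emeasure M U))
   \<and> (\<forall>U. openin T U \<longrightarrow> emeasure M U = (SUP K \<in> {K. compactin T K \<and> K \<subseteq> U}. emeasure M K))
   \<and> (\<forall>g \<in> carrier G. \<forall>A \<in> sets M.
        (\<lambda>x. g \<otimes>\<^bsub>G\<^esub> x) ` A \<in> sets M \<and> emeasure M ((\<lambda>x. g \<otimes>\<^bsub>G\<^esub> x) ` A) = emeasure M A)"

definition lp_fun :: "'a measure \<Rightarrow> real \<Rightarrow> ('a \<Rightarrow> complex) \<Rightarrow> bool" where
  "lp_fun M p f \<longleftrightarrow> f \<in> borel_measurable M \<and> (\<integral>\<^sup>+ x. ennreal (cmod (f x) powr p) \<partial>M) < \<infinity>"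

definition lp_norm :: "'a measure \<Rightarrow> real \<Rightarrow> ('a \<Rightarrow> complex) \<Rightarrow> real" where
  "lp_norm M p f = enn2real (\<integral>\<^sup>+ x. ennreal (cmod (f x) powr p) \<partial>M) powr (1 / p)"

text \<open>Convolution \<open>(g * f\<^sup>\<vee>)(x) = \<integral> g(y) f\<^sup>\<vee>(y\<^sup>-\<^sup>1 x) dy = \<integral> g(y) f(x\<^sup>-\<^sup>1 y) dy\<close>.\<close>
definition conv_check :: "('a, 'b) monoid_scheme \<Rightarrow> 'a measure \<Rightarrow> ('a \<Rightarrow> complex) \<Rightarrow> ('a \<Rightarrow> complex) \<Rightarrow> 'a \<Rightarrow> complex" where
  "conv_check G M g f x = (\<integral> y. g y * f (inv\<^bsub>G\<^esub> x \<otimes>\<^bsub>G\<^esub> y) \<partial>M)"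

definition conj_exp :: "real \<Rightarrow> real" where
  "conj_exp p = p / (p - 1)"

definition herz_rep :: "('a, 'b) monoid_scheme \<Rightarrow> 'a measure \<Rightarrow> real \<Rightarrow> ('a \<Rightarrow> complex)
    \<Rightarrow> (nat \<Rightarrow> 'a \<Rightarrow> complex) \<Rightarrow> (nat \<Rightarrow> 'a \<Rightarrow> complex) \<Rightarrow> bool" where
  "herz_rep G M p u f g \<longleftrightarrow>
     (\<forall>i. lp_fun M p (f i) \<and> lp_fun M (conj_exp p) (g i))
   \<and> summable (\<lambda>i. lp_norm M p (f i) * lp_norm M (conj_exp p) (g i))
   \<and> (\<forall>x \<in> carrier G. (\<lambda>i. conv_check G M (g i) (f i) x) sums u x)
   \<and> (\<forall>x. x \<notin> carrier G \<longrightarrow> u x = 0)"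

definition herz :: "('a, 'b) monoid_scheme \<Rightarrow> 'a measure \<Rightarrow> real \<Rightarrow> ('a \<Rightarrow> complex) set" where
  "herz G M p = {u. \<exists>f g. herz_rep G M p u f g}"

definition herz_norm :: "('a, 'b) monoid_scheme \<Rightarrow> 'a measure \<Rightarrow> real \<Rightarrow> ('a \<Rightarrow> complex) \<Rightarrow> real" where
  "herz_norm G M p u = Inf {(\<Sum>i. lp_norm M p (f i) * lp_norm M (conj_exp p) (g i)) | f g. herz_rep G M p u f g}"

definition lin_on :: "('a \<Rightarrow> complex) set \<Rightarrow> (('a \<Rightarrow> complex) \<Rightarrow> complex) \<Rightarrow> bool" where
  "lin_on A T \<longleftrightarrow> (\<forall>u\<in>A. \<forall>v\<in>A. T (\<lambda>x. u x + v x) = T u + T v)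
                 \<and> (\<forall>c. \<forall>u\<in>A. T (\<lambda>x. c * u x) = c * T u)"

definition dual_sp :: "('a \<Rightarrow> complex) set \<Rightarrow> (('a \<Rightarrow> complex) \<Rightarrow> real) \<Rightarrow> (('a \<Rightarrow> complex) \<Rightarrow> complex) set" where
  "dual_sp A N = {T. lin_on A T \<and> (\<exists>C. \<forall>u\<in>A. cmod (T u) \<le> C * N u) \<and> (\<forall>u. u \<notin> A \<longrightarrow> T u = 0)}"

definition dual_norm :: "('a \<Rightarrow> complex) set \<Rightarrow> (('a \<Rightarrow> complex) \<Rightarrow> real) \<Rightarrow> (('a \<Rightarrow> complex) \<Rightarrow> complex) \<Rightarrow> real" where
  "dual_norm A N T = Sup ((\<lambda>u. cmod (T u)) ` {u \<in> A. N u \<le> 1})"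

definition bidual_sp :: "('a \<Rightarrow> complex) set \<Rightarrow> (('a \<Rightarrow> complex) \<Rightarrow> real)
    \<Rightarrow> ((('a \<Rightarrow> complex) \<Rightarrow> complex) \<Rightarrow> complex) set" where
  "bidual_sp A N = {\<Phi>.
      (\<forall>T\<in>dual_sp A N. \<forall>S\<in>dual_sp A N. \<Phi> (\<lambda>u. T u + S u) = \<Phi> T + \<Phi> S)
    \<and> (\<forall>c. \<forall>T\<in>dual_sp A N. \<Phi> (\<lambda>u. c * T u) = c * \<Phi> T)
    \<and> (\<exists>C. \<forall>T\<in>dual_sp A N. cmod (\<Phi> T) \<le> C * dual_norm A N T)
    \<and> (\<forall>T. T \<notin> dual_sp A N \<longrightarrow> \<Phi> T = 0)}"

definition fa_act :: "('a \<Rightarrow> complex) set \<Rightarrow> (('a \<Rightarrow> complex) \<Rightarrow> complex) \<Rightarrow> ('a \<Rightarrow> complex) \<Rightarrow> (('a \<Rightarrow> complex) \<Rightarrow> complex)" where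
  "fa_act A T a = (\<lambda>b. if b \<in> A then T (\<lambda>x. a x * b x) else 0)"

definition af_act :: "('a \<Rightarrow> complex) set \<Rightarrow> ('a \<Rightarrow> complex) \<Rightarrow> (('a \<Rightarrow> complex) \<Rightarrow> complex) \<Rightarrow> (('a \<Rightarrow> complex) \<Rightarrow> complex)" where
  "af_act A a T = (\<lambda>b. if b \<in> A then T (\<lambda>x. b x * a x) else 0)"

definition mf_act :: "('a \<Rightarrow> complex) set \<Rightarrow> ((('a \<Rightarrow> complex) \<Rightarrow> complex) \<Rightarrow> complex)
    \<Rightarrow> (('a \<Rightarrow> complex) \<Rightarrow> complex) \<Rightarrow> (('a \<Rightarrow> complex) \<Rightarrow> complex)" where
  "mf_act A \<Phi> T = (\<lambda>a. if a \<in> A then \<Phi> (fa_act A T a) else 0)"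

definition fm_act :: "('a \<Rightarrow> complex) set \<Rightarrow> (('a \<Rightarrow> complex) \<Rightarrow> complex)
    \<Rightarrow> ((('a \<Rightarrow> complex) \<Rightarrow> complex) \<Rightarrow> complex) \<Rightarrow> (('a \<Rightarrow> complex) \<Rightarrow> complex)" where
  "fm_act A T \<Phi> = (\<lambda>a. if a \<in> A then \<Phi> (af_act A a T) else 0)"

definition arens1 :: "('a \<Rightarrow> complex) set \<Rightarrow> (('a \<Rightarrow> complex) \<Rightarrow> real)
    \<Rightarrow> ((('a \<Rightarrow> complex) \<Rightarrow> complex) \<Rightarrow> complex) \<Rightarrow> ((('a \<Rightarrow> complex) \<Rightarrow> complex) \<Rightarrow> complex)
    \<Rightarrow> ((('a \<Rightarrow> complex) \<Rightarrow> complex) \<Rightarrow> complex)" where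
  "arens1 A N \<Phi> \<Psi> = (\<lambda>T. if T \<in> dual_sp A N then \<Phi> (mf_act A \<Psi> T) else 0)"

definition arens2 :: "('a \<Rightarrow> complex) set \<Rightarrow> (('a \<Rightarrow> complex) \<Rightarrow> real)
    \<Rightarrow> ((('a \<Rightarrow> complex) \<Rightarrow> complex) \<Rightarrow> complex) \<Rightarrow> ((('a \<Rightarrow> complex) \<Rightarrow> complex) \<Rightarrow> complex)
    \<Rightarrow> ((('a \<Rightarrow> complex) \<Rightarrow> complex) \<Rightarrow> complex)" where
  "arens2 A N \<Phi> \<Psi> = (\<lambda>T. if T \<in> dual_sp A N then \<Psi> (fm_act A T \<Phi>) else 0)"

definition arens_regular :: "('a \<Rightarrow> complex) set \<Rightarrow> (('a \<Rightarrow> complex) \<Rightarrow> real) \<Rightarrow> bool" where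
  "arens_regular A N \<longleftrightarrow>
     (\<forall>\<Phi> \<in> bidual_sp A N. \<forall>\<Psi> \<in> bidual_sp A N. arens1 A N \<Phi> \<Psi> = arens2 A N \<Phi> \<Psi>)"

definition herz_arens_regular :: "('a, 'b) monoid_scheme \<Rightarrow> 'a measure \<Rightarrow> real \<Rightarrow> bool" where
  "herz_arens_regular G M p \<longleftrightarrow> arens_regular (herz G M p) (herz_norm G M p)"

end

theory Submission
  imports Defs
begin

text \<open>
  If \<open>G\<close> is not discrete, a product of dyadic digits \<open>d\<^sub>j\<close> tending quickly to \<open>\<one>\<close> embeds the dyadic
  tree in \<open>G\<close>. Since the kernel \<open>u(x\<^sub>w\<^sub>' x\<^sub>w\<^sup>-\<^sup>1)\<close> of an atom of the Herz algebra is an average of product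
  kernels, the martingale transform with alternating signs defines, by Burkholder's inequality, bounded
  functionals on the algebra. On a decreasing sequence of bump functions \<open>u\<^sub>n\<close> with \<open>u\<^sub>i u\<^sub>j = u\<^sub>j\<close> for
  \<open>i < j\<close> their limit takes values close to \<open>\<plusminus>1/3\<close> with alternating signs, and the iterated limits along even and odd
  indices differ.

  For discrete \<open>G\<close>, extension by zero and restriction make \<open>A\<^sub>p(H)\<close> a contractive retract of \<open>A\<^sub>p(G)\<close>
  for every subgroup \<open>H\<close>. Elements of \<open>A\<^sub>p(G)\<close> have countable support, so a pair of sequences with different iterated
  limits already lives on a countable subgroup.
\<close>

section \<open>Arens regularity and iterated limits\<close>

text \<open>Functionals on the Herz algebra act like convolution operators on L_p, and a general
  group offers no abelian subgroup or Fourier transform to produce singular ones. Unconditionality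
  of martingale differences holds for all 1 < p < infinity with a constant that ignores the depth of
  the tree, and it asks of the group only a choice of points. The value 1/3 is the sum 1/2 - 1/4 +
  1/8 - ...: every digit that a bump resolves contributes a power of 1/2 with alternating sign, and
  one more digit flips the sign of the total. Three obstacles shape the rest. The definition speaks
  of the bidual, so iterated limits are turned into functionals by generalized limits, and back by
  Goldstine's theorem with a diagonal choice. Closure of the algebra under products has to be
  proved; since Haar measure need not be sigma-finite, finite Riemann sums take the place of
  Fubini's theorem. Finally \<open>\<nu>\<close> is any Haar measure of a subgroup; as 1/p + 1/q =
  1, rescaling Haar measure changes neither the algebra nor its norm, and everything reduces to
  counting measure.\<close>

lemma generalized_limit_exists:
  obtains L :: "(nat \<Rightarrow> complex) \<Rightarrow> complex"
  where "\<And>s t. bounded (range s) \<Longrightarrow> bounded (range t) \<Longrightarrow> L (\<lambda>n. s n + t n) = L s + L t"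
    and "\<And>c s. bounded (range s) \<Longrightarrow> L (\<lambda>n. c * s n) = c * L s"
    and "\<And>s B. (\<And>n. cmod (s n) \<le> B) \<Longrightarrow> cmod (L s) \<le> B"
    and "\<And>s l. s \<longlonglongrightarrow> l \<Longrightarrow> L s = l"
proof -
  \<comment> \<open>Evaluations are cut to 0 on unbounded sequences, so that all \<open>ev n\<close>
    lie in a product of compact sets. By Tychonoff they have a cluster point, whose coordinates are
    the generalized limits.\<close>
  define K :: "(nat \<Rightarrow> complex) \<Rightarrow> complex set" where "K s = (if bounded (range s) then closure (range s) else {0})" for s
  define ev :: "nat \<Rightarrow> (nat \<Rightarrow> complex) \<Rightarrow> complex" where "ev n s = (if bounded (range s) then s n else 0)" for n s
  have "compactin (product_topology (\<lambda>i. euclidean) UNIV) (Pi\<^sub>E UNIV K)"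
    unfolding compactin_PiE by (auto simp: K_def)
  then have cpt: "compact (Pi\<^sub>E UNIV K)"
    by (simp add: euclidean_product_topology)
  define F where "F = filtermap ev sequentially"
  have "F \<noteq> bot" by (simp add: F_def filtermap_bot_iff)
  moreover have "eventually (\<lambda>x. x \<in> Pi\<^sub>E UNIV K) F"
    unfolding F_def eventually_filtermap
    by (rule always_eventually) (auto simp: ev_def K_def closure_subset[THEN subsetD])
  ultimately obtain L where L: "inf (nhds L) F \<noteq> bot"
    using cpt unfolding compact_filter by meson
  define G where "G = inf (nhds L) F"
  have Gnb: "G \<noteq> bot" using L by (simp add: G_def)
  \<comment> \<open>Whatever holds for every \<open>ev n\<close> holds eventually in
    \<open>G\<close> and passes to the limit; linearity and the norm bound are instances.\<close>
  have GF: "eventually P G" if "\<And>n. P (ev n)" for P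
    by (metis (no_types, lifting) F_def G_def always_eventually eventually_filtermap filter_leD inf.cobounded2 that)
  have lim: "((\<lambda>x. x s) \<longlongrightarrow> L s) G" for s
  proof -
    have c: "continuous_on UNIV (\<lambda>x::(nat \<Rightarrow> complex) \<Rightarrow> complex. x s)"
      by (rule continuous_on_product_coordinates)
    have "((\<lambda>x. x s) \<longlongrightarrow> L s) (nhds L)"
    proof (rule topological_tendstoI)
      fix S assume "open S" "L s \<in> S"
      then show "eventually (\<lambda>x. x s \<in> S) (nhds L)"
        unfolding eventually_nhds
        by (intro exI[of _ "(\<lambda>x. x s) -` S"]) (auto intro: open_vimage c)
    qed
    then show ?thesis unfolding G_def by (rule tendsto_mono[rotated]) simp
  qed
  show thesis
  proof
    fix s t :: "nat \<Rightarrow> complex" assume b: "bounded (range s)" "bounded (range t)"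
    then have b': "bounded (range (\<lambda>n. s n + t n))" by (rule bounded_plus_comp)
    have "eventually (\<lambda>x. x (\<lambda>n. s n + t n) = x s + x t) G"
      by (rule GF) (simp add: ev_def b b')
    then have "((\<lambda>x. x s + x t) \<longlongrightarrow> L (\<lambda>n. s n + t n)) G"
      using lim[of "\<lambda>n. s n + t n"] by (rule Lim_transform_eventually[rotated])
    moreover have "((\<lambda>x. x s + x t) \<longlongrightarrow> L s + L t) G" by (intro tendsto_add lim)
    ultimately show "L (\<lambda>n. s n + t n) = L s + L t" using Gnb tendsto_unique by blast
  next
    fix c and s :: "nat \<Rightarrow> complex" assume b: "bounded (range s)"
    then have b': "bounded (range (\<lambda>n. c * s n))" 
      by (metis bounded_linear_mult_right bounded_linear_image[of "range s" "(*) c"] image_image)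
    have "eventually (\<lambda>x. x (\<lambda>n. c * s n) = c * x s) G"
      by (rule GF) (simp add: ev_def b b')
    then have "((\<lambda>x. c * x s) \<longlongrightarrow> L (\<lambda>n. c * s n)) G"
      using lim[of "\<lambda>n. c * s n"] by (rule Lim_transform_eventually[rotated])
    moreover have "((\<lambda>x. c * x s) \<longlongrightarrow> c * L s) G" by (intro tendsto_intros lim)
    ultimately show "L (\<lambda>n. c * s n) = c * L s" using Gnb tendsto_unique by blast
  next
    fix s :: "nat \<Rightarrow> complex" and B assume b: "\<And>n. cmod (s n) \<le> B"
    then have "0 \<le> B" using norm_ge_zero order_trans by blast
    then have "eventually (\<lambda>x. norm (x s) \<le> B) G"
      by (intro GF) (simp add: ev_def b)
    then show "cmod (L s) \<le> B" using lim[of s] Gnb by (metis tendsto_norm tendsto_upperbound)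
  next
    fix s :: "nat \<Rightarrow> complex" and l assume l: "s \<longlonglongrightarrow> l"
    then have b: "bounded (range s)" by (rule convergent_imp_bounded)
    have "((\<lambda>x. x s) \<longlongrightarrow> l) F"
      unfolding F_def filterlim_filtermap using l b by (simp add: ev_def)
    then have "((\<lambda>x. x s) \<longlongrightarrow> l) G" unfolding G_def by (rule tendsto_mono[rotated]) simp
    then show "L s = l" using lim Gnb tendsto_unique by blast
  qed
qed

text \<open>Collects what the double limit criterion uses of a Herz algebra: closure under pointwise
  operations and a submultiplicative seminorm. It is instantiated for the group and for its
  subgroups, so the criterion is proved once.\<close>

locale fun_alg =
  fixes A :: "('a \<Rightarrow> complex) set" and N :: "('a \<Rightarrow> complex) \<Rightarrow> real"
  assumes zero_mem: "(\<lambda>x. 0) \<in> A"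
    and add_mem: "u \<in> A \<Longrightarrow> v \<in> A \<Longrightarrow> (\<lambda>x. u x + v x) \<in> A"
    and scale_mem: "u \<in> A \<Longrightarrow> (\<lambda>x. c * u x) \<in> A"
    and mult_mem: "u \<in> A \<Longrightarrow> v \<in> A \<Longrightarrow> (\<lambda>x. u x * v x) \<in> A"
    and N_nonneg: "u \<in> A \<Longrightarrow> 0 \<le> N u"
    and N_add: "u \<in> A \<Longrightarrow> v \<in> A \<Longrightarrow> N (\<lambda>x. u x + v x) \<le> N u + N v"
    and N_scale: "u \<in> A \<Longrightarrow> N (\<lambda>x. c * u x) \<le> cmod c * N u"
    and N_mult: "u \<in> A \<Longrightarrow> v \<in> A \<Longrightarrow> N (\<lambda>x. u x * v x) \<le> N u * N v"
begin

abbreviation "D \<equiv> dual_sp A N"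

lemma N_zero: "N (\<lambda>x. 0) = 0"
  using N_scale[OF zero_mem, of 0] N_nonneg[OF zero_mem] by simp

lemma dual_add: "T \<in> D \<Longrightarrow> u \<in> A \<Longrightarrow> v \<in> A \<Longrightarrow> T (\<lambda>x. u x + v x) = T u + T v"
  and dual_scale: "T \<in> D \<Longrightarrow> u \<in> A \<Longrightarrow> T (\<lambda>x. c * u x) = c * T u"
  by (auto simp: dual_sp_def lin_on_def)

lemma dual_bound:
  assumes "T \<in> D"
  obtains C where "0 \<le> C" "\<And>u. u \<in> A \<Longrightarrow> cmod (T u) \<le> C * N u"
proof -
  obtain C where C: "\<And>u. u \<in> A \<Longrightarrow> cmod (T u) \<le> C * N u"
    using assms by (auto simp: dual_sp_def)
  have "cmod (T u) \<le> max C 0 * N u" if "u \<in> A" for u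
    using C[OF that] N_nonneg[OF that] by (smt (verit) mult_right_mono)
  then show thesis using that[of "max C 0"] by simp
qed

lemma dual_norm_le:
  assumes "\<And>u. u \<in> A \<Longrightarrow> N u \<le> 1 \<Longrightarrow> cmod (T u) \<le> B"
  shows "dual_norm A N T \<le> B"
  unfolding dual_norm_def using zero_mem N_zero assms
  by (intro cSUP_least) auto

lemma bdd_dual_norm:
  assumes "T \<in> D" shows "bdd_above ((\<lambda>u. cmod (T u)) ` {u \<in> A. N u \<le> 1})"
proof -
  obtain C where C: "0 \<le> C" "\<And>u. u \<in> A \<Longrightarrow> cmod (T u) \<le> C * N u"
    using dual_bound[OF assms] by blast
  show ?thesis
  proof (rule bdd_aboveI2)
    fix u assume "u \<in> {u \<in> A. N u \<le> 1}"
    then show "cmod (T u) \<le> C" using C(2)[of u] C(1) mult_left_mono[of "N u" 1 C] by auto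
  qed
qed

lemma norm_le_dual_norm:
  assumes "T \<in> D" "u \<in> A" "N u \<le> 1" shows "cmod (T u) \<le> dual_norm A N T"
  unfolding dual_norm_def using assms by (intro cSUP_upper bdd_dual_norm) auto

lemma norm_le_dual_norm_mult:
  assumes "T \<in> D" "u \<in> A" "N u \<le> R" "0 < R" shows "cmod (T u) \<le> R * dual_norm A N T"
proof -
  have "cmod (complex_of_real (1/R)) * N u \<le> 1"
    using assms(3,4) by (simp add: norm_divide)
  then have "N (\<lambda>x. complex_of_real (1/R) * u x) \<le> 1"
    using N_scale[OF assms(2), of "complex_of_real (1/R)"] by linarith
  then have "cmod (T (\<lambda>x. complex_of_real (1/R) * u x)) \<le> dual_norm A N T"
    by (intro norm_le_dual_norm scale_mem assms)
  then have "cmod (T u) / R \<le> dual_norm A N T"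
    unfolding dual_scale[OF assms(1,2)] using assms(4) by (simp add: norm_divide)
  then show ?thesis using assms(4) by (simp add: pos_divide_le_eq mult.commute)
qed

lemma dual_norm_nonneg: "T \<in> D \<Longrightarrow> 0 \<le> dual_norm A N T"
  using norm_le_dual_norm[OF _ zero_mem] N_zero norm_ge_zero order_trans by (metis zero_le_one)

lemma dual_add_mem: "T \<in> D \<Longrightarrow> S \<in> D \<Longrightarrow> (\<lambda>u. T u + S u) \<in> D"
proof -
  assume T: "T \<in> D" and S: "S \<in> D"
  obtain C where C: "0 \<le> C" "\<And>u. u \<in> A \<Longrightarrow> cmod (T u) \<le> C * N u" using dual_bound[OF T] by blast
  obtain E where E: "0 \<le> E" "\<And>u. u \<in> A \<Longrightarrow> cmod (S u) \<le> E * N u" using dual_bound[OF S] by blast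
  have "cmod (T u + S u) \<le> (C + E) * N u" if "u \<in> A" for u
    using norm_triangle_ineq[of "T u" "S u"] C(2)[OF that] E(2)[OF that] by (simp add: algebra_simps)
  then have "\<exists>C. \<forall>u\<in>A. cmod (T u + S u) \<le> C * N u" by blast
  then show ?thesis using T S
    by (simp add: dual_sp_def lin_on_def algebra_simps)
qed

lemma dual_scale_mem: "T \<in> D \<Longrightarrow> (\<lambda>u. c * T u) \<in> D"
proof -
  assume T: "T \<in> D"
  obtain C where C: "0 \<le> C" "\<And>u. u \<in> A \<Longrightarrow> cmod (T u) \<le> C * N u" using dual_bound[OF T] by blast
  have "cmod (c * T u) \<le> (cmod c * C) * N u" if "u \<in> A" for u
    using C(2)[OF that] by (simp add: norm_mult mult.assoc mult_left_mono)
  then have "\<exists>C. \<forall>u\<in>A. cmod (c * T u) \<le> C * N u" by blast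
  then show ?thesis using T
    by (simp add: dual_sp_def lin_on_def algebra_simps)
qed

lemma dual_zero_mem: "(\<lambda>u. 0) \<in> D"
  by (auto simp: dual_sp_def lin_on_def intro!: exI[of _ 0])

lemma fa_act_mem:
  assumes T: "T \<in> D" and a: "a \<in> A" shows "fa_act A T a \<in> D"
proof -
  obtain C where C: "0 \<le> C" "\<And>u. u \<in> A \<Longrightarrow> cmod (T u) \<le> C * N u" using dual_bound[OF T] by blast
  have "cmod (T (\<lambda>x. a x * u x)) \<le> (C * N a) * N u" if "u \<in> A" for u
    using C(2)[OF mult_mem[OF a that]] mult_left_mono[OF N_mult[OF a that] C(1)] by (simp add: mult.assoc)
  then have "\<exists>E. \<forall>u\<in>A. cmod (fa_act A T a u) \<le> E * N u"
    by (intro exI[of _ "C * N a"]) (simp add: fa_act_def)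
  moreover have "fa_act A T a (\<lambda>x. u x + v x) = fa_act A T a u + fa_act A T a v" if "u \<in> A" "v \<in> A" for u v
    using dual_add[OF T mult_mem[OF a that(1)] mult_mem[OF a that(2)]] that
    by (simp add: fa_act_def add_mem algebra_simps)
  moreover have "fa_act A T a (\<lambda>x. c * u x) = c * fa_act A T a u" if "u \<in> A" for u c
    using dual_scale[OF T mult_mem[OF a that(1)], of c] that
    by (simp add: fa_act_def scale_mem algebra_simps)
  ultimately show ?thesis by (auto simp: dual_sp_def lin_on_def fa_act_def)
qed

lemma fa_act_norm:
  assumes T: "T \<in> D"
  obtains C where "0 \<le> C" "\<And>a. a \<in> A \<Longrightarrow> dual_norm A N (fa_act A T a) \<le> C * N a"
proof -
  obtain C where C: "0 \<le> C" "\<And>u. u \<in> A \<Longrightarrow> cmod (T u) \<le> C * N u" using dual_bound[OF T] by blast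
  have "dual_norm A N (fa_act A T a) \<le> C * N a" if a: "a \<in> A" for a
  proof (rule dual_norm_le)
    fix u assume u: "u \<in> A" "N u \<le> 1"
    have "N a * N u \<le> N a * 1" by (intro mult_left_mono u N_nonneg a)
    then have "N (\<lambda>x. a x * u x) \<le> N a" using N_mult[OF a u(1)] by simp
    then show "cmod (fa_act A T a u) \<le> C * N a"
      using C(2)[OF mult_mem[OF a u(1)]] mult_left_mono[OF _ C(1)] u by (fastforce simp: fa_act_def)
  qed
  then show thesis using that C by blast
qed

text \<open>Pointwise multiplication commutes, so the two actions on the dual agree, and with them
  the two actions of the bidual on the dual.\<close>

lemma af_act_eq: "af_act A a T = fa_act A T a"
  by (auto simp: af_act_def fa_act_def mult.commute)

lemma fm_act_eq: "fm_act A T \<Phi> = mf_act A \<Phi> T"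
  by (auto simp: fm_act_def mf_act_def af_act_eq)

lemma bidual_add: "\<Phi> \<in> bidual_sp A N \<Longrightarrow> T \<in> D \<Longrightarrow> S \<in> D \<Longrightarrow> \<Phi> (\<lambda>u. T u + S u) = \<Phi> T + \<Phi> S"
  and bidual_scale: "\<Phi> \<in> bidual_sp A N \<Longrightarrow> T \<in> D \<Longrightarrow> \<Phi> (\<lambda>u. c * T u) = c * \<Phi> T"
  by (auto simp: bidual_sp_def)

lemma bidual_bound:
  assumes "\<Phi> \<in> bidual_sp A N"
  obtains C where "0 < C" "\<And>T. T \<in> D \<Longrightarrow> cmod (\<Phi> T) \<le> C * dual_norm A N T"
proof -
  obtain C where C: "\<And>T. T \<in> D \<Longrightarrow> cmod (\<Phi> T) \<le> C * dual_norm A N T"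
    using assms unfolding bidual_sp_def by blast
  have "cmod (\<Phi> T) \<le> max C 1 * dual_norm A N T" if "T \<in> D" for T
    using C[OF that] dual_norm_nonneg[OF that] by (smt (verit) mult_right_mono)
  then show thesis using that[of "max C 1"] by simp
qed

lemma mf_act_mem:
  assumes T: "T \<in> D" and P: "\<Phi> \<in> bidual_sp A N" shows "mf_act A \<Phi> T \<in> D"
proof -
  obtain C where C: "0 \<le> C" "\<And>a. a \<in> A \<Longrightarrow> dual_norm A N (fa_act A T a) \<le> C * N a"
    using fa_act_norm[OF T] by blast
  obtain E where E: "0 < E" "\<And>T. T \<in> D \<Longrightarrow> cmod (\<Phi> T) \<le> E * dual_norm A N T"
    using bidual_bound[OF P] by blast
  have "cmod (\<Phi> (fa_act A T a)) \<le> (E * C) * N a" if "a \<in> A" for a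
    using order_trans[OF E(2)[OF fa_act_mem[OF T that]] mult_left_mono[OF C(2)[OF that]]] E(1) by (simp add: mult.assoc)
  then have "\<exists>E. \<forall>u\<in>A. cmod (mf_act A \<Phi> T u) \<le> E * N u"
    by (intro exI[of _ "E * C"]) (simp add: mf_act_def)
  moreover have "mf_act A \<Phi> T (\<lambda>x. u x + v x) = mf_act A \<Phi> T u + mf_act A \<Phi> T v" if "u \<in> A" "v \<in> A" for u v
  proof -
    have "fa_act A T (\<lambda>x. u x + v x) = (\<lambda>b. fa_act A T u b + fa_act A T v b)"
      using dual_add[OF T mult_mem[OF that(1)] mult_mem[OF that(2)]]
      by (auto simp: fa_act_def algebra_simps)
    then show ?thesis using bidual_add[OF P fa_act_mem[OF T that(1)] fa_act_mem[OF T that(2)]] that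
      by (simp add: mf_act_def add_mem)
  qed
  moreover have "mf_act A \<Phi> T (\<lambda>x. c * u x) = c * mf_act A \<Phi> T u" if "u \<in> A" for u c
  proof -
    have "fa_act A T (\<lambda>x. c * u x) = (\<lambda>b. c * fa_act A T u b)"
      using dual_scale[OF T mult_mem[OF that(1)], of _ c]
      by (auto simp: fa_act_def algebra_simps)
    then show ?thesis using bidual_scale[OF P fa_act_mem[OF T that(1)], of c] that
      by (simp add: mf_act_def scale_mem)
  qed
  ultimately show ?thesis by (auto simp: dual_sp_def lin_on_def mf_act_def)
qed

text \<open>Once the actions are identified, the two Arens products differ only in which of the two
  bidual elements acts first.\<close>

lemma arens_regular_iff:
  "arens_regular A N \<longleftrightarrow>
    (\<forall>\<Phi>\<in>bidual_sp A N. \<forall>\<Psi>\<in>bidual_sp A N. \<forall>T\<in>D. \<Phi> (mf_act A \<Psi> T) = \<Psi> (mf_act A \<Phi> T))"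
  unfolding arens_regular_def arens1_def arens2_def fm_act_eq fun_eq_iff by auto

text \<open>Stands in for a weak-star cluster point of the sequence \<open>a\<close> in the bidual.
  The value 0 off the dual is demanded by \<open>bidual_sp\<close>.\<close>

definition ev_lim :: "((nat \<Rightarrow> complex) \<Rightarrow> complex) \<Rightarrow> (nat \<Rightarrow> 'a \<Rightarrow> complex) \<Rightarrow> (('a \<Rightarrow> complex) \<Rightarrow> complex) \<Rightarrow> complex"
  where "ev_lim L a T = (if T \<in> D then L (\<lambda>n. T (a n)) else 0)"

definition double_limits :: "(('a \<Rightarrow> complex) \<Rightarrow> complex) \<Rightarrow> (nat \<Rightarrow> 'a \<Rightarrow> complex) \<Rightarrow> (nat \<Rightarrow> 'a \<Rightarrow> complex) \<Rightarrow> complex \<Rightarrow> complex \<Rightarrow> bool"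
  where "double_limits T a b k l \<longleftrightarrow>
    (\<exists>x. (\<forall>n. (\<lambda>m. T (\<lambda>t. a n t * b m t)) \<longlonglongrightarrow> x n) \<and> x \<longlonglongrightarrow> k) \<and>
    (\<exists>y. (\<forall>m. (\<lambda>n. T (\<lambda>t. a n t * b m t)) \<longlonglongrightarrow> y m) \<and> y \<longlonglongrightarrow> l)"

text \<open>With the generalized limits of \<open>a\<close> and \<open>b\<close> as bidual elements,
  the two orders of the pairing are exactly the two iterated limits, because a generalized limit
  agrees with the limit where the latter exists.\<close>

lemma arens_regular_imp_double_limits_eq:
  assumes reg: "arens_regular A N" and T: "T \<in> D"
    and a: "\<And>n. a n \<in> A" "\<And>n. N (a n) \<le> R"
    and b: "\<And>n. b n \<in> A" "\<And>n. N (b n) \<le> R"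
    and dl: "double_limits T a b k l"
  shows "k = l"
proof -
  obtain L :: "(nat \<Rightarrow> complex) \<Rightarrow> complex" where
    L: "\<And>s t. bounded (range s) \<Longrightarrow> bounded (range t) \<Longrightarrow> L (\<lambda>n. s n + t n) = L s + L t"
     "\<And>c s. bounded (range s) \<Longrightarrow> L (\<lambda>n. c * s n) = c * L s"
     "\<And>s B. (\<And>n. cmod (s n) \<le> B) \<Longrightarrow> cmod (L s) \<le> B"
     "\<And>s l. s \<longlonglongrightarrow> l \<Longrightarrow> L s = l"
    using generalized_limit_exists by blast
  \<comment> \<open>A positive radius, since \<open>norm_le_dual_norm_mult\<close> rescales by
    it.\<close>
  define M where "M = max R 1"
  have ev: "ev_lim L c \<in> bidual_sp A N" if c: "\<And>n. c n \<in> A" "\<And>n. N (c n) \<le> R" for c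
  proof -
    have bd: "cmod (S (c n)) \<le> M * dual_norm A N S" if "S \<in> D" for S n
      using norm_le_dual_norm_mult[OF that c(1), of n M] c(2)[of n] by (simp add: M_def)
    then have bdd: "bounded (range (\<lambda>n. S (c n)))" if "S \<in> D" for S
      unfolding bounded_iff using that by blast
    have "\<exists>C. \<forall>S\<in>D. cmod (ev_lim L c S) \<le> C * dual_norm A N S"
      by (intro exI[of _ M] ballI) (simp add: ev_lim_def L(3) bd)
    then show ?thesis
      unfolding bidual_sp_def by (auto simp: ev_lim_def dual_add_mem dual_scale_mem L(1,2) bdd)
  qed
  from dl obtain x y where x: "\<And>n. (\<lambda>m. T (\<lambda>t. a n t * b m t)) \<longlonglongrightarrow> x n" "x \<longlonglongrightarrow> k"
    and y: "\<And>m. (\<lambda>n. T (\<lambda>t. a n t * b m t)) \<longlonglongrightarrow> y m" "y \<longlonglongrightarrow> l"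
    unfolding double_limits_def by blast
  have ea: "ev_lim L a \<in> bidual_sp A N" and eb: "ev_lim L b \<in> bidual_sp A N" using ev a b by auto
  have "mf_act A (ev_lim L b) T (a n) = x n" for n

    using L(4)[OF x(1)] fa_act_mem[OF T a(1)] by (simp add: mf_act_def a ev_lim_def) (simp add: fa_act_def b)
  then have 1: "ev_lim L a (mf_act A (ev_lim L b) T) = k"
    using L(4)[OF x(2)] by (simp add: ev_lim_def mf_act_mem[OF T eb])
  have "mf_act A (ev_lim L a) T (b n) = y n" for n

    using L(4)[OF y(1)] fa_act_mem[OF T b(1)] by (simp add: mf_act_def b ev_lim_def) (simp add: fa_act_def a mult.commute)
  then have 2: "ev_lim L b (mf_act A (ev_lim L a) T) = l"
    using L(4)[OF y(2)] by (simp add: ev_lim_def mf_act_mem[OF T ea])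
  show ?thesis using reg ea eb T 1 2 unfolding arens_regular_iff by metis
qed

section \<open>Goldstine approximation and the diagonal construction of iterated limits\<close>

lemma bidual_sum:
  fixes k :: nat
  assumes P: "\<Phi> \<in> bidual_sp A N" and S: "\<And>i. i < k \<Longrightarrow> S i \<in> D"
  shows "(\<lambda>u. \<Sum>i<k. c i * S i u) \<in> D \<and> \<Phi> (\<lambda>u. \<Sum>i<k. c i * S i u) = (\<Sum>i<k. c i * \<Phi> (S i))"
  using S
proof (induction k)
  case 0
  show ?case using bidual_scale[OF P dual_zero_mem, of 0] dual_zero_mem by simp
next
  case (Suc k)
  then have IH: "(\<lambda>u. \<Sum>i<k. c i * S i u) \<in> D" "\<Phi> (\<lambda>u. \<Sum>i<k. c i * S i u) = (\<Sum>i<k. c i * \<Phi> (S i))"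
    and m: "(\<lambda>u. c k * S k u) \<in> D" using dual_scale_mem by auto
  show ?case
    using dual_add_mem[OF IH(1) m] bidual_add[OF P IH(1) m] bidual_scale[OF P Suc.prems[of k]] IH(2) by simp
qed

lemma convex_comb_mem:
  assumes "a \<in> A" "b \<in> A" "N a \<le> C" "N b \<le> C" "0 \<le> t" "t \<le> 1"
  shows "(\<lambda>x. complex_of_real (1 - t) * a x + complex_of_real t * b x) \<in> A"
    and "N (\<lambda>x. complex_of_real (1 - t) * a x + complex_of_real t * b x) \<le> C"
proof -
  show "(\<lambda>x. complex_of_real (1 - t) * a x + complex_of_real t * b x) \<in> A"
    by (intro add_mem scale_mem assms)
  have "N (\<lambda>x. complex_of_real (1 - t) * a x + complex_of_real t * b x)
     \<le> cmod (complex_of_real (1 - t)) * N a + cmod (complex_of_real t) * N b"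
    by (intro order_trans[OF N_add] scale_mem assms add_mono N_scale)
  also have "\<dots> = (1 - t) * N a + t * N b"
    using assms by (simp only: norm_of_real)
  also have "\<dots> \<le> (1 - t) * C + t * C" using assms by (intro add_mono mult_left_mono) auto
  finally show "N (\<lambda>x. complex_of_real (1 - t) * a x + complex_of_real t * b x) \<le> C"
    by (simp add: algebra_simps)
qed

text \<open>Goldstine's theorem, without Hahn--Banach: a near-minimizer \<open>a\<close> over the ball of the Euclidean
  distance of \<open>(S\<^sub>i a)\<^sub>i\<close> to \<open>(\<Phi> S\<^sub>i)\<^sub>i\<close> yields, through the difference vector, a functional on which
  \<open>\<Phi>\<close> exceeds its norm unless the distance vanishes.\<close>
lemma goldstine:
  fixes k :: nat
  assumes P: "\<Phi> \<in> bidual_sp A N" and C: "0 < C" "\<And>T. T \<in> D \<Longrightarrow> cmod (\<Phi> T) \<le> C * dual_norm A N T"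
    and S: "\<And>i. i < k \<Longrightarrow> S i \<in> D" and e: "0 < e"
  obtains a where "a \<in> A" "N a \<le> C" "\<forall>i<k. cmod (S i a - \<Phi> (S i)) < e"
proof -
  define q where "q a = (\<Sum>i<k. (cmod (\<Phi> (S i) - S i a))\<^sup>2)" for a
  define Q where "Q = q ` {a \<in> A. N a \<le> C}"
  have q0: "0 \<le> q a" for a by (simp add: q_def sum_nonneg)
  have Qne: "Q \<noteq> {}" using zero_mem N_zero C(1) by (auto simp: Q_def)
  have Qbd: "bdd_below Q" using q0 by (auto simp: Q_def intro!: bdd_belowI[of _ 0])
  define d where "d = Inf Q"
  define E where "E = (\<Sum>i<k. (2 * (C * dual_norm A N (S i)))\<^sup>2)"
  have E: "(\<Sum>i<k. (cmod (S i b - S i a))\<^sup>2) \<le> E" if "a \<in> A" "N a \<le> C" "b \<in> A" "N b \<le> C" for a b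
    unfolding E_def
  proof (intro sum_mono power_mono)
    fix i assume "i \<in> {..<k}"
    then have "S i \<in> D" using S by simp
    from norm_le_dual_norm_mult[OF this that(1,2) C(1)] norm_le_dual_norm_mult[OF this that(3,4) C(1)]
    show "cmod (S i b - S i a) \<le> 2 * (C * dual_norm A N (S i))"
      using norm_triangle_ineq4[of "S i b" "S i a"] by linarith
  qed simp
  \<comment> \<open>First-order optimality. A step of length \<open>t\<close> from the
    near-minimizer \<open>a\<close> towards any \<open>b\<close> in the ball cannot push
    \<open>q\<close> below \<open>d\<close>. The slack t^2 in the choice of \<open>a\<close> has the
    order of the quadratic term of the expansion, so dividing by \<open>t\<close> leaves a bound on
    \<open>Re (F b) - Re (F a)\<close> of order \<open>t\<close>.\<close>
  have key: "d \<le> t * ((1 + E) / 2)" if t: "0 < t" "t \<le> 1" for t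
  proof -
    have "Inf Q < d + t\<^sup>2" using t by (simp add: d_def)
    then obtain a where a: "a \<in> A" "N a \<le> C" "q a < d + t\<^sup>2"
      using cInf_less_iff[OF Qne Qbd] by (auto simp: Q_def)
    define r where "r i = \<Phi> (S i) - S i a" for i
    define F where "F u = (\<Sum>i<k. cnj (r i) * S i u)" for u
    have F: "F \<in> D" "\<Phi> F = (\<Sum>i<k. cnj (r i) * \<Phi> (S i))"
      using bidual_sum[OF P S, where k = k and c = "\<lambda>i. cnj (r i)"] by (auto simp: F_def[abs_def])
    define K where "K = Re (F a) + t * ((1 + E) / 2)"
    have Re: "Re (F b) \<le> K" if b: "b \<in> A" "N b \<le> C" for b
    proof -
      define c where "c = (\<lambda>x. complex_of_real (1 - t) * a x + complex_of_real t * b x)"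
      have c: "c \<in> A" "N c \<le> C" using convex_comb_mem[OF a(1) b(1) a(2) b(2), of t] t by (auto simp: c_def)
      have "d \<le> q c" unfolding d_def Q_def using c q0 by (intro cInf_lower) (auto intro!: bdd_belowI[of _ 0])
      have Sc: "S i c = complex_of_real (1 - t) * S i a + complex_of_real t * S i b" if "i < k" for i
        unfolding c_def dual_add[OF S[OF that] scale_mem[OF a(1)] scale_mem[OF b(1)]]
        using dual_scale[OF S[OF that]] a b by simp
      have sq: "(cmod (z - (complex_of_real (1 - t) * x + complex_of_real t * y)))\<^sup>2
          = (cmod (z - x))\<^sup>2 - 2 * t * Re (cnj (z - x) * (y - x)) + t\<^sup>2 * (cmod (y - x))\<^sup>2" for x y z
        unfolding cmod_power2 by (simp add: power2_eq_square algebra_simps)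
      have "q c = (\<Sum>i<k. (cmod (r i))\<^sup>2 - 2 * t * Re (cnj (r i) * (S i b - S i a)) + t\<^sup>2 * (cmod (S i b - S i a))\<^sup>2)"
        unfolding q_def by (rule sum.cong) (simp_all add: Sc sq r_def del: of_real_diff)
      also have "\<dots> = q a - 2 * t * (\<Sum>i<k. Re (cnj (r i) * (S i b - S i a))) + t\<^sup>2 * (\<Sum>i<k. (cmod (S i b - S i a))\<^sup>2)"
        by (simp add: sum.distrib sum_subtractf sum_distrib_left q_def r_def del: times_complex.sel minus_complex.sel)
      also have "(\<Sum>i<k. Re (cnj (r i) * (S i b - S i a))) = Re (F b) - Re (F a)"
        by (simp add: F_def Re_sum sum_subtractf[symmetric] algebra_simps)
      finally have "q c = q a - 2 * t * (Re (F b) - Re (F a)) + t\<^sup>2 * (\<Sum>i<k. (cmod (S i b - S i a))\<^sup>2)" .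
      with \<open>d \<le> q c\<close> a(3) mult_left_mono[OF E[OF a(1,2) b], of "t\<^sup>2"]
      have "2 * t * (Re (F b) - Re (F a)) \<le> t\<^sup>2 + t\<^sup>2 * E" by simp
      then have "t * (2 * (Re (F b) - Re (F a))) \<le> t * (t * (1 + E))"
        by (simp add: power2_eq_square algebra_simps)
      then have "2 * (Re (F b) - Re (F a)) \<le> t * (1 + E)" using t by simp
      then show ?thesis by (simp add: K_def)
    qed
    \<comment> \<open>The ball is invariant under multiplication by numbers of modulus at most 1,
      which upgrades the bound on the real part to one on the modulus.\<close>
    have Fb: "cmod (F b) \<le> K" if b: "b \<in> A" "N b \<le> C" for b
    proof -
      define z where "z = cnj (sgn (F b))"
      have z: "cmod z \<le> 1" by (simp add: z_def norm_sgn)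
      have "z * F b = complex_of_real (cmod (F b))"
        using complex_norm_square[of "F b"]
        by (cases "F b = 0") (simp_all add: z_def sgn_eq power2_eq_square field_simps)
      then have "Re (F (\<lambda>x. z * b x)) = cmod (F b)" using dual_scale[OF F(1) b(1)] by simp
      moreover have "N (\<lambda>x. z * b x) \<le> C"
        using N_scale[OF b(1), of z] mult_right_mono[OF z N_nonneg[OF b(1)]] b(2) by linarith
      ultimately show ?thesis using Re[OF scale_mem[OF b(1), of z]] by simp
    qed
    have "dual_norm A N F \<le> K / C"
    proof (rule dual_norm_le)
      fix u assume u: "u \<in> A" "N u \<le> 1"
      have "N (\<lambda>x. complex_of_real C * u x) \<le> C"
        using order_trans[OF N_scale[OF u(1), of "complex_of_real C"], of C] mult_left_mono[OF u(2), of C] C(1) by auto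
      then have "cmod (F (\<lambda>x. complex_of_real C * u x)) \<le> K" by (intro Fb scale_mem u)
      then show "cmod (F u) \<le> K / C" unfolding dual_scale[OF F(1) u(1)] using C(1)
        by (simp add: norm_mult field_simps)
    qed
    then have "C * dual_norm A N F \<le> K" using C(1) by (simp add: field_simps)
    then have "cmod (\<Phi> F) \<le> K" using C(2)[OF F(1)] by linarith
    then have "Re (\<Phi> F) \<le> K" using complex_Re_le_cmod order_trans by blast
    \<comment> \<open>The coefficients of \<open>F\<close> are the conjugates of the errors
      \<open>r\<close>, so \<open>\<Phi> F - F a\<close> is the squared distance \<open>q a\<close>;
      the bound of \<open>\<Phi> F\<close> by the norm of \<open>F\<close> therefore bounds
      \<open>q a\<close>.\<close>
    moreover have "Re (\<Phi> F) = q a + Re (F a)"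
    proof -
      have "Re (cnj (r i) * \<Phi> (S i)) = (cmod (r i))\<^sup>2 + Re (cnj (r i) * S i a)" for i
        unfolding cmod_power2 r_def by (simp add: power2_eq_square algebra_simps)
      then show ?thesis unfolding F(2) F_def Re_sum q_def r_def by (simp add: sum.distrib)
    qed
    ultimately have "q a \<le> t * ((1 + E) / 2)" by (simp add: K_def)
    moreover have "d \<le> q a" unfolding d_def using a Qbd by (intro cInf_lower) (auto simp: Q_def)
    ultimately show ?thesis by simp
  qed
  have "d \<le> 0"
  proof (rule ccontr)
    assume "\<not> d \<le> 0"
    have E0: "0 \<le> E" by (simp add: E_def sum_nonneg)
    define t where "t = min 1 (d / (1 + E))"
    have t: "0 < t" "t \<le> 1" using \<open>\<not> d \<le> 0\<close> E0 by (auto simp: t_def)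
    have "t * (1 + E) \<le> d" 
      using mult_right_mono[of t "d / (1 + E)" "1 + E"] E0 by (simp add: t_def)
    then show False using key[OF t] \<open>\<not> d \<le> 0\<close> by simp
  qed
  moreover have "0 < e\<^sup>2" using e by simp
  ultimately have "Inf Q < e\<^sup>2" unfolding d_def by linarith
  then obtain a where a: "a \<in> A" "N a \<le> C" "q a < e\<^sup>2"
    using cInf_less_iff[OF Qne Qbd] by (auto simp: Q_def)
  have "cmod (S i a - \<Phi> (S i)) < e" if "i < k" for i
  proof -
    have "(cmod (\<Phi> (S i) - S i a))\<^sup>2 \<le> q a"
      unfolding q_def using that by (intro member_le_sum) auto
    then have "(cmod (\<Phi> (S i) - S i a))\<^sup>2 < e\<^sup>2" using a(3) by simp
    then show ?thesis using e by (simp add: norm_minus_commute power2_less_imp_less)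
  qed
  then show thesis using that a by blast
qed

lemma tendsto_inverse_SucI:
  fixes s :: "nat \<Rightarrow> complex"
  assumes "\<And>n. k \<le> n \<Longrightarrow> cmod (s n - l) < 1 / Suc n"
  shows "s \<longlonglongrightarrow> l"
proof -
  have "(\<lambda>n. s n - l) \<longlonglongrightarrow> 0"

  proof (rule Lim_null_comparison[OF _ lim_inverse_n'[THEN LIMSEQ_Suc]])
    show "eventually (\<lambda>n. norm (s n - l) \<le> 1 / real (Suc n)) sequentially"
      unfolding eventually_sequentially using assms less_imp_le by blast
  qed
  then show ?thesis by (simp add: LIM_zero_iff)
qed

text \<open>Two bidual elements that violate the symmetry are approximated alternately by
  Goldstine's theorem: \<open>a n\<close> imitates \<open>\<Phi>\<close> on the functionals
  determined by the earlier \<open>b m\<close>, and \<open>b n\<close> imitates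
  \<open>\<Psi>\<close> on those determined by the \<open>a m\<close> chosen so far. The inner
  limits then give the mixed actions, and the outer ones the two different values.\<close>

lemma not_arens_regularE:
  assumes "\<not> arens_regular A N"
  obtains T a b k l R where "T \<in> D" "\<And>n. a n \<in> A" "\<And>n. N (a n) \<le> R" "\<And>n. b n \<in> A" "\<And>n. N (b n) \<le> R"
    "double_limits T a b k l" "k \<noteq> l"
proof -
  obtain \<Phi> \<Psi> T where P: "\<Phi> \<in> bidual_sp A N" and Q: "\<Psi> \<in> bidual_sp A N" and T: "T \<in> D"
    and ne: "\<Phi> (mf_act A \<Psi> T) \<noteq> \<Psi> (mf_act A \<Phi> T)"
    using assms unfolding arens_regular_iff by blast
  define F where "F = mf_act A \<Phi> T"
  define H where "H = mf_act A \<Psi> T"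
  have FH: "F \<in> D" "H \<in> D" using mf_act_mem T P Q by (auto simp: F_def H_def)
  obtain C1 where C1: "0 < C1" "\<And>T. T \<in> D \<Longrightarrow> cmod (\<Phi> T) \<le> C1 * dual_norm A N T"
    using bidual_bound[OF P] by blast
  obtain C2 where C2: "0 < C2" "\<And>T. T \<in> D \<Longrightarrow> cmod (\<Psi> T) \<le> C2 * dual_norm A N T"
    using bidual_bound[OF Q] by blast
  define R where "R = max C1 C2"
  \<comment> \<open>What stage \<open>n\<close> must achieve for the pair
    \<open>r = (a n, b n)\<close>. In the last clause the second component is tested against the
    first one of the same stage, so within a stage \<open>a n\<close> is chosen before
    \<open>b n\<close>.\<close>
  define X where "X f n r \<longleftrightarrow> fst r \<in> A \<and> snd r \<in> A \<and> N (fst r) \<le> R \<and> N (snd r) \<le> R \<and>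
      cmod (H (fst r) - \<Phi> H) < 1 / Suc n \<and> cmod (F (snd r) - \<Psi> F) < 1 / Suc n \<and>
      (\<forall>m<n. cmod (fa_act A T (snd (f m)) (fst r) - \<Phi> (fa_act A T (snd (f m)))) < 1 / Suc n) \<and>
      (\<forall>m<n. cmod (fa_act A T (fst (f m)) (snd r) - \<Psi> (fa_act A T (fst (f m)))) < 1 / Suc n) \<and>
      cmod (fa_act A T (fst r) (snd r) - \<Psi> (fa_act A T (fst r))) < 1 / Suc n"
    for f :: "nat \<Rightarrow> ('a \<Rightarrow> complex) \<times> ('a \<Rightarrow> complex)" and n :: nat and r
  have "\<exists>f. \<forall>n. X f n (f n)"
  proof (rule dependent_wellorder_choice)
    fix r and f g :: "nat \<Rightarrow> ('a \<Rightarrow> complex) \<times> ('a \<Rightarrow> complex)" and n :: nat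
    assume "\<And>y. y < n \<Longrightarrow> f y = g y"
    then show "X f n r = X g n r" by (simp add: X_def)
  next
    fix n and f :: "nat \<Rightarrow> ('a \<Rightarrow> complex) \<times> ('a \<Rightarrow> complex)"
    assume f: "\<And>y. y < n \<Longrightarrow> X f y (f y)"
    define S where "S i = (case i of 0 \<Rightarrow> H | Suc m \<Rightarrow> fa_act A T (snd (f m)))" for i
    have fm: "fst (f y) \<in> A" "snd (f y) \<in> A" if "y < n" for y
      using f[OF that] by (simp_all only: X_def)
    have S: "S i \<in> D" if "i < Suc n" for i
      using that FH fm by (cases i) (simp_all add: S_def fa_act_mem[OF T])
    have e: "0 < 1 / real (Suc n)" by simp
    obtain a where a: "a \<in> A" "N a \<le> C1" "\<forall>i<Suc n. cmod (S i a - \<Phi> (S i)) < 1 / real (Suc n)"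
      using goldstine[where S = S and k = "Suc n", OF P C1 S e] by blast
    define S' where "S' i = (case i of 0 \<Rightarrow> F | Suc m \<Rightarrow> fa_act A T (if m = n then a else fst (f m)))" for i
    have S': "S' i \<in> D" if "i < Suc (Suc n)" for i
      using that FH fm a(1) by (cases i) (auto simp: S'_def less_Suc_eq intro!: fa_act_mem[OF T])
    obtain b where b: "b \<in> A" "N b \<le> C2" "\<forall>i<Suc (Suc n). cmod (S' i b - \<Psi> (S' i)) < 1 / real (Suc n)"
      using goldstine[where S = S' and k = "Suc (Suc n)", OF Q C2 S' e] by blast
    have "cmod (fa_act A T (snd (f m)) a - \<Phi> (fa_act A T (snd (f m)))) < 1 / Suc n" if "m < n" for m
      using a(3)[rule_format, of "Suc m"] that by (simp add: S_def)
    moreover have "cmod (fa_act A T (fst (f m)) b - \<Psi> (fa_act A T (fst (f m)))) < 1 / Suc n" if "m < n" for m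
      using b(3)[rule_format, of "Suc m"] that by (simp add: S'_def)
    moreover have "cmod (fa_act A T a b - \<Psi> (fa_act A T a)) < 1 / Suc n"
      using b(3)[rule_format, of "Suc n"] by (simp add: S'_def)
    moreover have "cmod (H a - \<Phi> H) < 1 / Suc n" "cmod (F b - \<Psi> F) < 1 / Suc n"
      using a(3)[rule_format, of 0] b(3)[rule_format, of 0] by (simp_all add: S_def S'_def)
    moreover have "N a \<le> R" "N b \<le> R" using a(2) b(2) by (auto simp: R_def)
    ultimately have "X f n (a, b)" using a(1) b(1)
      unfolding X_def fst_conv snd_conv by (intro conjI allI impI) assumption+
    then show "\<exists>r. X f n r" ..
  qed
  then obtain f where f: "\<And>n. X f n (f n)" by blast
  define a where "a n = fst (f n)" for n
  define b where "b n = snd (f n)" for n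
  have mem: "a n \<in> A" "b n \<in> A" "N (a n) \<le> R" "N (b n) \<le> R" for n
    using f[of n] by (simp_all only: X_def a_def b_def)
  have Tab: "T (\<lambda>t. a n t * b m t) = fa_act A T (a n) (b m)"
    "T (\<lambda>t. a n t * b m t) = fa_act A T (b m) (a n)" for n m
    by (simp_all add: fa_act_def mem mult.commute)
  have HF: "H (a n) = \<Psi> (fa_act A T (a n))" "F (b n) = \<Phi> (fa_act A T (b n))" for n
    by (simp_all add: H_def F_def mf_act_def mem)
  \<comment> \<open>The ranges of the two estimates differ by one: \<open>b m\<close> takes
    \<open>a n\<close> into account already for n = m, whereas \<open>a n\<close> takes
    \<open>b m\<close> into account only for m < n.\<close>
  have 1: "cmod (fa_act A T (a n) (b m) - \<Psi> (fa_act A T (a n))) < 1 / Suc m" if "n \<le> m" for n m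
  proof (cases "n = m")
    case True then show ?thesis using f[of m] by (simp only: X_def a_def b_def)
  next
    case False
    with that have "n < m" by simp
    then show ?thesis using f[of m] by (simp only: X_def a_def b_def)
  qed
  have 2: "cmod (fa_act A T (b m) (a n) - \<Phi> (fa_act A T (b m))) < 1 / Suc n" if "Suc m \<le> n" for n m
  proof -
    have "m < n" using that by simp
    then show ?thesis using f[of n] by (simp only: X_def a_def b_def)
  qed
  have 3: "cmod (H (a n) - \<Phi> H) < 1 / Suc n" "cmod (F (b n) - \<Psi> F) < 1 / Suc n" for n
    using f[of n] by (simp_all only: X_def a_def b_def)
  have "(\<lambda>m. T (\<lambda>t. a n t * b m t)) \<longlonglongrightarrow> H (a n)" for n
    unfolding Tab(1) HF by (rule tendsto_inverse_SucI[OF 1])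
  moreover have "(\<lambda>n. H (a n)) \<longlonglongrightarrow> \<Phi> H"
    by (rule tendsto_inverse_SucI[OF 3(1)])
  moreover have "(\<lambda>n. T (\<lambda>t. a n t * b m t)) \<longlonglongrightarrow> F (b m)" for m
    unfolding Tab(2) HF by (rule tendsto_inverse_SucI[OF 2])
  moreover have "(\<lambda>n. F (b n)) \<longlonglongrightarrow> \<Psi> F"
    by (rule tendsto_inverse_SucI[OF 3(2)])
  ultimately have "double_limits T a b (\<Phi> H) (\<Psi> F)" unfolding double_limits_def
    by (intro conjI exI[of _ "\<lambda>n. H (a n)"] exI[of _ "\<lambda>m. F (b m)"] allI)
  then show thesis using that[OF T, of a R b] mem ne by (auto simp: F_def H_def)
qed

end

section \<open>Burkholder's inequality for dyadic martingale transforms\<close>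

lemma convex_on_cong_on:
  assumes "convex_on A f" "\<And>x. x \<in> A \<Longrightarrow> f x = g x" shows "convex_on A g"
proof -
  have "g (u *\<^sub>R x + v *\<^sub>R y) \<le> u * g x + v * g y"
    if "x \<in> A" "y \<in> A" "0 \<le> u" "0 \<le> v" "u + v = 1" for x y u v
  proof -
    have "u *\<^sub>R x + v *\<^sub>R y \<in> A" using assms(1) that by (auto simp: convex_on_def intro: convexD)
    moreover have "f (u *\<^sub>R x + v *\<^sub>R y) \<le> u * f x + v * f y"
      using assms(1) that by (simp add: convex_on_def)
    ultimately show ?thesis using assms(2) that by simp
  qed
  then show ?thesis using assms(1) by (simp add: convex_on_def)
qed

text \<open>A common supporting line at the junction excludes a concave kink there.\<close>

lemma convex_on_glue:
  fixes f :: "real \<Rightarrow> real"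
  assumes l: "convex_on {..a} f" and r: "convex_on {a..} f" and s: "\<And>y. f a + s * (y - a) \<le> f y"
  shows "convex_on UNIV f"
proof (rule convex_on_linorderI)
  fix t x y :: real
  assume t: "0 < t" "t < 1" and xy: "x < y"
  define z where "z = (1 - t) * x + t * y"
  have z: "x \<le> z" "z \<le> y"
    using t xy mult_left_mono[of x y t] mult_left_mono[of x y "1 - t"] by (auto simp: z_def algebra_simps)
  have "f z \<le> (1 - t) * f x + t * f y"
  proof -
    consider "y \<le> a" | "a \<le> x" | "x < a" "a < y" by linarith
    then show ?thesis
    proof cases
      case 1 then show ?thesis using convex_onD[OF l, of t x y] t xy by (simp add: z_def)
    next
      case 2 then show ?thesis using convex_onD[OF r, of t x y] t xy by (simp add: z_def)
    next
      case 3
      \<comment> \<open>The chord over [x, y]. The supporting line puts it above \<open>f\<close> at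
        the junction; on the side of the junction that contains \<open>z\<close>, convexity of that
        piece finishes the comparison.\<close>
      define c where "c w = f x + (f y - f x) * ((w - x) / (y - x))" for w
      have cz: "c z = (1 - t) * f x + t * f y"
        using xy by (simp add: c_def z_def field_simps)
      have ca: "f a \<le> c a"
      proof -
        define k where "k = (a - x) / (y - x)"
        have "k * (y - x) = a - x" using 3 by (simp add: k_def)
        then have "a = (1 - k) * x + k * y" by (simp add: algebra_simps)
        moreover have "0 \<le> k" "k \<le> 1" using 3 by (auto simp: k_def)
        ultimately have k: "0 \<le> k" "k \<le> 1" "a = (1 - k) * x + k * y" by auto
        have "(1 - k) * (f a + s * (x - a)) + k * (f a + s * (y - a)) \<le> (1 - k) * f x + k * f y"
          using k s by (intro add_mono mult_left_mono) auto
        moreover have "(1 - k) * (f a + s * (x - a)) + k * (f a + s * (y - a)) = f a"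
        proof -
          have "(1 - k) * (f a + s * (x - a)) + k * (f a + s * (y - a)) = f a + s * (((1 - k) * x + k * y) - a)"
            by (simp add: algebra_simps)
          then show ?thesis using k(3) by simp
        qed
        moreover have "(1 - k) * f x + k * f y = c a" by (simp add: c_def k_def[symmetric] algebra_simps)
        ultimately show ?thesis by linarith
      qed
      show ?thesis
      proof (cases "z \<le> a")
        case True
        define k where "k = (z - x) / (a - x)"
        have "k * (a - x) = z - x" using 3 by (simp add: k_def)
        then have "z = (1 - k) * x + k * a" by (simp add: algebra_simps)
        moreover have "0 \<le> k" "k \<le> 1" using 3 z True by (auto simp: k_def)
        ultimately have k: "0 \<le> k" "k \<le> 1" "z = (1 - k) * x + k * a" by auto
        have "f z \<le> (1 - k) * f x + k * f a" using convex_onD[OF l, of k x a] k 3 by simp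
        also have "\<dots> \<le> (1 - k) * f x + k * c a" using ca k by (intro add_mono mult_left_mono) auto
        also have "\<dots> = f x + k * ((f y - f x) * ((a - x) / (y - x)))" by (simp add: c_def algebra_simps)
        also have "\<dots> = c z" using 3 by (simp add: c_def k_def)
        finally show ?thesis using cz by simp
      next
        case False
        define k where "k = (y - z) / (y - a)"
        have "k * (y - a) = y - z" using 3 by (simp add: k_def)
        then have "z = (1 - k) * y + k * a" by (simp add: algebra_simps)
        moreover have "0 \<le> k" "k \<le> 1" using 3 z False by (auto simp: k_def)
        ultimately have k: "0 \<le> k" "k \<le> 1" "z = (1 - k) * y + k * a" by auto
        have cy: "c w = f y - (f y - f x) * ((y - w) / (y - x))" for w
          using xy by (simp add: c_def field_simps)
        have "f z \<le> (1 - k) * f y + k * f a" using convex_onD[OF r, of k y a] k 3 by simp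
        also have "\<dots> \<le> (1 - k) * f y + k * c a" using ca k by (intro add_mono mult_left_mono) auto
        also have "\<dots> = f y - k * ((f y - f x) * ((y - a) / (y - x)))" by (simp add: cy algebra_simps)
        also have "\<dots> = c z" using 3 by (simp add: cy k_def)
        finally show ?thesis using cz by simp
      qed
    qed
  qed
  then show "f ((1 - t) *\<^sub>R x + t *\<^sub>R y) \<le> (1 - t) * f x + t * f y" by (simp add: z_def)
qed simp

text \<open>Burkholder's function on the line v = 1 as a function of t = u / v. The branches
  correspond to which of |u| and |v| is the maximum and to the sign of u.\<close>

definition burk_slice :: "real \<Rightarrow> real \<Rightarrow> real" where
  "burk_slice p t = (if t \<le> -1 then (p - 2) * (- t) powr p - p * (- t) powr (p - 1)
     else if t \<le> 1 then (p - 2) + p * t else (p - 2) * t powr p + p * t powr (p - 1))"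

text \<open>The middle piece is affine of slope p and supports the graph at both junctions: at -1
  the slopes agree, and at 1 the slope jumps up from p to p (2 p - 3). The outer pieces are convex;
  on the left this is seen from the second derivative, which is nonnegative because there -t is at
  least 1.\<close>

lemma convex_burk_slice:
  assumes p: "2 \<le> p" shows "convex_on UNIV (burk_slice p)"
proof (rule convex_on_glue[where a = 1 and s = p])
  define k where "k t = (p - 2) * (- t) powr p - p * (- t) powr (p - 1)" for t :: real
  define k' where "k' t = - (p - 2) * p * (- t) powr (p - 1) + p * (p - 1) * (- t) powr (p - 2)" for t :: real
  define k'' where "k'' t = (p - 2) * p * (p - 1) * (- t) powr (p - 2) - p * (p - 1) * (p - 2) * (- t) powr (p - 3)" for t :: real
  have k1: "(k has_real_derivative k' t) (at t)" if "t \<in> {..-1}" for t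
    unfolding k_def k'_def using that by (auto intro!: derivative_eq_intros simp: algebra_simps)
  have k2: "(k' has_real_derivative k'' t) (at t)" if "t \<in> {..-1}" for t
    unfolding k'_def k''_def using that by (auto intro!: derivative_eq_intros simp: algebra_simps)
  have k3: "0 \<le> k'' t" if "t \<in> {..-1}" for t
  proof -
    have "(- t) powr (p - 3) \<le> (- t) powr (p - 2)" using that by (intro powr_mono) auto
    then have "(p - 2) * p * (p - 1) * (- t) powr (p - 3) \<le> (p - 2) * p * (p - 1) * (- t) powr (p - 2)"
      using p by (intro mult_left_mono) auto
    then show ?thesis by (simp add: k''_def algebra_simps)
  qed
  have kc: "convex_on {..-1} k" by (rule f''_ge0_imp_convex[OF _ k1 k2 k3]) auto
  have kt: "-2 + p * (y + 1) \<le> k y" if "y \<le> -1" for y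
    using f''_imp_f'[of "{..-1}" k k' k'' "-1" y, OF _ k1 k2 k3] that by (simp add: k_def k'_def algebra_simps)
  define l where "l t = (if t \<le> -1 then k t else (p - 2) + p * t)" for t
  have lt: "(p - 2) + p * y \<le> l y" for y
    using kt[of y] by (auto simp: l_def algebra_simps)
  have lc: "convex_on UNIV l"
  proof (rule convex_on_glue[where a = "-1" and s = p])
    show "convex_on {..-1} l" using kc by (rule convex_on_cong_on) (auto simp: l_def)
    have "convex_on {-1..} (\<lambda>t. (p - 2) + p * t)" 
      by (intro convex_onI) (auto simp: algebra_simps)
    then show "convex_on {-1..} l" by (rule convex_on_cong_on) (auto simp: l_def k_def)
    show "l (-1) + p * (y - -1) \<le> l y" for y using lt[of y] by (simp add: l_def k_def algebra_simps)
  qed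
  show "convex_on {..1} (burk_slice p)"
    using convex_on_subset[OF lc, of "{..1}"]
    by (rule convex_on_cong_on) (auto simp: l_def k_def burk_slice_def)
  have "convex_on {0<..} (\<lambda>t. (p - 2) * t powr p + p * t powr (p - 1))"
    using p by (intro convex_on_add convex_on_cmul powr_convex) auto
  then have "convex_on {1..} (\<lambda>t. (p - 2) * t powr p + p * t powr (p - 1))"
    by (rule convex_on_subset) auto
  then show "convex_on {1..} (burk_slice p)"
    by (rule convex_on_cong_on) (auto simp: burk_slice_def)
  show "burk_slice p 1 + p * (y - 1) \<le> burk_slice p y" for y
  proof (cases "y \<le> 1")
    case True
    then have "burk_slice p y = l y" by (auto simp: burk_slice_def l_def k_def)
    then show ?thesis using lt[of y] by (simp add: burk_slice_def algebra_simps)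
  next
    case False
    have "1 \<le> y powr p" using False p by (intro ge_one_powr_ge_zero) auto
    moreover have "y powr 1 \<le> y powr (p - 1)" using False p by (intro powr_mono) auto
    ultimately have "(p - 2) * 1 + p * y \<le> (p - 2) * y powr p + p * y powr (p - 1)"
      using False p by (intro add_mono mult_left_mono) auto
    then show ?thesis using False by (simp add: burk_slice_def algebra_simps)
  qed
qed

text \<open>A negative multiple of Burkholder's function, in the coordinates \<open>u = x + y\<close> and \<open>v = x - y\<close>. A step of a
  \<open>\<plusminus>1\<close>-transform \<open>y\<close> of \<open>x\<close> moves only one of \<open>u\<close> and \<open>v\<close>, so convexity in each variable separately
  is what makes its averages increase.\<close>
definition burk :: "real \<Rightarrow> real \<Rightarrow> real \<Rightarrow> real" where
  "burk p u v = (let m = max \<bar>u\<bar> \<bar>v\<bar> in (p - 2) * m powr p + p * m powr (p - 2) * (u * v))"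

lemma burk_sym: "burk p u v = burk p v u"
  unfolding burk_def max.commute[of "\<bar>u\<bar>"] mult.commute[of u v] ..

lemma burk_minus: "burk p (- u) (- v) = burk p u v"
  by (simp add: burk_def)

text \<open>\<open>burk\<close> is homogeneous of degree p, so for positive v it is determined by
  its values at v = 1.\<close>

lemma burk_eq_slice:
  assumes v: "0 < v" and p: "2 \<le> p"
  shows "burk p u v = v powr p * burk_slice p (u / v)"
proof -
  have e: "(x / v) powr a * v powr p = x powr a * v powr (p - a)" if "0 < x" for x a
    by (simp add: powr_divide powr_diff)
  have f: "x powr (p - 2) * x = x powr (p - 1)" if "0 < x" for x :: real
    using that powr_add[of x "p - 2" 1] by simp
  have g1: "V * (c * A - d * B) = c * (A * V) - d * (B * V)" "V * (c * A + d * B) = c * (A * V) + d * (B * V)"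
    for V c A d B :: real by (simp_all add: algebra_simps)
  have g2: "c * A - d * (B * (- x) * y) = c * A + d * B * (x * y)"
    "c * A + d * (B * x * y) = c * A + d * B * (x * y)" for c A d B x y :: real by simp_all
  have g3: "(B * y * y) * (c + d * (x / y)) = c * (B * y * y) + d * B * (x * y)" if "y \<noteq> 0" for B c d x y :: real
    using that by (simp add: field_simps)
  consider "u \<le> - v" | "- v < u" "u \<le> v" | "v < u" by linarith
  then show ?thesis
  proof cases
    case 1
    then have le: "u / v \<le> -1" using v by (simp add: pos_divide_le_eq)
    have m: "max \<bar>u\<bar> \<bar>v\<bar> = - u" using 1 v by auto
    have u: "0 < - u" using 1 v by simp
    have "burk_slice p (u / v) = (p - 2) * ((- u) / v) powr p - p * ((- u) / v) powr (p - 1)"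
      using le by (simp add: burk_slice_def)
    then have "v powr p * burk_slice p (u / v) = (p - 2) * (- u) powr p - p * ((- u) powr (p - 1) * v)"
      using v by (simp only: g1 e[OF u]) simp
    also have "(- u) powr (p - 1) = (- u) powr (p - 2) * (- u)" using f[OF u] by simp
    finally show ?thesis unfolding g2 burk_def Let_def m by simp
  next
    case 2
    then have le: "\<not> u / v \<le> -1" "u / v \<le> 1" using v by (auto simp: pos_divide_le_eq)
    have m: "max \<bar>u\<bar> \<bar>v\<bar> = v" using 2 v by auto
    have vp: "v powr p = v powr (p - 2) * v * v"
      using v powr_add[of v "p - 2" 2] by (simp add: power2_eq_square)
    have "v powr p * burk_slice p (u / v) = v powr p * ((p - 2) + p * (u / v))"
      using le by (simp add: burk_slice_def)
    then show ?thesis unfolding burk_def Let_def m vp using g3[of v] v by simp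
  next
    case 3
    then have le: "\<not> u / v \<le> -1" "\<not> u / v \<le> 1" using v by (auto simp: pos_divide_le_eq)
    have m: "max \<bar>u\<bar> \<bar>v\<bar> = u" using 3 v by auto
    have u: "0 < u" using 3 v by simp
    have "burk_slice p (u / v) = (p - 2) * (u / v) powr p + p * (u / v) powr (p - 1)"
      using le by (simp add: burk_slice_def)
    then have "v powr p * burk_slice p (u / v) = (p - 2) * u powr p + p * (u powr (p - 1) * v)"
      using v by (simp only: g1 e[OF u]) simp
    also have "u powr (p - 1) = u powr (p - 2) * u" using f[OF u] by simp
    finally show ?thesis unfolding g2 burk_def Let_def m by simp
  qed
qed

lemma powr_midpoint:
  fixes a b :: real
  assumes p: "1 \<le> p" shows "\<bar>(a + b) / 2\<bar> powr p \<le> (\<bar>a\<bar> powr p + \<bar>b\<bar> powr p) / 2"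
proof -
  have *: "((x + y) / 2) powr p \<le> (x powr p + y powr p) / 2" if "0 < x" "0 \<le> y" for x y
  proof (cases "y = 0")
    case True
    have "(1/2) powr p \<le> (1/2 :: real) powr 1" using p by (intro powr_mono') auto
    then have "x powr p * (1/2) powr p \<le> x powr p * (1/2)" by (intro mult_left_mono) auto
    then show ?thesis using True powr_mult[of x "1/2" p] by simp
  next
    case False
    then show ?thesis using convex_onD[OF powr_convex[OF p], of "1/2" x y] that by (simp add: field_simps)
  qed
  have "\<bar>(a + b) / 2\<bar> powr p \<le> ((\<bar>a\<bar> + \<bar>b\<bar>) / 2) powr p" using p by (intro powr_mono2) auto
  also have "\<dots> \<le> (\<bar>a\<bar> powr p + \<bar>b\<bar> powr p) / 2"
    using *[of "\<bar>a\<bar>" "\<bar>b\<bar>"] *[of "\<bar>b\<bar>" "\<bar>a\<bar>"] by (cases "a = 0"; cases "b = 0") (auto simp: add.commute)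
  finally show ?thesis .
qed

text \<open>Midpoints suffice because a node of the dyadic tree has two children of equal weight.
  Positive v is the convexity of the slice, negative v follows by the symmetry
  \<open>burk_minus\<close>, and at v = 0 only (p - 2) |u|^p remains.\<close>

lemma burk_midpoint:
  assumes p: "2 \<le> p"
  shows "burk p ((a + b) / 2) v \<le> (burk p a v + burk p b v) / 2"
proof -
  have pos: "burk p ((a + b) / 2) v \<le> (burk p a v + burk p b v) / 2" if v: "0 < v" for a b v
  proof -
    have "(1 - 1/2) *\<^sub>R (a / v) + (1/2) *\<^sub>R (b / v) = ((a + b) / 2) / v"
      by (simp add: add_divide_distrib mult.commute)
    then have "burk_slice p (((a + b) / 2) / v) \<le> (burk_slice p (a / v) + burk_slice p (b / v)) / 2"
      using convex_onD[OF convex_burk_slice[OF p], of "1/2" "a / v" "b / v"] by simp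
    then have "v powr p * burk_slice p (((a + b) / 2) / v) \<le> v powr p * ((burk_slice p (a / v) + burk_slice p (b / v)) / 2)"
      by (intro mult_left_mono) auto
    then show ?thesis unfolding burk_eq_slice[OF v p] by (simp add: algebra_simps)
  qed
  consider "0 < v" | "v = 0" | "0 < - v" by linarith
  then show ?thesis
  proof cases
    case 1 then show ?thesis by (rule pos)
  next
    case 2
    have "(p - 2) * \<bar>(a + b) / 2\<bar> powr p \<le> (p - 2) * ((\<bar>a\<bar> powr p + \<bar>b\<bar> powr p) / 2)"
      using p by (intro mult_left_mono powr_midpoint) auto
    then show ?thesis using 2 by (simp add: burk_def Let_def algebra_simps)
  next
    case 3
    have "burk p ((- a + - b) / 2) (- v) \<le> (burk p (- a) (- v) + burk p (- b) (- v)) / 2" by (rule pos[OF 3])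
    moreover have "(- a + - b) / 2 = - ((a + b) / 2)"
      by (simp only: minus_add_distrib[symmetric] minus_divide_left)
    ultimately show ?thesis by (simp only: burk_minus)
  qed
qed

lemma burk_diag: "2 \<le> p \<Longrightarrow> 0 \<le> burk p m m"
  by (simp add: burk_def Let_def)

text \<open>With M = |x| + |y| the function becomes M^(p-1) (2 (p-1) |x| - 2 |y|). If |y| is at
  least 2 (p-1) |x|, the negative part absorbs |y|^p and the left side is at most 0; otherwise |y|
  and M are both at most 2 p |x|, and each term is at most (2 p |x|)^p. The constant is far from
  sharp; only its finiteness matters.\<close>

lemma burk_lower:
  assumes p: "2 \<le> p"
  shows "\<bar>y\<bar> powr p + burk p (x + y) (x - y) \<le> 2 * (2 * p) powr p * \<bar>x\<bar> powr p"
proof (cases "x = 0 \<and> y = 0")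
  case True then show ?thesis by (simp add: burk_def)
next
  case False
  define M where "M = \<bar>x\<bar> + \<bar>y\<bar>"
  have M: "0 < M" "max \<bar>x + y\<bar> \<bar>x - y\<bar> = M" using False by (auto simp: M_def)
  have pw: "M powr p = M powr (p - 1) * M" "M powr (p - 1) = M powr (p - 2) * M"
    using M(1) powr_add[of M "p - 1" 1] powr_add[of M "p - 2" 1] by auto
  have "(x + y) * (x - y) = M * (\<bar>x\<bar> - \<bar>y\<bar>)"
    by (simp add: M_def algebra_simps abs_mult_self_eq)
  then have "burk p (x + y) (x - y) = (p - 2) * M powr p + p * M powr (p - 2) * (M * (\<bar>x\<bar> - \<bar>y\<bar>))"
    by (simp add: burk_def M)
  also have "\<dots> = M powr (p - 1) * ((p - 2) * M + p * (\<bar>x\<bar> - \<bar>y\<bar>))"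
    by (simp add: pw algebra_simps)
  also have "(p - 2) * M + p * (\<bar>x\<bar> - \<bar>y\<bar>) = 2 * (p - 1) * \<bar>x\<bar> - 2 * \<bar>y\<bar>"
    by (simp add: M_def algebra_simps)
  finally have b: "burk p (x + y) (x - y) = M powr (p - 1) * (2 * (p - 1) * \<bar>x\<bar> - 2 * \<bar>y\<bar>)" .
  show ?thesis
  proof (cases "2 * (p - 1) * \<bar>x\<bar> \<le> \<bar>y\<bar>")
    case True
    have "y \<noteq> 0" using True False p by (auto simp: mult_le_0_iff)
    have "\<bar>y\<bar> powr p = \<bar>y\<bar> powr (p - 1) * \<bar>y\<bar>" using powr_add[of "\<bar>y\<bar>" "p - 1" 1] \<open>y \<noteq> 0\<close> by simp
    also have "\<dots> \<le> M powr (p - 1) * (2 * \<bar>y\<bar> - 2 * (p - 1) * \<bar>x\<bar>)"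
      using True p by (intro mult_mono powr_mono2) (auto simp: M_def)
    finally have "\<bar>y\<bar> powr p + burk p (x + y) (x - y) \<le> 0" by (simp add: b algebra_simps)
    moreover have "0 \<le> 2 * (2 * p) powr p * \<bar>x\<bar> powr p" by simp
    ultimately show ?thesis by linarith
  next
    case F: False
    have x0: "x \<noteq> 0" using F by auto
    have y: "\<bar>y\<bar> \<le> 2 * p * \<bar>x\<bar>" using F by (simp add: algebra_simps)
    have M': "M \<le> 2 * p * \<bar>x\<bar>" using F by (simp add: M_def algebra_simps)
    have "burk p (x + y) (x - y) \<le> M powr (p - 1) * (2 * p * \<bar>x\<bar>)"
      unfolding b by (intro mult_left_mono) (auto simp: algebra_simps)
    also have "\<dots> \<le> (2 * p * \<bar>x\<bar>) powr (p - 1) * (2 * p * \<bar>x\<bar>)"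
      using M' M p by (intro mult_right_mono powr_mono2) auto
    also have "\<dots> = (2 * p * \<bar>x\<bar>) powr p" using powr_add[of "2 * p * \<bar>x\<bar>" "p - 1" 1] x0 p by simp
    finally have "burk p (x + y) (x - y) \<le> (2 * p * \<bar>x\<bar>) powr p" .
    moreover have "\<bar>y\<bar> powr p \<le> (2 * p * \<bar>x\<bar>) powr p" using y p by (intro powr_mono2) auto
    ultimately show ?thesis by (simp add: powr_mult)
  qed
qed

section \<open>Dyadic averages, martingale transforms and their bilinear forms\<close>

fun word_avg :: "nat \<Rightarrow> (bool list \<Rightarrow> 'b::real_vector) \<Rightarrow> 'b" where
  "word_avg 0 F = F []"
| "word_avg (Suc n) F = (1/2) *\<^sub>R (word_avg n (\<lambda>w. F (False # w)) + word_avg n (\<lambda>w. F (True # w)))"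

lemma word_avg_add: "word_avg n (\<lambda>w. F w + G w) = word_avg n F + word_avg n G"
  by (induction n arbitrary: F G) (simp_all add: algebra_simps)

lemma word_avg_scaleR: "word_avg n (\<lambda>w. c *\<^sub>R F w) = c *\<^sub>R word_avg n F"
  by (induction n arbitrary: F) (simp_all add: algebra_simps)

lemma word_avg_linear: "linear h \<Longrightarrow> word_avg n (\<lambda>w. h (F w)) = h (word_avg n F)"
  by (induction n arbitrary: F) (simp_all add: linear_add linear_scale)

lemma word_avg_cmult: "word_avg n (\<lambda>w. c * F w) = c * word_avg n F" for F :: "bool list \<Rightarrow> 'b::real_algebra"
  by (rule word_avg_linear) (simp add: bounded_linear.linear linear_iff algebra_simps)

lemma word_avg_mult_right: "word_avg n (\<lambda>w. F w * c) = word_avg n F * c" for F :: "bool list \<Rightarrow> 'b::real_algebra"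
  using word_avg_linear[of "\<lambda>x. x * c" n F] by (simp add: linear_iff algebra_simps)

lemma word_avg_mono: "(\<And>w. F w \<le> G w) \<Longrightarrow> word_avg n F \<le> word_avg n G" for F :: "bool list \<Rightarrow> real"
proof (induction n arbitrary: F G)
  case (Suc n)
  show ?case using Suc.IH[of "\<lambda>w. F (False # w)" "\<lambda>w. G (False # w)", OF Suc.prems]
    Suc.IH[of "\<lambda>w. F (True # w)" "\<lambda>w. G (True # w)", OF Suc.prems] by simp
qed simp

lemma word_avg_const: "word_avg n (\<lambda>w. c) = c"
  by (induction n) simp_all

lemma word_avg_nonneg: "(\<And>w. 0 \<le> F w) \<Longrightarrow> 0 \<le> word_avg n F" for F :: "bool list \<Rightarrow> real"
  using word_avg_mono[of "\<lambda>_. 0" F n] by (simp add: word_avg_const)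

lemma norm_word_avg: "norm (word_avg n F) \<le> word_avg n (\<lambda>w. norm (F w))" for F :: "bool list \<Rightarrow> 'b::real_normed_vector"
proof (induction n arbitrary: F)
  case (Suc n)
  have "norm (word_avg n (\<lambda>w. F (False # w)) + word_avg n (\<lambda>w. F (True # w))) \<le>
    word_avg n (\<lambda>w. norm (F (False # w))) + word_avg n (\<lambda>w. norm (F (True # w)))"
    by (intro norm_triangle_le add_mono Suc)
  then show ?case by simp
qed simp

text \<open>The martingale transform with signs \<open>s, -s, s, \<dots>\<close> on the dyadic tree of words of length \<open>n\<close>.\<close>
fun mart_tr :: "nat \<Rightarrow> real \<Rightarrow> (bool list \<Rightarrow> 'b::real_vector) \<Rightarrow> bool list \<Rightarrow> 'b" where
  "mart_tr (Suc n) s F (a # w) =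
     s *\<^sub>R (word_avg n (\<lambda>w. F (a # w)) - word_avg (Suc n) F) + mart_tr n (- s) (\<lambda>w. F (a # w)) w"
| "mart_tr _ _ _ _ = 0"

lemma mart_tr_0: "mart_tr 0 s F w = 0"
  by (cases w) simp_all

lemma mart_tr_linear: "linear h \<Longrightarrow> h (mart_tr n s F w) = mart_tr n s (\<lambda>w. h (F w)) w"
proof (induction n s F w rule: mart_tr.induct)
  case (1 n s F a w)
  then show ?case
    by (simp add: linear_add linear_scale linear_diff word_avg_linear[OF 1(2), symmetric] del: word_avg.simps)
qed (simp_all add: linear_0)

text \<open>The submartingale property, by induction on the depth. The offset \<open>c\<close>
  carries the transform accumulated on the way from the root to the current node. For s = 1 the step
  fixes the second argument of \<open>burk\<close>, for s = -1 the first, and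
  \<open>burk_midpoint\<close> applies to the other one.\<close>

lemma burkholder_mart_tr:
  fixes F :: "bool list \<Rightarrow> real"
  assumes p: "2 \<le> p" and s: "s = 1 \<or> s = -1"
  shows "burk p (word_avg n F + c) (word_avg n F - c)
     \<le> word_avg n (\<lambda>w. burk p (F w + (c + mart_tr n s F w)) (F w - (c + mart_tr n s F w)))"
  using s
proof (induction n arbitrary: s F c)
  case 0
  then show ?case by (simp add: mart_tr_0)
next
  case (Suc n)
  define m where "m a = word_avg n (\<lambda>w. F (a # w))" for a
  define m0 where "m0 = word_avg (Suc n) F"
  define d where "d a = c + s * (m a - m0)" for a
  define G where "G a = word_avg n (\<lambda>w. burk p (F (a # w) + (c + mart_tr (Suc n) s F (a # w))) (F (a # w) - (c + mart_tr (Suc n) s F (a # w))))" for a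
  have m0: "m0 = (m False + m True) / 2" by (simp add: m0_def m_def)
  have IH: "burk p (m a + d a) (m a - d a) \<le> G a" for a
    using Suc.IH[of "- s" "\<lambda>w. F (a # w)" "d a"] Suc.prems
    unfolding G_def m_def[symmetric] d_def m0_def[symmetric]
    by (auto simp: m_def[symmetric] m0_def[symmetric] add.assoc simp del: word_avg.simps)
  have "burk p (m0 + c) (m0 - c) \<le> (burk p (m False + d False) (m False - d False) + burk p (m True + d True) (m True - d True)) / 2"
  proof (cases "s = 1")
    case True
    then have e: "m a - d a = m0 - c" for a by (simp add: d_def)
    have "m0 + c = ((m False + d False) + (m True + d True)) / 2" using True m0 by (simp add: d_def field_simps)
    then show ?thesis unfolding e using burk_midpoint[OF p] by metis
  next
    case False
    then have s: "s = -1" using Suc.prems by simp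
    then have e: "m a + d a = m0 + c" for a by (simp add: d_def)
    have "m0 - c = ((m False - d False) + (m True - d True)) / 2" using s m0 by (simp add: d_def field_simps)
    then show ?thesis unfolding e burk_sym[of p "m0 + c"] using burk_midpoint[OF p] by metis
  qed
  also have "\<dots> \<le> (G False + G True) / 2" using IH by (simp add: add_mono)
  finally show ?case unfolding m0_def[symmetric] by (simp add: G_def del: mart_tr.simps)
qed

text \<open>At the root the transform is 0, so both arguments of \<open>burk\<close> coincide and
  its value is nonnegative. Hence the average of \<open>burk\<close> over the leaves is nonnegative
  and may be added to the left side before the pointwise bound \<open>burk_lower\<close> is
  used.\<close>

lemma mart_tr_powr_real:
  fixes F :: "bool list \<Rightarrow> real"
  assumes p: "2 \<le> p" and s: "s = 1 \<or> s = -1"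
  shows "word_avg n (\<lambda>w. \<bar>mart_tr n s F w\<bar> powr p) \<le> 2 * (2 * p) powr p * word_avg n (\<lambda>w. \<bar>F w\<bar> powr p)"
proof -
  have "0 \<le> word_avg n (\<lambda>w. burk p (F w + mart_tr n s F w) (F w - mart_tr n s F w))"
    using order_trans[OF burk_diag[OF p, of "word_avg n F"]] burkholder_mart_tr[OF p s, where c = 0 and F = F and n = n]
    by simp
  then have "word_avg n (\<lambda>w. \<bar>mart_tr n s F w\<bar> powr p) \<le>
     word_avg n (\<lambda>w. \<bar>mart_tr n s F w\<bar> powr p + burk p (F w + mart_tr n s F w) (F w - mart_tr n s F w))"
    by (simp add: word_avg_add)
  also have "\<dots> \<le> word_avg n (\<lambda>w. 2 * (2 * p) powr p * \<bar>F w\<bar> powr p)"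
    by (intro word_avg_mono burk_lower p)
  finally show ?thesis by (simp add: word_avg_cmult)
qed

lemma cmod_powr_le:
  assumes "0 \<le> p" shows "cmod z powr p \<le> 2 powr p * (\<bar>Re z\<bar> powr p + \<bar>Im z\<bar> powr p)"
proof -
  define m where "m = max \<bar>Re z\<bar> \<bar>Im z\<bar>"
  have "cmod z \<le> 2 * m" using cmod_le[of z] by (simp add: m_def)
  then have "cmod z powr p \<le> (2 * m) powr p" using assms by (intro powr_mono2) auto
  also have "\<dots> = 2 powr p * m powr p" by (simp add: powr_mult)
  also have "\<dots> \<le> 2 powr p * (\<bar>Re z\<bar> powr p + \<bar>Im z\<bar> powr p)"
    by (intro mult_left_mono) (auto simp: m_def max_def)
  finally show ?thesis .
qed

text \<open>The transform has real signs, so real and imaginary parts are treated separately. The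
  point is that the constant is chosen before the depth \<open>n\<close>.\<close>

lemma mart_tr_powr:
  fixes F :: "bool list \<Rightarrow> complex"
  assumes p: "2 \<le> p"
  shows "\<exists>C\<ge>0. \<forall>n s F. s = 1 \<or> s = -1 \<longrightarrow> word_avg n (\<lambda>w. cmod (mart_tr n s F w) powr p) \<le> C * word_avg n (\<lambda>w. cmod (F w) powr p)"
proof -
  define K where "K = 2 * (2 * p) powr p"
  have main: "word_avg n (\<lambda>w. cmod (mart_tr n s F w) powr p) \<le> 2 powr p * (2 * K) * word_avg n (\<lambda>w. cmod (F w) powr p)"
    if s: "s = 1 \<or> s = -1" for n and s :: real and F :: "bool list \<Rightarrow> complex"
  proof -
  have re: "Re (mart_tr n s F w) = mart_tr n s (\<lambda>w. Re (F w)) w"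
   and im: "Im (mart_tr n s F w) = mart_tr n s (\<lambda>w. Im (F w)) w" for w
    by (auto intro!: mart_tr_linear bounded_linear.linear bounded_linear_Re bounded_linear_Im)
  have "word_avg n (\<lambda>w. cmod (mart_tr n s F w) powr p)
     \<le> word_avg n (\<lambda>w. 2 powr p * (\<bar>mart_tr n s (\<lambda>w. Re (F w)) w\<bar> powr p + \<bar>mart_tr n s (\<lambda>w. Im (F w)) w\<bar> powr p))"
    using p by (intro word_avg_mono order_trans[OF cmod_powr_le]) (auto simp: re im)
  also have "\<dots> \<le> 2 powr p * (K * word_avg n (\<lambda>w. \<bar>Re (F w)\<bar> powr p) + K * word_avg n (\<lambda>w. \<bar>Im (F w)\<bar> powr p))"
    unfolding word_avg_cmult word_avg_add K_def by (intro mult_left_mono add_mono mart_tr_powr_real p s) auto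
  also have "\<dots> \<le> 2 powr p * (K * word_avg n (\<lambda>w. cmod (F w) powr p) + K * word_avg n (\<lambda>w. cmod (F w) powr p))"
    using p by (intro mult_left_mono add_mono word_avg_mono powr_mono2 abs_Re_le_cmod abs_Im_le_cmod) (auto simp: K_def)
  finally show ?thesis by (simp add: algebra_simps)
  qed
  show ?thesis
  proof (intro exI[of _ "2 powr p * (2 * K)"] conjI allI impI)
    show "0 \<le> 2 powr p * (2 * K)" by (simp add: K_def)
  qed (rule main)
qed

text \<open>The bilinear form of the martingale transform, evaluated on an arbitrary kernel.\<close>
fun mart_form :: "nat \<Rightarrow> real \<Rightarrow> (bool list \<Rightarrow> bool list \<Rightarrow> complex) \<Rightarrow> complex" where
  "mart_form 0 s k = 0"
| "mart_form (Suc n) s k =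
     s *\<^sub>R ((1/2) *\<^sub>R (word_avg n (\<lambda>w. word_avg n (\<lambda>w'. k (False # w) (False # w')))
               + word_avg n (\<lambda>w. word_avg n (\<lambda>w'. k (True # w) (True # w'))))
          - word_avg (Suc n) (\<lambda>w. word_avg (Suc n) (k w)))
     + (1/2) *\<^sub>R (mart_form n (- s) (\<lambda>w w'. k (False # w) (False # w'))
               + mart_form n (- s) (\<lambda>w w'. k (True # w) (True # w')))"

text \<open>Algebra of the induction steps below: \<open>a\<close> and \<open>b\<close> are the
  averages of the first factor over the two subtrees, \<open>c\<close> and \<open>d\<close> those of
  the second, and \<open>m\<close> is the full average of the factor that is transformed.\<close>

lemma mart_form_step:
  fixes a b c d i j m :: complex
  shows "s *\<^sub>R ((1/2) *\<^sub>R (a * c + b * d) - m * ((1/2) *\<^sub>R (c + d))) + (1/2) *\<^sub>R (i + j)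
    = (1/2) *\<^sub>R ((s *\<^sub>R ((a - m) * c) + i) + (s *\<^sub>R ((b - m) * d) + j))"
    and "s *\<^sub>R ((1/2) *\<^sub>R (a * c + b * d) - ((1/2) *\<^sub>R (a + b)) * m) + (1/2) *\<^sub>R (i + j)
    = (1/2) *\<^sub>R ((s *\<^sub>R (a * (c - m)) + i) + (s *\<^sub>R (b * (d - m)) + j))"
  by (simp_all add: scaleR_conv_of_real field_simps)

text \<open>On product kernels the form is a pairing of one transformed factor with the other. This
  version transforms the first factor, the next one the second; together they express that the
  transform is symmetric.\<close>

lemma mart_form_prod:
  "mart_form n s (\<lambda>w w'. F w * G w') = word_avg n (\<lambda>w. mart_tr n s F w * G w)"
proof (induction n arbitrary: s F G)
  case (Suc n)
  have "word_avg n (\<lambda>w. mart_tr (Suc n) s F (a # w) * G (a # w)) =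
     s *\<^sub>R ((word_avg n (\<lambda>w. F (a # w)) - word_avg (Suc n) F) * word_avg n (\<lambda>w. G (a # w)))
       + mart_form n (- s) (\<lambda>w w'. F (a # w) * G (a # w'))" for a
    by (simp add: Suc distrib_right word_avg_add word_avg_scaleR word_avg_cmult del: word_avg.simps)
  note step = this
  show ?case
    unfolding word_avg.simps(2)[of n "\<lambda>w. mart_tr (Suc n) s F w * G w"] step mart_form.simps
      word_avg_cmult word_avg_mult_right
    unfolding word_avg.simps(2)[of n G] by (rule mart_form_step(1))
qed (simp add: mart_tr_0)

lemma mart_form_prod':
  "mart_form n s (\<lambda>w w'. F w * G w') = word_avg n (\<lambda>w. F w * mart_tr n s G w)"
proof (induction n arbitrary: s F G)
  case (Suc n)
  have "word_avg n (\<lambda>w. F (a # w) * mart_tr (Suc n) s G (a # w)) =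
     s *\<^sub>R (word_avg n (\<lambda>w. F (a # w)) * (word_avg n (\<lambda>w. G (a # w)) - word_avg (Suc n) G))
       + mart_form n (- s) (\<lambda>w w'. F (a # w) * G (a # w'))" for a
    by (simp add: Suc distrib_left word_avg_add word_avg_scaleR word_avg_mult_right del: word_avg.simps)
  note step = this
  show ?case
    unfolding word_avg.simps(2)[of n "\<lambda>w. F w * mart_tr (Suc n) s G w"] step mart_form.simps
      word_avg_cmult word_avg_mult_right
    unfolding word_avg.simps(2)[of n F] by (rule mart_form_step(2))
qed (simp add: mart_tr_0)

text \<open>One of two conjugate exponents is at least 2, and the transform is placed on the factor
  with that exponent, where Burkholder's bound is available. Young's inequality leads to a sum of
  averages instead of a product of norms; a sum can be integrated over a parameter directly.\<close>

lemma mart_form_bound: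
  assumes p: "1 < p" "1 < q" "1 / p + 1 / q = 1"
  shows "\<exists>C\<ge>0. \<forall>n F G. cmod (mart_form n 1 (\<lambda>w w'. F w * G w'))
      \<le> C * (word_avg n (\<lambda>w. cmod (F w) powr p) + word_avg n (\<lambda>w. cmod (G w) powr q))"
proof -
  have young: "cmod (z * w) \<le> cmod z powr p + cmod w powr q" for z w
  proof -
    have "cmod z * cmod w \<le> cmod z powr p / p + cmod w powr q / q"
      using p by (intro Youngs_inequality) auto
    also have "\<dots> \<le> cmod z powr p + cmod w powr q"
      using p by (intro add_mono) (simp_all add: divide_le_eq mult_le_cancel_left1)
    finally show ?thesis by (simp add: norm_mult)
  qed
  have avg: "cmod (word_avg n (\<lambda>w. F w * G w)) \<le> word_avg n (\<lambda>w. cmod (F w) powr p) + word_avg n (\<lambda>w. cmod (G w) powr q)" for n F G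
    unfolding word_avg_add[symmetric] by (intro order_trans[OF norm_word_avg] word_avg_mono young)
  have pos: "0 \<le> word_avg n (\<lambda>w. cmod (F w) powr r)" for n F r by (intro word_avg_nonneg) auto
  show ?thesis
  proof (cases "2 \<le> p")
    case True
    obtain C where C: "0 \<le> C" "\<forall>n s F. s = 1 \<or> s = -1 \<longrightarrow> word_avg n (\<lambda>w. cmod (mart_tr n s F w) powr p) \<le> C * word_avg n (\<lambda>w. cmod (F w) powr p)"
      using mart_tr_powr[OF True] by blast
    show ?thesis
    proof (intro exI[of _ "C + 1"] conjI allI)
      fix n F G
      show "cmod (mart_form n 1 (\<lambda>w w'. F w * G w')) \<le> (C + 1) * (word_avg n (\<lambda>w. cmod (F w) powr p) + word_avg n (\<lambda>w. cmod (G w) powr q))"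
        unfolding mart_form_prod using avg[of n "mart_tr n 1 F" G] C(2)[rule_format, where s = 1 and n = n and F = F] C(1) pos[of n F p] pos[of n G q]
          mult_nonneg_nonneg[OF C(1) pos[of n G q]]
        unfolding distrib_left distrib_right mult_1 by linarith
    qed (use C in simp)
  next
    case False
    have "1 / q \<le> 1 / 2"
    proof -
      have "1 / 2 \<le> 1 / p" using False p by (intro divide_left_mono) auto
      then show ?thesis using p by linarith
    qed
    then have q: "2 \<le> q" using p by (simp add: field_simps)
    obtain C where C: "0 \<le> C" "\<forall>n s F. s = 1 \<or> s = -1 \<longrightarrow> word_avg n (\<lambda>w. cmod (mart_tr n s F w) powr q) \<le> C * word_avg n (\<lambda>w. cmod (F w) powr q)"
      using mart_tr_powr[OF q] by blast
    show ?thesis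
    proof (intro exI[of _ "C + 1"] conjI allI)
      fix n F G
      show "cmod (mart_form n 1 (\<lambda>w w'. F w * G w')) \<le> (C + 1) * (word_avg n (\<lambda>w. cmod (F w) powr p) + word_avg n (\<lambda>w. cmod (G w) powr q))"
        unfolding mart_form_prod' using avg[of n F "mart_tr n 1 G"] C(2)[rule_format, where s = 1 and n = n and F = G] C(1) pos[of n F p] pos[of n G q]
          mult_nonneg_nonneg[OF C(1) pos[of n F p]]
        unfolding distrib_left distrib_right mult_1 by linarith
    qed (use C in simp)
  qed
qed

lemma convex_on_powr_nonneg:
  assumes p: "1 \<le> p" shows "convex_on {0..} (\<lambda>x::real. x powr p)"
proof (rule convex_onI)
  fix t x y :: real
  assume t: "0 < t" "t < 1" and xy: "x \<in> {0..}" "y \<in> {0..}"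
  have pt: "s powr p \<le> s" if "0 < s" "s < 1" for s :: real
    using powr_mono'[of 1 p s] p that by simp
  consider "x = 0" | "y = 0" | "0 < x" "0 < y" using xy by force
  then show "((1 - t) *\<^sub>R x + t *\<^sub>R y) powr p \<le> (1 - t) * x powr p + t * y powr p"
  proof cases
    case 1
    then show ?thesis using pt[of t] t by (simp add: powr_mult mult_right_mono)
  next
    case 2
    then show ?thesis using pt[of "1 - t"] t by (simp add: powr_mult mult_right_mono)
  next
    case 3
    then show ?thesis using convex_onD[OF powr_convex[OF p], of t x y] t by simp
  qed
qed simp

section \<open>Spaces of p-integrable functions\<close>

lemma lp_fun_iff:
  "lp_fun M p f \<longleftrightarrow> f \<in> borel_measurable M \<and> integrable M (\<lambda>x. cmod (f x) powr p)"
proof -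
  have "(\<lambda>x. cmod (f x) powr p) \<in> borel_measurable M" if [measurable]: "f \<in> borel_measurable M"
    by measurable
  then show ?thesis unfolding lp_fun_def integrable_iff_bounded by auto
qed

lemma lp_funD: "lp_fun M p f \<Longrightarrow> f \<in> borel_measurable M" "lp_fun M p f \<Longrightarrow> integrable M (\<lambda>x. cmod (f x) powr p)"
  by (auto simp: lp_fun_iff)

lemma lp_norm_eq:
  assumes "lp_fun M p f" shows "lp_norm M p f = (\<integral>x. cmod (f x) powr p \<partial>M) powr (1 / p)"
proof -
  have "(\<integral>x. cmod (f x) powr p \<partial>M) = enn2real (\<integral>\<^sup>+ x. ennreal (cmod (f x) powr p) \<partial>M)"
    using lp_funD(2)[OF assms] by (intro integral_eq_nn_integral) auto
  then show ?thesis by (simp add: lp_norm_def)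
qed

lemma lp_norm_nonneg [simp]: "0 \<le> lp_norm M p f"
  by (simp add: lp_norm_def)

lemma lp_norm_powr:
  assumes "lp_fun M p f" "0 < p" shows "lp_norm M p f powr p = (\<integral>x. cmod (f x) powr p \<partial>M)"
proof -
  have "0 \<le> (\<integral>x. cmod (f x) powr p \<partial>M)" by simp
  then show ?thesis using assms(2) by (simp add: lp_norm_eq[OF assms(1)] powr_powr)
qed

lemma lp_norm_leI:
  assumes "lp_fun M p f" "0 < p" "0 \<le> c" "(\<integral>x. cmod (f x) powr p \<partial>M) \<le> c powr p"
  shows "lp_norm M p f \<le> c"
proof -
  have "lp_norm M p f \<le> (c powr p) powr (1 / p)"
    unfolding lp_norm_eq[OF assms(1)] using assms by (intro powr_mono2) auto
  also have "\<dots> = c" using assms by (simp add: powr_powr)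
  finally show ?thesis .
qed

lemma lp_norm_leD:
  assumes "lp_fun M p f" "0 < p" "lp_norm M p f \<le> c"
  shows "(\<integral>x. cmod (f x) powr p \<partial>M) \<le> c powr p"
  unfolding lp_norm_powr[OF assms(1,2), symmetric] using assms lp_norm_nonneg by (intro powr_mono2) auto

lemma lp_mono:
  assumes f: "lp_fun M p f" and g: "g \<in> borel_measurable M" and B: "0 \<le> B" and p: "0 < p"
    and le: "\<And>x. x \<in> space M \<Longrightarrow> cmod (g x) \<le> B * cmod (f x)"
  shows "lp_fun M p g" "lp_norm M p g \<le> B * lp_norm M p f"
proof -
  have le': "cmod (g x) powr p \<le> B powr p * cmod (f x) powr p" if "x \<in> space M" for x
    using powr_mono2[OF _ _ le[OF that], of p] p B by (simp add: powr_mult)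
  have i: "integrable M (\<lambda>x. B powr p * cmod (f x) powr p)" using lp_funD(2)[OF f] by simp
  have "(\<lambda>x. cmod (g x) powr p) \<in> borel_measurable M" using g by measurable
  then have ig: "integrable M (\<lambda>x. cmod (g x) powr p)"
    by (rule Bochner_Integration.integrable_bound[OF i]) (auto intro!: AE_I2 le')
  then show lg: "lp_fun M p g" using g by (simp add: lp_fun_iff)
  have "(\<integral>x. cmod (g x) powr p \<partial>M) \<le> (\<integral>x. B powr p * cmod (f x) powr p \<partial>M)"
    by (rule integral_mono[OF ig i le'])
  also have "\<dots> = (B * lp_norm M p f) powr p"
    by (simp add: powr_mult lp_norm_powr[OF f p])
  finally show "lp_norm M p g \<le> B * lp_norm M p f"
    using B by (intro lp_norm_leI lg p) auto
qed

lemma lp_scale: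
  assumes f: "lp_fun M p f" and p: "0 < p"
  shows "lp_fun M p (\<lambda>x. c * f x)" "lp_norm M p (\<lambda>x. c * f x) = cmod c * lp_norm M p f"
proof -
  have m: "(\<lambda>x. c * f x) \<in> borel_measurable M" using lp_funD(1)[OF f] by measurable
  show cf: "lp_fun M p (\<lambda>x. c * f x)"
    by (rule lp_mono(1)[OF f m norm_ge_zero[of c] p]) (simp add: norm_mult)
  show "lp_norm M p (\<lambda>x. c * f x) = cmod c * lp_norm M p f"
    unfolding lp_norm_eq[OF f] lp_norm_eq[OF cf] using p
    by (simp add: norm_mult powr_mult powr_powr)
qed

lemma lp_zero: "lp_fun M p (\<lambda>x. 0)" "0 < p \<Longrightarrow> lp_norm M p (\<lambda>x. 0) = 0"
  by (simp_all add: lp_fun_iff lp_norm_def)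

text \<open>Minkowski's inequality from convexity of x^p: the two functions are divided by bounds A
  and B of their norms and combined with weights A / (A + B) and B / (A + B).\<close>

lemma lp_add:
  assumes f: "lp_fun M p f" and g: "lp_fun M p g" and p: "1 \<le> p"
  shows "lp_fun M p (\<lambda>x. f x + g x)" "lp_norm M p (\<lambda>x. f x + g x) \<le> lp_norm M p f + lp_norm M p g"
proof -
  have mf: "f \<in> borel_measurable M" "g \<in> borel_measurable M" using f g by (auto simp: lp_fun_iff)
  have key: "cmod (z + w) powr p \<le> (A + B) powr p * (A / (A + B) * (cmod z powr p / A powr p) + B / (A + B) * (cmod w powr p / B powr p))"
    if AB: "0 < A" "0 < B" for A B z w
  proof -
    define t where "t = B / (A + B)"
    have t: "0 \<le> t" "t \<le> 1" "1 - t = A / (A + B)" using AB by (auto simp: t_def field_simps)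
    have "((1 - t) * (cmod z / A) + t * (cmod w / B)) powr p \<le> (1 - t) * (cmod z / A) powr p + t * (cmod w / B) powr p"
      using convex_onD[OF convex_on_powr_nonneg[OF p] t(1,2), of "cmod z / A" "cmod w / B"] AB by simp
    moreover have "(1 - t) * (cmod z / A) + t * (cmod w / B) = (cmod z + cmod w) / (A + B)"
      unfolding t(3) unfolding t_def using AB by (simp add: add_divide_distrib)
    ultimately have "((cmod z + cmod w) / (A + B)) powr p \<le> A / (A + B) * (cmod z powr p / A powr p) + B / (A + B) * (cmod w powr p / B powr p)"
      unfolding t(3) unfolding t_def by (simp add: powr_divide)
    then have "(A + B) powr p * ((cmod z + cmod w) / (A + B)) powr p \<le> (A + B) powr p * (A / (A + B) * (cmod z powr p / A powr p) + B / (A + B) * (cmod w powr p / B powr p))"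
      by (intro mult_left_mono) auto
    moreover have "(A + B) powr p * ((cmod z + cmod w) / (A + B)) powr p = (cmod z + cmod w) powr p"
      using AB by (simp add: powr_divide)
    moreover have "cmod (z + w) powr p \<le> (cmod z + cmod w) powr p"
      using p by (intro powr_mono2 norm_triangle_ineq) auto
    ultimately show ?thesis by linarith
  qed
  have if': "integrable M (\<lambda>x. cmod (f x) powr p)" "integrable M (\<lambda>x. cmod (g x) powr p)"
    using f g by (auto simp: lp_fun_iff)
  have iAB: "integrable M (\<lambda>x. (A + B) powr p * (A / (A + B) * (cmod (f x) powr p / A powr p) + B / (A + B) * (cmod (g x) powr p / B powr p)))" for A B
    using if' by (intro integrable_mult_right Bochner_Integration.integrable_add integrable_divide) auto
  have m: "(\<lambda>x. cmod (f x + g x) powr p) \<in> borel_measurable M" using mf by measurable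
  have isum: "integrable M (\<lambda>x. cmod (f x + g x) powr p)"
    using m by (rule Bochner_Integration.integrable_bound[OF iAB[of 1 1]]) (use key[of 1 1] in \<open>auto intro!: AE_I2 simp del: norm_triangle_ineq\<close>)
  then show fg: "lp_fun M p (\<lambda>x. f x + g x)" using mf by (simp add: lp_fun_iff)
  \<comment> \<open>Strict bounds \<open>A\<close> and \<open>B\<close> are positive even if a norm
    is 0, so nothing is divided by 0; the exact inequality follows by letting them approach the
    norms.\<close>
  have le: "lp_norm M p (\<lambda>x. f x + g x) \<le> A + B" if A: "lp_norm M p f < A" and B: "lp_norm M p g < B" for A B
  proof -
    have pos: "0 < A" "0 < B" using order.strict_trans1[OF lp_norm_nonneg A] order.strict_trans1[OF lp_norm_nonneg B] by auto
    have "(\<integral>x. cmod (f x + g x) powr p \<partial>M) \<le>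
      (\<integral>x. (A + B) powr p * (A / (A + B) * (cmod (f x) powr p / A powr p) + B / (A + B) * (cmod (g x) powr p / B powr p)) \<partial>M)"
      by (rule integral_mono[OF isum iAB key[OF pos]])
    also have "\<dots> = (A + B) powr p * (A / (A + B) * ((\<integral>x. cmod (f x) powr p \<partial>M) / A powr p) + B / (A + B) * ((\<integral>x. cmod (g x) powr p \<partial>M) / B powr p))"
      using if' by simp
    also have "\<dots> \<le> (A + B) powr p * (A / (A + B) * 1 + B / (A + B) * 1)"
      using lp_norm_leD[OF f _ less_imp_le[OF A]] lp_norm_leD[OF g _ less_imp_le[OF B]] pos p
      by (intro mult_left_mono add_mono) (auto simp: divide_le_eq_1)
    also have "\<dots> = (A + B) powr p" using pos by (simp add: add_divide_distrib[symmetric])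
    finally show ?thesis using pos p by (intro lp_norm_leI fg) auto
  qed
  show "lp_norm M p (\<lambda>x. f x + g x) \<le> lp_norm M p f + lp_norm M p g"
  proof (rule field_le_epsilon)
    fix e :: real assume "0 < e"
    then show "lp_norm M p (\<lambda>x. f x + g x) \<le> lp_norm M p f + lp_norm M p g + e"
      using le[of "lp_norm M p f + e / 2" "lp_norm M p g + e / 2"] by simp
  qed
qed

lemma lp_diff:
  assumes f: "lp_fun M p f" and g: "lp_fun M p g" and p: "1 \<le> p"
  shows "lp_fun M p (\<lambda>x. f x - g x)" "lp_norm M p (\<lambda>x. f x - g x) \<le> lp_norm M p f + lp_norm M p g"
  using lp_add[OF f lp_scale(1)[OF g, of "-1"] p] lp_scale(2)[OF g, of "-1"] p by simp_all

lemma lp_norm_0_AE: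
  assumes "lp_fun M p f" "0 < p" "lp_norm M p f = 0" shows "AE x in M. f x = 0"
proof -
  have "(\<integral>x. cmod (f x) powr p \<partial>M) = 0" using lp_norm_powr[OF assms(1,2)] assms by simp
  then have "AE x in M. cmod (f x) powr p = 0"
    using integral_nonneg_eq_0_iff_AE[OF lp_funD(2)[OF assms(1)]] by simp
  then show ?thesis by simp
qed

lemma hoelder:
  assumes pq: "1 < p" "1 < q" "1 / p + 1 / q = 1" and f: "lp_fun M p f" and g: "lp_fun M q g"
  shows "integrable M (\<lambda>x. g x * f x)" "(\<integral>x. cmod (g x * f x) \<partial>M) \<le> lp_norm M q g * lp_norm M p f"
proof -
  have mf: "f \<in> borel_measurable M" "g \<in> borel_measurable M" using f g by (auto simp: lp_fun_iff)
  then have m: "(\<lambda>x. g x * f x) \<in> borel_measurable M" by measurable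
  have if': "integrable M (\<lambda>x. cmod (f x) powr p)" "integrable M (\<lambda>x. cmod (g x) powr q)"
    using f g by (auto simp: lp_fun_iff)
  \<comment> \<open>A = B = 1 serves for integrability; the norms themselves as \<open>A\<close> and
    \<open>B\<close> give the sharp constant.\<close>
  have young: "cmod (w * z) \<le> A * B * (cmod z powr p / A powr p / p + cmod w powr q / B powr q / q)"
    if "0 < A" "0 < B" for A B z w
  proof -
    have "(cmod z / A) * (cmod w / B) \<le> (cmod z / A) powr p / p + (cmod w / B) powr q / q"
      using pq that by (intro Youngs_inequality) auto
    then have "(A * B) * ((cmod z / A) * (cmod w / B)) \<le> A * B * ((cmod z / A) powr p / p + (cmod w / B) powr q / q)"
      using that by (intro mult_left_mono) auto
    then show ?thesis using that by (simp add: powr_divide norm_mult mult.commute)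
  qed
  have iAB: "integrable M (\<lambda>x. A * B * (cmod (f x) powr p / A powr p / p + cmod (g x) powr q / B powr q / q))" for A B
    using if' by (intro integrable_mult_right Bochner_Integration.integrable_add integrable_divide) auto
  show i: "integrable M (\<lambda>x. g x * f x)"
    using m by (rule Bochner_Integration.integrable_bound[OF iAB[of 1 1]])
      (use young[of 1 1] in \<open>auto intro!: AE_I2 order_trans[OF _ abs_ge_self] simp del: norm_mult\<close>)
  show "(\<integral>x. cmod (g x * f x) \<partial>M) \<le> lp_norm M q g * lp_norm M p f"
  proof (cases "lp_norm M p f = 0 \<or> lp_norm M q g = 0")
    case True
    then have "AE x in M. cmod (g x * f x) = 0"
      using lp_norm_0_AE[OF f] lp_norm_0_AE[OF g] pq by (auto elim: AE_mp)
    then have "(\<integral>x. cmod (g x * f x) \<partial>M) = 0" by (rule integral_eq_zero_AE)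
    then show ?thesis using lp_norm_nonneg[of M p f] lp_norm_nonneg[of M q g] by simp
  next
    case False
    define A where "A = lp_norm M p f"
    define B where "B = lp_norm M q g"
    have AB: "0 < A" "0 < B" using False by (auto simp: A_def B_def less_le)
    have "(\<integral>x. cmod (g x * f x) \<partial>M) \<le> (\<integral>x. A * B * (cmod (f x) powr p / A powr p / p + cmod (g x) powr q / B powr q / q) \<partial>M)"
      by (rule integral_mono[OF integrable_norm[OF i] iAB young[OF AB]])
    also have "\<dots> = A * B * ((\<integral>x. cmod (f x) powr p \<partial>M) / A powr p / p + (\<integral>x. cmod (g x) powr q \<partial>M) / B powr q / q)"
      using if' by simp
    also have "\<dots> = A * B * (1 / p + 1 / q)"
    proof -
      have "(\<integral>x. cmod (f x) powr p \<partial>M) = A powr p" "(\<integral>x. cmod (g x) powr q \<partial>M) = B powr q"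
        unfolding A_def B_def using lp_norm_powr[OF f] lp_norm_powr[OF g] pq by auto
      then show ?thesis using AB by simp
    qed
    finally show ?thesis using pq by (simp add: A_def B_def mult.commute)
  qed
qed

text \<open>Merges a series of series into one along \<open>prod_decode\<close>. Rows are controlled
  by a summable majorant \<open>B\<close> and not by exact sums, because representations realize the
  Herz norm only up to an error.\<close>

lemma double_series_sums:
  fixes c :: "nat \<Rightarrow> nat \<Rightarrow> real" and z :: "nat \<Rightarrow> nat \<Rightarrow> complex"
  assumes c: "\<And>k l. 0 \<le> c k l" "\<And>k. summable (c k)" "\<And>k. (\<Sum>l. c k l) \<le> B k" and B: "summable B"
    and z: "\<And>k l. cmod (z k l) \<le> c k l" "\<And>k. z k sums w k" "w sums s"
  shows "(\<lambda>n. case prod_decode n of (k, l) \<Rightarrow> z k l) sums s"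
proof -
  define C where "C k = (\<Sum>l. c k l)" for k
  have C0: "0 \<le> C k" for k unfolding C_def using c by (intro suminf_nonneg) auto
  have "summable C" by (rule summable_comparison_test'[OF B, of 0]) (use c(3) C0 in \<open>simp add: C_def\<close>)
  then have "(C has_sum suminf C) UNIV" by (intro sums_nonneg_imp_has_sum summable_sums C0)
  then have Cs: "C summable_on UNIV" by (rule has_sum_imp_summable)
  have ck: "((\<lambda>l. c k l) has_sum C k) UNIV" for k
    unfolding C_def by (intro sums_nonneg_imp_has_sum summable_sums c)
  have cs: "(\<lambda>(k, l). c k l) summable_on UNIV \<times> UNIV"
    by (rule summable_on_SigmaI[where g = C]) (use ck Cs c(1) in auto)
  have "(\<lambda>x. norm ((\<lambda>(k, l). z k l) x)) summable_on UNIV \<times> UNIV"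
    by (rule Infinite_Sum.abs_summable_on_comparison_test'[OF cs]) (use z(1) in auto)
  then have "(\<lambda>(k, l). z k l) summable_on UNIV \<times> UNIV" by (rule Infinite_Sum.abs_summable_summable)
  then obtain S where S: "((\<lambda>(k, l). z k l) has_sum S) (UNIV \<times> UNIV)" by (auto simp: summable_on_def)
  have zk: "((\<lambda>l. z k l) has_sum w k) UNIV" for k
  proof (rule norm_summable_imp_has_sum)
    show "summable (\<lambda>l. norm (z k l))"
      by (rule summable_comparison_test'[OF c(2)[of k], of 0]) (use z(1) in simp)
  qed (rule z(2))
  have "(w has_sum S) UNIV"
    using has_sum_SigmaD[OF S, of w] zk by simp
  then have "S = s" using has_sum_imp_sums z(3) sums_unique2 by blast
  moreover have "((\<lambda>n. (\<lambda>(k, l). z k l) (prod_decode n)) has_sum S) UNIV"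
    using S has_sum_reindex_bij_betw[OF bij_prod_decode, of "\<lambda>(k, l). z k l" S] by simp
  ultimately show ?thesis using has_sum_imp_sums by fastforce
qed

lemma double_series_bound:
  fixes c :: "nat \<Rightarrow> nat \<Rightarrow> real"
  assumes c: "\<And>k l. 0 \<le> c k l" "\<And>k. summable (c k)" "\<And>k. (\<Sum>l. c k l) \<le> B k" and B: "summable B"
  shows "summable (\<lambda>n. case prod_decode n of (k, l) \<Rightarrow> c k l)"
    and "(\<Sum>n. case prod_decode n of (k, l) \<Rightarrow> c k l) \<le> suminf B"
proof -
  have C0: "0 \<le> suminf (c k)" for k using c by (intro suminf_nonneg) auto
  have Cs: "summable (\<lambda>k. suminf (c k))" by (rule summable_comparison_test'[OF B, of 0]) (use c(3) C0 in simp)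
  have "(\<lambda>n. case prod_decode n of (k, l) \<Rightarrow> complex_of_real (c k l)) sums complex_of_real (\<Sum>k. suminf (c k))"
  proof (rule double_series_sums[OF c B])
    show "(\<lambda>l. complex_of_real (c k l)) sums complex_of_real (suminf (c k))" for k
      by (intro sums_of_real summable_sums c)
    show "(\<lambda>k. complex_of_real (suminf (c k))) sums complex_of_real (\<Sum>k. suminf (c k))"
      by (intro sums_of_real summable_sums Cs)
  qed (use c in simp)
  moreover have "(\<lambda>n. case prod_decode n of (k, l) \<Rightarrow> complex_of_real (c k l)) = (\<lambda>n. complex_of_real (case prod_decode n of (k, l) \<Rightarrow> c k l))"
    by (auto split: prod.split)
  ultimately have *: "(\<lambda>n. case prod_decode n of (k, l) \<Rightarrow> c k l) sums (\<Sum>k. suminf (c k))"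
    by (simp only: sums_of_real_iff)
  then show "summable (\<lambda>n. case prod_decode n of (k, l) \<Rightarrow> c k l)" by (rule sums_summable)
  show "(\<Sum>n. case prod_decode n of (k, l) \<Rightarrow> c k l) \<le> suminf B"
    using sums_unique[OF *] suminf_le[OF c(3) Cs B] by simp
qed

section \<open>The Herz algebra\<close>

locale haar_group =
  fixes G :: "('a, 'b) monoid_scheme" (structure) and T :: "'a topology" and M :: "'a measure" and p q :: real
  assumes lc: "lc_group G T" and haar: "left_haar G T M" and p1: "1 < p" and q_def: "q = conj_exp p"
begin

sublocale group G
  using lc by (simp add: lc_group_def)

lemma topspace_T: "topspace T = carrier G"
  and Hausdorff_T: "Hausdorff_space T"
  and locally_compact_T: "locally_compact_space T"
  and cont_mult: "continuous_map (prod_topology T T) T (\<lambda>(x, y). x \<otimes> y)"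
  and cont_inv: "continuous_map T T (\<lambda>x. inv x)"
  using lc by (auto simp: lc_group_def)

lemma space_M: "space M = carrier G"
  and sets_M: "sets M = sigma_sets (carrier G) {U. openin T U}"
  and measure_carrier: "emeasure M (carrier G) \<noteq> 0"
  and compact_finite: "compactin T K \<Longrightarrow> emeasure M K < \<infinity>"
  and outer_regular: "A \<in> sets M \<Longrightarrow> emeasure M A = (INF U \<in> {U. openin T U \<and> A \<subseteq> U}. emeasure M U)"
  and inner_regular: "openin T U \<Longrightarrow> emeasure M U = (SUP K \<in> {K. compactin T K \<and> K \<subseteq> U}. emeasure M K)"
  and left_transl_sets: "g \<in> carrier G \<Longrightarrow> A \<in> sets M \<Longrightarrow> (\<lambda>x. g \<otimes> x) ` A \<in> sets M"
  and left_transl: "g \<in> carrier G \<Longrightarrow> A \<in> sets M \<Longrightarrow> emeasure M ((\<lambda>x. g \<otimes> x) ` A) = emeasure M A"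
  using haar by (auto simp: left_haar_def topspace_T)

lemma open_sets: "openin T U \<Longrightarrow> U \<in> sets M"
  by (simp add: sets_M)

lemma closed_sets: "closedin T C \<Longrightarrow> C \<in> sets M"
proof -
  assume C: "closedin T C"
  then have "carrier G - (carrier G - C) \<in> sets M"
    unfolding sets_M by (intro sigma_sets.Compl sigma_sets.Basic) (auto simp: closedin_def topspace_T)
  moreover have "carrier G - (carrier G - C) = C" using closedin_subset[OF C] by (auto simp: topspace_T)
  ultimately show ?thesis by simp
qed

lemma compact_sets: "compactin T K \<Longrightarrow> K \<in> sets M"
  using closed_sets compactin_imp_closedin[OF Hausdorff_T] by blast

lemma q1: "1 < q" and pq: "1 / p + 1 / q = 1"
  using p1 by (auto simp: q_def conj_exp_def field_simps)

lemma left_mult_vimage: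
  assumes "g \<in> carrier G" "A \<subseteq> carrier G"
  shows "(\<lambda>x. g \<otimes> x) -` A \<inter> carrier G = (\<lambda>x. inv g \<otimes> x) ` A"
proof (intro equalityI subsetI)
  fix x assume "x \<in> (\<lambda>x. g \<otimes> x) -` A \<inter> carrier G"
  then show "x \<in> (\<lambda>x. inv g \<otimes> x) ` A"
    using assms by (intro image_eqI[of _ _ "g \<otimes> x"]) (auto simp: m_assoc[symmetric])
next
  fix x assume "x \<in> (\<lambda>x. inv g \<otimes> x) ` A"
  then obtain a where "a \<in> A" "x = inv g \<otimes> a" by blast
  moreover from this have "a \<in> carrier G" using assms by blast
  ultimately show "x \<in> (\<lambda>x. g \<otimes> x) -` A \<inter> carrier G"
    using assms by (simp add: m_assoc[symmetric])
qed

lemma left_mult_measurable: "g \<in> carrier G \<Longrightarrow> (\<lambda>x. g \<otimes> x) \<in> measurable M M"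
proof (rule measurableI)
  fix A assume g: "g \<in> carrier G" and A: "A \<in> sets M"
  then show "(\<lambda>x. g \<otimes> x) -` A \<inter> space M \<in> sets M"
    using left_mult_vimage[OF g, of A] sets.sets_into_space[OF A] left_transl_sets[of "inv g" A]
    by (simp add: space_M)
qed (simp add: space_M)

lemma left_mult_distr: "g \<in> carrier G \<Longrightarrow> distr M M (\<lambda>x. g \<otimes> x) = M"
proof (rule measure_eqI)
  fix A assume g: "g \<in> carrier G" and "A \<in> sets (distr M M (\<lambda>x. g \<otimes> x))"
  then have A: "A \<in> sets M" by simp
  show "emeasure (distr M M (\<lambda>x. g \<otimes> x)) A = emeasure M A"
    using left_mult_vimage[OF g, of A] sets.sets_into_space[OF A] left_transl[of "inv g" A] g A
    by (simp add: emeasure_distr left_mult_measurable space_M)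
qed simp

lemma integral_left_transl:
  fixes f :: "'a \<Rightarrow> 'c::{banach, second_countable_topology}"
  assumes "g \<in> carrier G" "f \<in> borel_measurable M"
  shows "(\<integral>x. f (g \<otimes> x) \<partial>M) = (\<integral>x. f x \<partial>M)"
  using integral_distr[OF left_mult_measurable[OF assms(1)] assms(2)] left_mult_distr[OF assms(1)] by simp

lemma integrable_left_transl:
  fixes f :: "'a \<Rightarrow> 'c::{banach, second_countable_topology}"
  assumes "g \<in> carrier G" "integrable M f"
  shows "integrable M (\<lambda>x. f (g \<otimes> x))"
  using integrable_distr[OF left_mult_measurable[OF assms(1)], of f] left_mult_distr[OF assms(1)] assms(2) by simp

lemma lp_transl:
  assumes g: "g \<in> carrier G" and f: "lp_fun M r f"
  shows "lp_fun M r (\<lambda>y. f (g \<otimes> y))" "lp_norm M r (\<lambda>y. f (g \<otimes> y)) = lp_norm M r f"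
proof -
  have mf: "f \<in> borel_measurable M" and i: "integrable M (\<lambda>x. cmod (f x) powr r)" using f by (auto simp: lp_fun_iff)
  have "(\<lambda>y. f (g \<otimes> y)) \<in> borel_measurable M"
    using measurable_compose[OF left_mult_measurable[OF g] mf] .
  then show l: "lp_fun M r (\<lambda>y. f (g \<otimes> y))"
    using integrable_left_transl[OF g i] by (simp add: lp_fun_iff)
  show "lp_norm M r (\<lambda>y. f (g \<otimes> y)) = lp_norm M r f"
    unfolding lp_norm_eq[OF l] lp_norm_eq[OF f]
    using integral_left_transl[OF g, of "\<lambda>x. cmod (f x) powr r"] i by simp
qed

section \<open>Convolutions and atomic representations\<close>

abbreviation "conv \<equiv> conv_check G M"
abbreviation "A \<equiv> herz G M p"
abbreviation "N \<equiv> herz_norm G M p"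

lemma conv_integrable:
  assumes "lp_fun M p f" "lp_fun M q g" "x \<in> carrier G"
  shows "integrable M (\<lambda>y. g y * f (inv x \<otimes> y))"
  using hoelder(1)[OF p1 q1 pq lp_transl(1)[OF _ assms(1)] assms(2)] assms(3) by simp

lemma conv_bound:
  assumes f: "lp_fun M p f" and g: "lp_fun M q g" and x: "x \<in> carrier G"
  shows "cmod (conv g f x) \<le> lp_norm M q g * lp_norm M p f"
proof -
  have "cmod (conv g f x) \<le> (\<integral>y. cmod (g y * f (inv x \<otimes> y)) \<partial>M)"
    unfolding conv_check_def by (rule integral_norm_bound)
  also have "\<dots> \<le> lp_norm M q g * lp_norm M p (\<lambda>y. f (inv x \<otimes> y))"
    using x by (intro hoelder(2)[OF p1 q1 pq] lp_transl f g) auto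
  finally show ?thesis using lp_transl(2)[OF _ f, of "inv x"] x by simp
qed

lemma conv_scale_left: "conv (\<lambda>y. c * g y) f x = c * conv g f x"
  by (simp add: conv_check_def mult.assoc)

lemma conv_scale_right: "conv g (\<lambda>y. c * f y) x = c * conv g f x"
  by (simp add: conv_check_def mult.left_commute)

lemma conv_diff_right:
  assumes "lp_fun M p f" "lp_fun M p f'" "lp_fun M q g" "x \<in> carrier G"
  shows "conv g (\<lambda>y. f y - f' y) x = conv g f x - conv g f' x"
  using conv_integrable[OF assms(1,3,4)] conv_integrable[OF assms(2,3,4)]
  by (simp add: conv_check_def right_diff_distrib)

lemma conv_diff_left:
  assumes "lp_fun M p f" "lp_fun M q g" "lp_fun M q g'" "x \<in> carrier G"
  shows "conv (\<lambda>y. g y - g' y) f x = conv g f x - conv g' f x"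
  using conv_integrable[OF assms(1,2,4)] conv_integrable[OF assms(1,3,4)]
  by (simp add: conv_check_def left_diff_distrib)

lemma lp_sum:
  fixes n :: nat
  assumes "\<And>k. lp_fun M r (h k)" "1 \<le> r" shows "lp_fun M r (\<lambda>y. \<Sum>k<n. h k y)"
proof (induction n)
  case (Suc n) then show ?case using lp_add(1)[OF Suc assms(1) assms(2)] by simp
qed (simp add: lp_zero)

text \<open>\<open>conv_bound\<close> is uniform in the point, so convergence in L_p of the partial
  sums gives pointwise convergence of the convolutions. Later this replaces continuity when bounds
  are extended by density.\<close>

lemma conv_sums_right:
  assumes f: "lp_fun M p f" and g: "lp_fun M q g" and h: "\<And>k::nat. lp_fun M p (h k)" and x: "x \<in> carrier G"
    and lim: "(\<lambda>n. lp_norm M p (\<lambda>y. f y - (\<Sum>k<n. h k y))) \<longlonglongrightarrow> 0"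
  shows "(\<lambda>k. conv g (h k) x) sums conv g f x"
proof -
  have s: "lp_fun M p (\<lambda>y. \<Sum>k<n. h k y)" for n using lp_sum[OF h] p1 by simp
  have fin: "(\<Sum>k<n. conv g (h k) x) = conv g (\<lambda>y. \<Sum>k<n. h k y) x" for n
    unfolding conv_check_def sum_distrib_left
    using conv_integrable[OF h g x] by (subst Bochner_Integration.integral_sum) auto
  have "(\<lambda>n. conv g f x - (\<Sum>k<n. conv g (h k) x)) \<longlonglongrightarrow> 0"
  proof (rule Lim_null_comparison)
    show "eventually (\<lambda>n. norm (conv g f x - (\<Sum>k<n. conv g (h k) x)) \<le> lp_norm M q g * lp_norm M p (\<lambda>y. f y - (\<Sum>k<n. h k y))) sequentially"
      unfolding fin conv_diff_right[OF f s g x, symmetric]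
      using p1 by (intro always_eventually allI conv_bound lp_diff f s g x) auto
    show "(\<lambda>n. lp_norm M q g * lp_norm M p (\<lambda>y. f y - (\<Sum>k<n. h k y))) \<longlonglongrightarrow> 0"
      using tendsto_mult_right_zero[OF lim] by simp
  qed
  then have "(\<lambda>n. conv g f x - (conv g f x - (\<Sum>k<n. conv g (h k) x))) \<longlonglongrightarrow> conv g f x - 0" by (intro tendsto_intros)
  then show ?thesis by (simp add: sums_def)
qed

lemma conv_sums_left:
  assumes f: "lp_fun M p f" and g: "lp_fun M q g" and h: "\<And>k::nat. lp_fun M q (h k)" and x: "x \<in> carrier G"
    and lim: "(\<lambda>n. lp_norm M q (\<lambda>y. g y - (\<Sum>k<n. h k y))) \<longlonglongrightarrow> 0"
  shows "(\<lambda>k. conv (h k) f x) sums conv g f x"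
proof -
  have s: "lp_fun M q (\<lambda>y. \<Sum>k<n. h k y)" for n using lp_sum[OF h] q1 by simp
  have fin: "(\<Sum>k<n. conv (h k) f x) = conv (\<lambda>y. \<Sum>k<n. h k y) f x" for n
    unfolding conv_check_def sum_distrib_right
    using conv_integrable[OF f h x] by (subst Bochner_Integration.integral_sum) auto
  have "(\<lambda>n. conv g f x - (\<Sum>k<n. conv (h k) f x)) \<longlonglongrightarrow> 0"
  proof (rule Lim_null_comparison)
    show "eventually (\<lambda>n. norm (conv g f x - (\<Sum>k<n. conv (h k) f x)) \<le> lp_norm M q (\<lambda>y. g y - (\<Sum>k<n. h k y)) * lp_norm M p f) sequentially"
      unfolding fin conv_diff_left[OF f g s x, symmetric]
      using q1 by (intro always_eventually allI conv_bound lp_diff f s g x) auto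
    show "(\<lambda>n. lp_norm M q (\<lambda>y. g y - (\<Sum>k<n. h k y)) * lp_norm M p f) \<longlonglongrightarrow> 0"
      using tendsto_mult_left_zero[OF lim] by simp
  qed
  then have "(\<lambda>n. conv g f x - (conv g f x - (\<Sum>k<n. conv (h k) f x))) \<longlonglongrightarrow> conv g f x - 0" by (intro tendsto_intros)
  then show ?thesis by (simp add: sums_def)
qed

text \<open>Normal form of a representation: the sizes go into nonnegative coefficients and the
  factors into the unit balls. The Herz norm becomes the infimum of the coefficient sums, as for a
  projective tensor norm.\<close>

definition atom :: "('a \<Rightarrow> complex) \<Rightarrow> ('a \<Rightarrow> complex) \<Rightarrow> bool" where
  "atom f g \<longleftrightarrow> lp_fun M p f \<and> lp_norm M p f \<le> 1 \<and> lp_fun M q g \<and> lp_norm M q g \<le> 1"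

lemma atom_zero: "atom (\<lambda>x. 0) (\<lambda>x. 0)"
  using p1 q1 by (simp add: atom_def lp_zero)

lemma atom_conv_le: "atom f g \<Longrightarrow> x \<in> carrier G \<Longrightarrow> cmod (conv g f x) \<le> 1"
  using conv_bound[of f g x] mult_mono[of "lp_norm M q g" 1 "lp_norm M p f" 1] by (auto simp: atom_def)

lemma herz_norm_nonneg_bdd: "bdd_below {(\<Sum>i. lp_norm M p (f i) * lp_norm M (conj_exp p) (g i)) | f g. herz_rep G M p u f g}"
  by (rule bdd_belowI[of _ 0]) (auto simp: herz_rep_def intro!: suminf_nonneg)

lemma herz_norm_nonneg: "u \<in> A \<Longrightarrow> 0 \<le> N u"
proof -
  assume "u \<in> A"
  then have "{(\<Sum>i. lp_norm M p (f i) * lp_norm M (conj_exp p) (g i)) | f g. herz_rep G M p u f g} \<noteq> {}"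
    by (auto simp: herz_def)
  then show ?thesis
    unfolding herz_norm_def by (rule cInf_greatest) (auto simp: herz_rep_def intro!: suminf_nonneg)
qed

lemma herz_atomicI:
  assumes c: "\<And>i. 0 \<le> c i" "summable c" and at: "\<And>i. atom (f i) (g i)"
    and u: "\<And>x. x \<in> carrier G \<Longrightarrow> (\<lambda>i. complex_of_real (c i) * conv (g i) (f i) x) sums u x"
    and u0: "\<And>x. x \<notin> carrier G \<Longrightarrow> u x = 0"
  shows "u \<in> A" "N u \<le> suminf c"
proof -
  define g' where "g' i y = complex_of_real (c i) * g i y" for i y
  have q0: "0 < q" using q1 by simp
  have g': "lp_fun M q (g' i)" "lp_norm M q (g' i) = c i * lp_norm M q (g i)" for i
    using lp_scale[of M q "g i" "complex_of_real (c i)"] at q0 c(1)[of i] by (auto simp: g'_def[abs_def] atom_def)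
  have le: "lp_norm M p (f i) * lp_norm M q (g' i) \<le> c i" for i
  proof -
    have "lp_norm M p (f i) * lp_norm M q (g i) \<le> 1 * 1"
      using at by (intro mult_mono) (auto simp: atom_def)
    then have "c i * (lp_norm M p (f i) * lp_norm M q (g i)) \<le> c i * 1"
      using c(1) by (intro mult_left_mono) auto
    then show ?thesis by (simp add: g' mult.left_commute)
  qed
  have sm: "summable (\<lambda>i. lp_norm M p (f i) * lp_norm M q (g' i))"
    by (rule summable_comparison_test'[OF c(2), of 0]) (use le in auto)
  have "conv (g' i) (f i) x = complex_of_real (c i) * conv (g i) (f i) x" for i x
    unfolding g'_def conv_scale_left ..
  then have rep: "herz_rep G M p u f g'"
    unfolding herz_rep_def q_def[symmetric] using at g' sm u u0 by (auto simp: atom_def)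
  then show "u \<in> A" by (auto simp: herz_def)
  have "N u \<le> (\<Sum>i. lp_norm M p (f i) * lp_norm M q (g' i))"
    unfolding herz_norm_def using rep by (intro cInf_lower herz_norm_nonneg_bdd) (auto simp: q_def)
  also have "\<dots> \<le> suminf c" using le by (intro suminf_le sm c)
  finally show "N u \<le> suminf c" .
qed

lemma herz_out: "u \<in> A \<Longrightarrow> x \<notin> carrier G \<Longrightarrow> u x = 0"
  by (auto simp: herz_def herz_rep_def)

lemma herz_atomicE:
  assumes u: "u \<in> A" and d: "0 < d"
  obtains c f g where "\<forall>i. 0 \<le> c i \<and> atom (f i) (g i)" "summable c" "suminf c \<le> N u + d"
    "\<forall>x\<in>carrier G. (\<lambda>i. complex_of_real (c i) * conv (g i) (f i) x) sums u x"
proof -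
  have ne: "{(\<Sum>i. lp_norm M p (f i) * lp_norm M (conj_exp p) (g i)) | f g. herz_rep G M p u f g} \<noteq> {}"
    using u by (auto simp: herz_def)
  have "N u < N u + d" using d by simp
  then obtain f g where rep: "herz_rep G M p u f g" and lt: "(\<Sum>i. lp_norm M p (f i) * lp_norm M q (g i)) < N u + d"
    unfolding herz_norm_def cInf_less_iff[OF ne herz_norm_nonneg_bdd] by (auto simp: q_def)
  have fg: "lp_fun M p (f i)" "lp_fun M q (g i)" for i using rep by (auto simp: herz_rep_def q_def)
  define a where "a i = lp_norm M p (f i)" for i
  define b where "b i = lp_norm M q (g i)" for i
  have ab: "0 \<le> a i" "0 \<le> b i" for i by (auto simp: a_def b_def)
  \<comment> \<open>A factor of norm 0 cannot be normalized; its convolution vanishes by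
    \<open>conv_bound\<close>, so the zero atom with coefficient 0 takes its place.\<close>
  define f' where "f' i = (if a i * b i = 0 then (\<lambda>x. 0) else (\<lambda>x. complex_of_real (1 / a i) * f i x))" for i
  define g' where "g' i = (if a i * b i = 0 then (\<lambda>x. 0) else (\<lambda>x. complex_of_real (1 / b i) * g i x))" for i
  have at: "atom (f' i) (g' i)" for i
  proof (cases "a i * b i = 0")
    case True then show ?thesis using atom_zero by (simp add: f'_def g'_def)
  next
    case False
    have "cmod (complex_of_real (1 / a i)) * lp_norm M p (f i) = 1"
      using False ab[of i] by (simp add: norm_divide a_def[symmetric])
    moreover have "cmod (complex_of_real (1 / b i)) * lp_norm M q (g i) = 1"
      using False ab[of i] by (simp add: norm_divide b_def[symmetric])
    ultimately show ?thesis
      using False lp_scale[OF fg(1)[of i], of "complex_of_real (1 / a i)"] lp_scale[OF fg(2)[of i], of "complex_of_real (1 / b i)"] p1 q1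
      by (simp add: atom_def f'_def g'_def)
  qed
  have eq: "complex_of_real (a i * b i) * conv (g' i) (f' i) x = conv (g i) (f i) x" if x: "x \<in> carrier G" for i x
  proof (cases "a i * b i = 0")
    case True
    then have "conv (g i) (f i) x = 0" using conv_bound[OF fg(1)[of i] fg(2)[of i] x] by (auto simp: a_def b_def mult.commute)
    then show ?thesis using True by simp
  next
    case False
    then have "conv (g' i) (f' i) x = complex_of_real (1 / b i) * (complex_of_real (1 / a i) * conv (g i) (f i) x)"
      by (simp only: f'_def g'_def if_False conv_scale_left conv_scale_right)
    then show ?thesis using False by simp
  qed
  show thesis
  proof (rule that[of "\<lambda>i. a i * b i" f' g'])
    show "\<forall>i. 0 \<le> a i * b i \<and> atom (f' i) (g' i)" using ab at by simp
    show "summable (\<lambda>i. a i * b i)" using rep by (simp add: herz_rep_def a_def b_def q_def)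
    show "(\<Sum>i. a i * b i) \<le> N u + d" using lt by (simp add: a_def b_def)
    show "\<forall>x\<in>carrier G. (\<lambda>i. complex_of_real (a i * b i) * conv (g' i) (f' i) x) sums u x"
      using rep by (simp only: eq cong: ball_cong) (simp add: herz_rep_def)
  qed
qed

lemma herz_conv:
  assumes f: "lp_fun M p f" and g: "lp_fun M q g"
  shows "(\<lambda>x. if x \<in> carrier G then conv g f x else 0) \<in> A"
    "N (\<lambda>x. if x \<in> carrier G then conv g f x else 0) \<le> lp_norm M q g * lp_norm M p f"
proof -
  define f' where "f' i = (if i = 0 then f else (\<lambda>x. 0))" for i :: nat
  define g' where "g' i = (if i = 0 then g else (\<lambda>x. 0))" for i :: nat
  have l: "lp_norm M p (f' i) * lp_norm M (conj_exp p) (g' i) = (if i = 0 then lp_norm M q g * lp_norm M p f else 0)" for i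
    using p1 by (simp add: f'_def g'_def q_def lp_zero)
  have rep: "herz_rep G M p (\<lambda>x. if x \<in> carrier G then conv g f x else 0) f' g'"
    unfolding herz_rep_def l
  proof (intro conjI allI ballI impI)
    show "lp_fun M p (f' i)" "lp_fun M (conj_exp p) (g' i)" for i using f g by (auto simp: f'_def g'_def lp_zero q_def)
    show "summable (\<lambda>i::nat. if i = 0 then lp_norm M q g * lp_norm M p f else 0)"
      by (rule sums_summable[OF sums_If_finite[of "\<lambda>i. i = 0", simplified]])
    show "(\<lambda>i. conv (g' i) (f' i) x) sums (if x \<in> carrier G then conv g f x else 0)" if "x \<in> carrier G" for x
    proof -
      have "(\<lambda>i. conv (g' i) (f' i) x) = (\<lambda>i. if i = 0 then conv g f x else 0)"
        by (auto simp: f'_def g'_def conv_check_def)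
      then show ?thesis using that sums_single[of 0 "\<lambda>_. conv g f x"] by simp
    qed
  qed simp
  then show "(\<lambda>x. if x \<in> carrier G then conv g f x else 0) \<in> A" by (auto simp: herz_def)
  have "N (\<lambda>x. if x \<in> carrier G then conv g f x else 0) \<le> (\<Sum>i. lp_norm M p (f' i) * lp_norm M (conj_exp p) (g' i))"
    unfolding herz_norm_def using rep by (intro cInf_lower herz_norm_nonneg_bdd) auto
  also have "\<dots> = lp_norm M q g * lp_norm M p f"
    unfolding l using sums_single[of 0 "\<lambda>_. lp_norm M q g * lp_norm M p f"] by (simp add: sums_iff)
  finally show "N (\<lambda>x. if x \<in> carrier G then conv g f x else 0) \<le> lp_norm M q g * lp_norm M p f" .
qed

text \<open>Countable subadditivity, the form in which completeness of the algebra enters. Term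
  \<open>k\<close> is represented with an excess of at most e / 2^(k+1), all the representations are
  merged into one, and the total excess is \<open>e\<close>.\<close>

lemma herz_series:
  assumes w: "\<And>k::nat. w k \<in> A" "\<And>k. N (w k) \<le> b k" and b: "summable b"
    and u: "\<And>x. x \<in> carrier G \<Longrightarrow> (\<lambda>k. w k x) sums u x" and u0: "\<And>x. x \<notin> carrier G \<Longrightarrow> u x = 0"
  shows "u \<in> A" "N u \<le> suminf b"
proof -
  have main: "u \<in> A \<and> N u \<le> suminf b + e" if e: "0 < e" for e
  proof -
    have "\<exists>cfg. (\<forall>i. 0 \<le> fst cfg i \<and> atom (fst (snd cfg) i) (snd (snd cfg) i)) \<and> summable (fst cfg) \<and> suminf (fst cfg) \<le> N (w k) + e * (1/2) ^ Suc k \<and>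
      (\<forall>x\<in>carrier G. (\<lambda>i. complex_of_real (fst cfg i) * conv (snd (snd cfg) i) (fst (snd cfg) i) x) sums w k x)" for k
    proof -
      have "0 < e * (1/2) ^ Suc k" using e by simp
      from herz_atomicE[OF w(1)[of k] this] obtain c f g where
        "\<forall>i. 0 \<le> c i \<and> atom (f i) (g i)" "summable c" "suminf c \<le> N (w k) + e * (1/2) ^ Suc k"
        "\<forall>x\<in>carrier G. (\<lambda>i. complex_of_real (c i) * conv (g i) (f i) x) sums w k x" .
      then show ?thesis by (intro exI[of _ "(c, f, g)"]) (simp only: fst_conv snd_conv simp_thms)
    qed
    then have "\<exists>F. \<forall>k. (\<forall>i. 0 \<le> fst (F k) i \<and> atom (fst (snd (F k)) i) (snd (snd (F k)) i)) \<and> summable (fst (F k)) \<and> suminf (fst (F k)) \<le> N (w k) + e * (1/2) ^ Suc k \<and>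
      (\<forall>x\<in>carrier G. (\<lambda>i. complex_of_real (fst (F k) i) * conv (snd (snd (F k)) i) (fst (snd (F k)) i) x) sums w k x)"
      by (intro choice allI)
    then obtain F where F: "\<forall>k. (\<forall>i. 0 \<le> fst (F k) i \<and> atom (fst (snd (F k)) i) (snd (snd (F k)) i)) \<and> summable (fst (F k)) \<and> suminf (fst (F k)) \<le> N (w k) + e * (1/2) ^ Suc k \<and>
      (\<forall>x\<in>carrier G. (\<lambda>i. complex_of_real (fst (F k) i) * conv (snd (snd (F k)) i) (fst (snd (F k)) i) x) sums w k x)" ..
    define c where "c k = fst (F k)" for k
    define f where "f k = fst (snd (F k))" for k
    define g where "g k = snd (snd (F k))" for k
    define B where "B k = b k + e * (1/2) ^ Suc k" for k
    have c: "0 \<le> c k l" "summable (c k)" and at: "atom (f k l) (g k l)" for k l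
      using F[rule_format, of k] by (simp_all add: c_def f_def g_def)
    have cB: "suminf (c k) \<le> B k" for k
    proof -
      have "suminf (c k) \<le> N (w k) + e * (1/2) ^ Suc k"
        using F[rule_format, of k] unfolding c_def by blast
      then show ?thesis using w(2)[of k] unfolding B_def by linarith
    qed
    have s: "(\<lambda>i. complex_of_real (c k i) * conv (g k i) (f k i) x) sums w k x" if "x \<in> carrier G" for k x
      using F[rule_format, of k] that unfolding c_def f_def g_def by blast
    have Bs: "B sums (suminf b + e)"
      unfolding B_def using sums_add[OF summable_sums[OF b] sums_mult[OF power_half_series, of e]] by simp
    note db = double_series_bound[OF c cB sums_summable[OF Bs]]
    have z: "(\<lambda>n. case prod_decode n of (k, l) \<Rightarrow> complex_of_real (c k l) * conv (g k l) (f k l) x) sums u x"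
      if x: "x \<in> carrier G" for x
    proof (rule double_series_sums[OF c cB sums_summable[OF Bs]])
      fix k l
      show "cmod (complex_of_real (c k l) * conv (g k l) (f k l) x) \<le> c k l"
        using mult_left_mono[OF atom_conv_le[OF at x] c(1)] c(1)[of k l] by (simp add: norm_mult)
    qed (use s u x in auto)
    have eq: "(\<lambda>n. complex_of_real (case prod_decode n of (k, l) \<Rightarrow> c k l) * conv (case prod_decode n of (k, l) \<Rightarrow> g k l) (case prod_decode n of (k, l) \<Rightarrow> f k l) x)
      = (\<lambda>n. case prod_decode n of (k, l) \<Rightarrow> complex_of_real (c k l) * conv (g k l) (f k l) x)" for x
      by (auto split: prod.split)
    have "u \<in> A \<and> N u \<le> (\<Sum>n. case prod_decode n of (k, l) \<Rightarrow> c k l)"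
    proof (intro conjI herz_atomicI[where f = "\<lambda>n. case prod_decode n of (k, l) \<Rightarrow> f k l" and g = "\<lambda>n. case prod_decode n of (k, l) \<Rightarrow> g k l"])
    qed (use db(1) c(1) at u0 z in \<open>auto simp: eq split: prod.split\<close>)
    then show ?thesis using db(2) sums_unique[OF Bs] by simp
  qed
  show "u \<in> A" using main[of 1] by simp
  show "N u \<le> suminf b" by (rule field_le_epsilon) (use main in blast)
qed

lemma herz_zero: "(\<lambda>x. 0) \<in> A" "N (\<lambda>x. 0) = 0"
proof -
  have z: "(\<lambda>x. 0) \<in> A \<and> N (\<lambda>x. 0) \<le> suminf (\<lambda>i::nat. 0)"
    by (intro conjI herz_atomicI[where c = "\<lambda>_. 0" and f = "\<lambda>_ x. 0" and g = "\<lambda>_ x. 0"]) (auto simp: atom_zero)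
  then show "(\<lambda>x. 0) \<in> A" by simp
  then show "N (\<lambda>x. 0) = 0" using herz_norm_nonneg[of "\<lambda>x. 0"] z by simp
qed

lemma sums_pair:
  fixes h :: "('a \<Rightarrow> complex) \<Rightarrow> 'd::real_normed_vector"
  assumes "h (\<lambda>x. 0) = 0"
  shows "(\<lambda>k::nat. h (if k = 0 then u else if k = 1 then v else (\<lambda>x. 0))) sums (h u + h v)"
proof -
  have "(\<lambda>k::nat. h (if k = 0 then u else if k = 1 then v else (\<lambda>x. 0))) sums
      (\<Sum>k\<in>{0, 1::nat}. h (if k = 0 then u else if k = 1 then v else (\<lambda>x. 0)))"
    by (rule sums_finite) (use assms in auto)
  then show ?thesis by simp
qed

lemma herz_add:
  assumes u: "u \<in> A" and v: "v \<in> A"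
  shows "(\<lambda>x. u x + v x) \<in> A" "N (\<lambda>x. u x + v x) \<le> N u + N v"
proof -
  define w where "w k = (if k = 0 then u else if k = 1 then v else (\<lambda>x. 0))" for k :: nat
  have Nw: "(\<lambda>k. N (w k)) sums (N u + N v)"
    unfolding w_def by (rule sums_pair) (rule herz_zero)
  have w: "w k \<in> A" for k using u v herz_zero by (simp add: w_def)
  have s: "(\<lambda>k. w k x) sums (u x + v x)" for x
    unfolding w_def by (rule sums_pair[of "\<lambda>u. u x"]) simp
  have u0: "u x + v x = 0" if "x \<notin> carrier G" for x
    using herz_out[OF u that] herz_out[OF v that] by simp
  show "(\<lambda>x. u x + v x) \<in> A"
    by (rule herz_series(1)[OF w order_refl sums_summable[OF Nw] s u0])
  show "N (\<lambda>x. u x + v x) \<le> N u + N v"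
    using herz_series(2)[OF w order_refl sums_summable[OF Nw] s u0] sums_unique[OF Nw] by simp
qed

lemma herz_scale:
  assumes u: "u \<in> A"
  shows "(\<lambda>x. a * u x) \<in> A" "N (\<lambda>x. a * u x) \<le> cmod a * N u"
proof -
  have main: "(\<lambda>x. a * u x) \<in> A \<and> N (\<lambda>x. a * u x) \<le> cmod a * (N u + e)" if e: "0 < e" for e
  proof -
    obtain c f g where c: "\<forall>i. 0 \<le> c i \<and> atom (f i) (g i)" "summable c" "suminf c \<le> N u + e"
      and s: "\<forall>x\<in>carrier G. (\<lambda>i. complex_of_real (c i) * conv (g i) (f i) x) sums u x"
      by (rule herz_atomicE[OF u e])
    \<comment> \<open>The phase of \<open>a\<close> goes into the second factor and its modulus into
      the coefficient, which has to stay nonnegative.\<close>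
    have at: "atom (f i) (\<lambda>y. sgn a * g i y)" for i
      using c(1)[rule_format, of i] lp_scale[of M q "g i" "sgn a"] q1
        mult_mono[of "cmod (sgn a)" 1 "lp_norm M q (g i)" 1] by (auto simp: atom_def norm_sgn)
    have ss: "(\<lambda>i. complex_of_real (cmod a * c i) * conv (\<lambda>y. sgn a * g i y) (f i) x) sums (a * u x)" if "x \<in> carrier G" for x
    proof -
      have eq: "complex_of_real (cmod a * c i) * conv (\<lambda>y. sgn a * g i y) (f i) x = a * (complex_of_real (c i) * conv (g i) (f i) x)" for i
      proof -
        have "complex_of_real (cmod a) * sgn a = a" by (cases "a = 0") (simp_all add: sgn_eq)
        then show ?thesis unfolding conv_scale_left by (metis mult.assoc mult.commute of_real_mult)
      qed
      show ?thesis unfolding eq by (rule sums_mult[OF s[rule_format, OF that]])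
    qed
    have c0: "0 \<le> cmod a * c i" for i using c(1) by simp
    have u0: "a * u x = 0" if "x \<notin> carrier G" for x using herz_out[OF u that] by simp
    have "(\<lambda>x. a * u x) \<in> A \<and> N (\<lambda>x. a * u x) \<le> (\<Sum>i. cmod a * c i)"
      using herz_atomicI[OF c0 summable_mult[OF c(2)] at ss u0] by blast
    moreover have "(\<Sum>i. cmod a * c i) \<le> cmod a * (N u + e)"
      unfolding suminf_mult[OF c(2)] by (rule mult_left_mono[OF c(3)]) simp
    ultimately show ?thesis by linarith
  qed
  show "(\<lambda>x. a * u x) \<in> A" using main[of 1] by simp
  show "N (\<lambda>x. a * u x) \<le> cmod a * N u"
  proof (rule field_le_epsilon)
    fix e :: real assume e: "0 < e"
    have pos: "0 < cmod a + 1" by (simp add: add_nonneg_pos)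
    define d where "d = e / (cmod a + 1)"
    have d: "0 < d" "d * (cmod a + 1) = e" using e pos by (auto simp: d_def)
    then have "cmod a * (N u + d) \<le> cmod a * N u + e" by (simp add: algebra_simps)
    then show "N (\<lambda>x. a * u x) \<le> cmod a * N u + e"
      using main[OF d(1)] by linarith
  qed
qed

end

lemma lp_cong:
  assumes "\<And>x. x \<in> space M \<Longrightarrow> f x = g x"
  shows "lp_fun M r f \<longleftrightarrow> lp_fun M r g" "lp_norm M r f = lp_norm M r g"
proof -
  have "(\<integral>\<^sup>+ x. ennreal (cmod (f x) powr r) \<partial>M) = (\<integral>\<^sup>+ x. ennreal (cmod (g x) powr r) \<partial>M)"
    by (rule nn_integral_cong) (simp add: assms)
  then show "lp_fun M r f \<longleftrightarrow> lp_fun M r g" "lp_norm M r f = lp_norm M r g"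
    using measurable_cong[of M f g borel] assms by (auto simp: lp_fun_def lp_norm_def)
qed

section \<open>Density of compactly supported continuous functions\<close>

context haar_group
begin

definition cc :: "('a \<Rightarrow> complex) \<Rightarrow> bool" where
  "cc f \<longleftrightarrow> continuous_map T euclidean f \<and> (\<exists>K. compactin T K \<and> (\<forall>x\<in>carrier G - K. f x = 0))"

lemma continuous_measurable:
  assumes "continuous_map T euclidean f" shows "f \<in> borel_measurable M"
proof (rule borel_measurableI)
  fix S :: "'c set" assume "open S"
  then have "openin T {x \<in> topspace T. f x \<in> S}"
    using openin_continuous_map_preimage[OF assms] by simp
  moreover have "{x \<in> topspace T. f x \<in> S} = f -` S \<inter> space M" by (auto simp: topspace_T space_M)
  ultimately show "f -` S \<inter> space M \<in> sets M" using open_sets by simp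
qed

lemma cc_measurable: "cc f \<Longrightarrow> f \<in> borel_measurable M"
  by (simp add: cc_def continuous_measurable)

lemma cc_bounded:
  assumes "cc f" shows "\<exists>B\<ge>0. \<forall>x\<in>carrier G. cmod (f x) \<le> B"
proof -
  obtain K where K: "compactin T K" "\<forall>x\<in>carrier G - K. f x = 0" and c: "continuous_map T euclidean f"
    using assms by (auto simp: cc_def)
  have "compact (f ` K)" using image_compactin[OF K(1) c] by simp
  then obtain B where "\<forall>z\<in>f ` K. cmod z \<le> B" using compact_imp_bounded bounded_iff by blast
  then have "cmod (f x) \<le> max B 0" if "x \<in> carrier G" for x using K(2) that by (cases "x \<in> K") force+
  then show ?thesis by (intro exI[of _ "max B 0"]) auto
qed

lemma cc_lp:
  assumes f: "cc f" and r: "0 < r" shows "lp_fun M r f"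
proof -
  obtain K where K: "compactin T K" "\<forall>x\<in>carrier G - K. f x = 0" using f by (auto simp: cc_def)
  obtain B where B: "0 \<le> B" "\<forall>x\<in>carrier G. cmod (f x) \<le> B" using cc_bounded[OF f] by blast
  have m: "f \<in> borel_measurable M" by (rule cc_measurable[OF f])
  have "integrable M (\<lambda>x. cmod (f x) powr r)"
  proof (rule integrableI_bounded_set[where A = K and B = "B powr r"])
    show "K \<in> sets M" using K compact_sets by simp
    show "(\<lambda>x. cmod (f x) powr r) \<in> borel_measurable M" using m by measurable
    show "emeasure M K < \<infinity>" using K compact_finite by simp
    show "AE x in M. x \<in> K \<longrightarrow> norm (cmod (f x) powr r) \<le> B powr r"
      using B r by (intro AE_I2) (auto simp: space_M intro!: powr_mono2)
    show "AE x in M. x \<notin> K \<longrightarrow> cmod (f x) powr r = 0"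
      using K by (intro AE_I2) (auto simp: space_M)
  qed
  then show ?thesis using m by (simp add: lp_fun_iff)
qed

lemma cc_comp:
  assumes f: "cc f" and h: "continuous_on UNIV h" "h 0 = 0" shows "cc (\<lambda>x. h (f x))"
proof -
  obtain K where K: "compactin T K" "\<forall>x\<in>carrier G - K. f x = 0" and c: "continuous_map T euclidean f"
    using f by (auto simp: cc_def)
  have "continuous_map T euclidean (h \<circ> f)"
    using c h(1) by (intro continuous_map_compose[OF c]) simp
  then show ?thesis using K h(2) by (auto simp: cc_def comp_def)
qed

lemma cc_powr: "cc f \<Longrightarrow> 0 < r \<Longrightarrow> cc (\<lambda>x. complex_of_real (cmod (f x) powr r))"
  by (rule cc_comp[where h = "\<lambda>z. complex_of_real (cmod z powr r)"])
     (auto intro!: continuous_intros continuous_on_powr')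

lemma cc_scale: "cc f \<Longrightarrow> cc (\<lambda>x. c * f x)"
  by (rule cc_comp[where h = "\<lambda>z. c * z"]) (auto intro!: continuous_intros)

lemma cc_add: assumes "cc f" "cc g" shows "cc (\<lambda>x. f x + g x)"
proof -
  obtain K L where "compactin T K" "\<forall>x\<in>carrier G - K. f x = 0" "compactin T L" "\<forall>x\<in>carrier G - L. g x = 0"
    using assms by (auto simp: cc_def)
  moreover have "continuous_map T euclidean (\<lambda>x. f x + g x)"
    using assms by (auto simp: cc_def intro: continuous_map_add)
  ultimately show ?thesis unfolding cc_def by (intro conjI exI[of _ "K \<union> L"] compactin_Un) auto
qed

lemma cc_diff: "cc f \<Longrightarrow> cc g \<Longrightarrow> cc (\<lambda>x. f x - g x)"
  using cc_add[of f "\<lambda>x. -1 * g x"] cc_scale[of g "-1"] by simp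

lemma cc_zero: "cc (\<lambda>x. 0)"
  by (auto simp: cc_def intro!: exI[of _ "{}"])

text \<open>A property of a single function: being an L_r limit of functions satisfying
  \<open>cc\<close>. It is stable under sums and multiples, which carries it from indicators to
  simple functions.\<close>

definition dense_in_lp :: "real \<Rightarrow> ('a \<Rightarrow> complex) \<Rightarrow> bool" where
  "dense_in_lp r f \<longleftrightarrow> lp_fun M r f \<and> (\<forall>e>0. \<exists>h. cc h \<and> lp_norm M r (\<lambda>x. f x - h x) < e)"

lemma dense_diff: "dense_in_lp r f \<Longrightarrow> cc h \<Longrightarrow> 1 \<le> r \<Longrightarrow> lp_fun M r (\<lambda>x. f x - h x)"
  using lp_diff(1)[of M r f h] cc_lp[of h r] by (auto simp: dense_in_lp_def)

lemma cc_dense_add: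
  assumes f: "dense_in_lp r f" and g: "dense_in_lp r g" and r: "1 \<le> r"
  shows "dense_in_lp r (\<lambda>x. f x + g x)"
  unfolding dense_in_lp_def
proof (intro conjI allI impI)
  show "lp_fun M r (\<lambda>x. f x + g x)" using f g r by (auto simp: dense_in_lp_def intro: lp_add)
  fix e :: real assume "0 < e"
  then have e2: "0 < e / 2" by simp
  obtain h where h: "cc h" "lp_norm M r (\<lambda>x. f x - h x) < e / 2" using f e2 unfolding dense_in_lp_def by blast
  obtain k where k: "cc k" "lp_norm M r (\<lambda>x. g x - k x) < e / 2" using g e2 unfolding dense_in_lp_def by blast
  have "lp_fun M r (\<lambda>x. f x - h x)" "lp_fun M r (\<lambda>x. g x - k x)"
    using dense_diff[OF f h(1) r] dense_diff[OF g k(1) r] by auto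
  from lp_add(2)[OF this r] h k have "lp_norm M r (\<lambda>x. (f x - h x) + (g x - k x)) < e" by linarith
  moreover have "(\<lambda>x. (f x - h x) + (g x - k x)) = (\<lambda>x. (f x + g x) - (h x + k x))" by (auto simp: algebra_simps)
  ultimately show "\<exists>h. cc h \<and> lp_norm M r (\<lambda>x. f x + g x - h x) < e"
    using cc_add[OF h(1) k(1)] by (intro exI[of _ "\<lambda>x. h x + k x"]) auto
qed

lemma cc_dense_scale:
  assumes f: "dense_in_lp r f" and r: "1 \<le> r"
  shows "dense_in_lp r (\<lambda>x. c * f x)"
  unfolding dense_in_lp_def
proof (intro conjI allI impI)
  show "lp_fun M r (\<lambda>x. c * f x)" using f r by (auto simp: dense_in_lp_def intro: lp_scale)
  fix e :: real assume e: "0 < e"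
  have pos: "0 < cmod c + 1" by (simp add: add_nonneg_pos)
  then have "0 < e / (cmod c + 1)" using e by simp
  then obtain h where h: "cc h" "lp_norm M r (\<lambda>x. f x - h x) < e / (cmod c + 1)"
    using f unfolding dense_in_lp_def by blast
  have l: "lp_fun M r (\<lambda>x. f x - h x)" using dense_diff[OF f h(1) r] .
  have "lp_norm M r (\<lambda>x. f x - h x) * (cmod c + 1) < e" using h(2) pos by (simp add: pos_less_divide_eq)
  moreover have "lp_norm M r (\<lambda>x. c * (f x - h x)) = cmod c * lp_norm M r (\<lambda>x. f x - h x)"
    using lp_scale(2)[OF l] r by simp
  ultimately have "lp_norm M r (\<lambda>x. c * (f x - h x)) < e"
    using lp_norm_nonneg[of M r "\<lambda>x. f x - h x"] unfolding distrib_left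
    by (simp only: mult.commute mult_1 mult_1_right)
  then show "\<exists>h. cc h \<and> lp_norm M r (\<lambda>x. c * f x - h x) < e"
    using cc_scale[OF h(1), of c] by (intro exI[of _ "\<lambda>x. c * h x"]) (auto simp: right_diff_distrib)
qed

text \<open>Outer regularity gives an open \<open>U\<close> around \<open>B\<close>, inner
  regularity a compact \<open>K\<close> in \<open>U\<close>, and Urysohn's lemma a function that is
  1 on \<open>K\<close> and 0 off \<open>U\<close>. It can differ from the indicator only on
  \<open>E\<close>, which has small measure; local compactness makes its support compact.\<close>

lemma cc_dense_indicator:
  assumes B: "B \<in> sets M" "emeasure M B < \<infinity>" and r: "1 \<le> r"
  shows "dense_in_lp r (indicator B)"
  unfolding dense_in_lp_def
proof (intro conjI allI impI)
  have ip: "cmod (indicator B x) powr r = indicator B x" for x by (simp add: indicator_def)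
  show lB: "lp_fun M r (indicator B)"
    unfolding lp_fun_iff ip using B by (auto intro: integrable_real_indicator)
  fix e :: real assume e: "0 < e"
  \<comment> \<open>Makes 2 d, the bound for the measure of \<open>E\<close>, equal to (e /
    2)^r.\<close>
  define d where "d = (e / 2) powr r / 2"
  have d: "0 < d" using e by (simp add: d_def)
  have Bfin: "emeasure M B \<noteq> \<infinity>" using B(2) by simp
  obtain U where U: "openin T U" "B \<subseteq> U" "emeasure M U < emeasure M B + ennreal d"
    using INF_approx_ennreal[OF d outer_regular[OF B(1)] Bfin] by blast
  have "emeasure M B + ennreal d < \<infinity>" using B(2) by simp
  then have Ufin: "emeasure M U \<noteq> \<infinity>" using order.strict_trans[OF U(3)] by fastforce
  have ne: "{K. compactin T K \<and> K \<subseteq> U} \<noteq> {}" using compactin_empty by blast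
  \<comment> \<open>Inner regularity is given for open sets, so \<open>K\<close> exhausts
    \<open>U\<close> and need not lie in \<open>B\<close>.\<close>
  obtain K where K: "compactin T K" "K \<subseteq> U" "emeasure M U < emeasure M K + ennreal d"
    using SUP_approx_ennreal[OF d ne inner_regular[OF U(1)] Ufin] by blast
  obtain V L where V: "openin T V" "compactin T L" "K \<subseteq> V" "V \<subseteq> L"
    using locally_compact_space_compact_closed_compact[of T] Hausdorff_T locally_compact_T K(1) by blast
  have cr: "completely_regular_space T"
    by (intro locally_compact_regular_imp_completely_regular_space locally_compact_Hausdorff_imp_regular_space
        Hausdorff_T locally_compact_T disjI1) 
  have UV: "openin T (U \<inter> V)" using U V by auto
  then have "closedin T (topspace T - U \<inter> V)" by auto
  moreover have "disjnt K (topspace T - U \<inter> V)" using K V by (auto simp: disjnt_def)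
  ultimately obtain \<phi> where \<phi>: "continuous_map T (top_of_set {0..1::real}) \<phi>" "\<phi> ` (topspace T - U \<inter> V) \<subseteq> {0}" "\<phi> ` K \<subseteq> {1}"
    using Urysohn_completely_regular_compact_closed[OF zero_le_one cr K(1)] by metis
  define h where "h x = complex_of_real (\<phi> x)" for x
  have \<phi>01: "0 \<le> \<phi> x" "\<phi> x \<le> 1" if "x \<in> carrier G" for x
    using \<phi>(1) that topspace_T by (auto simp: continuous_map_in_subtopology image_subset_iff)
  have "continuous_map T euclidean (complex_of_real \<circ> \<phi>)"
    using \<phi>(1) by (intro continuous_map_compose[of _ euclideanreal])
      (auto simp: continuous_map_in_subtopology intro!: continuous_intros)
  then have h: "cc h"
    unfolding cc_def using V(2,4) \<phi>(2) topspace_T by (auto simp: h_def[abs_def] comp_def intro!: exI[of _ L])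
  define E where "E = (U - B) \<union> (U - K)"
  have Es: "U \<in> sets M" "K \<in> sets M" "E \<in> sets M"
    using open_sets U compact_sets K B by (auto simp: E_def)
  have "emeasure M (U - B) \<le> ennreal d"
    using U B Es by (subst emeasure_Diff) (auto simp: ennreal_minus_le_iff less_imp_le add.commute)
  moreover have "emeasure M (U - K) \<le> ennreal d"
    using K Es Ufin emeasure_mono[OF K(2) Es(1)] 
    by (subst emeasure_Diff) (auto simp: ennreal_minus_le_iff less_imp_le add.commute top_unique)
  ultimately have "emeasure M E \<le> ennreal d + ennreal d"
    unfolding E_def using Es B by (intro order_trans[OF emeasure_subadditive] add_mono) auto
  then have E: "emeasure M E \<le> ennreal (2 * d)" using d by (simp flip: ennreal_plus)
  have Efin: "emeasure M E < \<infinity>" using order_le_less_trans[OF E ennreal_less_top] by simp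
  have mE: "measure M E \<le> 2 * d" using E d by (simp add: measure_def enn2real_leI)
  have le: "cmod (indicator B x - h x) powr r \<le> indicator E x" if x: "x \<in> space M" for x
  proof (cases "x \<in> E")
    case True
    have "cmod (indicator B x - h x) \<le> 1"
    proof (cases "x \<in> B")
      case True
      then have "indicator B x - h x = complex_of_real (1 - \<phi> x)" by (simp add: h_def)
      then show ?thesis using \<phi>01[of x] x by (simp only: norm_of_real space_M) simp
    next
      case False
      then show ?thesis using \<phi>01[of x] x by (simp add: h_def space_M)
    qed
    then have "cmod (indicator B x - h x) powr r \<le> 1 powr r" using r by (intro powr_mono2) auto
    then show ?thesis using True by simp
  next
    case False
    then have "x \<in> B \<inter> K \<or> x \<notin> U" using x U(2) by (auto simp: E_def)
    then have "indicator B x = h x"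
      using \<phi>(2,3) U(2) x topspace_T by (auto simp: h_def space_M image_subset_iff indicator_def)
    then show ?thesis by simp
  qed
  have ld: "lp_fun M r (\<lambda>x. indicator B x - h x)" using r by (intro lp_diff lB cc_lp h) auto
  have "(\<integral>x. cmod (indicator B x - h x) powr r \<partial>M) \<le> (\<integral>x. indicator E x \<partial>M)"
    using lp_funD(2)[OF ld] Es Efin le by (intro integral_mono) (auto intro: integrable_real_indicator)
  also have "\<dots> \<le> (e / 2) powr r" using mE Es sets.sets_into_space[OF Es(3)] by (simp add: d_def Int_absorb2)
  finally have "lp_norm M r (\<lambda>x. indicator B x - h x) \<le> e / 2"
    using r e by (intro lp_norm_leI ld) auto
  then show "\<exists>h. cc h \<and> lp_norm M r (\<lambda>x. indicator B x - h x) < e" using h e by (intro exI[of _ h]) auto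
qed

text \<open>Simple functions dominated by 2 |f| converge to \<open>f\<close> in L_r by dominated
  convergence; the majorant 3^r |f|^r comes from |f| + 2 |f|. One of them is then a finite
  combination of indicators.\<close>

lemma cc_dense:
  assumes f: "lp_fun M r f" and r: "1 \<le> r" and e: "0 < e"
  shows "\<exists>h. cc h \<and> lp_norm M r (\<lambda>x. f x - h x) < e"
proof -
  have mf: "f \<in> borel_measurable M" using f by (simp add: lp_fun_iff)
  obtain s where s': "(\<forall>i. simple_function M (s i)) \<and> (\<forall>x\<in>space M. (\<lambda>i. s i x) \<longlonglongrightarrow> f x) \<and>
    (\<forall>i. \<forall>x\<in>space M. dist (s i x) 0 \<le> 2 * dist (f x) 0)"
    using borel_measurable_implies_sequence_metric[OF mf, of 0] by blast
  have s: "simple_function M (s i)" "x \<in> space M \<Longrightarrow> (\<lambda>i. s i x) \<longlonglongrightarrow> f x"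
    "x \<in> space M \<Longrightarrow> cmod (s i x) \<le> 2 * cmod (f x)" for i x
    using s' by (auto simp: dist_norm)
  have ms: "s i \<in> borel_measurable M" for i by (rule borel_measurable_simple_function[OF s(1)])
  have ls: "lp_fun M r (s i)" for i by (rule lp_mono(1)[OF f ms, of 2]) (use r s(3) in auto)
  have ld: "lp_fun M r (\<lambda>x. f x - s i x)" for i by (intro lp_diff f ls r)
  have "(\<lambda>i. \<integral>x. cmod (f x - s i x) powr r \<partial>M) \<longlonglongrightarrow> (\<integral>x. 0 \<partial>M)"
  proof (rule integral_dominated_convergence[where w = "\<lambda>x. 3 powr r * cmod (f x) powr r"])
    show "(\<lambda>x. cmod (f x - s i x) powr r) \<in> borel_measurable M" for i using mf ms by measurable
    show "integrable M (\<lambda>x. 3 powr r * cmod (f x) powr r)" using lp_funD(2)[OF f] by simp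
    show "AE x in M. (\<lambda>i. cmod (f x - s i x) powr r) \<longlonglongrightarrow> 0"
    proof (rule AE_I2)
      fix x assume x: "x \<in> space M"
      have "(\<lambda>i. cmod (f x - s i x)) \<longlonglongrightarrow> 0"
        using tendsto_norm[OF tendsto_diff[OF tendsto_const[of "f x"] s(2)[OF x]]] by simp
      then have "(\<lambda>i. cmod (f x - s i x) powr r) \<longlonglongrightarrow> 0 powr r"
        using r by (intro tendsto_powr') auto
      then show "(\<lambda>i. cmod (f x - s i x) powr r) \<longlonglongrightarrow> 0" by simp
    qed
    show "AE x in M. norm (cmod (f x - s i x) powr r) \<le> 3 powr r * cmod (f x) powr r" for i
    proof (rule AE_I2)
      fix x assume "x \<in> space M"
      then have "cmod (f x - s i x) \<le> 3 * cmod (f x)" using norm_triangle_ineq4[of "f x" "s i x"] s(3)[of x i] by linarith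
      then have "cmod (f x - s i x) powr r \<le> (3 * cmod (f x)) powr r" using r by (intro powr_mono2) auto
      then show "norm (cmod (f x - s i x) powr r) \<le> 3 powr r * cmod (f x) powr r" by (simp add: powr_mult)
    qed
  qed simp
  then have "eventually (\<lambda>i. (\<integral>x. cmod (f x - s i x) powr r \<partial>M) < (e / 4) powr r) sequentially"
    using e by (intro order_tendstoD) auto
  then obtain i where i: "(\<integral>x. cmod (f x - s i x) powr r \<partial>M) < (e / 4) powr r"
    by (auto simp: eventually_sequentially)
  have i': "lp_norm M r (\<lambda>x. f x - s i x) \<le> e / 4" using r e i by (intro lp_norm_leI ld) auto
  have "dense_in_lp r (\<lambda>x. \<Sum>c\<in>C. c * indicator (s i -` {c} \<inter> space M) x)" if "finite C" "C \<subseteq> s i ` space M - {0}" for C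
    using that
  proof (induction C)
    case empty
    have "dense_in_lp r (\<lambda>x. 0)"
      unfolding dense_in_lp_def using r lp_zero(1) lp_zero(2)[of r M] cc_zero by (auto intro!: exI[of _ "\<lambda>x. 0"])
    then show ?case by simp
  next
    case (insert c C)
    define Z where "Z = s i -` {c} \<inter> space M"
    have Z: "Z \<in> sets M" unfolding Z_def by (rule simple_functionD(2)[OF s(1)])
    have c: "c \<noteq> 0" using insert.prems by auto
    \<comment> \<open>On the level set \<open>Z\<close> the function |s i|^r is the constant |c|^r,
      which is positive because the value 0 was left out; integrability therefore forces finite
      measure.\<close>
    have "integrable M (\<lambda>x. indicator Z x * cmod (s i x) powr r)"
      using integrable_mult_indicator[OF Z lp_funD(2)[OF ls]] by simp
    also have "(\<lambda>x. indicator Z x * cmod (s i x) powr r) = (\<lambda>x. cmod c powr r * indicator Z x)"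
      by (auto simp: Z_def indicator_def)
    finally have "integrable M (\<lambda>x. (1 / cmod c powr r) * (cmod c powr r * indicator Z x :: real))"
      by (rule integrable_mult_right)
    then have "integrable M (indicator Z :: 'a \<Rightarrow> real)" using c by simp
    then have "emeasure M Z < \<infinity>" using Z integrable_indicator_iff[of M Z] sets.sets_into_space[OF Z] by (simp add: Int_absorb2)
    then have "dense_in_lp r (\<lambda>x. c * indicator Z x)" by (intro cc_dense_scale cc_dense_indicator Z r)
    moreover have "dense_in_lp r (\<lambda>x. \<Sum>c\<in>C. c * indicator (s i -` {c} \<inter> space M) x)" using insert by auto
    ultimately have "dense_in_lp r (\<lambda>x. c * indicator Z x + (\<Sum>c\<in>C. c * indicator (s i -` {c} \<inter> space M) x))"
      by (intro cc_dense_add r)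
    then show ?case unfolding sum.insert[OF insert.hyps(1,2)] Z_def .
  qed
  from this[of "s i ` space M - {0}"] simple_functionD(1)[OF s(1)]
  have D: "dense_in_lp r (\<lambda>x. \<Sum>c\<in>s i ` space M - {0}. c * indicator (s i -` {c} \<inter> space M) x)" by auto
  have eq: "(\<Sum>c\<in>s i ` space M - {0}. c * indicator (s i -` {c} \<inter> space M) x) = s i x" if "x \<in> space M" for x
  proof -
    have "(\<Sum>c\<in>s i ` space M - {0}. c * indicator (s i -` {c} \<inter> space M) x) = (\<Sum>c\<in>s i ` space M - {0}. if c = s i x then c else 0)"
      using that by (intro sum.cong) (auto simp: indicator_def)
    also have "\<dots> = s i x" using simple_functionD(1)[OF s(1), of i] that by auto
    finally show ?thesis .
  qed
  obtain h where h: "cc h" "lp_norm M r (\<lambda>x. (\<Sum>c\<in>s i ` space M - {0}. c * indicator (s i -` {c} \<inter> space M) x) - h x) < e / 2"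
    using D e unfolding dense_in_lp_def by (meson half_gt_zero)
  have "lp_norm M r (\<lambda>x. s i x - h x) < e / 2"
    using h(2) lp_cong(2)[of M "\<lambda>x. s i x - h x" "\<lambda>x. (\<Sum>c\<in>s i ` space M - {0}. c * indicator (s i -` {c} \<inter> space M) x) - h x" r] eq
    by simp
  moreover have "lp_norm M r (\<lambda>x. (f x - s i x) + (s i x - h x)) \<le> lp_norm M r (\<lambda>x. f x - s i x) + lp_norm M r (\<lambda>x. s i x - h x)"
    using r by (intro lp_add ld lp_diff ls cc_lp h) auto
  ultimately have "lp_norm M r (\<lambda>x. f x - h x) < e" using i' e by simp
  then show ?thesis using h(1) by blast
qed

text \<open>Telescoping sum of approximations with geometric errors, so that the norms of the terms
  add up to at most \<open>d\<close> more than the norm of \<open>f\<close>. The factor 1/8 leaves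
  room: two consecutive errors of at most (d / 8) / 2^j add up to d / 2^(j+2).\<close>

lemma cc_series:
  assumes f: "lp_fun M r f" and r: "1 \<le> r" and d: "0 < d"
  shows "\<exists>h :: nat \<Rightarrow> 'a \<Rightarrow> complex. (\<forall>k. cc (h k)) \<and> (\<lambda>n. lp_norm M r (\<lambda>x. f x - (\<Sum>k<n. h k x))) \<longlonglongrightarrow> 0
     \<and> (\<forall>k. lp_norm M r (h k) \<le> (if k = 0 then lp_norm M r f else 0) + d * (1/2) ^ Suc k)"
proof -
  have "\<forall>n. \<exists>h. cc h \<and> lp_norm M r (\<lambda>x. f x - h x) < d / 8 * (1/2) ^ n"
    using d by (intro allI cc_dense f r) simp
  then obtain H where H: "\<forall>n. cc (H n) \<and> lp_norm M r (\<lambda>x. f x - H n x) < d / 8 * (1/2) ^ n"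
    using choice by metis
  have r0: "0 < r" using r by simp
  have lH: "lp_fun M r (H n)" for n using H r0 cc_lp by blast
  have lfH: "lp_fun M r (\<lambda>x. f x - H n x)" for n by (rule lp_diff(1)[OF f lH r])
  define h where "h k = (case k of 0 \<Rightarrow> H 0 | Suc j \<Rightarrow> (\<lambda>x. H (Suc j) x - H j x))" for k
  have part: "(\<Sum>k<Suc n. h k x) = H n x" for n x
    by (induction n) (simp_all add: h_def)
  have P1: "cc (h k)" for k using H by (cases k) (auto simp: h_def intro!: cc_diff)
  have P2: "(\<lambda>n. lp_norm M r (\<lambda>x. f x - (\<Sum>k<n. h k x))) \<longlonglongrightarrow> 0"
  proof (rule LIMSEQ_imp_Suc, unfold part, rule Lim_null_comparison)
    show "eventually (\<lambda>n. norm (lp_norm M r (\<lambda>x. f x - H n x)) \<le> d / 8 * (1/2) ^ n) sequentially"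
      using H by (auto intro!: always_eventually less_imp_le)
    show "(\<lambda>n. d / 8 * (1/2) ^ n) \<longlonglongrightarrow> 0" by (intro tendsto_mult_right_zero LIMSEQ_power_zero) simp
  qed
  have P3: "lp_norm M r (h k) \<le> (if k = 0 then lp_norm M r f else 0) + d * (1/2) ^ Suc k" for k
  proof (cases k)
    case 0
    have "lp_norm M r (\<lambda>x. f x - (f x - H 0 x)) \<le> lp_norm M r f + lp_norm M r (\<lambda>x. f x - H 0 x)"
      by (intro lp_diff(2) f lfH r)
    then show ?thesis using 0 H[rule_format, of 0] d by (simp add: h_def)
  next
    case (Suc j)
    have "lp_norm M r (\<lambda>x. (f x - H j x) - (f x - H (Suc j) x)) \<le> lp_norm M r (\<lambda>x. f x - H j x) + lp_norm M r (\<lambda>x. f x - H (Suc j) x)"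
      by (intro lp_diff(2) lfH r)
    moreover have "(\<lambda>x. (f x - H j x) - (f x - H (Suc j) x)) = h k" using Suc by (auto simp: h_def)
    moreover have "d / 8 * (1/2) ^ Suc j \<le> d / 8 * (1/2) ^ j" using d by simp
    moreover have "d / 8 * (1/2) ^ j + d / 8 * (1/2) ^ j = d * (1/2) ^ Suc (Suc j)" by simp
    ultimately show ?thesis using Suc H[rule_format, of j] H[rule_format, of "Suc j"] by simp
  qed
  show ?thesis by (rule exI[of _ h], rule conjI[OF allI[OF P1] conjI[OF P2 allI[OF P3]]])
qed

text \<open>Extension of a bounded map by density, phrased for maps into the Herz algebra:
  \<open>hsums\<close> stands for linearity together with continuity, and the image of
  \<open>f\<close> is assembled with \<open>herz_series\<close> from the images of the terms of
  \<open>cc_series\<close>.\<close>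

lemma herz_extend:
  fixes \<Phi> :: "('a \<Rightarrow> complex) \<Rightarrow> 'a \<Rightarrow> complex"
  assumes f: "lp_fun M r f" and r: "1 \<le> r" and K: "0 \<le> K"
    and hcc: "\<forall>h. cc h \<longrightarrow> \<Phi> h \<in> herz G M p \<and> herz_norm G M p (\<Phi> h) \<le> K * lp_norm M r h"
    and hsums: "\<forall>h x. (\<forall>k::nat. lp_fun M r (h k)) \<longrightarrow> (\<lambda>n. lp_norm M r (\<lambda>y. f y - (\<Sum>k<n. h k y))) \<longlonglongrightarrow> 0 \<longrightarrow>
        x \<in> carrier G \<longrightarrow> (\<lambda>k. \<Phi> (h k) x) sums (\<Phi> f x)"
    and out: "\<And>x. x \<notin> carrier G \<Longrightarrow> \<Phi> f x = 0"
  shows "\<Phi> f \<in> A" "N (\<Phi> f) \<le> K * lp_norm M r f"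
proof -
  have main: "\<Phi> f \<in> A \<and> N (\<Phi> f) \<le> K * (lp_norm M r f + d)" if d: "0 < d" for d
  proof -
    from cc_series[OF f r d] obtain h :: "nat \<Rightarrow> 'a \<Rightarrow> complex" where h: "\<forall>k. cc (h k)"
      "(\<lambda>n. lp_norm M r (\<lambda>x. f x - (\<Sum>k<n. h k x))) \<longlonglongrightarrow> 0"
      "\<forall>k. lp_norm M r (h k) \<le> (if k = 0 then lp_norm M r f else 0) + d * (1/2) ^ Suc k"
      by (elim exE conjE)
    have lh: "lp_fun M r (h k)" for k using h(1) r cc_lp by simp
    define b where "b k = K * ((if k = 0 then lp_norm M r f else 0) + d * (1/2) ^ Suc k)" for k :: nat
    have b: "b sums (K * (lp_norm M r f + d))"
      unfolding b_def using sums_mult[OF sums_add[OF sums_single[of 0 "\<lambda>_. lp_norm M r f"] sums_mult[OF power_half_series, of d]], of K] by simp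
    have 1: "\<Phi> (h k) \<in> A" for k using hcc h(1) by blast
    have 2: "N (\<Phi> (h k)) \<le> b k" for k
      using order_trans[OF hcc[rule_format, OF h(1)[rule_format], THEN conjunct2] mult_left_mono[OF h(3)[rule_format] K]] unfolding b_def .
    have 3: "(\<lambda>k. \<Phi> (h k) x) sums \<Phi> f x" if "x \<in> carrier G" for x using hsums[rule_format, OF lh h(2) that] .
    show ?thesis using herz_series[OF 1 2 sums_summable[OF b] 3 out] sums_unique[OF b] by simp
  qed
  show "\<Phi> f \<in> A" using main[of 1] by simp
  show "N (\<Phi> f) \<le> K * lp_norm M r f"
  proof (rule field_le_epsilon)
    fix e :: real assume e: "0 < e"
    define d where "d = e / (K + 1)"
    have d: "0 < d" "d * (K + 1) = e" using e K by (auto simp: d_def)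
    then have "K * (lp_norm M r f + d) \<le> K * lp_norm M r f + e" by (simp add: algebra_simps)
    then show "N (\<Phi> f) \<le> K * lp_norm M r f + e" using main[OF d(1)] by linarith
  qed
qed

end

lemma norm_integral_le:
  fixes f :: "'a \<Rightarrow> 'b::{banach, second_countable_topology}"
  assumes "integrable M f" "integrable M g" "\<And>x. x \<in> space M \<Longrightarrow> norm (f x) \<le> g x"
  shows "norm (\<integral>x. f x \<partial>M) \<le> (\<integral>x. g x \<partial>M)"
  by (rule order_trans[OF integral_norm_bound integral_mono[OF integrable_norm[OF assms(1)] assms(2,3)]])

section \<open>Uniform continuity and Riemann sums over compact sets\<close>

context haar_group
begin

lemma cont_right_mult: "t \<in> carrier G \<Longrightarrow> continuous_map T T (\<lambda>y. y \<otimes> t)"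
proof -
  assume t: "t \<in> carrier G"
  have "continuous_map T (prod_topology T T) (\<lambda>y. (y, t))"
    using t by (intro continuous_map_pairedI) (auto simp: topspace_T)
  from continuous_map_compose[OF this cont_mult] show ?thesis by (simp add: comp_def)
qed

lemma cont_left_mult: "t \<in> carrier G \<Longrightarrow> continuous_map T T (\<lambda>y. t \<otimes> y)"
proof -
  assume t: "t \<in> carrier G"
  have "continuous_map T (prod_topology T T) (\<lambda>y. (t, y))"
    using t by (intro continuous_map_pairedI) (auto simp: topspace_T)
  from continuous_map_compose[OF this cont_mult] show ?thesis by (simp add: comp_def)
qed

lemma open_left_transl:
  assumes V: "openin T V" and g: "g \<in> carrier G" shows "openin T ((\<lambda>x. g \<otimes> x) ` V)"
proof -
  have Vc: "V \<subseteq> carrier G" using openin_subset[OF V] topspace_T by simp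
  have "openin T {x \<in> topspace T. inv g \<otimes> x \<in> V}"
    by (rule openin_continuous_map_preimage[OF cont_left_mult V]) (use g in simp)
  moreover have "{x \<in> topspace T. inv g \<otimes> x \<in> V} = (\<lambda>x. g \<otimes> x) ` V"
    using left_mult_vimage[of "inv g" V] g Vc by (auto simp: topspace_T)
  ultimately show ?thesis by simp
qed

lemma open_right_transl:
  assumes V: "openin T V" and g: "g \<in> carrier G" shows "openin T ((\<lambda>x. x \<otimes> g) ` V)"
proof -
  have Vc: "V \<subseteq> carrier G" using openin_subset[OF V] topspace_T by simp
  have "openin T {x \<in> topspace T. x \<otimes> inv g \<in> V}"
    by (rule openin_continuous_map_preimage[OF cont_right_mult V]) (use g in simp)
  moreover have "{x \<in> topspace T. x \<otimes> inv g \<in> V} = (\<lambda>x. x \<otimes> g) ` V"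
  proof (intro equalityI subsetI)
    fix x assume "x \<in> {x \<in> topspace T. x \<otimes> inv g \<in> V}"
    then show "x \<in> (\<lambda>x. x \<otimes> g) ` V"
      using g by (intro image_eqI[of _ _ "x \<otimes> inv g"]) (auto simp: m_assoc topspace_T)
  next
    fix x assume "x \<in> (\<lambda>x. x \<otimes> g) ` V"
    then obtain a where "a \<in> V" "x = a \<otimes> g" by blast
    moreover from this have "a \<in> carrier G" using Vc by blast
    ultimately show "x \<in> {x \<in> topspace T. x \<otimes> inv g \<in> V}" using g by (simp add: m_assoc topspace_T)
  qed
  ultimately show ?thesis by simp
qed

lemma cc_right_transl_measurable: "cc f \<Longrightarrow> t \<in> carrier G \<Longrightarrow> (\<lambda>y. f (y \<otimes> t)) \<in> borel_measurable M"
  using continuous_map_compose[OF cont_right_mult] by (intro continuous_measurable) (auto simp: cc_def comp_def)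

text \<open>Near K x {1} the tube lemma gives one neighbourhood \<open>V\<close> that works for all
  points of the compact set \<open>K\<close> carrying \<open>f\<close>.\<close>

lemma cc_right_uniform:
  assumes f: "cc f" and e: "0 < e"
  shows "\<exists>V. openin T V \<and> \<one> \<in> V \<and> (\<forall>w\<in>carrier G. \<forall>v\<in>V. cmod (f (w \<otimes> v) - f w) < e)"
proof -
  obtain K where K: "compactin T K" "\<forall>x\<in>carrier G - K. f x = 0" and c: "continuous_map T euclidean f"
    using f by (auto simp: cc_def)
  have Kc: "K \<subseteq> carrier G" using compactin_subset_topspace[OF K(1)] topspace_T by simp
  define W where "W = {z \<in> topspace (prod_topology T T). f ((\<lambda>(x, y). x \<otimes> y) z) - f (fst z) \<in> {c. cmod c < e}}"
  have "continuous_map (prod_topology T T) euclidean (\<lambda>z. f ((\<lambda>(x, y). x \<otimes> y) z) - f (fst z))"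
    using continuous_map_compose[OF cont_mult c] continuous_map_compose[OF continuous_map_fst c]
    by (intro continuous_map_diff) (auto simp: comp_def)
  then have "openin (prod_topology T T) W"
    unfolding W_def by (rule openin_continuous_map_preimage) (auto intro: open_Collect_less continuous_intros)
  moreover have "K \<times> {\<one>} \<subseteq> W" using Kc e by (auto simp: W_def topspace_T)
  moreover have "compactin T {\<one>}" by (simp add: topspace_T)
  ultimately obtain U V where UV: "openin T U" "openin T V" "K \<subseteq> U" "{\<one>} \<subseteq> V" "U \<times> V \<subseteq> W"
    using Wallace_theorem_prod_topology[OF K(1)] by metis
  \<comment> \<open>Intersecting with the inverse of \<open>V\<close> also covers the case that only
    w v lies in \<open>K\<close>: there w = (w v) v^-1.\<close>
  define V' where "V' = V \<inter> {x \<in> topspace T. inv x \<in> V}"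
  have V': "openin T V'" "\<one> \<in> V'"
    using UV(2,4) openin_continuous_map_preimage[OF cont_inv UV(2)] by (auto simp: V'_def topspace_T)
  have "cmod (f (w \<otimes> v) - f w) < e" if w: "w \<in> carrier G" and v: "v \<in> V'" for w v
  proof -
    have vc: "v \<in> carrier G" "v \<in> V" "inv v \<in> V" using v by (auto simp: V'_def topspace_T)
    consider "w \<in> K" | "w \<otimes> v \<in> K" | "w \<notin> K" "w \<otimes> v \<notin> K" by blast
    then show ?thesis
    proof cases
      case 1
      then have "(w, v) \<in> W" using UV vc by blast
      then show ?thesis by (simp add: W_def)
    next
      case 2
      then have "(w \<otimes> v, inv v) \<in> W" using UV vc by blast
      then show ?thesis using w vc by (simp add: W_def m_assoc norm_minus_commute)
    next
      case 3
      then show ?thesis using K(2) w vc e by simp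
    qed
  qed
  then show ?thesis using V' by blast
qed

lemma cc_right_uniform_finite:
  assumes "finite F" "\<forall>f\<in>F. cc f" and e: "0 < e"
  shows "\<exists>V. openin T V \<and> \<one> \<in> V \<and> (\<forall>f\<in>F. \<forall>w\<in>carrier G. \<forall>v\<in>V. cmod (f (w \<otimes> v) - f w) < e)"
  using assms(1,2)
proof (induction F)
  case empty
  show ?case using openin_topspace[of T] by (intro exI[of _ "carrier G"]) (simp add: topspace_T)
next
  case (insert f F)
  obtain V where V: "openin T V" "\<one> \<in> V" "\<forall>f\<in>F. \<forall>w\<in>carrier G. \<forall>v\<in>V. cmod (f (w \<otimes> v) - f w) < e"
    using insert by auto
  obtain V' where V': "openin T V'" "\<one> \<in> V'" "\<forall>w\<in>carrier G. \<forall>v\<in>V'. cmod (f (w \<otimes> v) - f w) < e"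
    using cc_right_uniform[OF _ e, of f] insert.prems by auto
  show ?case using V V' by (intro exI[of _ "V \<inter> V'"]) auto
qed

lemma finite_selector:
  assumes "finite F" "\<forall>a\<in>F. B a \<in> sets M"
  shows "\<exists>\<tau>. (\<forall>t\<in>\<Union>(B ` F). \<tau> t \<in> F \<and> t \<in> B (\<tau> t)) \<and> (\<forall>a. {t \<in> \<Union>(B ` F). \<tau> t = a} \<in> sets M)"
  using assms
proof (induction F)
  case (insert b F)
  then obtain \<tau> where \<tau>: "\<forall>t\<in>\<Union>(B ` F). \<tau> t \<in> F \<and> t \<in> B (\<tau> t)" "\<forall>a. {t \<in> \<Union>(B ` F). \<tau> t = a} \<in> sets M"
    by auto
  define \<sigma> where "\<sigma> t = (if t \<in> B b then b else \<tau> t)" for t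
  have "{t \<in> \<Union>(B ` insert b F). \<sigma> t = a} = (if a = b then B b else {}) \<union> ({t \<in> \<Union>(B ` F). \<tau> t = a} - B b)" for a
    by (auto simp: \<sigma>_def)
  then have "\<forall>a. {t \<in> \<Union>(B ` insert b F). \<sigma> t = a} \<in> sets M" using \<tau>(2) insert.prems by auto
  moreover have "\<forall>t\<in>\<Union>(B ` insert b F). \<sigma> t \<in> insert b F \<and> t \<in> B (\<sigma> t)" using \<tau>(1) by (auto simp: \<sigma>_def)
  ultimately show ?case by blast
qed simp

text \<open>A partition of \<open>Q\<close> into finitely many measurable cells, the cell {\<tau> =
  a} being tagged by \<open>a\<close>. Sums over \<open>I\<close> weighted by the measures of the
  cells are Riemann sums.\<close>

definition selector :: "'a set \<Rightarrow> ('a \<Rightarrow> 'i) \<Rightarrow> 'i set \<Rightarrow> bool" where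
  "selector Q \<tau> I \<longleftrightarrow> finite I \<and> (\<forall>t\<in>Q. \<tau> t \<in> I) \<and> (\<forall>a. {t \<in> Q. \<tau> t = a} \<in> sets M)"

text \<open>\<open>Q\<close> is covered by finitely many translates a V of a neighbourhood from
  uniform continuity; a point of a V is tagged by \<open>a\<close>. The error is uniform in
  \<open>y\<close>, since y t = (y a) v with v in V.\<close>

lemma approx_selector:
  assumes Q: "compactin T Q" and F: "finite F" "\<forall>f\<in>F. cc f" and e: "0 < e"
  shows "\<exists>\<tau> I. selector Q \<tau> I \<and> I \<subseteq> carrier G \<and> (\<forall>f\<in>F. \<forall>y\<in>carrier G. \<forall>t\<in>Q. cmod (f (y \<otimes> \<tau> t) - f (y \<otimes> t)) \<le> e)"
proof -
  obtain V where V: "openin T V" "\<one> \<in> V" "\<forall>f\<in>F. \<forall>w\<in>carrier G. \<forall>v\<in>V. cmod (f (w \<otimes> v) - f w) < e"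
    using cc_right_uniform_finite[OF F e] by blast
  have Qc: "Q \<subseteq> carrier G" and Vc: "V \<subseteq> carrier G"
    using compactin_subset_topspace[OF Q] openin_subset[OF V(1)] topspace_T by auto
  define B where "B a = (\<lambda>x. a \<otimes> x) ` V" for a
  have oB: "openin T (B a)" if "a \<in> Q" for a unfolding B_def using open_left_transl[OF V(1)] that Qc by blast
  have "a \<in> B a" if "a \<in> Q" for a unfolding B_def using V(2) Qc that by (intro image_eqI[of _ _ \<one>]) auto
  then have "Q \<subseteq> \<Union>(B ` Q)" by blast
  then obtain \<F> where \<F>: "finite \<F>" "\<F> \<subseteq> B ` Q" "Q \<subseteq> \<Union>\<F>"
    using Q oB unfolding compactin_def by (metis (mono_tags, lifting) imageE)
  obtain C where C: "C \<subseteq> Q" "finite C" "\<F> = B ` C" using finite_subset_image[OF \<F>(1,2)] by blast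
  have "\<forall>a\<in>C. B a \<in> sets M" using C oB open_sets by blast
  then obtain \<tau> where \<tau>: "\<forall>t\<in>\<Union>(B ` C). \<tau> t \<in> C \<and> t \<in> B (\<tau> t)" "\<forall>a. {t \<in> \<Union>(B ` C). \<tau> t = a} \<in> sets M"
    using finite_selector[OF C(2), of B] by blast
  have sub: "Q \<subseteq> \<Union>(B ` C)" using \<F>(3) C(3) by simp
  have "{t \<in> Q. \<tau> t = a} = Q \<inter> {t \<in> \<Union>(B ` C). \<tau> t = a}" for a using sub by blast
  then have "selector Q \<tau> C" unfolding selector_def using \<tau> sub C(2) compact_sets[OF Q] by auto
  moreover have "cmod (f (y \<otimes> \<tau> t) - f (y \<otimes> t)) \<le> e" if "f \<in> F" "y \<in> carrier G" "t \<in> Q" for f y t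
  proof -
    have t: "\<tau> t \<in> C" "t \<in> B (\<tau> t)" using \<tau>(1) sub that by auto
    then have tc: "\<tau> t \<in> carrier G" using C(1) Qc by blast
    obtain v where v: "v \<in> V" "t = \<tau> t \<otimes> v" using t(2) by (auto simp: B_def)
    have "cmod (f ((y \<otimes> \<tau> t) \<otimes> v) - f (y \<otimes> \<tau> t)) < e" using V(3) that tc v(1) by simp
    moreover have "(y \<otimes> \<tau> t) \<otimes> v = y \<otimes> t" using v that tc Vc by (metis m_assoc subsetD)
    ultimately show ?thesis by (simp add: norm_minus_commute)
  qed
  ultimately show ?thesis using C(1) Qc by (intro exI[of _ \<tau>] exI[of _ C]) auto
qed

lemma selector_integral:
  fixes \<psi> :: "'i \<Rightarrow> 'c::{banach, second_countable_topology}"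
  assumes s: "selector Q \<tau> I" and Q: "Q \<in> sets M" "emeasure M Q < \<infinity>"
  shows "integrable M (\<lambda>t. indicator Q t *\<^sub>R \<psi> (\<tau> t))"
    "(\<integral>t. indicator Q t *\<^sub>R \<psi> (\<tau> t) \<partial>M) = (\<Sum>a\<in>I. measure M {t \<in> Q. \<tau> t = a} *\<^sub>R \<psi> a)"
proof -
  define R where "R a = {t \<in> Q. \<tau> t = a}" for a
  have R: "R a \<in> sets M" for a using s by (simp add: selector_def R_def)
  have Rf: "emeasure M (R a) < \<infinity>" for a
    using emeasure_mono[of "R a" Q M] Q by (auto simp: R_def intro: order_le_less_trans)
  have eq: "indicator Q t *\<^sub>R \<psi> (\<tau> t) = (\<Sum>a\<in>I. indicator (R a) t *\<^sub>R \<psi> a)" for t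
  proof (cases "t \<in> Q")
    case True
    then have "(\<Sum>a\<in>I. indicator (R a) t *\<^sub>R \<psi> a) = (\<Sum>a\<in>I. if a = \<tau> t then \<psi> a else 0)"
      by (intro sum.cong) (auto simp: R_def)
    then show ?thesis using s True by (simp add: selector_def)
  next
    case False
    then show ?thesis by (simp add: R_def)
  qed
  have i: "integrable M (\<lambda>t. indicator (R a) t *\<^sub>R \<psi> a)" for a
    using R Rf by (intro integrable_scaleR_left integrable_real_indicator)
  show "integrable M (\<lambda>t. indicator Q t *\<^sub>R \<psi> (\<tau> t))"
    unfolding eq by (intro Bochner_Integration.integrable_sum i)
  show "(\<integral>t. indicator Q t *\<^sub>R \<psi> (\<tau> t) \<partial>M) = (\<Sum>a\<in>I. measure M {t \<in> Q. \<tau> t = a} *\<^sub>R \<psi> a)"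
    unfolding eq using i R Rf sets.sets_into_space[OF R]
    by (subst Bochner_Integration.integral_sum) (auto simp: R_def[symmetric] Int_absorb2)
qed

lemma herz_sum:
  assumes "finite J" "\<And>j. j \<in> J \<Longrightarrow> w j \<in> A" "\<And>j. j \<in> J \<Longrightarrow> 0 \<le> c j"
  shows "(\<lambda>x. \<Sum>j\<in>J. c j *\<^sub>R w j x) \<in> A \<and> N (\<lambda>x. \<Sum>j\<in>J. c j *\<^sub>R w j x) \<le> (\<Sum>j\<in>J. c j * N (w j))"
  using assms
proof (induction J)
  case empty show ?case using herz_zero by simp
next
  case (insert j J)
  then have IH: "(\<lambda>x. \<Sum>j\<in>J. c j *\<^sub>R w j x) \<in> A" "N (\<lambda>x. \<Sum>j\<in>J. c j *\<^sub>R w j x) \<le> (\<Sum>j\<in>J. c j * N (w j))" by auto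
  have j: "(\<lambda>x. c j *\<^sub>R w j x) \<in> A" "N (\<lambda>x. c j *\<^sub>R w j x) \<le> c j * N (w j)"
    using herz_scale[OF insert.prems(1)[of j], of "complex_of_real (c j)"] insert.prems(2)[of j]
    by (auto simp: scaleR_conv_of_real)
  show ?case using herz_add[OF j(1) IH(1)] j(2) IH(2) insert.hyps by simp
qed

text \<open>For exact integrals over t, left invariance gives the r-th power of the norm of
  \<open>f2\<close> for each y, hence a total of at most 1. Replacing the integral over t by a
  Riemann sum costs \<open>e * measure M Q\<close>, and only a finite sum has to be exchanged with
  the integral over y.\<close>

lemma selector_norm_bound:
  assumes r: "0 < r" and f1: "lp_fun M r f1" "lp_norm M r f1 \<le> 1" and f2: "cc f2" "lp_norm M r f2 \<le> 1"
    and Q: "compactin T Q" and s: "selector Q \<tau> I" "I \<subseteq> carrier G" and e: "0 \<le> e"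
    and ap: "\<forall>y\<in>carrier G. \<forall>t\<in>Q. cmod (complex_of_real (cmod (f2 (y \<otimes> \<tau> t)) powr r) - complex_of_real (cmod (f2 (y \<otimes> t)) powr r)) \<le> e"
    and F: "\<And>a. a \<in> I \<Longrightarrow> lp_fun M r (\<lambda>y. f1 y * f2 (y \<otimes> a))"
  shows "(\<Sum>a\<in>I. measure M {t \<in> Q. \<tau> t = a} * lp_norm M r (\<lambda>y. f1 y * f2 (y \<otimes> a)) powr r) \<le> 1 + e * measure M Q"
proof -
  have Qs: "Q \<in> sets M" "emeasure M Q < \<infinity>" using compact_sets compact_finite Q by auto
  have l2: "lp_fun M r f2" using cc_lp f2 r by simp
  have i2: "integrable M (\<lambda>x. cmod (f2 x) powr r)" using lp_funD(2)[OF l2] .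
  define S where "S y = (\<Sum>a\<in>I. measure M {t \<in> Q. \<tau> t = a} * cmod (f2 (y \<otimes> a)) powr r)" for y
  have Sle: "S y \<le> 1 + e * measure M Q" if y: "y \<in> carrier G" for y
  proof -
    have iy: "integrable M (\<lambda>t. cmod (f2 (y \<otimes> t)) powr r)" using integrable_left_transl[OF y i2] .
    have iI: "integrable M (\<lambda>t. indicator Q t *\<^sub>R (cmod (f2 (y \<otimes> t)) powr r))" by (rule integrable_mult_indicator[OF Qs(1) iy])
    have iQ: "integrable M (\<lambda>t. e * indicator Q t)" using Qs by (intro integrable_mult_right integrable_real_indicator)
    have "S y = (\<integral>t. indicator Q t *\<^sub>R (cmod (f2 (y \<otimes> \<tau> t)) powr r) \<partial>M)"
      using selector_integral(2)[OF s(1) Qs, of "\<lambda>a. cmod (f2 (y \<otimes> a)) powr r"] by (simp add: S_def)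
    also have "\<dots> \<le> (\<integral>t. indicator Q t *\<^sub>R (cmod (f2 (y \<otimes> t)) powr r) + e * indicator Q t \<partial>M)"
    proof (rule integral_mono)
      show "integrable M (\<lambda>t. indicator Q t *\<^sub>R (cmod (f2 (y \<otimes> \<tau> t)) powr r))"
        using selector_integral(1)[OF s(1) Qs, of "\<lambda>a. cmod (f2 (y \<otimes> a)) powr r"] .
      show "integrable M (\<lambda>t. indicator Q t *\<^sub>R (cmod (f2 (y \<otimes> t)) powr r) + e * indicator Q t)"
        using iI iQ by (rule Bochner_Integration.integrable_add)
      fix t
      show "indicator Q t *\<^sub>R (cmod (f2 (y \<otimes> \<tau> t)) powr r) \<le> indicator Q t *\<^sub>R (cmod (f2 (y \<otimes> t)) powr r) + e * indicator Q t"
      proof (cases "t \<in> Q")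
        case True
        have "\<bar>cmod (f2 (y \<otimes> \<tau> t)) powr r - cmod (f2 (y \<otimes> t)) powr r\<bar> \<le> e"
          using ap[rule_format, OF y True] by (simp only: of_real_diff[symmetric] norm_of_real)
        then show ?thesis using True by simp
      qed simp
    qed
    also have "\<dots> = (\<integral>t. indicator Q t *\<^sub>R (cmod (f2 (y \<otimes> t)) powr r) \<partial>M) + e * measure M Q"
      using iI iQ sets.sets_into_space[OF Qs(1)] by (simp add: Int_absorb2)
    also have "(\<integral>t. indicator Q t *\<^sub>R (cmod (f2 (y \<otimes> t)) powr r) \<partial>M) \<le> (\<integral>t. cmod (f2 (y \<otimes> t)) powr r \<partial>M)"
      by (rule integral_mono[OF iI iy]) (simp add: indicator_def)
    also have "\<dots> = (\<integral>t. cmod (f2 t) powr r \<partial>M)"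
      using integral_left_transl[OF y, of "\<lambda>t. cmod (f2 t) powr r"] i2 by simp
    also have "\<dots> \<le> 1" using lp_norm_leD[OF l2 r f2(2)] by simp
    finally show ?thesis by simp
  qed
  have Fi: "integrable M (\<lambda>y. cmod (f1 y * f2 (y \<otimes> a)) powr r)" if "a \<in> I" for a using lp_funD(2)[OF F[OF that]] .
  have "(\<Sum>a\<in>I. measure M {t \<in> Q. \<tau> t = a} * lp_norm M r (\<lambda>y. f1 y * f2 (y \<otimes> a)) powr r)
     = (\<Sum>a\<in>I. (\<integral>y. measure M {t \<in> Q. \<tau> t = a} * cmod (f1 y * f2 (y \<otimes> a)) powr r \<partial>M))"
    using lp_norm_powr[OF F r] by (intro sum.cong) auto
  also have "\<dots> = (\<integral>y. (\<Sum>a\<in>I. measure M {t \<in> Q. \<tau> t = a} * cmod (f1 y * f2 (y \<otimes> a)) powr r) \<partial>M)"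
    using Fi by (subst Bochner_Integration.integral_sum) auto
  also have "\<dots> \<le> (\<integral>y. (1 + e * measure M Q) * cmod (f1 y) powr r \<partial>M)"
  proof (rule integral_mono)
    show "integrable M (\<lambda>y. \<Sum>a\<in>I. measure M {t \<in> Q. \<tau> t = a} * cmod (f1 y * f2 (y \<otimes> a)) powr r)"
      using Fi by (intro Bochner_Integration.integrable_sum integrable_mult_right) auto
    show "integrable M (\<lambda>y. (1 + e * measure M Q) * cmod (f1 y) powr r)" using lp_funD(2)[OF f1(1)] by simp
    fix y assume "y \<in> space M"
    then have y: "y \<in> carrier G" by (simp add: space_M)
    have "(\<Sum>a\<in>I. measure M {t \<in> Q. \<tau> t = a} * cmod (f1 y * f2 (y \<otimes> a)) powr r) = cmod (f1 y) powr r * S y"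
      by (simp add: S_def sum_distrib_left norm_mult powr_mult mult_ac)
    also have "\<dots> \<le> cmod (f1 y) powr r * (1 + e * measure M Q)" by (intro mult_left_mono Sle y) simp
    finally show "(\<Sum>a\<in>I. measure M {t \<in> Q. \<tau> t = a} * cmod (f1 y * f2 (y \<otimes> a)) powr r) \<le> (1 + e * measure M Q) * cmod (f1 y) powr r"
      by (simp add: mult.commute)
  qed
  also have "\<dots> = (1 + e * measure M Q) * (\<integral>y. cmod (f1 y) powr r \<partial>M)" by simp
  also have "\<dots> \<le> (1 + e * measure M Q) * 1"
    using lp_norm_leD[OF f1(1) r f1(2)] e by (intro mult_left_mono) auto
  finally show ?thesis by simp
qed

end

section \<open>The pointwise product of two elements of the algebra\<close>

context haar_group
begin

definition herz_prod where
  "herz_prod g1 f1 g2 f2 x = (if x \<in> carrier G then conv g1 f1 x * conv g2 f2 x else 0)"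

text \<open>\<open>(g\<^sub>1 * f\<^sub>1\<^sup>\<or>)(g\<^sub>2 * f\<^sub>2\<^sup>\<or>) = \<integral> (g\<^sub>1 g\<^sub>2(\<cdot>t)) * (f\<^sub>1 f\<^sub>2(\<cdot>t))\<^sup>\<or> dt\<close>. The integral over \<open>t\<close> is replaced by finite
  sums over selectors; the telescoping series of successive approximations converges in the Herz norm.\<close>
lemma herz_prod_cc1:
  assumes cc: "cc f1" "cc g1" "cc f2" "cc g2"
    and n1: "lp_norm M p f1 \<le> 1" "lp_norm M q g1 \<le> 1" "lp_norm M p f2 \<le> 1" "lp_norm M q g2 \<le> 1"
  shows "herz_prod g1 f1 g2 f2 \<in> A" "N (herz_prod g1 f1 g2 f2) \<le> 1"
proof -
  have p0: "0 < p" "0 < q" using p1 q1 by auto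
  have l: "lp_fun M p f1" "lp_fun M q g1" "lp_fun M p f2" "lp_fun M q g2" using cc cc_lp p0 by auto
  obtain K1 where K1: "compactin T K1" "\<forall>x\<in>carrier G - K1. g1 x = 0" using cc by (auto simp: cc_def)
  obtain K2 where K2: "compactin T K2" "\<forall>x\<in>carrier G - K2. g2 x = 0" using cc by (auto simp: cc_def)
  have Kc: "K1 \<subseteq> carrier G" "K2 \<subseteq> carrier G" using compactin_subset_topspace K1(1) K2(1) topspace_T by auto
  \<comment> \<open>If g1 y and g2 (y t) are both nonzero, then t lies in the compact set K1^-1 K2.
    All integrals over t may be restricted to it.\<close>
  define Q where "Q = (\<lambda>(y, t). inv y \<otimes> t) ` (K1 \<times> K2)"
  have "continuous_map (prod_topology T T) T (\<lambda>(y, t). inv y \<otimes> t)"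
  proof -
    have "continuous_map (prod_topology T T) (prod_topology T T) (\<lambda>z. (inv (fst z), snd z))"
      using continuous_map_compose[OF continuous_map_fst cont_inv]
      by (intro continuous_map_pairedI continuous_map_snd) (simp add: comp_def)
    from continuous_map_compose[OF this cont_mult] show ?thesis by (simp add: comp_def case_prod_unfold)
  qed
  then have Q: "compactin T Q" unfolding Q_def by (rule image_compactin[rotated]) (simp add: compactin_Times K1 K2)
  have Qs: "Q \<in> sets M" "emeasure M Q < \<infinity>" using compact_sets compact_finite Q by auto
  have Qz: "g2 (y \<otimes> t) = 0" if "y \<in> K1" "t \<in> carrier G" "t \<notin> Q" for y t
  proof (rule ccontr)
    assume "g2 (y \<otimes> t) \<noteq> 0"
    then have "y \<otimes> t \<in> K2" using K2(2) that Kc by auto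
    then have "t \<in> Q" unfolding Q_def using that Kc
      by (intro image_eqI[of _ _ "(y, y \<otimes> t)"]) (auto simp: m_assoc[symmetric])
    then show False using that by simp
  qed
  define m where "m = measure M Q"
  have m0: "0 \<le> m" by (simp add: m_def)
  obtain Bf where Bf: "0 \<le> Bf" "\<forall>x\<in>carrier G. cmod (f2 x) \<le> Bf" using cc_bounded[OF cc(3)] by blast
  obtain Bg where Bg: "0 \<le> Bg" "\<forall>x\<in>carrier G. cmod (g2 x) \<le> Bg" using cc_bounded[OF cc(4)] by blast
  define F where "F a y = f1 y * f2 (y \<otimes> a)" for a y
  define H where "H a y = g1 y * g2 (y \<otimes> a)" for a y
  have mF: "F a \<in> borel_measurable M" "H a \<in> borel_measurable M" if "a \<in> carrier G" for a
    unfolding F_def[abs_def] H_def[abs_def]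
    using cc_right_transl_measurable[OF cc(3) that] cc_right_transl_measurable[OF cc(4) that] cc_measurable cc by auto
  have lF: "lp_fun M p (F a)" "lp_norm M p (F a) \<le> Bf" if a: "a \<in> carrier G" for a
  proof -
    have "cmod (F a x) \<le> Bf * cmod (f1 x)" if "x \<in> space M" for x
    proof -
      have "cmod (f2 (x \<otimes> a)) * cmod (f1 x) \<le> Bf * cmod (f1 x)"
        using Bf(2) a that by (intro mult_right_mono) (auto simp: space_M)
      then show ?thesis by (simp add: F_def norm_mult mult.commute[of "cmod (f1 x)"])
    qed
    note lm = lp_mono[OF l(1) mF(1)[OF a] Bf(1) p0(1) this]
    show "lp_fun M p (F a)" by (rule lm(1))
    show "lp_norm M p (F a) \<le> Bf" using lm(2) mult_left_mono[OF n1(1) Bf(1)] by simp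
  qed
  have lH: "lp_fun M q (H a)" "lp_norm M q (H a) \<le> Bg" if a: "a \<in> carrier G" for a
  proof -
    have "cmod (H a x) \<le> Bg * cmod (g1 x)" if "x \<in> space M" for x
    proof -
      have "cmod (g2 (x \<otimes> a)) * cmod (g1 x) \<le> Bg * cmod (g1 x)"
        using Bg(2) a that by (intro mult_right_mono) (auto simp: space_M)
      then show ?thesis by (simp add: H_def norm_mult mult.commute[of "cmod (g1 x)"])
    qed
    note lm = lp_mono[OF l(2) mF(2)[OF a] Bg(1) p0(2) this]
    show "lp_fun M q (H a)" by (rule lm(1))
    show "lp_norm M q (H a) \<le> Bg" using lm(2) mult_left_mono[OF n1(2) Bg(1)] by simp
  qed
  define W where "W a x = (if x \<in> carrier G then conv (H a) (F a) x else 0)" for a x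
  have W: "W a \<in> A" "N (W a) \<le> lp_norm M q (H a) * lp_norm M p (F a)" if "a \<in> carrier G" for a
    using herz_conv[OF lF(1)[OF that] lH(1)[OF that]] by (auto simp: W_def[abs_def])
  \<comment> \<open>Bilinear splitting H a F a - H b F b = (H a - H b) F a + H b (F a - F b):
    uniformly close translates of \<open>f2\<close> and \<open>g2\<close> give elements
    \<open>W\<close> that are close in the Herz norm.\<close>
  have dW: "(\<lambda>x. W a x - W b x) \<in> A" "N (\<lambda>x. W a x - W b x) \<le> d * (Bf + Bg)"
    if a: "a \<in> carrier G" and b: "b \<in> carrier G" and d: "0 \<le> d"
      and df: "\<And>y. y \<in> carrier G \<Longrightarrow> cmod (f2 (y \<otimes> a) - f2 (y \<otimes> b)) \<le> d"
      and dg: "\<And>y. y \<in> carrier G \<Longrightarrow> cmod (g2 (y \<otimes> a) - g2 (y \<otimes> b)) \<le> d" for a b d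
  proof -
    have "cmod (F a x - F b x) \<le> d * cmod (f1 x)" if "x \<in> space M" for x
    proof -
      have "cmod (f2 (x \<otimes> a) - f2 (x \<otimes> b)) * cmod (f1 x) \<le> d * cmod (f1 x)"
        using df that by (intro mult_right_mono) (auto simp: space_M)
      then show ?thesis
        by (simp add: F_def right_diff_distrib[symmetric] norm_mult mult.commute[of "cmod (f1 x)"])
    qed
    note lm = lp_mono[OF l(1) borel_measurable_diff[OF mF(1)[OF a] mF(1)[OF b]] d p0(1) this]
    have nF: "lp_fun M p (\<lambda>y. F a y - F b y)" "lp_norm M p (\<lambda>y. F a y - F b y) \<le> d"
      using lm mult_left_mono[OF n1(1) d] by auto
    have "cmod (H a x - H b x) \<le> d * cmod (g1 x)" if "x \<in> space M" for x
    proof -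
      have "cmod (g2 (x \<otimes> a) - g2 (x \<otimes> b)) * cmod (g1 x) \<le> d * cmod (g1 x)"
        using dg that by (intro mult_right_mono) (auto simp: space_M)
      then show ?thesis
        by (simp add: H_def right_diff_distrib[symmetric] norm_mult mult.commute[of "cmod (g1 x)"])
    qed
    note lm = lp_mono[OF l(2) borel_measurable_diff[OF mF(2)[OF a] mF(2)[OF b]] d p0(2) this]
    have nH: "lp_fun M q (\<lambda>y. H a y - H b y)" "lp_norm M q (\<lambda>y. H a y - H b y) \<le> d"
      using lm mult_left_mono[OF n1(2) d] by auto
    define U1 where "U1 = (\<lambda>x. if x \<in> carrier G then conv (\<lambda>y. H a y - H b y) (F a) x else 0)"
    define U2 where "U2 = (\<lambda>x. if x \<in> carrier G then conv (H b) (\<lambda>y. F a y - F b y) x else 0)"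
    have U1: "U1 \<in> A" "N U1 \<le> d * Bf"
      using herz_conv[OF lF(1)[OF a] nH(1)] mult_mono[OF nH(2) lF(2)[OF a]] d by (auto simp: U1_def)
    have U2: "U2 \<in> A" "N U2 \<le> Bg * d"
      using herz_conv[OF nF(1) lH(1)[OF b]] mult_mono[OF lH(2)[OF b] nF(2)] Bg(1) by (auto simp: U2_def)
    have eq: "(\<lambda>x. W a x - W b x) = (\<lambda>x. U1 x + U2 x)"
      using conv_diff_left[OF lF(1)[OF a] lH(1)[OF a] lH(1)[OF b]] conv_diff_right[OF lF(1)[OF a] lF(1)[OF b] lH(1)[OF b]]
      by (auto simp: U1_def U2_def W_def)
    show "(\<lambda>x. W a x - W b x) \<in> A" "N (\<lambda>x. W a x - W b x) \<le> d * (Bf + Bg)"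
      unfolding eq using herz_add[OF U1(1) U2(1)] U1(2) U2(2) by (auto simp: algebra_simps)
  qed
  \<comment> \<open>Besides \<open>f2\<close> and \<open>g2\<close>, the powers |f2|^p and |g2|^q
    are approximated too: \<open>selector_norm_bound\<close> compares Riemann sums of those powers
    with their integrals.\<close>
  define ok where "ok e \<tau> I \<longleftrightarrow> selector Q \<tau> I \<and> I \<subseteq> carrier G \<and>
    (\<forall>f\<in>{f2, g2, \<lambda>x. complex_of_real (cmod (f2 x) powr p), \<lambda>x. complex_of_real (cmod (g2 x) powr q)}.
       \<forall>y\<in>carrier G. \<forall>t\<in>Q. cmod (f (y \<otimes> \<tau> t) - f (y \<otimes> t)) \<le> e)" for e :: real and \<tau> :: "'a \<Rightarrow> 'a" and I
  have ex_ok: "\<exists>\<tau> I. ok e \<tau> I" if "0 < e" for e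
    unfolding ok_def using cc p0 by (intro approx_selector[OF Q] that) (auto intro: cc_powr)
  have okD: "selector Q \<tau> I" "I \<subseteq> carrier G"
    "\<forall>y\<in>carrier G. \<forall>t\<in>Q. cmod (f2 (y \<otimes> \<tau> t) - f2 (y \<otimes> t)) \<le> e"
    "\<forall>y\<in>carrier G. \<forall>t\<in>Q. cmod (g2 (y \<otimes> \<tau> t) - g2 (y \<otimes> t)) \<le> e"
    "\<forall>y\<in>carrier G. \<forall>t\<in>Q. cmod (complex_of_real (cmod (f2 (y \<otimes> \<tau> t)) powr p) - complex_of_real (cmod (f2 (y \<otimes> t)) powr p)) \<le> e"
    "\<forall>y\<in>carrier G. \<forall>t\<in>Q. cmod (complex_of_real (cmod (g2 (y \<otimes> \<tau> t)) powr q) - complex_of_real (cmod (g2 (y \<otimes> t)) powr q)) \<le> e"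
    if "ok e \<tau> I" for e \<tau> I using that unfolding ok_def ball_simps by blast+
  have okc: "\<tau> t \<in> carrier G" if "ok e \<tau> I" "t \<in> Q" for e \<tau> I t
    using okD(1,2)[OF that(1)] that(2) by (auto simp: selector_def)
  define P where "P \<tau> I x = (\<Sum>a\<in>I. measure M {t \<in> Q. \<tau> t = a} *\<^sub>R W a x)" for \<tau> I x
  have P_int: "P \<tau> I x = (\<integral>t. indicator Q t *\<^sub>R W (\<tau> t) x \<partial>M)" "integrable M (\<lambda>t. indicator Q t *\<^sub>R W (\<tau> t) x)"
    if "ok e \<tau> I" for e \<tau> I x
    using selector_integral[OF okD(1)[OF that] Qs, of "\<lambda>a. W a x"] by (auto simp: P_def)
  have PA: "P \<tau> I \<in> A" "N (P \<tau> I) \<le> (\<Sum>a\<in>I. measure M {t \<in> Q. \<tau> t = a} * N (W a))" if o: "ok e \<tau> I" for e \<tau> I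
    using herz_sum[of I W "\<lambda>a. measure M {t \<in> Q. \<tau> t = a}"] W(1) okD(1,2)[OF o]
    unfolding P_def[abs_def] by (auto simp: selector_def)
  \<comment> \<open>Young's inequality in every cell: the two weighted sums of powers are at most 1
    + e m each, and the weights 1/p and 1/q add up to 1.\<close>
  have claim1: "N (P \<tau> I) \<le> 1 + e * m" if o: "ok e \<tau> I" and e: "0 \<le> e" for e \<tau> I
  proof -
    note D = okD[OF o]
    have "N (P \<tau> I) \<le> (\<Sum>a\<in>I. measure M {t \<in> Q. \<tau> t = a} * N (W a))" by (rule PA(2)[OF o])
    also have "\<dots> \<le> (\<Sum>a\<in>I. measure M {t \<in> Q. \<tau> t = a} * (lp_norm M p (F a) powr p / p + lp_norm M q (H a) powr q / q))"
    proof (intro sum_mono mult_left_mono)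
      fix a assume "a \<in> I"
      then have a: "a \<in> carrier G" using D(2) by blast
      have "lp_norm M p (F a) * lp_norm M q (H a) \<le> lp_norm M p (F a) powr p / p + lp_norm M q (H a) powr q / q"
        using p1 q1 pq by (intro Youngs_inequality) auto
      then show "N (W a) \<le> lp_norm M p (F a) powr p / p + lp_norm M q (H a) powr q / q"
        using W(2)[OF a] by (simp add: mult.commute)
    qed simp
    also have "\<dots> = (\<Sum>a\<in>I. measure M {t \<in> Q. \<tau> t = a} * lp_norm M p (F a) powr p) / p
        + (\<Sum>a\<in>I. measure M {t \<in> Q. \<tau> t = a} * lp_norm M q (H a) powr q) / q"
      by (simp add: distrib_left sum.distrib sum_divide_distrib)
    also have "\<dots> \<le> (1 + e * m) / p + (1 + e * m) / q"
    proof (intro add_mono divide_right_mono)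
      show "(\<Sum>a\<in>I. measure M {t \<in> Q. \<tau> t = a} * lp_norm M p (F a) powr p) \<le> 1 + e * m"
        unfolding F_def[abs_def] m_def
        by (rule selector_norm_bound[OF p0(1) l(1) n1(1) cc(3) n1(3) Q D(1,2) e D(5)])
           (use lF(1) D(2) in \<open>auto simp: F_def[abs_def]\<close>)
      show "(\<Sum>a\<in>I. measure M {t \<in> Q. \<tau> t = a} * lp_norm M q (H a) powr q) \<le> 1 + e * m"
        unfolding H_def[abs_def] m_def
        by (rule selector_norm_bound[OF p0(2) l(2) n1(2) cc(4) n1(4) Q D(1,2) e D(6)])
           (use lH(1) D(2) in \<open>auto simp: H_def[abs_def]\<close>)
    qed (use p0 in auto)
    also have "\<dots> = (1 + e * m) * (1 / p + 1 / q)" by (simp only: distrib_left mult_1_right times_divide_eq_right)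
    finally show ?thesis using pq by simp
  qed
  have claim2: "(\<lambda>x. P \<tau> I x - P \<tau>' I' x) \<in> A" "N (\<lambda>x. P \<tau> I x - P \<tau>' I' x) \<le> m * ((e + e') * (Bf + Bg))"
    if o: "ok e \<tau> I" and o': "ok e' \<tau>' I'" and e: "0 \<le> e" "0 \<le> e'" for e e' \<tau> \<tau>' I I'
  proof -
    define \<sigma> where "\<sigma> t = (\<tau> t, \<tau>' t)" for t
    have s: "selector Q \<sigma> (I \<times> I')"
    proof -
      have "{t \<in> Q. \<sigma> t = z} = {t \<in> Q. \<tau> t = fst z} \<inter> {t \<in> Q. \<tau>' t = snd z}" for z by (auto simp: \<sigma>_def)
      then show ?thesis using okD(1)[OF o] okD(1)[OF o'] by (auto simp: selector_def \<sigma>_def)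
    qed
    \<comment> \<open>Both Riemann sums are written over the common refinement with tags in I x I'.
      Pairs of tags that no point of \<open>Q\<close> attains get 0, since for them nothing makes
      the difference small.\<close>
    define V where "V z x = (if \<exists>t\<in>Q. \<sigma> t = z then W (fst z) x - W (snd z) x else 0)" for z x
    have VI: "P \<tau> I x - P \<tau>' I' x = (\<integral>t. indicator Q t *\<^sub>R V (\<sigma> t) x \<partial>M)" for x
      unfolding P_int(1)[OF o] P_int(1)[OF o'] Bochner_Integration.integral_diff[OF P_int(2)[OF o] P_int(2)[OF o'], symmetric]
      by (rule Bochner_Integration.integral_cong) (auto simp: V_def \<sigma>_def indicator_def)
    have eq: "(\<lambda>x. P \<tau> I x - P \<tau>' I' x) = (\<lambda>x. \<Sum>z\<in>I \<times> I'. measure M {t \<in> Q. \<sigma> t = z} *\<^sub>R V z x)"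
      using selector_integral(2)[OF s Qs, of "\<lambda>z. V z x" for x] VI by (intro ext) simp
    have V: "V z \<in> A \<and> N (V z) \<le> (e + e') * (Bf + Bg)" for z
    proof (cases "\<exists>t\<in>Q. \<sigma> t = z")
      case True
      then obtain t where t: "t \<in> Q" "\<tau> t = fst z" "\<tau>' t = snd z" by (auto simp: \<sigma>_def)
      have c: "fst z \<in> carrier G" "snd z \<in> carrier G" using okc[OF o t(1)] okc[OF o' t(1)] t by auto
      have tri: "cmod (u - v) \<le> e + e'" if "cmod (u - w) \<le> e" "cmod (v - w) \<le> e'" for u v w
        using that norm_triangle_ineq4[of "u - w" "v - w"] by simp
      have "(\<lambda>x. W (fst z) x - W (snd z) x) \<in> A \<and> N (\<lambda>x. W (fst z) x - W (snd z) x) \<le> (e + e') * (Bf + Bg)"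
      proof (intro conjI dW c)
        show "0 \<le> e + e'" using e by simp
        then show "0 \<le> e + e'" .
        show "cmod (f2 (y \<otimes> fst z) - f2 (y \<otimes> snd z)) \<le> e + e'" if "y \<in> carrier G" for y
          by (rule tri[OF okD(3)[OF o, rule_format, OF that t(1), unfolded t] okD(3)[OF o', rule_format, OF that t(1), unfolded t]])
        then show "cmod (f2 (y \<otimes> fst z) - f2 (y \<otimes> snd z)) \<le> e + e'" if "y \<in> carrier G" for y using that .
        show "cmod (g2 (y \<otimes> fst z) - g2 (y \<otimes> snd z)) \<le> e + e'" if "y \<in> carrier G" for y
          by (rule tri[OF okD(4)[OF o, rule_format, OF that t(1), unfolded t] okD(4)[OF o', rule_format, OF that t(1), unfolded t]])
        then show "cmod (g2 (y \<otimes> fst z) - g2 (y \<otimes> snd z)) \<le> e + e'" if "y \<in> carrier G" for y using that .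
      qed
      moreover have "V z = (\<lambda>x. W (fst z) x - W (snd z) x)" by (rule ext) (use True in \<open>simp add: V_def\<close>)
      ultimately show ?thesis by simp
    next
      case False
      then have "V z = (\<lambda>x. 0)" by (auto simp: V_def)
      then show ?thesis using herz_zero e Bf(1) Bg(1) by simp
    qed
    have hs: "(\<lambda>x. \<Sum>z\<in>I \<times> I'. measure M {t \<in> Q. \<sigma> t = z} *\<^sub>R V z x) \<in> A \<and>
        N (\<lambda>x. \<Sum>z\<in>I \<times> I'. measure M {t \<in> Q. \<sigma> t = z} *\<^sub>R V z x) \<le> (\<Sum>z\<in>I \<times> I'. measure M {t \<in> Q. \<sigma> t = z} * N (V z))"
      by (rule herz_sum) (use s V in \<open>auto simp: selector_def\<close>)
    have "(\<Sum>z\<in>I \<times> I'. measure M {t \<in> Q. \<sigma> t = z} * N (V z)) \<le> (\<Sum>z\<in>I \<times> I'. measure M {t \<in> Q. \<sigma> t = z} * ((e + e') * (Bf + Bg)))"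
      by (intro sum_mono mult_left_mono) (use V in auto)
    also have "\<dots> = (\<Sum>z\<in>I \<times> I'. measure M {t \<in> Q. \<sigma> t = z}) * ((e + e') * (Bf + Bg))" by (simp only: sum_distrib_right)
    also have "(\<Sum>z\<in>I \<times> I'. measure M {t \<in> Q. \<sigma> t = z}) = m"
      using selector_integral(2)[OF s Qs, of "\<lambda>_. 1::real"] sets.sets_into_space[OF Qs(1)] by (simp add: m_def Int_absorb2)
    finally show "N (\<lambda>x. P \<tau> I x - P \<tau>' I' x) \<le> m * ((e + e') * (Bf + Bg))" using hs unfolding eq by linarith
    show "(\<lambda>x. P \<tau> I x - P \<tau>' I' x) \<in> A" using hs unfolding eq by blast
  qed
  \<comment> \<open>By left invariance the integral of \<open>\<psi> y\<close> is
    \<open>conv g2 f2 x\<close> for every y, so \<open>P\<close> averages approximations of one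
    number against \<open>\<phi>\<close>, whose L_1 norm is at most 1. Where g1 y = 0 there is
    nothing to show; elsewhere y lies in K1 and \<open>Q\<close> carries the integrand.\<close>
  have claim3: "cmod (P \<tau> I x - conv g1 f1 x * conv g2 f2 x) \<le> e * (m * (Bf + Bg))"
    if o: "ok e \<tau> I" and e: "0 \<le> e" and x: "x \<in> carrier G" for e \<tau> I x
  proof -
    note D = okD[OF o]
    define \<phi> where "\<phi> y = g1 y * f1 (inv x \<otimes> y)" for y
    have i\<phi>: "integrable M \<phi>" unfolding \<phi>_def[abs_def] by (rule conv_integrable[OF l(1,2) x])
    have n\<phi>: "(\<integral>y. cmod (\<phi> y) \<partial>M) \<le> 1"
    proof -
      have "(\<integral>y. cmod (\<phi> y) \<partial>M) \<le> lp_norm M q g1 * lp_norm M p (\<lambda>y. f1 (inv x \<otimes> y))"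
        unfolding \<phi>_def using x by (intro hoelder(2)[OF p1 q1 pq] lp_transl l) auto
      also have "\<dots> \<le> 1 * 1" using lp_transl(2)[OF _ l(1), of "inv x"] x n1 by (intro mult_mono) auto
      finally show ?thesis by simp
    qed
    define \<psi> where "\<psi> y t = g2 (y \<otimes> t) * f2 (inv x \<otimes> (y \<otimes> t))" for y t
    define S where "S y = (\<Sum>a\<in>I. measure M {t \<in> Q. \<tau> t = a} *\<^sub>R \<psi> y a)" for y
    define c where "c = conv g2 f2 x"
    have iW: "integrable M (\<lambda>y. H a y * F a (inv x \<otimes> y))" if "a \<in> I" for a
      using conv_integrable[OF lF(1) lH(1) x] D(2) that by blast
    have Weq: "H a y * F a (inv x \<otimes> y) = \<phi> y * \<psi> y a" if "a \<in> I" "y \<in> carrier G" for a y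
      using that D(2) x by (auto simp: H_def F_def \<phi>_def \<psi>_def m_assoc subset_iff)
    have i\<phi>\<psi>: "integrable M (\<lambda>y. \<phi> y * \<psi> y a)" if "a \<in> I" for a
      using iW[OF that] Weq[OF that] by (subst Bochner_Integration.integrable_cong[OF refl, where g = "\<lambda>y. H a y * F a (inv x \<otimes> y)"]) (auto simp: space_M)
    have "P \<tau> I x = (\<Sum>a\<in>I. measure M {t \<in> Q. \<tau> t = a} *\<^sub>R (\<integral>y. \<phi> y * \<psi> y a \<partial>M))"
      unfolding P_def
    proof (intro sum.cong arg_cong2[where f = scaleR] refl)
      fix a assume a: "a \<in> I"
      show "W a x = (\<integral>y. \<phi> y * \<psi> y a \<partial>M)"
        using x Weq[OF a] by (auto simp: W_def conv_check_def space_M intro!: Bochner_Integration.integral_cong)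
    qed
    also have "\<dots> = (\<integral>y. \<phi> y * S y \<partial>M)"
      using i\<phi>\<psi> unfolding S_def sum_distrib_left mult_scaleR_right
      by (subst Bochner_Integration.integral_sum) auto
    finally have PS: "P \<tau> I x = (\<integral>y. \<phi> y * S y \<partial>M)" .
    have iS: "integrable M (\<lambda>y. \<phi> y * S y)"
      using i\<phi>\<psi> unfolding S_def sum_distrib_left mult_scaleR_right by auto
    have ic: "integrable M (\<lambda>y. \<phi> y * c)" using i\<phi> by simp
    have "conv g1 f1 x * conv g2 f2 x = (\<integral>y. \<phi> y * c \<partial>M)"
      using i\<phi> by (simp add: c_def \<phi>_def[abs_def] conv_check_def[of G M g1])
    then have diff: "P \<tau> I x - conv g1 f1 x * conv g2 f2 x = (\<integral>y. \<phi> y * S y - \<phi> y * c \<partial>M)"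
      using PS Bochner_Integration.integral_diff[OF iS ic] by simp
    have pt: "cmod (\<phi> y * S y - \<phi> y * c) \<le> e * (m * (Bf + Bg)) * cmod (\<phi> y)" if y: "y \<in> carrier G" for y
    proof (cases "g1 y = 0")
      case True then show ?thesis by (simp add: \<phi>_def)
    next
      case False
      then have yK: "y \<in> K1" using K1(2) y by blast
      have ig: "integrable M (\<lambda>t. g2 t * f2 (inv x \<otimes> t))" by (rule conv_integrable[OF l(3,4) x])
      have c': "c = (\<integral>t. \<psi> y t \<partial>M)"
        using integral_left_transl[OF y borel_measurable_integrable[OF ig]] by (simp add: c_def conv_check_def \<psi>_def)
      have i\<psi>: "integrable M (\<psi> y)" using integrable_left_transl[OF y ig] by (simp add: \<psi>_def[abs_def])
      have iQ: "integrable M (\<lambda>t. indicator Q t *\<^sub>R \<psi> y t)" by (rule integrable_mult_indicator[OF Qs(1) i\<psi>])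
      have "c = (\<integral>t. indicator Q t *\<^sub>R \<psi> y t \<partial>M)"
        unfolding c' using Qz[OF yK] by (intro Bochner_Integration.integral_cong) (auto simp: \<psi>_def space_M indicator_def)
      moreover have "S y = (\<integral>t. indicator Q t *\<^sub>R \<psi> y (\<tau> t) \<partial>M)" "integrable M (\<lambda>t. indicator Q t *\<^sub>R \<psi> y (\<tau> t))"
        using selector_integral[OF D(1) Qs, of "\<psi> y"] by (auto simp: S_def)
      ultimately have "S y - c = (\<integral>t. indicator Q t *\<^sub>R \<psi> y (\<tau> t) - indicator Q t *\<^sub>R \<psi> y t \<partial>M)"
        using iQ by simp
      also have "cmod \<dots> \<le> (\<integral>t. (e * (Bf + Bg)) * indicator Q t \<partial>M)"
      proof (rule norm_integral_le)
        show "integrable M (\<lambda>t. indicator Q t *\<^sub>R \<psi> y (\<tau> t) - indicator Q t *\<^sub>R \<psi> y t)"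
          using selector_integral(1)[OF D(1) Qs, of "\<psi> y"] iQ by simp
        show "integrable M (\<lambda>t. (e * (Bf + Bg)) * indicator Q t)" using Qs by (intro integrable_mult_right integrable_real_indicator)
        fix t assume t: "t \<in> space M"
        show "cmod (indicator Q t *\<^sub>R \<psi> y (\<tau> t) - indicator Q t *\<^sub>R \<psi> y t) \<le> e * (Bf + Bg) * indicator Q t"
        proof (cases "t \<in> Q")
          case True
          have tc: "t \<in> carrier G" "\<tau> t \<in> carrier G" using t okc[OF o True] by (auto simp: space_M)
          define a1 where "a1 = g2 (y \<otimes> \<tau> t)"
          define a2 where "a2 = g2 (y \<otimes> t)"
          define b1 where "b1 = f2 (inv x \<otimes> (y \<otimes> \<tau> t))"
          define b2 where "b2 = f2 (inv x \<otimes> (y \<otimes> t))"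
          have da: "cmod (a1 - a2) \<le> e" using D(4) y True by (simp add: a1_def a2_def)
          have db: "cmod (b1 - b2) \<le> e"
            using D(3)[rule_format, of "inv x \<otimes> y" t] x y True tc by (simp add: b1_def b2_def m_assoc)
          have ba: "cmod b1 \<le> Bf" "cmod a2 \<le> Bg" using Bf(2) Bg(2) x y tc by (auto simp: b1_def a2_def)
          have "a1 * b1 - a2 * b2 = (a1 - a2) * b1 + a2 * (b1 - b2)" by (simp add: algebra_simps)
          then have "cmod (a1 * b1 - a2 * b2) \<le> cmod (a1 - a2) * cmod b1 + cmod a2 * cmod (b1 - b2)"
            using norm_triangle_ineq[of "(a1 - a2) * b1" "a2 * (b1 - b2)"] by (simp add: norm_mult)
          also have "\<dots> \<le> e * Bf + Bg * e" using da db ba e Bg(1) by (intro add_mono mult_mono) auto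
          finally show ?thesis using True by (simp add: \<psi>_def a1_def a2_def b1_def b2_def algebra_simps)
        qed simp
      qed
      also have "\<dots> = e * (m * (Bf + Bg))"
        using Qs sets.sets_into_space[OF Qs(1)] by (simp add: m_def Int_absorb2)
      finally have "cmod (S y - c) \<le> e * (m * (Bf + Bg))" .
      then have "cmod (\<phi> y) * cmod (S y - c) \<le> cmod (\<phi> y) * (e * (m * (Bf + Bg)))" by (intro mult_left_mono) auto
      moreover have "\<phi> y * S y - \<phi> y * c = \<phi> y * (S y - c)" by (simp only: right_diff_distrib)
      ultimately show ?thesis by (simp only: norm_mult mult.commute)
    qed
    have "cmod (P \<tau> I x - conv g1 f1 x * conv g2 f2 x) \<le> (\<integral>y. e * (m * (Bf + Bg)) * cmod (\<phi> y) \<partial>M)"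
      unfolding diff
    proof (rule norm_integral_le)
      show "integrable M (\<lambda>y. \<phi> y * S y - \<phi> y * c)" using iS ic by (rule Bochner_Integration.integrable_diff)
      show "integrable M (\<lambda>y. e * (m * (Bf + Bg)) * cmod (\<phi> y))" using i\<phi> by simp
    qed (use pt in \<open>simp add: space_M\<close>)
    also have "\<dots> = e * (m * (Bf + Bg)) * (\<integral>y. cmod (\<phi> y) \<partial>M)" by simp
    also have "\<dots> \<le> e * (m * (Bf + Bg)) * 1" using n\<phi> e m0 Bf(1) Bg(1) by (intro mult_left_mono) auto
    finally show ?thesis by simp
  qed
  define B where "B = Bf + Bg"
  have B0: "0 \<le> B" using Bf Bg by (simp add: B_def)
  have main: "herz_prod g1 f1 g2 f2 \<in> A \<and> N (herz_prod g1 f1 g2 f2) \<le> 1 + \<eta>" if \<eta>: "0 < \<eta>" for \<eta>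
  proof -
    \<comment> \<open>All tolerances are e n = k / 2^n. Two consecutive ones add up to 6 k /
      2^(j+2), which explains the 6; the norm bounds \<open>b\<close> then sum to 1 + k m + 6 m B k,
      and \<open>k\<close> keeps this below 1 + \<eta>.\<close>
    define k where "k = \<eta> / (m * (1 + 6 * B) + 1)"
    have pos: "0 < m * (1 + 6 * B) + 1" using m0 B0 by (intro add_nonneg_pos mult_nonneg_nonneg) auto
    have k0: "0 < k" using \<eta> pos by (simp add: k_def)
    have "k * (m * (1 + 6 * B) + 1) = \<eta>" using pos by (simp add: k_def)
    then have km: "k * m * (1 + 6 * B) \<le> \<eta>" using k0 by (simp add: algebra_simps)
    define e where "e n = k * (1/2) ^ n" for n :: nat
    have e0: "0 < e n" for n using k0 by (simp add: e_def)
    have "\<forall>n. \<exists>z. ok (e n) (fst z) (snd z)" using ex_ok[OF e0] by simp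
    then have "\<exists>z. \<forall>n. ok (e n) (fst (z n)) (snd (z n))" by (rule choice)
    then obtain z where z: "ok (e n) (fst (z n)) (snd (z n))" for n by blast
    define R where "R n = P (fst (z n)) (snd (z n))" for n
    define w where "w n = (case n of 0 \<Rightarrow> R 0 | Suc j \<Rightarrow> (\<lambda>x. R (Suc j) x - R j x))" for n
    define b where "b n = (if n = 0 then 1 + k * m else 0) + 6 * m * B * k * (1/2) ^ Suc n" for n :: nat
    have part: "(\<Sum>n<Suc j. w n x) = R j x" for j x by (induction j) (simp_all add: w_def)
    have wA: "w n \<in> A" for n
      using PA(1)[OF z] claim2(1)[OF z z less_imp_le[OF e0] less_imp_le[OF e0]] by (cases n) (auto simp: w_def R_def)
    have wb: "N (w n) \<le> b n" for n
    proof (cases n)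
      case 0
      have "N (w 0) \<le> 1 + e 0 * m" using claim1[OF z[of 0]] e0[of 0] by (simp add: w_def R_def)
      moreover have "0 \<le> 6 * m * B * k * (1/2) ^ Suc 0" using m0 B0 k0 by simp
      ultimately show ?thesis using 0 by (simp add: b_def e_def)
    next
      case (Suc j)
      have "N (w n) \<le> m * ((e (Suc j) + e j) * B)"
        using claim2(2)[OF z[of "Suc j"] z[of j]] e0[of "Suc j"] e0[of j] Suc by (simp add: w_def R_def B_def)
      also have "\<dots> = b n" using Suc by (simp add: b_def e_def algebra_simps)
      finally show ?thesis .
    qed
    have bs: "b sums ((1 + k * m) + 6 * m * B * k)"
      unfolding b_def using sums_add[OF sums_single[of 0 "\<lambda>_. 1 + k * m"] sums_mult[OF power_half_series, of "6 * m * B * k"]] by simp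
    have ws: "(\<lambda>n. w n x) sums herz_prod g1 f1 g2 f2 x" if x: "x \<in> carrier G" for x
      unfolding sums_def
    proof (rule LIMSEQ_imp_Suc, unfold part)
      have "(\<lambda>n. R n x - conv g1 f1 x * conv g2 f2 x) \<longlonglongrightarrow> 0"
      proof (rule Lim_null_comparison)
        show "eventually (\<lambda>n. norm (R n x - conv g1 f1 x * conv g2 f2 x) \<le> e n * (m * B)) sequentially"
          unfolding R_def B_def using e0 by (intro always_eventually allI claim3[OF z] x less_imp_le)
        have "e \<longlonglongrightarrow> 0" unfolding e_def by (intro tendsto_mult_right_zero LIMSEQ_power_zero) simp
        then show "(\<lambda>n. e n * (m * B)) \<longlonglongrightarrow> 0" by (rule tendsto_mult_left_zero)
      qed
      then show "(\<lambda>n. R n x) \<longlonglongrightarrow> herz_prod g1 f1 g2 f2 x" using x by (simp add: herz_prod_def LIM_zero_iff)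
    qed
    have out: "herz_prod g1 f1 g2 f2 x = 0" if "x \<notin> carrier G" for x using that by (simp add: herz_prod_def)
    have "(1 + k * m) + 6 * m * B * k \<le> 1 + \<eta>" using km by (simp add: algebra_simps)
    then show ?thesis using herz_series[OF wA wb sums_summable[OF bs] ws out] sums_unique[OF bs] by simp
  qed
  show "herz_prod g1 f1 g2 f2 \<in> A" using main[of 1] by simp
  show "N (herz_prod g1 f1 g2 f2) \<le> 1" by (rule field_le_epsilon) (use main in blast)
qed

lemma herz_prod_scale:
  "herz_prod (\<lambda>y. a * g1 y) (\<lambda>y. b * f1 y) (\<lambda>y. c * g2 y) (\<lambda>y. d * f2 y) = (\<lambda>x. (a * b * c * d) * herz_prod g1 f1 g2 f2 x)"
  by (auto simp: herz_prod_def conv_scale_left conv_scale_right)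

lemma herz_prod_zero:
  assumes l: "lp_fun M p f1" "lp_fun M q g1" "lp_fun M p f2" "lp_fun M q g2"
    and z: "lp_norm M p f1 = 0 \<or> lp_norm M q g1 = 0 \<or> lp_norm M p f2 = 0 \<or> lp_norm M q g2 = 0"
  shows "herz_prod g1 f1 g2 f2 = (\<lambda>x. 0)"
proof (rule ext)
  fix x
  show "herz_prod g1 f1 g2 f2 x = 0"
    using conv_bound[OF l(1,2), of x] conv_bound[OF l(3,4), of x] z
    by (auto simp: herz_prod_def)
qed

lemma herz_prod_cc:
  assumes cc: "cc f1" "cc g1" "cc f2" "cc g2"
  shows "herz_prod g1 f1 g2 f2 \<in> A \<and> N (herz_prod g1 f1 g2 f2) \<le> lp_norm M q g1 * lp_norm M q g2 * lp_norm M p f2 * lp_norm M p f1"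
proof -
  have p0: "0 < p" "0 < q" using p1 q1 by auto
  have l: "lp_fun M p f1" "lp_fun M q g1" "lp_fun M p f2" "lp_fun M q g2" using cc cc_lp p0 by auto
  define a b c d where "a = lp_norm M q g1" and "b = lp_norm M p f1" and "c = lp_norm M q g2" and "d = lp_norm M p f2"
  show ?thesis
  proof (cases "a = 0 \<or> b = 0 \<or> c = 0 \<or> d = 0")
    case True
    then have "herz_prod g1 f1 g2 f2 = (\<lambda>x. 0)" by (intro herz_prod_zero l) (auto simp: a_def b_def c_def d_def)
    then show ?thesis using herz_zero by simp
  next
    case False
    then have pos: "0 < a" "0 < b" "0 < c" "0 < d" by (auto simp: a_def b_def c_def d_def less_le)
    define u where "u = herz_prod (\<lambda>y. complex_of_real (1 / a) * g1 y) (\<lambda>y. complex_of_real (1 / b) * f1 y)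
        (\<lambda>y. complex_of_real (1 / c) * g2 y) (\<lambda>y. complex_of_real (1 / d) * f2 y)"
    have n: "lp_norm M r (\<lambda>y. complex_of_real (1 / s) * h y) \<le> 1" if "lp_fun M r h" "0 < r" "s = lp_norm M r h" "0 < s" for h r s
      using lp_scale(2)[OF that(1,2), of "complex_of_real (1 / s)"] that(3,4) by (simp add: norm_divide)
    have u: "u \<in> A" "N u \<le> 1"
      unfolding u_def using cc p0 l pos
      by (intro herz_prod_cc1 cc_scale n; simp add: a_def b_def c_def d_def)+
    have eq: "herz_prod g1 f1 g2 f2 = (\<lambda>x. complex_of_real (a * b * c * d) * u x)"
      unfolding u_def herz_prod_scale using pos by (auto simp: fun_eq_iff)
    have "N (herz_prod g1 f1 g2 f2) \<le> cmod (complex_of_real (a * b * c * d)) * N u"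
      unfolding eq by (rule herz_scale(2)[OF u(1)])
    also have "\<dots> \<le> cmod (complex_of_real (a * b * c * d)) * 1" by (intro mult_left_mono u) simp
    also have "\<dots> = a * c * d * b" using pos by (simp only: norm_of_real) simp
    finally show ?thesis using herz_scale(1)[OF u(1)] by (simp add: eq a_def b_def c_def d_def)
  qed
qed

text \<open>The product is linear in each of its four factors. They are released from compact
  support one at a time by \<open>herz_extend\<close>, in the order f1, g1, f2, g2, while the
  remaining norms form the constant.\<close>

lemma herz_prod_lp:
  assumes l: "lp_fun M p f1" "lp_fun M q g1" "lp_fun M p f2" "lp_fun M q g2"
  shows "herz_prod g1 f1 g2 f2 \<in> A \<and> N (herz_prod g1 f1 g2 f2) \<le> lp_norm M q g1 * lp_norm M p f1 * lp_norm M q g2 * lp_norm M p f2"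
proof -
  have p0: "1 \<le> p" "1 \<le> q" using p1 q1 by auto
  have cl: "lp_fun M p h" "lp_fun M q h" if "cc h" for h using cc_lp[OF that] p1 q1 by auto
  have s1: "herz_prod g1 f1 g2 f2 \<in> A \<and> N (herz_prod g1 f1 g2 f2) \<le> (lp_norm M q g1 * lp_norm M q g2 * lp_norm M p f2) * lp_norm M p f1"
    if "lp_fun M p f1" "cc g1" "cc g2" "cc f2" for f1 g1 g2 f2
  proof (intro conjI herz_extend[where \<Phi> = "\<lambda>f. herz_prod g1 f g2 f2", OF that(1) p0(1)])
    show *: "\<forall>h x. (\<forall>k::nat. lp_fun M p (h k)) \<longrightarrow> (\<lambda>n. lp_norm M p (\<lambda>y. f1 y - (\<Sum>k<n. h k y))) \<longlonglongrightarrow> 0 \<longrightarrow> x \<in> carrier G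
        \<longrightarrow> (\<lambda>k. herz_prod g1 (h k) g2 f2 x) sums (herz_prod g1 f1 g2 f2 x)"
      using conv_sums_right[OF that(1) cl(2)[OF that(2)]] by (auto simp: herz_prod_def intro!: sums_mult2)
    then show "\<forall>h x. (\<forall>k::nat. lp_fun M p (h k)) \<longrightarrow> (\<lambda>n. lp_norm M p (\<lambda>y. f1 y - (\<Sum>k<n. h k y))) \<longlonglongrightarrow> 0 \<longrightarrow> x \<in> carrier G
        \<longrightarrow> (\<lambda>k. herz_prod g1 (h k) g2 f2 x) sums (herz_prod g1 f1 g2 f2 x)" .
    show "\<forall>h. cc h \<longrightarrow> herz_prod g1 h g2 f2 \<in> A \<and> N (herz_prod g1 h g2 f2) \<le> (lp_norm M q g1 * lp_norm M q g2 * lp_norm M p f2) * lp_norm M p h"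
      using herz_prod_cc that by blast
    then show "\<forall>h. cc h \<longrightarrow> herz_prod g1 h g2 f2 \<in> A \<and> N (herz_prod g1 h g2 f2) \<le> (lp_norm M q g1 * lp_norm M q g2 * lp_norm M p f2) * lp_norm M p h" .
  qed (auto simp: herz_prod_def)
  have s2: "herz_prod g1 f1 g2 f2 \<in> A \<and> N (herz_prod g1 f1 g2 f2) \<le> (lp_norm M q g2 * lp_norm M p f2 * lp_norm M p f1) * lp_norm M q g1"
    if "lp_fun M p f1" "lp_fun M q g1" "cc g2" "cc f2" for f1 g1 g2 f2
  proof (intro conjI herz_extend[where \<Phi> = "\<lambda>g. herz_prod g f1 g2 f2", OF that(2) p0(2)])
    show *: "\<forall>h x. (\<forall>k::nat. lp_fun M q (h k)) \<longrightarrow> (\<lambda>n. lp_norm M q (\<lambda>y. g1 y - (\<Sum>k<n. h k y))) \<longlonglongrightarrow> 0 \<longrightarrow> x \<in> carrier G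
        \<longrightarrow> (\<lambda>k. herz_prod (h k) f1 g2 f2 x) sums (herz_prod g1 f1 g2 f2 x)"
      using conv_sums_left[OF that(1,2)] by (auto simp: herz_prod_def intro!: sums_mult2)
    then show "\<forall>h x. (\<forall>k::nat. lp_fun M q (h k)) \<longrightarrow> (\<lambda>n. lp_norm M q (\<lambda>y. g1 y - (\<Sum>k<n. h k y))) \<longlonglongrightarrow> 0 \<longrightarrow> x \<in> carrier G
        \<longrightarrow> (\<lambda>k. herz_prod (h k) f1 g2 f2 x) sums (herz_prod g1 f1 g2 f2 x)" .
    show "\<forall>h. cc h \<longrightarrow> herz_prod h f1 g2 f2 \<in> A \<and> N (herz_prod h f1 g2 f2) \<le> (lp_norm M q g2 * lp_norm M p f2 * lp_norm M p f1) * lp_norm M q h"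
      using s1[OF that(1) _ that(3,4)] by (simp add: mult_ac)
    then show "\<forall>h. cc h \<longrightarrow> herz_prod h f1 g2 f2 \<in> A \<and> N (herz_prod h f1 g2 f2) \<le> (lp_norm M q g2 * lp_norm M p f2 * lp_norm M p f1) * lp_norm M q h" .
  qed (auto simp: herz_prod_def)
  have s3: "herz_prod g1 f1 g2 f2 \<in> A \<and> N (herz_prod g1 f1 g2 f2) \<le> (lp_norm M q g2 * lp_norm M p f1 * lp_norm M q g1) * lp_norm M p f2"
    if "lp_fun M p f1" "lp_fun M q g1" "cc g2" "lp_fun M p f2" for f1 g1 g2 f2
  proof (intro conjI herz_extend[where \<Phi> = "\<lambda>f. herz_prod g1 f1 g2 f", OF that(4) p0(1)])
    show *: "\<forall>h x. (\<forall>k::nat. lp_fun M p (h k)) \<longrightarrow> (\<lambda>n. lp_norm M p (\<lambda>y. f2 y - (\<Sum>k<n. h k y))) \<longlonglongrightarrow> 0 \<longrightarrow> x \<in> carrier G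
        \<longrightarrow> (\<lambda>k. herz_prod g1 f1 g2 (h k) x) sums (herz_prod g1 f1 g2 f2 x)"
      using conv_sums_right[OF that(4) cl(2)[OF that(3)]] by (auto simp: herz_prod_def intro!: sums_mult)
    then show "\<forall>h x. (\<forall>k::nat. lp_fun M p (h k)) \<longrightarrow> (\<lambda>n. lp_norm M p (\<lambda>y. f2 y - (\<Sum>k<n. h k y))) \<longlonglongrightarrow> 0 \<longrightarrow> x \<in> carrier G
        \<longrightarrow> (\<lambda>k. herz_prod g1 f1 g2 (h k) x) sums (herz_prod g1 f1 g2 f2 x)" .
    show "\<forall>h. cc h \<longrightarrow> herz_prod g1 f1 g2 h \<in> A \<and> N (herz_prod g1 f1 g2 h) \<le> (lp_norm M q g2 * lp_norm M p f1 * lp_norm M q g1) * lp_norm M p h"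
      using s2[OF that(1,2,3)] by (simp add: mult_ac)
    then show "\<forall>h. cc h \<longrightarrow> herz_prod g1 f1 g2 h \<in> A \<and> N (herz_prod g1 f1 g2 h) \<le> (lp_norm M q g2 * lp_norm M p f1 * lp_norm M q g1) * lp_norm M p h" .
  qed (auto simp: herz_prod_def)
  have "herz_prod g1 f1 g2 f2 \<in> A \<and> N (herz_prod g1 f1 g2 f2) \<le> (lp_norm M p f1 * lp_norm M q g1 * lp_norm M p f2) * lp_norm M q g2"
  proof (intro conjI herz_extend[where \<Phi> = "\<lambda>g. herz_prod g1 f1 g f2", OF l(4) p0(2)])
    show *: "\<forall>h x. (\<forall>k::nat. lp_fun M q (h k)) \<longrightarrow> (\<lambda>n. lp_norm M q (\<lambda>y. g2 y - (\<Sum>k<n. h k y))) \<longlonglongrightarrow> 0 \<longrightarrow> x \<in> carrier G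
        \<longrightarrow> (\<lambda>k. herz_prod g1 f1 (h k) f2 x) sums (herz_prod g1 f1 g2 f2 x)"
      using conv_sums_left[OF l(3,4)] by (auto simp: herz_prod_def intro!: sums_mult)
    then show "\<forall>h x. (\<forall>k::nat. lp_fun M q (h k)) \<longrightarrow> (\<lambda>n. lp_norm M q (\<lambda>y. g2 y - (\<Sum>k<n. h k y))) \<longlonglongrightarrow> 0 \<longrightarrow> x \<in> carrier G
        \<longrightarrow> (\<lambda>k. herz_prod g1 f1 (h k) f2 x) sums (herz_prod g1 f1 g2 f2 x)" .
    show "\<forall>h. cc h \<longrightarrow> herz_prod g1 f1 h f2 \<in> A \<and> N (herz_prod g1 f1 h f2) \<le> (lp_norm M p f1 * lp_norm M q g1 * lp_norm M p f2) * lp_norm M q h"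
      using s3[OF l(1,2) _ l(3)] by (simp add: mult_ac)
    then show "\<forall>h. cc h \<longrightarrow> herz_prod g1 f1 h f2 \<in> A \<and> N (herz_prod g1 f1 h f2) \<le> (lp_norm M p f1 * lp_norm M q g1 * lp_norm M p f2) * lp_norm M q h" .
  qed (auto simp: herz_prod_def)
  then show ?thesis by (simp add: mult_ac)
qed

lemma herz_prod_atom:
  assumes "atom f1 g1" "atom f2 g2"
  shows "herz_prod g1 f1 g2 f2 \<in> A" "N (herz_prod g1 f1 g2 f2) \<le> 1"
proof -
  have h: "herz_prod g1 f1 g2 f2 \<in> A \<and> N (herz_prod g1 f1 g2 f2) \<le> lp_norm M q g1 * lp_norm M p f1 * lp_norm M q g2 * lp_norm M p f2"
    using assms by (intro herz_prod_lp) (auto simp: atom_def)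
  have "lp_norm M q g1 * lp_norm M p f1 * lp_norm M q g2 * lp_norm M p f2 \<le> 1 * 1 * 1 * 1"
    using assms by (intro mult_mono mult_nonneg_nonneg) (auto simp: atom_def)
  then show "herz_prod g1 f1 g2 f2 \<in> A" "N (herz_prod g1 f1 g2 f2) \<le> 1" using h by auto
qed

lemma herz_mult_atom:
  assumes a: "atom f g" and v: "v \<in> A" and e: "0 < e"
  shows "(\<lambda>x. if x \<in> carrier G then conv g f x * v x else 0) \<in> A \<and> N (\<lambda>x. if x \<in> carrier G then conv g f x * v x else 0) \<le> N v + e"
proof -
  obtain c f' g' where c: "\<forall>i. 0 \<le> c i \<and> atom (f' i) (g' i)" "summable c" "suminf c \<le> N v + e"
    and s: "\<forall>x\<in>carrier G. (\<lambda>i. complex_of_real (c i) * conv (g' i) (f' i) x) sums v x"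
    by (rule herz_atomicE[OF v e])
  define w where "w i x = complex_of_real (c i) * herz_prod g f (g' i) (f' i) x" for i x
  have w: "w i \<in> A" "N (w i) \<le> c i" for i
  proof -
    note h = herz_prod_atom[OF a conjunct2[OF c(1)[rule_format, of i]]]
    show "w i \<in> A" unfolding w_def[abs_def] by (rule herz_scale(1)[OF h(1)])
    have "N (w i) \<le> cmod (complex_of_real (c i)) * N (herz_prod g f (g' i) (f' i))"
      unfolding w_def[abs_def] by (rule herz_scale(2)[OF h(1)])
    also have "\<dots> \<le> c i * 1" using c(1) h(2) by (simp add: mult_left_le)
    finally show "N (w i) \<le> c i" by simp
  qed
  have ws: "(\<lambda>i. w i x) sums (if x \<in> carrier G then conv g f x * v x else 0)" if "x \<in> carrier G" for x
    using sums_mult[OF s[rule_format, OF that], of "conv g f x"] that by (simp add: w_def herz_prod_def mult_ac)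
  note hs = herz_series[OF w c(2) ws]
  show ?thesis using hs c(3) by auto
qed

text \<open>\<open>u\<close> is expanded into atoms; each atom times \<open>v\<close> has been
  handled by expanding \<open>v\<close>. The excess e in both factors tends to 0 at the end.\<close>

lemma herz_mult:
  assumes u: "u \<in> A" and v: "v \<in> A"
  shows "(\<lambda>x. u x * v x) \<in> A" "N (\<lambda>x. u x * v x) \<le> N u * N v"
proof -
  have main: "(\<lambda>x. u x * v x) \<in> A \<and> N (\<lambda>x. u x * v x) \<le> (N u + e) * (N v + e)" if e: "0 < e" for e
  proof -
    obtain c f g where c: "\<forall>i. 0 \<le> c i \<and> atom (f i) (g i)" "summable c" "suminf c \<le> N u + e"
      and s: "\<forall>x\<in>carrier G. (\<lambda>i. complex_of_real (c i) * conv (g i) (f i) x) sums u x"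
      by (rule herz_atomicE[OF u e])
    define h where "h i = (\<lambda>x. if x \<in> carrier G then conv (g i) (f i) x * v x else 0)" for i
    have h: "h i \<in> A" "N (h i) \<le> N v + e" for i
      using herz_mult_atom[OF conjunct2[OF c(1)[rule_format, of i]] v e] by (auto simp: h_def)
    define w where "w i x = complex_of_real (c i) * h i x" for i x
    have wA: "w i \<in> A" for i unfolding w_def[abs_def] by (rule herz_scale(1)[OF h(1)])
    have wb: "N (w i) \<le> c i * (N v + e)" for i
    proof -
      have "N (w i) \<le> cmod (complex_of_real (c i)) * N (h i)" unfolding w_def[abs_def] by (rule herz_scale(2)[OF h(1)])
      also have "\<dots> \<le> c i * (N v + e)" using c(1) h(2) by (simp add: mult_left_mono)
      finally show ?thesis .
    qed
    have ws: "(\<lambda>i. w i x) sums (u x * v x)" if "x \<in> carrier G" for x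
      using sums_mult2[OF s[rule_format, OF that], of "v x"] that by (simp add: w_def h_def mult_ac)
    have out: "u x * v x = 0" if "x \<notin> carrier G" for x using herz_out[OF u that] by simp
    note hs = herz_series[OF wA wb summable_mult2[OF c(2)] ws out]
    have "(\<Sum>i. c i * (N v + e)) = suminf c * (N v + e)" using suminf_mult2[OF c(2)] by simp
    also have "\<dots> \<le> (N u + e) * (N v + e)" using c(3) herz_norm_nonneg[OF v] e by (intro mult_right_mono) auto
    finally show ?thesis using hs by auto
  qed
  show "(\<lambda>x. u x * v x) \<in> A" using main[of 1] by simp
  have "((\<lambda>e. (N u + e) * (N v + e)) \<longlongrightarrow> N u * N v) (at_right 0)"
    by (auto intro!: tendsto_eq_intros)
  then show "N (\<lambda>x. u x * v x) \<le> N u * N v"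
  proof (rule tendsto_lowerbound)
    show "\<forall>\<^sub>F e in at_right 0. N (\<lambda>x. u x * v x) \<le> (N u + e) * (N v + e)"
      using main by (auto simp: eventually_at_filter)
  qed simp
qed

sublocale fun_alg A N
  by unfold_locales (auto intro: herz_zero herz_add herz_scale herz_mult herz_norm_nonneg)

end

section \<open>Nondiscrete groups\<close>

lemma word_avg_sums:
  fixes F :: "nat \<Rightarrow> bool list \<Rightarrow> 'b::real_normed_vector"
  assumes "\<And>w. (\<lambda>i. F i w) sums F' w" shows "(\<lambda>i. word_avg n (F i)) sums word_avg n F'"
  using assms
proof (induction n arbitrary: F F')
  case (Suc n)
  have "(\<lambda>i. word_avg n (\<lambda>w. F i (a # w))) sums word_avg n (\<lambda>w. F' (a # w))" for a
    by (rule Suc.IH) (rule Suc.prems)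
  then show ?case by (simp only: word_avg.simps) (intro sums_scaleR_right sums_add)
qed simp

lemma mart_form_sums:
  assumes "\<And>w w'. (\<lambda>i. k i w w') sums k' w w'" shows "(\<lambda>i. mart_form n s (k i)) sums mart_form n s k'"
  using assms
proof (induction n arbitrary: s k k')
  case (Suc n)
  have 1: "(\<lambda>i. mart_form n (- s) (\<lambda>w w'. k i (a # w) (a # w'))) sums mart_form n (- s) (\<lambda>w w'. k' (a # w) (a # w'))" for a
    by (rule Suc.IH) (rule Suc.prems)
  show ?case unfolding mart_form.simps
    by (intro sums_add sums_scaleR_right sums_diff word_avg_sums 1 Suc.prems)
qed simp

lemma word_avg_integral:
  fixes F :: "'a \<Rightarrow> bool list \<Rightarrow> 'b::{banach, second_countable_topology}"
  assumes "\<And>w. integrable M (\<lambda>z. F z w)"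
  shows "integrable M (\<lambda>z. word_avg n (F z)) \<and> word_avg n (\<lambda>w. \<integral>z. F z w \<partial>M) = (\<integral>z. word_avg n (F z) \<partial>M)"
  using assms
proof (induction n arbitrary: F)
  case (Suc n)
  have "integrable M (\<lambda>z. word_avg n (\<lambda>w. F z (a # w))) \<and> word_avg n (\<lambda>w. \<integral>z. F z (a # w) \<partial>M) = (\<integral>z. word_avg n (\<lambda>w. F z (a # w)) \<partial>M)" for a
    by (rule Suc.IH) (rule Suc.prems)
  then show ?case by simp
qed simp

lemma mart_form_integral:
  fixes k :: "'a \<Rightarrow> bool list \<Rightarrow> bool list \<Rightarrow> complex"
  assumes "\<And>w w'. integrable M (\<lambda>z. k z w w')"
  shows "integrable M (\<lambda>z. mart_form n s (k z)) \<and> mart_form n s (\<lambda>w w'. \<integral>z. k z w w' \<partial>M) = (\<integral>z. mart_form n s (k z) \<partial>M)"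
  using assms
proof (induction n arbitrary: s k)
  case (Suc n)
  have 1: "integrable M (\<lambda>z. mart_form n (- s) (\<lambda>w w'. k z (a # w) (a # w')))"
    "mart_form n (- s) (\<lambda>w w'. \<integral>z. k z (a # w) (a # w') \<partial>M) = (\<integral>z. mart_form n (- s) (\<lambda>w w'. k z (a # w) (a # w')) \<partial>M)" for a
    using Suc.IH[of "\<lambda>z w w'. k z (a # w) (a # w')" "- s"] Suc.prems by auto
  have 2: "integrable M (\<lambda>z. word_avg m (\<lambda>w. word_avg m (\<lambda>w'. h z w w')))"
    "word_avg m (\<lambda>w. word_avg m (\<lambda>w'. \<integral>z. h z w w' \<partial>M)) = (\<integral>z. word_avg m (\<lambda>w. word_avg m (\<lambda>w'. h z w w')) \<partial>M)"
    if h: "\<And>w w'. integrable M (\<lambda>z. h z w w')" for m and h :: "'a \<Rightarrow> bool list \<Rightarrow> bool list \<Rightarrow> complex"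
  proof -
    have i: "integrable M (\<lambda>z. word_avg m (h z w))" "word_avg m (\<lambda>w'. \<integral>z. h z w w' \<partial>M) = (\<integral>z. word_avg m (h z w) \<partial>M)" for w
      using word_avg_integral[of M "\<lambda>z. h z w" m] h by auto
    show "integrable M (\<lambda>z. word_avg m (\<lambda>w. word_avg m (\<lambda>w'. h z w w')))"
      "word_avg m (\<lambda>w. word_avg m (\<lambda>w'. \<integral>z. h z w w' \<partial>M)) = (\<integral>z. word_avg m (\<lambda>w. word_avg m (\<lambda>w'. h z w w')) \<partial>M)"
      unfolding i(2) using word_avg_integral[of M "\<lambda>z w. word_avg m (h z w)" m] i(1) by auto
  qed
  note A = 2[of "\<lambda>z w w'. k z (False # w) (False # w')", OF Suc.prems] 2[of "\<lambda>z w w'. k z (True # w) (True # w')", OF Suc.prems]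
    2[of k, OF Suc.prems]
  show ?case unfolding mart_form.simps A 1 using A(1,3,5) 1(1)
    by (simp del: word_avg.simps)
qed simp

section \<open>Functionals from words of digits, and bump functions\<close>

context haar_group
begin

text \<open>The first digit stands on the right, so in x' x^-1 it cancels when both words begin with
  the same letter. The kernel on a subtree is then the kernel of the shifted digit sequence, which
  matches the recursion of \<open>mart_form\<close>.\<close>

primrec word_pt :: "(nat \<Rightarrow> 'a) \<Rightarrow> nat \<Rightarrow> bool list \<Rightarrow> 'a" where
  "word_pt d j [] = \<one>"
| "word_pt d j (a # w) = word_pt d (Suc j) w \<otimes> (if a then d j else \<one>)"

lemma word_pt_closed: "(\<And>j. d j \<in> carrier G) \<Longrightarrow> word_pt d j w \<in> carrier G"
  by (induction w arbitrary: j) auto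

definition mart_fun :: "(nat \<Rightarrow> 'a) \<Rightarrow> nat \<Rightarrow> real \<Rightarrow> nat \<Rightarrow> ('a \<Rightarrow> complex) \<Rightarrow> complex" where
  "mart_fun d n s j u = mart_form n s (\<lambda>w w'. u (word_pt d j w' \<otimes> inv (word_pt d j w)))"

lemma conv_two_points:
  assumes x: "x \<in> carrier G" and y: "y \<in> carrier G" and f: "lp_fun M p f" and g: "lp_fun M q g"
  shows "conv g f (y \<otimes> inv x) = (\<integral>z. f (x \<otimes> z) * g (y \<otimes> z) \<partial>M)" "integrable M (\<lambda>z. f (x \<otimes> z) * g (y \<otimes> z))"
proof -
  define h where "h w = g w * f (inv (y \<otimes> inv x) \<otimes> w)" for w
  have i: "integrable M h" unfolding h_def using conv_integrable[OF f g, of "y \<otimes> inv x"] x y by simp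
  have e: "h (y \<otimes> z) = f (x \<otimes> z) * g (y \<otimes> z)" if z: "z \<in> carrier G" for z
  proof -
    have "inv (y \<otimes> inv x) \<otimes> (y \<otimes> z) = x \<otimes> z"
      using x y z by (simp add: inv_mult_group m_assoc) (simp add: m_assoc[symmetric])
    then show ?thesis by (simp add: h_def mult.commute)
  qed
  have "conv g f (y \<otimes> inv x) = (\<integral>z. h (y \<otimes> z) \<partial>M)"
    using integral_left_transl[OF y borel_measurable_integrable[OF i]] by (simp add: conv_check_def h_def)
  also have "\<dots> = (\<integral>z. f (x \<otimes> z) * g (y \<otimes> z) \<partial>M)"
    by (rule Bochner_Integration.integral_cong) (auto simp: e space_M)
  finally show "conv g f (y \<otimes> inv x) = (\<integral>z. f (x \<otimes> z) * g (y \<otimes> z) \<partial>M)" .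
  have "integrable M (\<lambda>z. h (y \<otimes> z)) \<longleftrightarrow> integrable M (\<lambda>z. f (x \<otimes> z) * g (y \<otimes> z))"
    by (rule Bochner_Integration.integrable_cong) (auto simp: e space_M)
  then show "integrable M (\<lambda>z. f (x \<otimes> z) * g (y \<otimes> z))"
    using integrable_left_transl[OF y i] by simp
qed

text \<open>By left invariance \<open>(g * f\<^sup>\<or>)(b a\<^sup>-\<^sup>1) = \<integral> f(a z) g(b z) dz\<close>, an average of product kernels.\<close>
lemma mart_fun_bound:
  "\<exists>C\<ge>0. \<forall>d n u. (\<forall>j. d j \<in> carrier G) \<longrightarrow> u \<in> A \<longrightarrow> cmod (mart_fun d n 1 0 u) \<le> C * N u"
proof -
  obtain C where C: "0 \<le> C" "\<forall>n F G. cmod (mart_form n 1 (\<lambda>w w'. F w * G w'))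
      \<le> C * (word_avg n (\<lambda>w. cmod (F w) powr p) + word_avg n (\<lambda>w. cmod (G w) powr q))"
    using mart_form_bound[OF p1 q1 pq] by (elim exE conjE)
  \<comment> \<open>The 2 comes from the two averages in \<open>mart_form_bound\<close>: after
    integration over z each is at most 1, because translation preserves the norms of the atom.
    Neither depth nor digits enter.\<close>
  have atm: "cmod (mart_fun d n 1 0 (conv g f)) \<le> 2 * C" if d: "\<And>j. d j \<in> carrier G" and a: "atom f g" for d n f g
  proof -
    define x where "x w = word_pt d 0 w" for w
    have x: "x w \<in> carrier G" for w unfolding x_def by (rule word_pt_closed[OF d])
    have l: "lp_fun M p f" "lp_fun M q g" and n: "lp_norm M p f \<le> 1" "lp_norm M q g \<le> 1" using a by (auto simp: atom_def)
    define k where "k z w w' = f (x w \<otimes> z) * g (x w' \<otimes> z)" for z w w'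
    have ki: "integrable M (\<lambda>z. k z w w')" for w w'
      unfolding k_def by (rule conv_two_points(2)[OF x x l])
    note mi = mart_form_integral[of M k n 1, OF ki]
    have eq: "mart_fun d n 1 0 (conv g f) = (\<integral>z. mart_form n 1 (k z) \<partial>M)"
      unfolding mart_fun_def x_def[symmetric] conv_two_points(1)[OF x x l] using mi by (simp add: k_def)
    have fi: "integrable M (\<lambda>z. cmod (f (x w \<otimes> z)) powr p)" "(\<integral>z. cmod (f (x w \<otimes> z)) powr p \<partial>M) \<le> 1" for w
    proof -
      note t = lp_transl[OF x[of w] l(1)]
      show "integrable M (\<lambda>z. cmod (f (x w \<otimes> z)) powr p)" using lp_funD(2)[OF t(1)] .
      show "(\<integral>z. cmod (f (x w \<otimes> z)) powr p \<partial>M) \<le> 1" using lp_norm_leD[OF t(1), of 1] t(2) n p1 by simp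
    qed
    have gi: "integrable M (\<lambda>z. cmod (g (x w \<otimes> z)) powr q)" "(\<integral>z. cmod (g (x w \<otimes> z)) powr q \<partial>M) \<le> 1" for w
    proof -
      note t = lp_transl[OF x[of w] l(2)]
      show "integrable M (\<lambda>z. cmod (g (x w \<otimes> z)) powr q)" using lp_funD(2)[OF t(1)] .
      show "(\<integral>z. cmod (g (x w \<otimes> z)) powr q \<partial>M) \<le> 1" using lp_norm_leD[OF t(1), of 1] t(2) n q1 by simp
    qed
    have wf: "integrable M (\<lambda>z. word_avg n (\<lambda>w. cmod (f (x w \<otimes> z)) powr p))" "(\<integral>z. word_avg n (\<lambda>w. cmod (f (x w \<otimes> z)) powr p) \<partial>M) \<le> 1"
      using word_avg_integral[of M "\<lambda>z w. cmod (f (x w \<otimes> z)) powr p" n, OF fi(1)] word_avg_mono[of "\<lambda>w. \<integral>z. cmod (f (x w \<otimes> z)) powr p \<partial>M" "\<lambda>_. 1" n, OF fi(2)]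
      by (auto simp: word_avg_const)
    have wg: "integrable M (\<lambda>z. word_avg n (\<lambda>w. cmod (g (x w \<otimes> z)) powr q))" "(\<integral>z. word_avg n (\<lambda>w. cmod (g (x w \<otimes> z)) powr q) \<partial>M) \<le> 1"
      using word_avg_integral[of M "\<lambda>z w. cmod (g (x w \<otimes> z)) powr q" n, OF gi(1)] word_avg_mono[of "\<lambda>w. \<integral>z. cmod (g (x w \<otimes> z)) powr q \<partial>M" "\<lambda>_. 1" n, OF gi(2)]
      by (auto simp: word_avg_const)
    have "cmod (\<integral>z. mart_form n 1 (k z) \<partial>M) \<le> (\<integral>z. C * (word_avg n (\<lambda>w. cmod (f (x w \<otimes> z)) powr p) + word_avg n (\<lambda>w. cmod (g (x w \<otimes> z)) powr q)) \<partial>M)"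
    proof (rule norm_integral_le)
      show "integrable M (\<lambda>z. mart_form n 1 (k z))" using mi by simp
      show "integrable M (\<lambda>z. C * (word_avg n (\<lambda>w. cmod (f (x w \<otimes> z)) powr p) + word_avg n (\<lambda>w. cmod (g (x w \<otimes> z)) powr q)))"
        using wf wg by simp
      show "cmod (mart_form n 1 (k z)) \<le> C * (word_avg n (\<lambda>w. cmod (f (x w \<otimes> z)) powr p) + word_avg n (\<lambda>w. cmod (g (x w \<otimes> z)) powr q))" for z
        unfolding k_def by (rule C(2)[rule_format, where n=n and F="\<lambda>w. f (x w \<otimes> z)" and G="\<lambda>w. g (x w \<otimes> z)"])
    qed
    also have "\<dots> = C * ((\<integral>z. word_avg n (\<lambda>w. cmod (f (x w \<otimes> z)) powr p) \<partial>M) + (\<integral>z. word_avg n (\<lambda>w. cmod (g (x w \<otimes> z)) powr q) \<partial>M))"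
      using wf wg by simp
    also have "\<dots> \<le> C * (1 + 1)" using wf wg C by (intro mult_left_mono add_mono) auto
    finally show ?thesis unfolding eq by simp
  qed
  have "cmod (mart_fun d n 1 0 u) \<le> 2 * C * N u" if d: "\<forall>j. d j \<in> carrier G" and u: "u \<in> A" for d n u
  proof (rule field_le_epsilon)
    fix e :: real assume e: "0 < e"
    define e' where "e' = e / (2 * C + 1)"
    have e': "0 < e'" "2 * C * e' \<le> e" using e C(1) by (auto simp: e'_def field_simps)
    obtain c f g where c: "\<forall>i. 0 \<le> c i \<and> atom (f i) (g i)" "summable c" "suminf c \<le> N u + e'"
      and s: "\<forall>x\<in>carrier G. (\<lambda>i. complex_of_real (c i) * conv (g i) (f i) x) sums u x"
      by (rule herz_atomicE[OF u e'(1)])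
    have pc: "word_pt d 0 w' \<otimes> inv (word_pt d 0 w) \<in> carrier G" for w w'
      using word_pt_closed d by simp
    have "(\<lambda>i. mart_fun d n 1 0 (\<lambda>x. complex_of_real (c i) * conv (g i) (f i) x)) sums mart_fun d n 1 0 u"
      unfolding mart_fun_def using s pc by (intro mart_form_sums) blast
    moreover have "mart_fun d n 1 0 (\<lambda>x. complex_of_real (c i) * conv (g i) (f i) x) = complex_of_real (c i) * mart_fun d n 1 0 (conv (g i) (f i))" for i
    proof -
      have "mart_form m t (\<lambda>w w'. b * k w w') = b * mart_form m t k" for m t b and k :: "bool list \<Rightarrow> bool list \<Rightarrow> complex"
        by (induction m arbitrary: t k) (simp_all add: word_avg_cmult algebra_simps del: word_avg.simps)
      then show ?thesis by (simp add: mart_fun_def)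
    qed
    ultimately have su: "(\<lambda>i. complex_of_real (c i) * mart_fun d n 1 0 (conv (g i) (f i))) sums mart_fun d n 1 0 u" by simp
    have "cmod (mart_fun d n 1 0 u) = cmod (\<Sum>i. complex_of_real (c i) * mart_fun d n 1 0 (conv (g i) (f i)))"
      using sums_unique[OF su] by simp
    also have "\<dots> \<le> (\<Sum>i. 2 * C * c i)"
    proof (rule norm_suminf_le)
      show "cmod (complex_of_real (c i) * mart_fun d n 1 0 (conv (g i) (f i))) \<le> 2 * C * c i" for i
        using mult_left_mono[OF atm[of d "f i" "g i" n], of "c i"] c(1) d by (simp add: norm_mult mult.commute)
    qed (intro summable_mult c)
    also have "\<dots> = 2 * C * suminf c" by (rule suminf_mult[OF c(2)])
    also have "\<dots> \<le> 2 * C * (N u + e')" using c(3) C(1) by (intro mult_left_mono) auto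
    finally show "cmod (mart_fun d n 1 0 u) \<le> 2 * C * N u + e" using e'(2) by (simp add: algebra_simps)
  qed
  then show ?thesis using C(1) by (intro exI[of _ "2 * C"]) auto
qed

text \<open>Finitely many translates of a nonempty open set cover any given compact set. If the open
  set were null, all compact sets would be null, and by inner regularity so would be the whole
  group.\<close>

lemma open_measure_pos:
  assumes U: "openin T U" "U \<noteq> {}" shows "0 < emeasure M U"
proof (rule ccontr)
  assume "\<not> 0 < emeasure M U"
  then have z: "emeasure M U = 0" by simp
  obtain a where a: "a \<in> U" using U by blast
  have ac: "a \<in> carrier G" using a openin_subset[OF U(1)] topspace_T by auto
  define B where "B x = (\<lambda>y. (x \<otimes> inv a) \<otimes> y) ` U" for x
  have B: "openin T (B x)" "x \<in> B x" "emeasure M (B x) = 0" if "x \<in> carrier G" for x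
  proof -
    show "openin T (B x)" unfolding B_def using that ac by (intro open_left_transl U) simp
    show "x \<in> B x" unfolding B_def using that ac a by (intro image_eqI[of _ _ a]) (auto simp: m_assoc)
    show "emeasure M (B x) = 0" unfolding B_def using left_transl[OF _ open_sets[OF U(1)]] that ac z by simp
  qed
  have "emeasure M K = 0" if K: "compactin T K" for K
  proof -
    have Kc: "K \<subseteq> carrier G" using compactin_subset_topspace[OF K] topspace_T by simp
    have "\<forall>V\<in>B ` K. openin T V" "K \<subseteq> \<Union>(B ` K)" using B Kc by blast+
    then obtain \<F> where \<F>: "finite \<F>" "\<F> \<subseteq> B ` K" "K \<subseteq> \<Union>\<F>"
      using K unfolding compactin_def by meson
    have "X \<in> null_sets M" if X: "X \<in> \<F>" for X
    proof -
      obtain y where y: "y \<in> K" "X = B y" using X \<F>(2) by blast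
      have yc: "y \<in> carrier G" using y Kc by blast
      show ?thesis unfolding y(2) by (intro null_setsI B(3)[OF yc] open_sets B(1)[OF yc])
    qed
    then have "\<Union>\<F> \<in> null_sets M"
      using \<F>(1) by (intro null_sets.finite_Union subsetI)
    then show ?thesis using null_sets_subset[OF _ compact_sets[OF K] \<F>(3)] by blast
  qed
  then have "emeasure M (topspace T) = 0"
    using inner_regular[OF openin_topspace] by (auto simp: SUP_eq_const intro!: antisym SUP_least)
  then show False using measure_carrier topspace_T by simp
qed

lemma nbhd_continuous:
  assumes h: "continuous_map (prod_topology T T) T h" "h (\<one>, \<one>) = \<one>" and U: "openin T U" "\<one> \<in> U"
  shows "\<exists>V. openin T V \<and> \<one> \<in> V \<and> (\<forall>a\<in>V. \<forall>b\<in>V. h (a, b) \<in> U)"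
proof -
  define W where "W = {z \<in> topspace (prod_topology T T). h z \<in> U}"
  have "openin (prod_topology T T) W" unfolding W_def by (rule openin_continuous_map_preimage[OF h(1) U(1)])
  moreover have "(\<one>, \<one>) \<in> W" using h U by (simp add: W_def topspace_T)
  ultimately obtain V1 V2 where V: "openin T V1" "openin T V2" "\<one> \<in> V1" "\<one> \<in> V2" "V1 \<times> V2 \<subseteq> W"
    unfolding openin_prod_topology_alt by meson
  then show ?thesis by (intro exI[of _ "V1 \<inter> V2"]) (auto simp: W_def)
qed

lemma nbhd_mult:
  assumes "openin T U" "\<one> \<in> U"
  shows "\<exists>V. openin T V \<and> \<one> \<in> V \<and> (\<forall>a\<in>V. \<forall>b\<in>V. a \<otimes> b \<in> U)"
  using nbhd_continuous[OF cont_mult _ assms] by simp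

lemma nbhd_mult_inv:
  assumes "openin T U" "\<one> \<in> U"
  shows "\<exists>V. openin T V \<and> \<one> \<in> V \<and> (\<forall>a\<in>V. \<forall>b\<in>V. a \<otimes> inv b \<in> U)"
proof -
  have "continuous_map (prod_topology T T) (prod_topology T T) (\<lambda>z. (fst z, inv (snd z)))"
    using continuous_map_compose[OF continuous_map_snd cont_inv]
    by (intro continuous_map_pairedI continuous_map_fst) (simp add: comp_def)
  from nbhd_continuous[OF continuous_map_compose[OF this cont_mult] _ assms] show ?thesis by simp
qed

lemma nbhd_inv_mult:
  assumes "openin T U" "\<one> \<in> U"
  shows "\<exists>V. openin T V \<and> \<one> \<in> V \<and> (\<forall>a\<in>V. \<forall>b\<in>V. inv a \<otimes> b \<in> U)"
proof -
  have "continuous_map (prod_topology T T) (prod_topology T T) (\<lambda>z. (inv (fst z), snd z))"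
    using continuous_map_compose[OF continuous_map_fst cont_inv]
    by (intro continuous_map_pairedI continuous_map_snd) (simp add: comp_def)
  from nbhd_continuous[OF continuous_map_compose[OF this cont_mult] _ assms] show ?thesis by simp
qed

lemma lp_indicator:
  assumes B: "B \<in> sets M" "emeasure M B < \<infinity>" and r: "0 < r"
  shows "lp_fun M r (indicator B)" "lp_norm M r (indicator B) = measure M B powr (1 / r)"
proof -
  have ip: "cmod (indicator B x) powr r = indicator B x" for x by (simp add: indicator_def)
  show l: "lp_fun M r (indicator B)"
    unfolding lp_fun_iff ip using B by (auto intro: integrable_real_indicator)
  show "lp_norm M r (indicator B) = measure M B powr (1 / r)"
    unfolding lp_norm_eq[OF l] ip using B sets.sets_into_space[OF B(1)] by (simp add: Int_absorb2)
qed

text \<open>The function is x |-> measure (E \<inter> x W) / m with E = V W and m the measure of W.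
  For x in V the set x W lies in E, giving the value 1; a nonempty intersection forces x into V W
  W^-1, hence into U. As E has measure at most 2 m, the norm is at most 2^(1/q). What matters is a
  bound that does not depend on U.\<close>

lemma bump:
  assumes U: "openin T U" "\<one> \<in> U"
  shows "\<exists>u V. u \<in> A \<and> N u \<le> 2 \<and> openin T V \<and> \<one> \<in> V \<and> (\<forall>x\<in>V. u x = 1) \<and> (\<forall>x. x \<notin> U \<longrightarrow> u x = 0)"
proof -
  obtain U1 where U1: "openin T U1" "\<one> \<in> U1" "\<forall>a\<in>U1. \<forall>b\<in>U1. a \<otimes> inv b \<in> U" using nbhd_mult_inv[OF U] by blast
  obtain U2 where U2: "openin T U2" "\<one> \<in> U2" "\<forall>a\<in>U2. \<forall>b\<in>U2. a \<otimes> b \<in> U1" using nbhd_mult[OF U1(1,2)] by blast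
  have U2c: "U2 \<subseteq> carrier G" using openin_subset[OF U2(1)] topspace_T by simp
  have "0 < emeasure M U2" using open_measure_pos U2 by blast
  then obtain W where W: "compactin T W" "W \<subseteq> U2" "0 < emeasure M W"
    unfolding inner_regular[OF U2(1)] less_SUP_iff by blast
  have Ws: "W \<in> sets M" "emeasure M W < \<infinity>" using compact_sets compact_finite W by auto
  have Wc: "W \<subseteq> carrier G" using W U2c by blast
  define m where "m = measure M W"
  have em: "emeasure M W = ennreal m" unfolding m_def using Ws by (intro emeasure_eq_ennreal_measure) auto
  then have m0: "0 < m" using W(3) by simp
  have Wfin: "emeasure M W \<noteq> \<infinity>" using Ws by simp
  \<comment> \<open>An open set around the compact \<open>W\<close> of at most twice its measure;
    the tube lemma then finds \<open>V\<close> with V W inside it.\<close>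
  obtain Q where Q: "openin T Q" "W \<subseteq> Q" "emeasure M Q < emeasure M W + ennreal m"
    using INF_approx_ennreal[OF m0 outer_regular[OF Ws(1)] Wfin] by blast
  define P where "P = {z \<in> topspace (prod_topology T T). (\<lambda>(x, y). x \<otimes> y) z \<in> Q}"
  have "openin (prod_topology T T) P" unfolding P_def by (rule openin_continuous_map_preimage[OF cont_mult Q(1)])
  moreover have "{\<one>} \<times> W \<subseteq> P"
  proof
    fix z assume "z \<in> {\<one>} \<times> W"
    then obtain b where b: "z = (\<one>, b)" "b \<in> W" by blast
    have "b \<in> carrier G" using b(2) Wc by blast
    then show "z \<in> P" using b(2) Q(2) by (auto simp: P_def topspace_T b(1))
  qed
  moreover have "compactin T {\<one>}" by (simp add: topspace_T)
  ultimately obtain V0 V1 where V0: "openin T V0" "openin T V1" "{\<one>} \<subseteq> V0" "W \<subseteq> V1" "V0 \<times> V1 \<subseteq> P"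
    using Wallace_theorem_prod_topology[OF _ W(1)] by metis
  define V where "V = V0 \<inter> U2"
  have V: "openin T V" "\<one> \<in> V" using V0 U2 by (auto simp: V_def)
  have Vc: "V \<subseteq> carrier G" using U2c by (auto simp: V_def)
  define E where "E = (\<Union>w\<in>W. (\<lambda>v. v \<otimes> w) ` V)"
  have "openin T E" unfolding E_def using Wc by (intro openin_Union) (auto intro: open_right_transl V)
  then have Es: "E \<in> sets M" by (rule open_sets)
  have "E \<subseteq> Q"
  proof
    fix z assume "z \<in> E"
    then obtain a b where b: "z = a \<otimes> b" "a \<in> V0" "b \<in> W" by (auto simp: E_def V_def)
    have "(a, b) \<in> P" using b(2,3) V0(4,5) by blast
    then show "z \<in> Q" by (simp add: P_def b(1))
  qed
  then have "emeasure M E \<le> emeasure M Q" using open_sets[OF Q(1)] by (rule emeasure_mono)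
  also have "\<dots> \<le> ennreal (2 * m)" using Q(3) m0 by (simp add: em less_imp_le flip: ennreal_plus)
  finally have E: "emeasure M E \<le> ennreal (2 * m)" .
  have Efin: "emeasure M E < \<infinity>" using order_le_less_trans[OF E ennreal_less_top] by simp
  have mE: "measure M E \<le> 2 * m" using E m0 by (simp add: measure_def enn2real_leI)
  have p0: "0 < p" "0 < q" using p1 q1 by auto
  note lW = lp_indicator[OF Ws p0(1)] and lE = lp_indicator[OF Es Efin p0(2)]
  define v where "v x = (if x \<in> carrier G then conv (indicator E) (indicator W) x else 0)" for x
  have v: "v \<in> A" "N v \<le> measure M E powr (1 / q) * m powr (1 / p)"
    using herz_conv[OF lW(1) lE(1)] lW(2) lE(2) by (auto simp: v_def[abs_def] m_def)
  have "measure M E powr (1 / q) * m powr (1 / p) \<le> (2 * m) powr (1 / q) * m powr (1 / p)"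
    using mE p0 by (intro mult_right_mono powr_mono2) auto
  also have "\<dots> = 2 powr (1 / q) * (m powr (1 / p + 1 / q))" by (simp add: powr_mult powr_add)
  also have "\<dots> = 2 powr (1 / q) * m" using m0 by (simp add: pq)
  also have "\<dots> \<le> 2 powr 1 * m" using m0 q1 by (intro mult_right_mono powr_mono) auto
  finally have Nv: "N v \<le> 2 * m" using v(2) by simp
  have cv: "conv (indicator E) (indicator W) x = complex_of_real (measure M (E \<inter> (\<lambda>y. x \<otimes> y) ` W))" if x: "x \<in> carrier G" for x
  proof -
    have sW: "(\<lambda>y. x \<otimes> y) ` W \<in> sets M" by (rule left_transl_sets[OF x Ws(1)])
    have "indicator E y * indicator W (inv x \<otimes> y) = complex_of_real (indicator (E \<inter> (\<lambda>y. x \<otimes> y) ` W) y)" if y: "y \<in> carrier G" for y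
    proof -
      have "y \<in> (\<lambda>y. x \<otimes> y) ` W \<longleftrightarrow> inv x \<otimes> y \<in> W"
        using left_mult_vimage[of "inv x" W] x y Wc by auto
      then show ?thesis by (simp add: indicator_def)
    qed
    then have "conv (indicator E) (indicator W) x = (\<integral>y. complex_of_real (indicator (E \<inter> (\<lambda>y. x \<otimes> y) ` W) y) \<partial>M)"
      unfolding conv_check_def by (intro Bochner_Integration.integral_cong) (auto simp: space_M)
    also have "\<dots> = complex_of_real (\<integral>y. indicator (E \<inter> (\<lambda>y. x \<otimes> y) ` W) y \<partial>M)" by simp
    also have "(\<integral>y. indicator (E \<inter> (\<lambda>y. x \<otimes> y) ` W) y \<partial>M) = measure M (E \<inter> (\<lambda>y. x \<otimes> y) ` W)"
      using sets.sets_into_space[OF Es] by (simp add: Int_absorb2 le_infI1)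
    finally show ?thesis .
  qed
  have one: "v x = complex_of_real m" if x: "x \<in> V" for x
  proof -
    have xc: "x \<in> carrier G" using x Vc by blast
    have "(\<lambda>y. x \<otimes> y) ` W \<subseteq> E" using x by (auto simp: E_def)
    then have "E \<inter> (\<lambda>y. x \<otimes> y) ` W = (\<lambda>y. x \<otimes> y) ` W" by blast
    then show ?thesis using cv[OF xc] xc left_transl[OF xc Ws(1)] by (simp add: v_def m_def measure_def)
  qed
  have zero: "v x = 0" if x: "x \<notin> U" for x
  proof (cases "x \<in> carrier G")
    case True
    have "E \<inter> (\<lambda>y. x \<otimes> y) ` W = {}"
    proof (rule ccontr)
      assume "E \<inter> (\<lambda>y. x \<otimes> y) ` W \<noteq> {}"
      then obtain y where y: "y \<in> E" "y \<in> (\<lambda>y. x \<otimes> y) ` W" by blast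
      obtain w' where w': "w' \<in> W" "y = x \<otimes> w'" using y(2) by (rule imageE)
      obtain a w where aw: "a \<in> V" "w \<in> W" "y = a \<otimes> w" using y(1) unfolding E_def by blast
      have a: "a \<in> V" "w \<in> W" "w' \<in> W" "a \<otimes> w = x \<otimes> w'" using aw w' by simp_all
      have c: "a \<in> carrier G" "w \<in> carrier G" "w' \<in> carrier G" using a Vc Wc by auto
      have "a \<in> U2" "w \<in> U2" using a(1,2) W(2) by (auto simp: V_def)
      then have "a \<otimes> w \<in> U1" using U2(3) by blast
      moreover have "w' \<in> U1" using U2(2,3) a W(2) c by (metis l_one subsetD)
      ultimately have "(a \<otimes> w) \<otimes> inv w' \<in> U" using U1(3) by blast
      moreover have "(a \<otimes> w) \<otimes> inv w' = x" unfolding a(4) using True c by (simp add: m_assoc)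
      ultimately show False using x by simp
    qed
    then show ?thesis using cv[OF True] True by (simp add: v_def)
  qed (simp add: v_def)
  define u where "u x = complex_of_real (1 / m) * v x" for x
  have "u \<in> A" unfolding u_def[abs_def] by (rule herz_scale(1)[OF v(1)])
  moreover have "N u \<le> 2"
  proof -
    have "N u \<le> cmod (complex_of_real (1 / m)) * N v" unfolding u_def[abs_def] by (rule herz_scale(2)[OF v(1)])
    also have "\<dots> = N v / m" using m0 by (simp add: norm_divide)
    also have "\<dots> \<le> 2" using Nv m0 by (simp add: pos_divide_le_eq)
    finally show ?thesis .
  qed
  ultimately show ?thesis
    using V one zero m0 by (intro exI[of _ u] exI[of _ V]) (auto simp: u_def)
qed

end

section \<open>Martingale forms of branching kernels\<close>

lemma mart_form_add: "mart_form n s (\<lambda>w w'. k w w' + k' w w') = mart_form n s k + mart_form n s k'"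
proof (induction n arbitrary: s k k')
  case (Suc n) show ?case by (simp only: mart_form.simps Suc.IH word_avg_add) (simp add: algebra_simps)
qed simp

lemma mart_form_cmult: "mart_form n s (\<lambda>w w'. b * k w w') = b * mart_form n s k"
proof (induction n arbitrary: s k)
  case (Suc n) show ?case by (simp only: mart_form.simps Suc.IH word_avg_cmult) (simp add: algebra_simps)
qed simp

context
  fixes K :: "nat \<Rightarrow> bool list \<Rightarrow> bool list \<Rightarrow> complex" and n :: nat
  assumes branch: "\<And>j a b w w'. j \<le> n \<Longrightarrow> K j (a # w) (b # w') = (if a = b then K (Suc j) w w' else 0)"
    and const: "\<And>j w w'. n < j \<Longrightarrow> K j w w' = 1"
begin

text \<open>The kernels \<open>K j\<close> model a bump function evaluated along words of digits \<open>j, j + 1, \<dots>\<close>: words that differ in one of the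
  digits \<open>j, \<dots>, n\<close> are separated by it, and later digits are invisible.\<close>
lemma branching_avg:
  "j + i = Suc n \<Longrightarrow> i \<le> l \<Longrightarrow> word_avg l (\<lambda>w. word_avg l (K j w)) = 1 / 2 ^ i"
proof (induction i arbitrary: j l)
  case 0
  then have "K j w w' = 1" for w w' by (intro const) simp
  then have "K j = (\<lambda>_ _. 1)" by (intro ext)
  then show ?case by (simp add: word_avg_const)
next
  case (Suc i)
  then obtain l' where l: "l = Suc l'" "i \<le> l'" by (cases l) auto
  have j: "j \<le> n" using Suc.prems by simp
  have "word_avg l (K j (a # w)) = (1/2) *\<^sub>R word_avg l' (K (Suc j) w)" for a w
    by (cases a) (simp_all add: l branch[OF j] word_avg_const)
  then have "word_avg l (\<lambda>w. word_avg l (K j w)) = (1/2) *\<^sub>R word_avg l' (\<lambda>w. word_avg l' (K (Suc j) w))"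
    by (subst l(1)) (simp add: word_avg_scaleR)
  also have "word_avg l' (\<lambda>w. word_avg l' (K (Suc j) w)) = 1 / 2 ^ i"
    using Suc.prems l by (intro Suc.IH) simp_all
  finally show ?case by (simp add: scaleR_conv_of_real)
qed

text \<open>A level with i + 1 resolved digits contributes its sign times 1/2^i - 1/2^(i+1), and the
  signs alternate down the tree; the closed form is the alternating geometric sum of (-1)^(i-k) /
  2^k over k = 1, ..., i. Levels beyond the resolved digits see a constant kernel and add 0, so only
  \<open>i \<le> l\<close> is required of the depth.\<close>

lemma branching_mart_form:
  "j + i = Suc n \<Longrightarrow> i \<le> l \<Longrightarrow> mart_form l s (K j) = of_real s * ((1 / 2 ^ i - (- 1) ^ i) / 3)"
proof (induction i arbitrary: j l s)
  case 0
  then have "K j w w' = 1" for w w' by (intro const) simp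
  then have "K j = (\<lambda>_ _. 1)" by (intro ext)
  moreover have "mart_form m t (\<lambda>_ _. 1) = 0" for m t
    by (induction m arbitrary: t) (simp_all add: word_avg_const scaleR_conv_of_real)
  ultimately show ?case by simp
next
  case (Suc i)
  then obtain l' where l: "l = Suc l'" "i \<le> l'" by (cases l) auto
  have j: "j \<le> n" using Suc.prems by simp
  have 1: "word_avg l (\<lambda>w. word_avg l (K j w)) = 1 / 2 ^ Suc i"
    using Suc.prems by (intro branching_avg)
  have 2: "word_avg l' (\<lambda>w. word_avg l' (K (Suc j) w)) = 1 / 2 ^ i"
    using Suc.prems l by (intro branching_avg) simp_all
  have 3: "mart_form l' (- s) (K (Suc j)) = of_real (- s) * ((1 / 2 ^ i - (- 1) ^ i) / 3)"
    using Suc.prems l by (intro Suc.IH) simp_all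
  have "mart_form (Suc l') s (K j) = s *\<^sub>R (1 / 2 ^ i - 1 / 2 ^ Suc i) + of_real (- s) * ((1 / 2 ^ i - (- 1) ^ i) / 3)"
    using 1 unfolding mart_form.simps branch[OF j] l(1) simp_thms if_True 2 3
    by (simp add: scaleR_conv_of_real)
  also have "\<dots> = of_real s * ((1 / 2 ^ Suc i - (- 1) ^ Suc i) / 3)"
    by (simp add: scaleR_conv_of_real field_simps)
  finally show ?case by (simp only: l(1))
qed

end

section \<open>Choice of the digits and failure of the double limit criterion\<close>

context haar_group
begin

lemma discrete_if_open_one:
  assumes "openin T {\<one>}" shows "T = discrete_topology (carrier G)"
proof -
  have "openin T {x}" if x: "x \<in> carrier G" for x
    using open_left_transl[OF assms x] x by simp
  then have "discrete_topology (carrier G) = T" by (simp add: discrete_topology_unique topspace_T)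
  then show ?thesis by simp
qed

text \<open>One stage of the tree. \<open>Y'\<close> is the room left for later digits, and s, t
  stand for products of these. The bump does not see later digits (value 1 at s t^-1) and vanishes
  when \<open>d\<close> occurs in one of the two words only. Being 1 on \<open>Y'\<close> and 0 off
  \<open>Y\<close> yields \<open>u\<^sub>i u\<^sub>j = u\<^sub>j\<close> along the sequence, and s d
  in \<open>Y\<close> keeps longer words inside.\<close>

definition separating_step :: "'a set \<Rightarrow> 'a \<Rightarrow> ('a \<Rightarrow> complex) \<Rightarrow> 'a set \<Rightarrow> bool" where
  "separating_step Y d u Y' \<longleftrightarrow> d \<in> carrier G \<and> u \<in> A \<and> N u \<le> 2 \<and> (\<forall>x. x \<notin> Y \<longrightarrow> u x = 0) \<and>
     (\<forall>s\<in>Y'. s \<in> Y \<and> s \<otimes> d \<in> Y \<and> u s = 1) \<and>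
     (\<forall>s\<in>Y'. \<forall>t\<in>Y'. u (s \<otimes> inv t) = 1 \<and> u (s \<otimes> d \<otimes> inv t) = 0 \<and> u (s \<otimes> inv d \<otimes> inv t) = 0)"

text \<open>Nondiscreteness provides d other than the identity inside any neighbourhood. Then C, the
  complement of {d, d^-1}, is a neighbourhood of the identity, and Z is chosen with s^-1 x t in C
  for all s, x, t in Z. Hence s d t^-1 and s d^-1 t^-1 lie outside Z, where a bump supported in Z
  vanishes.\<close>

lemma separating_step_exists:
  assumes nd: "\<not> openin T {\<one>}" and Y: "openin T Y" "\<one> \<in> Y"
  shows "\<exists>d u Y'. openin T Y' \<and> \<one> \<in> Y' \<and> separating_step Y d u Y'"
proof -
  have car: "X \<subseteq> carrier G" if "openin T X" for X using openin_subset[OF that] topspace_T by simp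
  obtain W where W: "openin T W" "\<one> \<in> W" "\<forall>a\<in>W. \<forall>b\<in>W. a \<otimes> b \<in> Y" using nbhd_mult[OF Y] by (elim exE conjE)
  have "W \<noteq> {\<one>}" using W(1) nd by auto
  then obtain d where d: "d \<in> W" "d \<noteq> \<one>" using W(2) by blast
  have dc: "d \<in> carrier G" using d car[OF W(1)] by blast
  define C where "C = carrier G - {d, inv d}"
  have "closedin T {d, inv d}"
    using Hausdorff_T dc by (intro closedin_Hausdorff_finite) (auto simp: topspace_T)
  then have C: "openin T C" unfolding C_def using topspace_T by (metis closedin_def)
  have C1: "\<one> \<in> C" using d(2) dc by (auto simp: C_def) (metis inv_inv inv_one)
  obtain Z2 where Z2: "openin T Z2" "\<one> \<in> Z2" "\<forall>a\<in>Z2. \<forall>b\<in>Z2. a \<otimes> b \<in> C"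
    using nbhd_mult[OF C C1] by (elim exE conjE)
  obtain Z1 where Z1: "openin T Z1" "\<one> \<in> Z1" "\<forall>a\<in>Z1. \<forall>b\<in>Z1. inv a \<otimes> b \<in> Z2" using nbhd_inv_mult[OF Z2(1,2)] by (elim exE conjE)
  define Z where "Z = Z1 \<inter> Z2"
  have Z: "openin T Z" "\<one> \<in> Z" using Z1 Z2 by (auto simp: Z_def)
  have Zc: "inv s \<otimes> x \<otimes> t \<in> C" if "s \<in> Z" "x \<in> Z" "t \<in> Z" for s x t
    using Z1(3) Z2(3) that by (auto simp: Z_def)
  define U where "U = Z \<inter> Y"
  have U: "openin T U" "\<one> \<in> U" using Z Y by (auto simp: U_def)
  obtain u V where u: "u \<in> A" "N u \<le> 2" "openin T V" "\<one> \<in> V" "\<forall>x\<in>V. u x = 1" "\<forall>x. x \<notin> U \<longrightarrow> u x = 0"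
    using bump[OF U] by (elim exE conjE)
  have VU: "V \<subseteq> U" using u(5,6) by force
  obtain Y1 where Y1: "openin T Y1" "\<one> \<in> Y1" "\<forall>a\<in>Y1. \<forall>b\<in>Y1. a \<otimes> inv b \<in> V" using nbhd_mult_inv[OF u(3,4)] by (elim exE conjE)
  define Y' where "Y' = Y1 \<inter> Z \<inter> W \<inter> V"
  have Y': "openin T Y'" "\<one> \<in> Y'" using Y1 Z W u by (auto simp: Y'_def)
  have off: "u (s \<otimes> e \<otimes> inv t) = 0" if s: "s \<in> Y'" "t \<in> Y'" and e: "e \<in> {d, inv d}" for s t e
  proof -
    have c: "s \<in> carrier G" "t \<in> carrier G" "e \<in> carrier G" using s e dc car[OF Y'(1)] by auto
    have "s \<otimes> e \<otimes> inv t \<notin> Z"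
    proof
      assume "s \<otimes> e \<otimes> inv t \<in> Z"
      then have "inv s \<otimes> (s \<otimes> e \<otimes> inv t) \<otimes> t \<in> C" using s Zc by (auto simp: Y'_def)
      moreover have "inv s \<otimes> (s \<otimes> e \<otimes> inv t) \<otimes> t = e"
        using c by (simp add: m_assoc) (simp add: c flip: m_assoc)
      ultimately show False using e by (simp add: C_def)
    qed
    then show ?thesis using u(6) by (simp add: U_def)
  qed
  have "separating_step Y d u Y'"
    unfolding separating_step_def
  proof (intro conjI ballI allI impI)
    show "d \<in> carrier G" "u \<in> A" "N u \<le> 2" by fact+
    show "u x = 0" if "x \<notin> Y" for x using u(6) that by (simp add: U_def)
    show "s \<in> Y" if "s \<in> Y'" for s using that VU by (auto simp: Y'_def U_def)
    show "s \<otimes> d \<in> Y" if "s \<in> Y'" for s using that W(3) d(1) by (auto simp: Y'_def)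
    show "u s = 1" if "s \<in> Y'" for s using that u(5) by (auto simp: Y'_def)
    show "u (s \<otimes> inv t) = 1" if "s \<in> Y'" "t \<in> Y'" for s t using that u(5) Y1(3) by (auto simp: Y'_def)
    show "u (s \<otimes> d \<otimes> inv t) = 0" "u (s \<otimes> inv d \<otimes> inv t) = 0" if "s \<in> Y'" "t \<in> Y'" for s t
      using off[OF that] by auto
  qed
  then show ?thesis using Y' by blast
qed

lemma separating_sequence:
  assumes nd: "\<not> openin T {\<one>}"
  shows "\<exists>Y d u. \<forall>n. openin T (Y n) \<and> \<one> \<in> Y n \<and> separating_step (Y n) (d n) (u n) (Y (Suc n))"
proof -
  define P where "P z \<longleftrightarrow> openin T (fst z) \<and> \<one> \<in> fst z" for z :: "'a set \<times> 'a \<times> ('a \<Rightarrow> complex)"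
  define Q where "Q z z' \<longleftrightarrow> separating_step (fst z) (fst (snd z')) (snd (snd z')) (fst z')"
    for z z' :: "'a set \<times> 'a \<times> ('a \<Rightarrow> complex)"
  have "\<exists>f. \<forall>n. P (f n) \<and> Q (f n) (f (Suc n))"
  proof (rule dependent_nat_choice[of "\<lambda>_. P" "\<lambda>_. Q"])
    \<comment> \<open>The digit and the bump in a state belong to the preceding step, so those of
      the initial state are arbitrary; this also explains the shifted index when they are read
      off.\<close>
    show "\<exists>z. P z" by (rule exI[of _ "(carrier G, undefined)"]) (use openin_topspace[of T] in \<open>auto simp: P_def topspace_T\<close>)
    show "\<exists>z'. P z' \<and> Q z z'" if "P z" for z n
    proof -
      have z: "openin T (fst z)" "\<one> \<in> fst z" using that by (simp_all add: P_def)
      obtain d u Y' where "openin T Y'" "\<one> \<in> Y'" "separating_step (fst z) d u Y'"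
        using separating_step_exists[OF nd z] by (elim exE conjE)
      then show ?thesis by (intro exI[of _ "(Y', d, u)"]) (simp add: P_def Q_def)
    qed
  qed
  then obtain f where f: "\<forall>n. P (f n) \<and> Q (f n) (f (Suc n))" by (elim exE)
  have "openin T (fst (f n)) \<and> \<one> \<in> fst (f n) \<and>
      separating_step (fst (f n)) (fst (snd (f (Suc n)))) (snd (snd (f (Suc n)))) (fst (f (Suc n)))" for n
    using f[rule_format, of n] unfolding P_def Q_def by blast
  then show ?thesis by (intro exI allI)
qed

text \<open>The kernel of \<open>u n\<close> is a branching kernel: it resolves exactly the digits
  0, ..., n. With n + 1 resolved digits the closed form has exponent n + 1, and the minus sign turns
  (-1)^(n+1) into (-1)^n.\<close>

lemma mart_fun_separating:
  assumes Y: "\<And>n. \<one> \<in> Y n" "\<And>n. openin T (Y n)" and st: "\<And>n. separating_step (Y n) (d n) (u n) (Y (Suc n))"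
    and l: "n < l"
  shows "mart_fun d l 1 0 (u n) = (1 / 2 ^ Suc n + (- 1) ^ n) / 3"
proof -
  have Yc: "s \<in> carrier G" if "s \<in> Y j" for s j using openin_subset[OF Y(2)[of j]] that by (auto simp: topspace_T)
  have dc: "d j \<in> carrier G" for j using st[of j] by (simp add: separating_step_def)
  have "Y (Suc j) \<subseteq> Y j" for j using st[of j] unfolding separating_step_def by blast
  then have dec: "Y m \<subseteq> Y j" if "j \<le> m" for j m
    using that by (rule lift_Suc_antimono_le)
  have pt: "word_pt d j w \<in> Y j" for j w
  proof (induction w arbitrary: j)
    case (Cons a w) then show ?case using Cons[of "Suc j"] st[of j] Yc[of _ "Suc j"] by (auto simp: separating_step_def)
  qed (simp add: Y)
  define K where "K j w w' = u n (word_pt d j w' \<otimes> inv (word_pt d j w))" for j w w'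
  have "mart_form l 1 (K 0) = of_real 1 * ((1 / 2 ^ Suc n - (- 1) ^ Suc n) / 3)"
  proof (rule branching_mart_form[where n=n])
    show "K j w w' = 1" if "n < j" for j w w'
    proof -
      have "word_pt d j w \<in> Y (Suc n)" for w using pt dec[of "Suc n" j] that by auto
      then show ?thesis unfolding K_def using st[of n] by (simp add: separating_step_def)
    qed
    show "K j (a # w) (b # w') = (if a = b then K (Suc j) w w' else 0)" if j: "j \<le> n" for j a b w w'
    proof -
      define s t where "s = word_pt d (Suc j) w'" and "t = word_pt d (Suc j) w"
      have c: "s \<in> Y (Suc j)" "t \<in> Y (Suc j)" by (simp_all add: s_def t_def pt)
      have c': "s \<in> carrier G" "t \<in> carrier G" "d j \<in> carrier G" using c Yc dc by blast+
      \<comment> \<open>Separation at digit j is known for the bump \<open>u j\<close> and has to be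
        passed to \<open>u n\<close>: off \<open>Y (Suc j)\<close>, where every point not seen by
        \<open>u j\<close> lies, all later bumps vanish.\<close>
      have z: "u n x = 0" if x: "u j x = 0" for x
      proof (cases "j = n")
        case False
        have "x \<notin> Y (Suc j)" using x st[of j] by (auto simp: separating_step_def)
        then have "x \<notin> Y n" using dec[of "Suc j" n] False j by auto
        then show ?thesis using st[of n] by (simp add: separating_step_def)
      qed (use x in simp)
      have z1: "u j (s \<otimes> d j \<otimes> inv t) = 0" and z2: "u j (s \<otimes> inv d j \<otimes> inv t) = 0"
        using st[of j] c by (auto simp: separating_step_def)
      have e1: "s \<otimes> d j \<otimes> inv (t \<otimes> d j) = s \<otimes> inv t"
        using c' by (simp add: inv_mult_group m_assoc) (simp add: c' flip: m_assoc)
      have e2: "s \<otimes> inv (t \<otimes> d j) = s \<otimes> inv d j \<otimes> inv t"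
        using c' by (simp add: inv_mult_group m_assoc)
      show ?thesis
        using z[OF z1] z[OF z2] c' by (cases a; cases b) (simp_all add: K_def e1 e2 flip: s_def t_def)
    qed
  qed (use l in auto)
  then show ?thesis by (simp add: mart_fun_def K_def[abs_def])
qed

text \<open>The bound on \<open>mart_fun\<close> is uniform in the depth, so a generalized limit
  over depths is again bounded. On elements whose values stabilize it returns the stable value
  exactly.\<close>

lemma mart_limit_dual:
  assumes d: "\<And>j. d j \<in> carrier G"
  shows "\<exists>S\<in>D. \<forall>u\<in>A. \<forall>c. eventually (\<lambda>n. mart_fun d n 1 0 u = c) sequentially \<longrightarrow> S u = c"
proof -
  obtain L :: "(nat \<Rightarrow> complex) \<Rightarrow> complex" where
    L: "\<And>s t. bounded (range s) \<Longrightarrow> bounded (range t) \<Longrightarrow> L (\<lambda>n. s n + t n) = L s + L t"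
      "\<And>c s. bounded (range s) \<Longrightarrow> L (\<lambda>n. c * s n) = c * L s"
      "\<And>s B. (\<And>n. cmod (s n) \<le> B) \<Longrightarrow> cmod (L s) \<le> B"
      "\<And>s l. s \<longlonglongrightarrow> l \<Longrightarrow> L s = l"
    using generalized_limit_exists by blast
  obtain C where C: "0 \<le> C" "\<forall>d n u. (\<forall>j. d j \<in> carrier G) \<longrightarrow> u \<in> A \<longrightarrow> cmod (mart_fun d n 1 0 u) \<le> C * N u"
    using mart_fun_bound by (elim exE conjE)
  have Cb: "cmod (mart_fun d n 1 0 u) \<le> C * N u" if "u \<in> A" for n u
    using C(2)[rule_format, OF d that] .
  then have bd: "bounded (range (\<lambda>n. mart_fun d n 1 0 u))" if "u \<in> A" for u
    using that by (intro boundedI[of _ "C * N u"]) auto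
  define S where "S u = (if u \<in> A then L (\<lambda>n. mart_fun d n 1 0 u) else 0)" for u
  have "S \<in> D"
    unfolding dual_sp_def lin_on_def
  proof (intro CollectI conjI ballI allI impI)
    show "S (\<lambda>x. u x + v x) = S u + S v" if "u \<in> A" "v \<in> A" for u v
      using that add_mem[OF that] bd by (simp add: S_def mart_fun_def mart_form_add flip: L(1))
    show "S (\<lambda>x. c * u x) = c * S u" if "u \<in> A" for u c
      using that scale_mem[OF that] bd by (simp add: S_def mart_fun_def mart_form_cmult flip: L(2))
    show "\<exists>C. \<forall>u\<in>A. cmod (S u) \<le> C * N u"
      by (intro exI[of _ C] ballI) (simp add: S_def L(3)[OF Cb])
    show "S u = 0" if "u \<notin> A" for u using that by (simp add: S_def)
  qed
  moreover have "S u = c" if "u \<in> A" "eventually (\<lambda>n. mart_fun d n 1 0 u = c) sequentially" for u c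
    using that by (simp add: S_def L(4)[OF tendsto_eventually])
  ultimately show ?thesis by (intro bexI[of _ S]) auto
qed

lemma arens_regular_imp_discrete:
  assumes reg: "arens_regular A N" shows "T = discrete_topology (carrier G)"
proof (rule discrete_if_open_one, rule ccontr)
  assume nd: "\<not> openin T {\<one>}"
  obtain Y d u where all: "\<forall>n. openin T (Y n) \<and> \<one> \<in> Y n \<and> separating_step (Y n) (d n) (u n) (Y (Suc n))"
    using separating_sequence[OF nd] by (elim exE)
  then have Y: "\<And>n. \<one> \<in> Y n" "\<And>n. openin T (Y n)" and st: "\<And>n. separating_step (Y n) (d n) (u n) (Y (Suc n))"
    by blast+
  have dc: "d j \<in> carrier G" and uA: "u j \<in> A" and uN: "N (u j) \<le> 2" for j using st[of j] by (simp_all add: separating_step_def)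
  have "Y (Suc j) \<subseteq> Y j" for j using st[of j] unfolding separating_step_def by blast
  then have dec: "Y m \<subseteq> Y j" if "j \<le> m" for j m
    using that by (rule lift_Suc_antimono_le)
  have prod: "u i x * u j x = u j x" if "i < j" for i j x
  proof (cases "x \<in> Y j")
    case True
    then have "x \<in> Y (Suc i)" using dec[of "Suc i" j] that by auto
    then show ?thesis using st[of i] by (simp add: separating_step_def)
  next
    case False
    then show ?thesis using st[of j] by (simp add: separating_step_def)
  qed
  obtain S where S: "S \<in> D" "\<forall>u\<in>A. \<forall>c. eventually (\<lambda>n. mart_fun d n 1 0 u = c) sequentially \<longrightarrow> S u = c"
    using mart_limit_dual[of d, OF dc] by (elim bexE)
  have Su: "S (u n) = (1 / 2 ^ Suc n + (- 1) ^ n) / 3" for n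
    using mart_fun_separating[of Y d u, OF Y st] by (intro S(2)[rule_format] uA eventually_sequentiallyI[of "Suc n"]) auto
  have lim0: "(\<lambda>n. 1 / 2 ^ n :: complex) \<longlonglongrightarrow> 0"
    using LIMSEQ_power_zero[of "1 / 2 :: complex"] by (simp add: power_one_over norm_divide)
  have limc: "(\<lambda>m. 1 / 2 ^ Suc (2 * m + c) :: complex) \<longlonglongrightarrow> 0" for c
    using LIMSEQ_subseq_LIMSEQ[OF lim0, of "\<lambda>m. Suc (2 * m + c)"] by (simp only: comp_def) (simp add: strict_mono_def)
  \<comment> \<open>The product of an even and an odd bump is the one of larger index. Letting the
    odd index run first leaves values tending to -1/3; letting the even index run first leaves
    values tending to 1/3. Both inner limits are independent of the other index.\<close>
  have "double_limits S (\<lambda>n. u (2 * n)) (\<lambda>m. u (2 * m + 1)) (- 1 / 3) (1 / 3)"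
    unfolding double_limits_def
  proof (intro conjI exI allI)
    show "(\<lambda>m. S (\<lambda>t. u (2 * n) t * u (2 * m + 1) t)) \<longlonglongrightarrow> - 1 / 3" for n
    proof (rule Lim_transform_eventually)
      show "(\<lambda>m. (1 / 2 ^ (Suc (2 * m + 1)) + (- 1)) / 3) \<longlonglongrightarrow> - 1 / (3 :: complex)"
        using tendsto_divide[OF tendsto_add[OF limc[of 1] tendsto_const] tendsto_const, of 3 "- 1"] by simp
      show "\<forall>\<^sub>F m in sequentially. (1 / 2 ^ (Suc (2 * m + 1)) + (- 1)) / 3 = S (\<lambda>t. u (2 * n) t * u (2 * m + 1) t)"
      proof (intro eventually_sequentiallyI[of n])
        fix m assume "n \<le> m"
        then have "(\<lambda>t. u (2 * n) t * u (2 * m + 1) t) = u (2 * m + 1)" using prod by auto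
        then show "(1 / 2 ^ (Suc (2 * m + 1)) + (- 1)) / 3 = S (\<lambda>t. u (2 * n) t * u (2 * m + 1) t)"
          by (simp only: Su) simp
      qed
    qed
    show "(\<lambda>n. - 1 / 3 :: complex) \<longlonglongrightarrow> - 1 / 3" "(\<lambda>n. 1 / 3 :: complex) \<longlonglongrightarrow> 1 / 3" by simp_all
    show "(\<lambda>n. S (\<lambda>t. u (2 * n) t * u (2 * m + 1) t)) \<longlonglongrightarrow> 1 / 3" for m
    proof (rule Lim_transform_eventually)
      show "(\<lambda>n. (1 / 2 ^ (Suc (2 * n)) + 1) / 3) \<longlonglongrightarrow> 1 / (3 :: complex)"
        using tendsto_divide[OF tendsto_add[OF limc[of 0] tendsto_const] tendsto_const, of 3 1] by simp
      show "\<forall>\<^sub>F n in sequentially. (1 / 2 ^ (Suc (2 * n)) + 1) / 3 = S (\<lambda>t. u (2 * n) t * u (2 * m + 1) t)"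
      proof (intro eventually_sequentiallyI[of "Suc m"])
        fix n assume "Suc m \<le> n"
        then have "(\<lambda>t. u (2 * n) t * u (2 * m + 1) t) = u (2 * n)" using prod[of "2 * m + 1" "2 * n"] by (auto simp: mult.commute)
        then show "(1 / 2 ^ (Suc (2 * n)) + 1) / 3 = S (\<lambda>t. u (2 * n) t * u (2 * m + 1) t)"
          by (simp only: Su) simp
      qed
    qed
  qed
  from arens_regular_imp_double_limits_eq[OF reg S(1) uA uN uA uN this] show False by simp
qed

end

section \<open>Discrete groups and their subgroups\<close>

lemma discrete_lc_group:
  assumes "group G" shows "lc_group G (discrete_topology (carrier G))"
proof -
  interpret group G by fact
  show ?thesis
    by (auto simp: lc_group_def is_group locally_compact_space_discrete_topology simp flip: prod_topology_discrete_topology)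
qed

lemma sigma_sets_discrete: "sigma_sets X {U. openin (discrete_topology X) U} = Pow X"
  using sigma_algebra.sigma_sets_eq[OF sigma_algebra_Pow, of X] by (simp add: Pow_def)

lemma count_space_left_haar:
  assumes "group G" shows "left_haar G (discrete_topology (carrier G)) (count_space (carrier G))"
proof -
  interpret group G by fact
  show ?thesis
    unfolding left_haar_def topspace_discrete_topology sigma_sets_discrete
  proof (intro conjI ballI allI impI)
    show "emeasure (count_space (carrier G)) (carrier G) \<noteq> 0"
      using one_closed by (subst emeasure_count_space_eq_0) auto
    show "emeasure (count_space (carrier G)) K < \<infinity>" if "compactin (discrete_topology (carrier G)) K" for K
      using that by (simp add: compactin_discrete_topology ennreal_of_nat_eq_real_of_nat)
    show "emeasure (count_space (carrier G)) B = (INF U \<in> {U. openin (discrete_topology (carrier G)) U \<and> B \<subseteq> U}. emeasure (count_space (carrier G)) U)"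
      if "B \<in> sets (count_space (carrier G))" for B
      using that by (intro antisym INF_greatest INF_lower2[of B] emeasure_mono) auto
    show "emeasure (count_space (carrier G)) U = (SUP K \<in> {K. compactin (discrete_topology (carrier G)) K \<and> K \<subseteq> U}. emeasure (count_space (carrier G)) K)" (is "_ = ?S")
      if U: "openin (discrete_topology (carrier G)) U" for U
    proof (rule antisym)
      have Uc: "U \<subseteq> carrier G" using U by simp
      show "?S \<le> emeasure (count_space (carrier G)) U" using Uc by (intro SUP_least emeasure_mono) auto
      show "emeasure (count_space (carrier G)) U \<le> ?S"
      proof (cases "finite U")
        case True
        then show ?thesis using Uc by (intro SUP_upper2[of U]) (auto simp: compactin_discrete_topology)
      next
        case False
        have "of_nat n \<le> ?S" for n
        proof -
          obtain K where K: "finite K" "card K = n" "K \<subseteq> U" using infinite_arbitrarily_large[OF False, of n] by (elim exE conjE)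
          have Kc: "K \<subseteq> carrier G" using K(3) Uc by (rule subset_trans)
          have "emeasure (count_space (carrier G)) K = of_nat n" using K Kc by simp
          moreover have "emeasure (count_space (carrier G)) K \<le> ?S"
            using K Kc by (intro SUP_upper) (simp add: compactin_discrete_topology)
          ultimately show ?thesis by simp
        qed
        then have "(SUP n. of_nat n) \<le> ?S" by (intro SUP_least)
        then show ?thesis unfolding ennreal_SUP_of_nat_eq_top by (rule order_trans[OF top_greatest])
      qed
    qed
    show "(\<lambda>x. g \<otimes>\<^bsub>G\<^esub> x) ` B \<in> sets (count_space (carrier G))"
      if "g \<in> carrier G" "B \<in> sets (count_space (carrier G))" for g B
      using that by auto
    show "emeasure (count_space (carrier G)) ((\<lambda>x. g \<otimes>\<^bsub>G\<^esub> x) ` B) = emeasure (count_space (carrier G)) B"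
      if g: "g \<in> carrier G" and B: "B \<in> sets (count_space (carrier G))" for g B
    proof -
      have inj: "inj_on (\<lambda>x. g \<otimes>\<^bsub>G\<^esub> x) B" 
      proof (rule inj_onI)
        fix x y assume "x \<in> B" "y \<in> B" and eq: "g \<otimes>\<^bsub>G\<^esub> x = g \<otimes>\<^bsub>G\<^esub> y"
        then have "x \<in> carrier G" "y \<in> carrier G" using B by auto
        then have "inv\<^bsub>G\<^esub> g \<otimes>\<^bsub>G\<^esub> (g \<otimes>\<^bsub>G\<^esub> x) = x" "inv\<^bsub>G\<^esub> g \<otimes>\<^bsub>G\<^esub> (g \<otimes>\<^bsub>G\<^esub> y) = y"
          using g by (simp_all flip: m_assoc)
        then show "x = y" unfolding eq by simp
      qed
      have "finite ((\<lambda>x. g \<otimes>\<^bsub>G\<^esub> x) ` B) = finite B" by (rule finite_image_iff[OF inj])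
      moreover have sub: "(\<lambda>x. g \<otimes>\<^bsub>G\<^esub> x) ` B \<subseteq> carrier G" using g B by auto
      ultimately show ?thesis using B card_image[OF inj] by (auto simp: emeasure_count_space)
    qed
  qed simp_all
qed

lemma conj_exp_facts: "1 < p \<Longrightarrow> 1 < conj_exp p" "1 < p \<Longrightarrow> 1 / p + 1 / conj_exp p = 1"
  by (auto simp: conj_exp_def field_simps)

context
  fixes X :: "'a set" and c :: real
  assumes c: "0 < c"
begin

abbreviation (input) "scaled \<equiv> density (count_space X) (\<lambda>_. ennreal c)"

lemma lp_fun_scaled: "lp_fun scaled r f \<longleftrightarrow> lp_fun (count_space X) r f"
  using c by (auto simp: lp_fun_def nn_integral_density nn_integral_cmult ennreal_mult_less_top)

lemma lp_norm_scaled: "lp_norm scaled r f = c powr (1 / r) * lp_norm (count_space X) r f"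
  using c by (simp add: lp_norm_def nn_integral_density nn_integral_cmult enn2real_mult powr_mult)

lemma conv_scaled: "conv_check G scaled g f x = of_real c * conv_check G (count_space X) g f x"
  using c by (simp add: conv_check_def integral_density scaleR_conv_of_real)

lemma lp_norm_scaled_prod:
  assumes "1 < p"
  shows "lp_norm scaled p f * lp_norm scaled (conj_exp p) g = lp_norm (count_space X) p f * (c * lp_norm (count_space X) (conj_exp p) g)"
proof -
  have "c powr (1 / p) * c powr (1 / conj_exp p) = c"
    unfolding powr_add[symmetric] conj_exp_facts(2)[OF assms] using c by simp
  then show ?thesis unfolding lp_norm_scaled by (metis mult.commute mult.left_commute)
qed

text \<open>Scaling the measure by c multiplies convolutions by c and the product of the two norms
  by c^(1/p + 1/q) = c. Moving the factor c into \<open>g\<close> turns representations for one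
  measure into representations for the other, at the same cost.\<close>

lemma herz_rep_scaled:
  assumes p: "1 < p"
  shows "herz_rep G scaled p u f g \<longleftrightarrow> herz_rep G (count_space X) p u f (\<lambda>i x. of_real c * g i x)"
proof -
  have q: "0 < conj_exp p" using conj_exp_facts(1)[OF p] by simp
  have lg: "lp_fun (count_space X) (conj_exp p) (\<lambda>x. of_real c * h x) \<longleftrightarrow> lp_fun (count_space X) (conj_exp p) h" for h :: "'a \<Rightarrow> complex"
  proof
    assume "lp_fun (count_space X) (conj_exp p) (\<lambda>x. of_real c * h x)"
    from lp_scale(1)[OF this q, of "of_real (1 / c)"] show "lp_fun (count_space X) (conj_exp p) h" using c by simp
  qed (rule lp_scale(1)[OF _ q])
  have cg: "conv_check G (count_space X) (\<lambda>x. of_real c * g i x) (f i) x = of_real c * conv_check G (count_space X) (g i) (f i) x" for i x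
    by (simp add: conv_check_def mult.assoc)
  have n: "lp_norm (count_space X) (conj_exp p) (\<lambda>x. of_real c * g i x) = c * lp_norm (count_space X) (conj_exp p) (g i)"
    if "\<forall>i. lp_fun (count_space X) (conj_exp p) (g i)" for i
    using lp_scale(2)[OF that[rule_format] q, of "of_real c" i] c by simp
  show ?thesis
    unfolding herz_rep_def lp_fun_scaled lp_norm_scaled_prod[OF p] conv_scaled cg lg
    using n by auto
qed

lemma herz_sums_scaled:
  assumes p: "1 < p"
  shows "{(\<Sum>i. lp_norm scaled p (f i) * lp_norm scaled (conj_exp p) (g i)) | f g. herz_rep G scaled p u f g}
    = {(\<Sum>i. lp_norm (count_space X) p (f i) * lp_norm (count_space X) (conj_exp p) (g i)) | f g. herz_rep G (count_space X) p u f g}"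
    (is "?L = ?R")
proof -
  have q: "0 < conj_exp p" using conj_exp_facts(1)[OF p] by simp
  have eq: "(\<Sum>i. lp_norm scaled p (f i) * lp_norm scaled (conj_exp p) (g i))
      = (\<Sum>i. lp_norm (count_space X) p (f i) * lp_norm (count_space X) (conj_exp p) (\<lambda>x. of_real c * g i x))"
    if r: "herz_rep G scaled p u f g" for f g
  proof -
    have "lp_norm (count_space X) (conj_exp p) (\<lambda>x. of_real c * g i x) = c * lp_norm (count_space X) (conj_exp p) (g i)" for i
      using lp_scale(2)[OF _ q, of "count_space X" "g i" "of_real c"] c r by (simp add: herz_rep_def lp_fun_scaled)
    then show ?thesis by (simp add: lp_norm_scaled_prod[OF p])
  qed
  show ?thesis
  proof (intro equalityI subsetI)
    fix s assume "s \<in> ?L"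
    then obtain f g where r: "herz_rep G scaled p u f g" and s: "s = (\<Sum>i. lp_norm scaled p (f i) * lp_norm scaled (conj_exp p) (g i))"
      by blast
    show "s \<in> ?R" unfolding s eq[OF r]
      by (rule CollectI, rule exI[of _ f], rule exI[of _ "\<lambda>i x. of_real c * g i x"])
        (use r in \<open>simp only: herz_rep_scaled[OF p] simp_thms\<close>)
  next
    fix s assume "s \<in> ?R"
    then obtain f g where r: "herz_rep G (count_space X) p u f g"
      and s: "s = (\<Sum>i. lp_norm (count_space X) p (f i) * lp_norm (count_space X) (conj_exp p) (g i))"
      by blast
    define g' where "g' i x = of_real (1 / c) * g i x" for i x
    have g': "(\<lambda>x. of_real c * g' i x) = g i" for i using c by (auto simp: g'_def)
    have r': "herz_rep G scaled p u f g'" unfolding herz_rep_scaled[OF p] g' by (rule r)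
    show "s \<in> ?L" unfolding s
      by (rule CollectI, rule exI[of _ f], rule exI[of _ g']) (use eq[OF r', unfolded g'] r' in simp)
  qed
qed

lemma herz_scaled:
  assumes p: "1 < p"
  shows "herz G scaled p = herz G (count_space X) p" "herz_norm G scaled p = herz_norm G (count_space X) p"
proof -
  have mem: "u \<in> herz G \<mu> p \<longleftrightarrow>
      {(\<Sum>i. lp_norm \<mu> p (f i) * lp_norm \<mu> (conj_exp p) (g i)) | f g. herz_rep G \<mu> p u f g} \<noteq> {}" for u \<mu>
    unfolding herz_def by blast
  show "herz G scaled p = herz G (count_space X) p"
    by (rule Set.set_eqI) (simp only: mem herz_sums_scaled[OF p])
  show "herz_norm G scaled p = herz_norm G (count_space X) p"
    unfolding herz_norm_def herz_sums_scaled[OF p] ..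
qed

end

text \<open>By translation invariance all points have the same mass, which is finite since points
  are compact and positive since they are open. Compact sets are the finite ones, and inner
  regularity then fixes the measure of every set.\<close>

lemma (in haar_group) discrete_haar_unique:
  assumes T: "T = discrete_topology (carrier G)"
  shows "\<exists>c>0. M = density (count_space (carrier G)) (\<lambda>_. ennreal c)"
proof -
  define c where "c = measure M {\<one>}"
  have os: "openin T B \<longleftrightarrow> B \<subseteq> carrier G" and cs: "compactin T B \<longleftrightarrow> B \<subseteq> carrier G \<and> finite B" for B
    by (simp_all add: T compactin_discrete_topology)
  have sM: "B \<in> sets M \<longleftrightarrow> B \<subseteq> carrier G" for B
  proof
    show "B \<subseteq> carrier G" if "B \<in> sets M" using sets.sets_into_space[OF that] by (simp only: space_M)
    show "B \<in> sets M" if "B \<subseteq> carrier G" using that by (intro open_sets) (simp only: os)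
  qed
  have "emeasure M {\<one>} < \<infinity>" by (rule compact_finite) (simp add: topspace_T)
  then have e1: "emeasure M {\<one>} = ennreal c" unfolding c_def by (intro emeasure_eq_ennreal_measure) auto
  moreover have "0 < emeasure M {\<one>}" by (rule open_measure_pos) (simp_all add: os)
  ultimately have c: "0 < c" by simp
  have ex: "emeasure M {x} = ennreal c" if "x \<in> carrier G" for x
    using left_transl[OF that, of "{\<one>}"] that e1 by (simp add: sM)
  let ?C = "count_space (carrier G)"
  \<comment> \<open>Makes inner regularity available for counting measure as well, so both measures
    are suprema over the same finite sets.\<close>
  interpret C: haar_group G "discrete_topology (carrier G)" ?C p q
    using discrete_lc_group[OF is_group] count_space_left_haar[OF is_group] p1 q_def by unfold_locales
  have "M = density ?C (\<lambda>_. ennreal c)"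
  proof (rule measure_eqI)
    show "sets M = sets (density ?C (\<lambda>_. ennreal c))" using sM by auto
    fix B assume "B \<in> sets M"
    then have B: "B \<subseteq> carrier G" by (simp add: sM)
    have fin: "emeasure M K = ennreal c * emeasure ?C K" if K: "K \<in> {K. compactin T K \<and> K \<subseteq> B}" for K
    proof -
      have "emeasure M K = (\<Sum>x\<in>K. emeasure M {x})"
        using K by (intro emeasure_eq_sum_singleton) (auto simp: cs sM)
      also have "\<dots> = (\<Sum>x\<in>K. ennreal c)" using K by (intro sum.cong refl ex) (auto simp: cs)
      also have "\<dots> = ennreal c * emeasure ?C K" using K by (simp add: cs mult.commute)
      finally show ?thesis .
    qed
    have "emeasure M B = (SUP K \<in> {K. compactin T K \<and> K \<subseteq> B}. emeasure M K)"
      using B by (intro inner_regular) (simp add: os)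
    also have "\<dots> = (SUP K \<in> {K. compactin T K \<and> K \<subseteq> B}. ennreal c * emeasure ?C K)"
      by (intro SUP_cong refl fin)
    also have "\<dots> = ennreal c * emeasure ?C B"
    proof -
      have "emeasure ?C B = (SUP K \<in> {K. compactin T K \<and> K \<subseteq> B}. emeasure ?C K)"
        using B by (intro C.inner_regular[folded T]) (simp only: os)
      then show ?thesis by (simp only: SUP_mult_left_ennreal)
    qed
    also have "\<dots> = emeasure (density ?C (\<lambda>_. ennreal c)) B" using B by (simp add: emeasure_density_const)
    finally show "emeasure M B = emeasure (density ?C (\<lambda>_. ennreal c)) B" .
  qed
  then show ?thesis using c by blast
qed

lemma (in haar_group) herz_discrete:
  assumes T: "T = discrete_topology (carrier G)"
  shows "A = herz G (count_space (carrier G)) p" "N = herz_norm G (count_space (carrier G)) p"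
proof -
  obtain c where c: "0 < c" and M: "M = density (count_space (carrier G)) (\<lambda>_. ennreal c)"
    using discrete_haar_unique[OF T] by (elim exE conjE)
  show "A = herz G (count_space (carrier G)) p" "N = herz_norm G (count_space (carrier G)) p"
    unfolding M by (rule herz_scaled[OF c p1])+
qed

section \<open>Extension and restriction between a discrete group and a subgroup\<close>

lemma haar_group_discrete:
  assumes "group G" "1 < p" "q = conj_exp p"
  shows "haar_group G (discrete_topology (carrier G)) (count_space (carrier G)) p q"
  using discrete_lc_group[OF assms(1)] count_space_left_haar[OF assms(1)] assms(2,3) by unfold_locales

text \<open>Both groups carry counting measure, so no choice of normalization has to be tracked
  between \<open>amb\<close> and \<open>sub\<close>.\<close>

locale discrete_subgroup = group G for G (structure) +
  fixes H p q
  assumes sub: "subgroup H G" and p1: "1 < p" and q_def: "q = conj_exp p"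
begin

abbreviation "GH \<equiv> G\<lparr>carrier := H\<rparr>"
abbreviation "MG \<equiv> count_space (carrier G)"
abbreviation "MH \<equiv> count_space H"

sublocale amb: haar_group G "discrete_topology (carrier G)" MG p q
  by (rule haar_group_discrete[OF is_group p1 q_def])

sublocale sub: haar_group GH "discrete_topology H" MH p q
  using haar_group_discrete[OF subgroup.subgroup_is_group[OF sub is_group] p1 q_def] by simp

lemma H_carrier: "x \<in> H \<Longrightarrow> x \<in> carrier G"
  by (rule subgroup.mem_carrier[OF sub])

lemma H_mult: "x \<in> H \<Longrightarrow> y \<in> H \<Longrightarrow> x \<otimes> y \<in> H"
  by (rule subgroup.m_closed[OF sub])

lemma H_inv: "x \<in> H \<Longrightarrow> inv x \<in> H"
  by (rule subgroup.m_inv_closed[OF sub])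

lemma conv_sub:
  "x \<in> H \<Longrightarrow> sub.conv g f x = (\<integral>y. g y * f (inv x \<otimes> y) \<partial>MH)"
  by (simp add: conv_check_def m_inv_consistent[OF sub])

lemma extension_integral:
  fixes F :: "'a \<Rightarrow> 'c::{banach, second_countable_topology}"
  shows "integrable MG (\<lambda>y. indicator H y *\<^sub>R F y) \<longleftrightarrow> integrable MH F"
    "(\<integral>y. indicator H y *\<^sub>R F y \<partial>MG) = (\<integral>y. F y \<partial>MH)"
proof -
  have "H \<inter> carrier G = H" using H_carrier by blast
  then have r: "restrict_space MG H = MH" by (simp only: restrict_count_space)
  show "integrable MG (\<lambda>y. indicator H y *\<^sub>R F y) \<longleftrightarrow> integrable MH F"
    using integrable_restrict_space[of H MG F] unfolding r by auto
  show "(\<integral>y. indicator H y *\<^sub>R F y \<partial>MG) = (\<integral>y. F y \<partial>MH)"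
    using integral_restrict_space[of H MG F] unfolding r by auto
qed

definition ext :: "('a \<Rightarrow> complex) \<Rightarrow> 'a \<Rightarrow> complex" where
  "ext f y = (if y \<in> H then f y else 0)"

lemma lp_ext:
  assumes f: "lp_fun MH r f" shows "lp_fun MG r (ext f)" "lp_norm MG r (ext f) = lp_norm MH r f"
proof -
  have e: "cmod (ext f y) powr r = indicator H y *\<^sub>R (cmod (f y) powr r)" for y by (simp add: ext_def)
  show l: "lp_fun MG r (ext f)"
    unfolding lp_fun_iff e extension_integral(1) using lp_funD(2)[OF f] by simp
  show "lp_norm MG r (ext f) = lp_norm MH r f"
    unfolding lp_norm_eq[OF l] lp_norm_eq[OF f] e extension_integral(2) ..
qed

text \<open>For y in H the point x^-1 y lies in H exactly when x does, so the convolution of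
  extensions by zero is itself an extension by zero.\<close>

lemma conv_ext:
  assumes x: "x \<in> carrier G"
  shows "amb.conv (ext g) (ext f) x = (if x \<in> H then sub.conv g f x else 0)"
proof -
  have e: "ext g y * ext f (inv x \<otimes> y) = indicator H y *\<^sub>R (if x \<in> H then g y * f (inv x \<otimes> y) else 0)" if y: "y \<in> carrier G" for y
  proof (cases "y \<in> H")
    case True
    have "inv x \<otimes> y \<in> H \<longleftrightarrow> x \<in> H"
    proof
      assume "inv x \<otimes> y \<in> H"
      then have "y \<otimes> inv (inv x \<otimes> y) \<in> H" using True H_mult H_inv by blast
      moreover have "y \<otimes> inv (inv x \<otimes> y) = x" using x y by (simp add: inv_mult_group) (simp add: x y flip: m_assoc)
      ultimately show "x \<in> H" by simp
    qed (simp add: True H_mult H_inv)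
    then show ?thesis using True by (simp add: ext_def)
  qed (simp add: ext_def)
  have "amb.conv (ext g) (ext f) x = (\<integral>y. indicator H y *\<^sub>R (if x \<in> H then g y * f (inv x \<otimes> y) else 0) \<partial>MG)"
    unfolding conv_check_def by (rule Bochner_Integration.integral_cong[OF refl]) (simp add: e)
  also have "\<dots> = (\<integral>y. (if x \<in> H then g y * f (inv x \<otimes> y) else 0) \<partial>MH)" by (rule extension_integral(2))
  finally show ?thesis by (simp add: conv_sub)
qed

lemma herz_extension:
  assumes u: "u \<in> sub.A" shows "u \<in> amb.A" "amb.N u \<le> sub.N u"
proof -
  have *: "u \<in> amb.A \<and> amb.N u \<le> sub.N u + e" if e: "0 < e" for e
  proof -
    obtain c f g where c: "\<forall>i. 0 \<le> c i \<and> sub.atom (f i) (g i)" "summable c" "suminf c \<le> sub.N u + e"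
      and s: "\<forall>x\<in>carrier GH. (\<lambda>i. complex_of_real (c i) * sub.conv (g i) (f i) x) sums u x"
      by (rule sub.herz_atomicE[OF u e])
    have u0: "u x = 0" if "x \<notin> H" for x using sub.herz_out[OF u] that by simp
    have at: "amb.atom (ext (f i)) (ext (g i))" for i
      using c(1) lp_ext by (simp add: amb.atom_def sub.atom_def)
    have "(\<lambda>i. complex_of_real (c i) * amb.conv (ext (g i)) (ext (f i)) x) sums u x" if "x \<in> carrier G" for x
      unfolding conv_ext[OF that] using s u0 by (cases "x \<in> H") auto
    note sm = this
    have c0: "0 \<le> c i" for i using c(1) by blast
    have u0': "u x = 0" if "x \<notin> carrier G" for x using u0 H_carrier that by blast
    have "u \<in> amb.A" "amb.N u \<le> suminf c"
      by (rule amb.herz_atomicI[where u=u, OF c0 c(2) at sm u0']; assumption)+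
    then show ?thesis using c(3) by simp
  qed
  show "u \<in> amb.A" using *[of 1] by simp
  show "amb.N u \<le> sub.N u" by (rule field_le_epsilon) (simp add: *)
qed

text \<open>Right cosets, because for x in H the arguments y and x^-1 y of the convolution integrand
  lie in the same one.\<close>

definition rcoset :: "'a \<Rightarrow> 'a set" where
  "rcoset y = (\<lambda>h. h \<otimes> y) ` H"

lemma rcoset_self: "y \<in> carrier G \<Longrightarrow> y \<in> rcoset y"
  unfolding rcoset_def using subgroup.one_closed[OF sub] by (intro image_eqI[of _ _ \<one>]) auto

lemma rcoset_eq:
  assumes y: "y \<in> carrier G" and z: "z \<in> rcoset y" shows "rcoset z = rcoset y"
proof -
  obtain k where k: "k \<in> H" "z = k \<otimes> y" using z by (auto simp: rcoset_def)
  have kc: "k \<in> carrier G" using k H_carrier by blast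
  have "h \<otimes> z = (h \<otimes> k) \<otimes> y" "h \<otimes> y = (h \<otimes> inv k) \<otimes> z" if "h \<in> H" for h
    using that k y kc H_carrier[OF that] by (simp_all add: m_assoc) (simp add: kc y flip: m_assoc)
  then show ?thesis
    unfolding rcoset_def using k(1) H_mult H_inv by (intro equalityI image_subsetI) (metis image_eqI)+
qed

lemma coset_integral:
  fixes F :: "'a \<Rightarrow> 'c::{banach, second_countable_topology}"
  assumes t: "t \<in> carrier G" and F: "integrable MG F"
  shows "integrable MH (\<lambda>h. F (h \<otimes> t))" "(\<integral>h. F (h \<otimes> t) \<partial>MH) = (\<integral>y. indicator (rcoset t) y *\<^sub>R F y \<partial>MG)"
proof -
  have c: "rcoset t \<subseteq> carrier G" using t H_carrier by (auto simp: rcoset_def)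
  then have "rcoset t \<inter> carrier G = rcoset t" by blast
  then have r: "restrict_space MG (rcoset t) = count_space (rcoset t)" by (simp only: restrict_count_space)
  have b: "bij_betw (\<lambda>h. h \<otimes> t) H (rcoset t)"
    unfolding bij_betw_def rcoset_def
  proof (intro conjI inj_onI)
    fix x y assume "x \<in> H" "y \<in> H" and eq: "x \<otimes> t = y \<otimes> t"
    then have "x \<in> carrier G" "y \<in> carrier G" using H_carrier by auto
    then have "(x \<otimes> t) \<otimes> inv t = x" "(y \<otimes> t) \<otimes> inv t = y" using t by (simp_all add: m_assoc)
    then show "x = y" unfolding eq by simp
  qed simp
  have "integrable MG (\<lambda>y. indicator (rcoset t) y *\<^sub>R F y)"
    using F by (rule Bochner_Integration.integrable_bound) (auto simp: indicator_def)
  then have "integrable (count_space (rcoset t)) F"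
    using integrable_restrict_space[of "rcoset t" MG F] unfolding r by auto
  then show "integrable MH (\<lambda>h. F (h \<otimes> t))" unfolding integrable_bij_count_space[OF b] .
  show "(\<integral>h. F (h \<otimes> t) \<partial>MH) = (\<integral>y. indicator (rcoset t) y *\<^sub>R F y \<partial>MG)"
    using integral_bij_count_space[OF b, of F] integral_restrict_space[of "rcoset t" MG F] unfolding r by auto
qed

lemma sums_disjoint_integral:
  fixes F :: "'a \<Rightarrow> 'c::{banach, second_countable_topology}" and B :: "nat \<Rightarrow> 'a set"
  assumes F: "integrable MG F" and dis: "disjoint_family B" and off: "\<And>y. y \<in> carrier G \<Longrightarrow> (\<forall>k. y \<notin> B k) \<Longrightarrow> F y = 0"
  shows "(\<lambda>k. \<integral>y. indicator (B k) y *\<^sub>R F y \<partial>MG) sums (\<integral>y. F y \<partial>MG)"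
proof -
  have i: "integrable MG (\<lambda>y. indicator (B k) y *\<^sub>R F y)" for k
    using F by (rule Bochner_Integration.integrable_bound) (auto simp: indicator_def)
  have one: "indicator (B k) y *\<^sub>R F y = (if k = j then F y else 0)" if "y \<in> B j" for y j k
    using dis that by (auto simp: disjoint_family_on_def indicator_def)
  have "(\<lambda>n. \<integral>y. (\<Sum>k<n. indicator (B k) y *\<^sub>R F y) \<partial>MG) \<longlonglongrightarrow> (\<integral>y. F y \<partial>MG)"
  proof (rule integral_dominated_convergence[where w="\<lambda>y. norm (F y)"])
    show "AE y in MG. (\<lambda>n. \<Sum>k<n. indicator (B k) y *\<^sub>R F y) \<longlonglongrightarrow> F y"
    proof (rule AE_I2)
      fix y assume y: "y \<in> space MG"
      show "(\<lambda>n. \<Sum>k<n. indicator (B k) y *\<^sub>R F y) \<longlonglongrightarrow> F y"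
      proof (cases "\<exists>j. y \<in> B j")
        case True
        then obtain j where j: "y \<in> B j" by (elim exE)
        show ?thesis
          by (rule tendsto_eventually, rule eventually_sequentiallyI[of "Suc j"]) (simp add: one[OF j])
      next
        case False
        then show ?thesis using off[of y] y by simp
      qed
    qed
    show "AE y in MG. norm (\<Sum>k<n. indicator (B k) y *\<^sub>R F y) \<le> norm (F y)" for n
    proof (rule AE_I2)
      fix y
      show "norm (\<Sum>k<n. indicator (B k) y *\<^sub>R F y) \<le> norm (F y)"
      proof (cases "\<exists>j. y \<in> B j")
        case True
        then obtain j where j: "y \<in> B j" by (elim exE)
        show ?thesis by (simp add: one[OF j])
      qed simp
    qed
  qed (use F in auto)
  moreover have "(\<integral>y. (\<Sum>k<n. indicator (B k) y *\<^sub>R F y) \<partial>MG) = (\<Sum>k<n. \<integral>y. indicator (B k) y *\<^sub>R F y \<partial>MG)" for n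
    by (rule Bochner_Integration.integral_sum) (rule i)
  ultimately show ?thesis by (simp add: sums_def)
qed

lemma disjoint_nonneg_integral_le:
  fixes F :: "'a \<Rightarrow> real" and B :: "nat \<Rightarrow> 'a set"
  assumes F: "integrable MG F" and nn: "\<And>y. 0 \<le> F y" and dis: "disjoint_family B"
  shows "(\<Sum>k<n. \<integral>y. indicator (B k) y *\<^sub>R F y \<partial>MG) \<le> (\<integral>y. F y \<partial>MG)"
proof -
  define U where "U = (\<Union>k. B k)"
  have i: "integrable MG (\<lambda>y. indicator X y *\<^sub>R F y)" for X
    using F by (rule Bochner_Integration.integrable_bound) (auto simp: indicator_def)
  have "(\<lambda>k. \<integral>y. indicator (B k) y *\<^sub>R (indicator U y *\<^sub>R F y) \<partial>MG) sums (\<integral>y. indicator U y *\<^sub>R F y \<partial>MG)"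
    by (rule sums_disjoint_integral[OF i dis]) (auto simp: U_def)
  moreover have eq: "indicator (B k) y *\<^sub>R (indicator U y *\<^sub>R F y) = indicator (B k) y *\<^sub>R F y" for k y
    by (auto simp: U_def indicator_def)
  ultimately have s: "(\<lambda>k. \<integral>y. indicator (B k) y *\<^sub>R F y \<partial>MG) sums (\<integral>y. indicator U y *\<^sub>R F y \<partial>MG)" by (simp only: eq)
  have "(\<Sum>k<n. \<integral>y. indicator (B k) y *\<^sub>R F y \<partial>MG) \<le> (\<integral>y. indicator U y *\<^sub>R F y \<partial>MG)"
    unfolding sums_unique[OF s] by (rule sum_le_suminf[OF sums_summable[OF s]]) (auto intro!: Bochner_Integration.integral_nonneg simp: nn)
  also have "\<dots> \<le> (\<integral>y. F y \<partial>MG)"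
    by (rule integral_mono[OF i F]) (auto simp: indicator_def nn)
  finally show ?thesis .
qed

text \<open>The support is the union of the sets where |f|^r is at least 1/n, and Markov's
  inequality for counting measure makes each of them finite.\<close>

lemma countable_support:
  assumes f: "lp_fun MG r f" shows "countable {y \<in> carrier G. f y \<noteq> 0}"
proof -
  define F where "F y = ennreal (cmod (f y) powr r)" for y
  have Ffin: "(\<integral>\<^sup>+ y. F y \<partial>MG) < \<infinity>" using f by (simp add: lp_fun_def F_def)
  define E where "E n = {y \<in> carrier G. 1 \<le> ennreal (real n) * F y}" for n
  have "finite (E n)" for n
  proof (rule ccontr)
    assume "infinite (E n)"
    then have "emeasure MG (E n) = \<infinity>" by (simp add: E_def)
    moreover have "emeasure MG (E n) \<le> ennreal (real n) * (\<integral>\<^sup>+ y. F y * indicator (carrier G) y \<partial>MG)"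
      unfolding E_def by (rule nn_integral_Markov_inequality) auto
    moreover have "(\<integral>\<^sup>+ y. F y * indicator (carrier G) y \<partial>MG) = (\<integral>\<^sup>+ y. F y \<partial>MG)"
      by (rule nn_integral_cong) simp
    ultimately show False using Ffin by (simp add: ennreal_mult_eq_top_iff top_unique)
  qed
  then have "countable (\<Union>n. E n)" by (intro countable_UN) (auto intro: countable_finite)
  moreover have "{y \<in> carrier G. f y \<noteq> 0} \<subseteq> (\<Union>n. E n)"
  proof (rule subsetI)
    fix y assume y: "y \<in> {y \<in> carrier G. f y \<noteq> 0}"
    define v where "v = cmod (f y) powr r"
    have v: "0 < v" using y by (simp add: v_def)
    obtain n where n: "1 / v < real n" using reals_Archimedean2 by blast
    have "1 \<le> real n * v" using n v by (simp add: pos_divide_less_eq)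
    then have "1 \<le> ennreal (real n) * F y" unfolding F_def v_def[symmetric] using v
      by (simp flip: ennreal_mult)
    then show "y \<in> (\<Union>n. E n)" using y by (auto simp: E_def)
  qed
  ultimately show ?thesis by (rule countable_subset[rotated])
qed

definition rst :: "('a \<Rightarrow> complex) \<Rightarrow> 'a \<Rightarrow> complex" where
  "rst u x = (if x \<in> H then u x else 0)"

text \<open>On each right coset of \<open>H\<close> that meets the support of \<open>g\<close>, the convolution at points of \<open>H\<close> is a convolution
  over \<open>H\<close>; Young's inequality bounds the sum of the norms of these pieces by \<open>1/p + 1/q = 1\<close>.\<close>
lemma herz_restrict_conv:
  assumes f: "lp_fun MG p f" "lp_norm MG p f \<le> 1" and g: "lp_fun MG q g" "lp_norm MG q g \<le> 1"
  shows "rst (amb.conv g f) \<in> sub.A" "sub.N (rst (amb.conv g f)) \<le> 1"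
proof -
  note q1 = amb.q1 and pq = amb.pq
  define S where "S = {y \<in> carrier G. g y \<noteq> 0}"
  define C where "C = rcoset ` S"
  \<comment> \<open>The support of \<open>g\<close> is countable and hence meets only countably many
    cosets, even if H has uncountable index. On the other cosets the integrand vanishes, so the
    pieces form a sequence as in \<open>herz_series\<close>.\<close>
  have Cc: "countable C" unfolding C_def S_def by (intro countable_image countable_support[OF g(1)])
  \<comment> \<open>The k-th coset in the numbering \<open>to_nat_on\<close>. For a number that is
    not taken \<open>B k\<close> is empty; the representative \<open>t k\<close> is then arbitrary,
    and \<open>sl\<close> is set to 0.\<close>
  define B where "B k = {y \<in> carrier G. rcoset y \<in> C \<and> to_nat_on C (rcoset y) = k}" for k
  define t where "t k = (SOME y. y \<in> B k)" for k
  have t: "t k \<in> B k" if ne: "B k \<noteq> {}" for k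
  proof -
    obtain y where "y \<in> B k" using ne by blast
    then show ?thesis unfolding t_def by (rule someI)
  qed
  have Bt: "B k = rcoset (t k)" "t k \<in> carrier G" if "B k \<noteq> {}" for k
  proof -
    show tc: "t k \<in> carrier G" using t[OF that] by (simp add: B_def)
    have "y \<in> rcoset (t k)" if y: "y \<in> B k" for y
    proof -
      have "rcoset y = rcoset (t k)"
        using y t[OF \<open>B k \<noteq> {}\<close>] inj_onD[OF inj_on_to_nat_on[OF Cc], of "rcoset y" "rcoset (t k)"] by (simp add: B_def)
      then show ?thesis using rcoset_self[of y] y by (simp add: B_def)
    qed
    moreover have "y \<in> B k" if y: "y \<in> rcoset (t k)" for y
    proof -
      have "rcoset y = rcoset (t k)" by (rule rcoset_eq[OF tc y])
      moreover have "y \<in> carrier G" using y tc H_carrier by (auto simp: rcoset_def)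
      ultimately show ?thesis using t[OF \<open>B k \<noteq> {}\<close>] by (simp add: B_def)
    qed
    ultimately show "B k = rcoset (t k)" by blast
  qed
  have dis: "disjoint_family B" by (auto simp: disjoint_family_on_def B_def)
  have cov: "\<exists>k. y \<in> B k" if "y \<in> S" for y
    using that by (auto simp: B_def C_def S_def)
  define sl where "sl k h y = (if B k = {} then 0 else h (y \<otimes> t k))" for k y and h :: "'a \<Rightarrow> complex"
  have slice: "integrable MH (\<lambda>y. if B k = {} then 0 else F (y \<otimes> t k))"
      "(\<integral>y. (if B k = {} then 0 else F (y \<otimes> t k)) \<partial>MH) = (\<integral>y. indicator (B k) y *\<^sub>R F y \<partial>MG)"
    if "integrable MG F" for k and F :: "'a \<Rightarrow> 'c::{banach, second_countable_topology}"
  proof -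
    show "integrable MH (\<lambda>y. if B k = {} then 0 else F (y \<otimes> t k))"
    proof (cases "B k = {}")
      case False then show ?thesis using coset_integral(1)[OF Bt(2)[OF False] that] by (simp only: if_False)
    qed simp
    show "(\<integral>y. (if B k = {} then 0 else F (y \<otimes> t k)) \<partial>MH) = (\<integral>y. indicator (B k) y *\<^sub>R F y \<partial>MG)"
    proof (cases "B k = {}")
      case False
      then show ?thesis using coset_integral(2)[OF Bt(2)[OF False] that] unfolding Bt(1)[OF False, symmetric] by (simp only: if_False)
    qed simp
  qed
  have pw: "cmod (sl k h y) powr r = (if B k = {} then 0 else cmod (h (y \<otimes> t k)) powr r)" for k h y r
    by (simp add: sl_def)
  have lsl: "lp_fun MH r (sl k h)" "lp_norm MH r (sl k h) powr r = (\<integral>y. indicator (B k) y *\<^sub>R (cmod (h y) powr r) \<partial>MG)"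
    if h: "lp_fun MG r h" and r: "0 < r" for k h r
  proof -
    show l: "lp_fun MH r (sl k h)"
      unfolding lp_fun_iff pw using slice(1)[OF lp_funD(2)[OF h]] by simp
    show "lp_norm MH r (sl k h) powr r = (\<integral>y. indicator (B k) y *\<^sub>R (cmod (h y) powr r) \<partial>MG)"
      unfolding lp_norm_powr[OF l r] pw by (rule slice(2)[OF lp_funD(2)[OF h]])
  qed
  have p0: "0 < p" "0 < q" using p1 q1 by auto
  define b where "b k = lp_norm MH q (sl k g) * lp_norm MH p (sl k f)" for k
  have bs: "(\<Sum>k<n. b k) \<le> 1" for n
  proof -
    have "b k \<le> lp_norm MH p (sl k f) powr p / p + lp_norm MH q (sl k g) powr q / q" for k
      unfolding b_def using Youngs_inequality[OF p1 q1 pq, of "lp_norm MH p (sl k f)" "lp_norm MH q (sl k g)"] by (simp add: mult.commute)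
    then have "(\<Sum>k<n. b k) \<le> (\<Sum>k<n. lp_norm MH p (sl k f) powr p / p + lp_norm MH q (sl k g) powr q / q)"
      by (rule sum_mono)
    also have "\<dots> = (\<Sum>k<n. lp_norm MH p (sl k f) powr p) / p + (\<Sum>k<n. lp_norm MH q (sl k g) powr q) / q"
      by (simp add: sum.distrib sum_divide_distrib)
    also have "\<dots> \<le> 1 / p + 1 / q"
    proof (intro add_mono divide_right_mono)
      show "(\<Sum>k<n. lp_norm MH p (sl k f) powr p) \<le> 1"
        unfolding lsl(2)[OF f(1) p0(1)]
        using disjoint_nonneg_integral_le[OF lp_funD(2)[OF f(1)] _ dis, of n] lp_norm_leD[OF f(1) p0(1) f(2)] by simp
      show "(\<Sum>k<n. lp_norm MH q (sl k g) powr q) \<le> 1"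
        unfolding lsl(2)[OF g(1) p0(2)]
        using disjoint_nonneg_integral_le[OF lp_funD(2)[OF g(1)] _ dis, of n] lp_norm_leD[OF g(1) p0(2) g(2)] by simp
    qed (use p0 in auto)
    finally show ?thesis using pq by simp
  qed
  have b0: "0 \<le> b k" for k by (simp add: b_def)
  have bsum: "summable b" by (rule summableI_nonneg_bounded[OF b0 bs])
  define w where "w k x = (if x \<in> H then sub.conv (sl k g) (sl k f) x else 0)" for k x
  have w: "w k \<in> sub.A" "sub.N (w k) \<le> b k" for k
    using sub.herz_conv[OF lsl(1)[OF f(1) p0(1)] lsl(1)[OF g(1) p0(2)], of k k] by (simp_all add: w_def[abs_def] b_def)
  have ws: "(\<lambda>k. w k x) sums rst (amb.conv g f) x" if x: "x \<in> carrier GH" for x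
  proof -
    have xH: "x \<in> H" and xc: "x \<in> carrier G" using x H_carrier by auto
    have Fi: "integrable MG (\<lambda>y. g y * f (inv x \<otimes> y))" by (rule amb.conv_integrable[OF f(1) g(1) xc])
    have "w k x = (\<integral>y. indicator (B k) y *\<^sub>R (g y * f (inv x \<otimes> y)) \<partial>MG)" for k
    proof -
      have "sl k g y * sl k f (inv x \<otimes> y) = (if B k = {} then 0 else g (y \<otimes> t k) * f (inv x \<otimes> (y \<otimes> t k)))" if "y \<in> H" for y
        using Bt(2)[of k] xc H_carrier[OF that] by (simp add: sl_def m_assoc)
      then have "w k x = (\<integral>y. (if B k = {} then 0 else g (y \<otimes> t k) * f (inv x \<otimes> (y \<otimes> t k))) \<partial>MH)"
        unfolding w_def if_P[OF xH] conv_sub[OF xH] by (intro Bochner_Integration.integral_cong refl) simp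
      also have "\<dots> = (\<integral>y. indicator (B k) y *\<^sub>R (g y * f (inv x \<otimes> y)) \<partial>MG)" by (rule slice(2)[OF Fi])
      finally show ?thesis .
    qed
    moreover have "(\<lambda>k. \<integral>y. indicator (B k) y *\<^sub>R (g y * f (inv x \<otimes> y)) \<partial>MG) sums (\<integral>y. g y * f (inv x \<otimes> y) \<partial>MG)"
      using cov by (intro sums_disjoint_integral[OF Fi dis]) (auto simp: S_def)
    ultimately show ?thesis using xH by (simp add: rst_def conv_check_def)
  qed
  show "rst (amb.conv g f) \<in> sub.A"
    by (rule sub.herz_series(1)[OF w bsum ws]) (auto simp: rst_def)
  have "sub.N (rst (amb.conv g f)) \<le> suminf b"
    by (rule sub.herz_series(2)[OF w bsum ws]) (auto simp: rst_def)
  also have "\<dots> \<le> 1" by (rule suminf_le_const[OF bsum bs])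
  finally show "sub.N (rst (amb.conv g f)) \<le> 1" .
qed

lemma herz_restriction:
  assumes u: "u \<in> amb.A" shows "rst u \<in> sub.A" "sub.N (rst u) \<le> amb.N u"
proof -
  have *: "rst u \<in> sub.A \<and> sub.N (rst u) \<le> amb.N u + e" if e: "0 < e" for e
  proof -
    obtain c f g where c: "\<forall>i. 0 \<le> c i \<and> amb.atom (f i) (g i)" "summable c" "suminf c \<le> amb.N u + e"
      and s: "\<forall>x\<in>carrier G. (\<lambda>i. complex_of_real (c i) * amb.conv (g i) (f i) x) sums u x"
      by (rule amb.herz_atomicE[OF u e])
    define w where "w k = (\<lambda>x. complex_of_real (c k) * rst (amb.conv (g k) (f k)) x)" for k
    have r: "rst (amb.conv (g k) (f k)) \<in> sub.A" "sub.N (rst (amb.conv (g k) (f k))) \<le> 1" for k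
      using herz_restrict_conv[of "f k" "g k"] c(1) by (simp_all add: amb.atom_def)
    have w: "w k \<in> sub.A" "sub.N (w k) \<le> c k" for k
    proof -
      show "w k \<in> sub.A" unfolding w_def by (rule sub.herz_scale(1)[OF r(1)])
      have "sub.N (w k) \<le> cmod (complex_of_real (c k)) * sub.N (rst (amb.conv (g k) (f k)))"
        unfolding w_def by (rule sub.herz_scale(2)[OF r(1)])
      also have "\<dots> \<le> c k" using mult_left_mono[OF r(2)[of k], of "c k"] c(1) by simp
      finally show "sub.N (w k) \<le> c k" .
    qed
    have ws: "(\<lambda>k. w k x) sums rst u x" if "x \<in> carrier GH" for x
      using s H_carrier[of x] that by (simp add: w_def rst_def)
    have r0: "rst u x = 0" if "x \<notin> carrier GH" for x using that by (simp add: rst_def)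
    have "rst u \<in> sub.A" "sub.N (rst u) \<le> suminf c"
      by (rule sub.herz_series[where u="rst u", OF w c(2) ws r0]; assumption)+
    then show ?thesis using c(3) by simp
  qed
  show "rst u \<in> sub.A" using *[of 1] by simp
  show "sub.N (rst u) \<le> amb.N u" by (rule field_le_epsilon) (simp add: *)
qed

text \<open>An element supported in H is its own restriction. Together with
  \<open>herz_extension\<close>, the algebra of H is isometrically the part of the ambient algebra
  that lives on H.\<close>

lemma herz_supported:
  assumes "u \<in> amb.A" "\<And>x. x \<notin> H \<Longrightarrow> u x = 0" shows "u \<in> sub.A" "sub.N u \<le> amb.N u"
proof -
  have "rst u = u" using assms(2) by (auto simp: rst_def)
  then show "u \<in> sub.A" "sub.N u \<le> amb.N u" using herz_restriction[OF assms(1)] by simp_all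
qed

end

context fun_alg
begin

lemma arens_regular_iff_double_limits:
  "arens_regular A N \<longleftrightarrow> (\<forall>T\<in>D. \<forall>a b R k l. (\<forall>n. a n \<in> A \<and> N (a n) \<le> R \<and> b n \<in> A \<and> N (b n) \<le> R) \<longrightarrow>
     double_limits T a b k l \<longrightarrow> k = l)" (is "_ \<longleftrightarrow> ?dl")
proof
  assume reg: "arens_regular A N"
  show ?dl
  proof (intro ballI allI impI)
    fix T a b R k l
    assume "T \<in> D" "\<forall>n. a n \<in> A \<and> N (a n) \<le> R \<and> b n \<in> A \<and> N (b n) \<le> R" "double_limits T a b k l"
    then show "k = l" using arens_regular_imp_double_limits_eq[OF reg, of T a R b k l] by simp
  qed
next
  assume dl: ?dl
  show "arens_regular A N"
  proof (rule ccontr)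
    assume "\<not> arens_regular A N"
    then show False
    proof (rule not_arens_regularE)
      fix T a b k l R
      assume T: "T \<in> D" and ab: "\<And>n. a n \<in> A" "\<And>n. N (a n) \<le> R" "\<And>n. b n \<in> A" "\<And>n. N (b n) \<le> R"
        and lim: "double_limits T a b k l" and ne: "k \<noteq> l"
      have "k = l" by (rule dl[rule_format, OF T, where R=R and a=a and b=b]) (use ab lim in simp_all)
      then show False using ne by simp
    qed
  qed
qed

end

section \<open>Transfer of Arens regularity between the group and its subgroups\<close>

context discrete_subgroup
begin

text \<open>A convolution is nonzero at x only if x = y z^-1 with y in the support of
  \<open>g i\<close> and z in that of \<open>f i\<close>; both supports are countable, and a
  representation has countably many terms.\<close>

lemma herz_countable_support:
  assumes u: "u \<in> amb.A" shows "countable {x. u x \<noteq> 0}"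
proof -
  obtain c f g where c: "\<forall>i. 0 \<le> c i \<and> amb.atom (f i) (g i)" "summable c" "suminf c \<le> amb.N u + 1"
    and s: "\<forall>x\<in>carrier G. (\<lambda>i. complex_of_real (c i) * amb.conv (g i) (f i) x) sums u x"
    by (rule amb.herz_atomicE[OF u zero_less_one])
  define E where "E i = (\<lambda>(y, z). y \<otimes> inv z) ` ({y \<in> carrier G. g i y \<noteq> 0} \<times> {z \<in> carrier G. f i z \<noteq> 0})" for i
  have fg: "lp_fun MG p (f i)" "lp_fun MG q (g i)" for i using c(1) by (simp_all add: amb.atom_def)
  have "countable (E i)" for i
    unfolding E_def by (intro countable_image countable_SIGMA countable_support[OF fg(1)] countable_support[OF fg(2)])
  then have "countable (\<Union>i. E i)" by (intro countable_UN) auto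
  moreover have "{x. u x \<noteq> 0} \<subseteq> (\<Union>i. E i)"
  proof (rule subsetI, rule ccontr)
    fix x assume "x \<in> {x. u x \<noteq> 0}" and nx: "x \<notin> (\<Union>i. E i)"
    then have ux: "u x \<noteq> 0" by simp
    then have x: "x \<in> carrier G" using amb.herz_out[OF u] by blast
    have "amb.conv (g i) (f i) x = 0" for i
    proof -
      have "g i y * f i (inv x \<otimes> y) = 0" if y: "y \<in> carrier G" for y
      proof (rule ccontr)
        assume "g i y * f i (inv x \<otimes> y) \<noteq> 0"
        then have "(y, inv x \<otimes> y) \<in> {y \<in> carrier G. g i y \<noteq> 0} \<times> {z \<in> carrier G. f i z \<noteq> 0}" using x y by simp
        moreover have "x = y \<otimes> inv (inv x \<otimes> y)" using x y by (simp add: inv_mult_group) (simp add: x y flip: m_assoc)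
        ultimately have "x \<in> E i" unfolding E_def by (intro image_eqI[of _ _ "(y, inv x \<otimes> y)"]) simp_all
        then show False using nx by blast
      qed
      then have "amb.conv (g i) (f i) x = (\<integral>y. 0 \<partial>MG)"
        unfolding conv_check_def by (intro Bochner_Integration.integral_cong refl) simp
      then show ?thesis by simp
    qed
    then have "(\<lambda>i. 0) sums u x" using s x by auto
    from sums_unique2[OF this sums_zero] show False using ux by contradiction
  qed
  ultimately show ?thesis by (rule countable_subset[rotated])
qed

text \<open>A functional on the algebra of H is pulled back along \<open>rst\<close>, while the
  sequences are extended by zero. Contractivity of both maps keeps all bounds, and the values on
  products do not change.\<close>

lemma arens_regular_subgroup:
  assumes reg: "arens_regular amb.A amb.N" shows "arens_regular sub.A sub.N"
  unfolding sub.arens_regular_iff_double_limits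
proof (intro ballI allI impI)
  fix S a b R k l
  assume S: "S \<in> sub.D" and ab: "\<forall>n. a n \<in> sub.A \<and> sub.N (a n) \<le> R \<and> b n \<in> sub.A \<and> sub.N (b n) \<le> R"
    and dl: "sub.double_limits S a b k l"
  define S' where "S' u = (if u \<in> amb.A then S (rst u) else 0)" for u
  obtain C where C: "0 \<le> C" "\<And>u. u \<in> sub.A \<Longrightarrow> cmod (S u) \<le> C * sub.N u" using sub.dual_bound[OF S] by blast
  have "S' \<in> amb.D"
    unfolding dual_sp_def lin_on_def
  proof (intro CollectI conjI ballI allI impI)
    fix u v assume u: "u \<in> amb.A" and v: "v \<in> amb.A"
    have "rst (\<lambda>x. u x + v x) = (\<lambda>x. rst u x + rst v x)" by (auto simp: rst_def)
    then show "S' (\<lambda>x. u x + v x) = S' u + S' v"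
      using u v amb.add_mem[OF u v] sub.dual_add[OF S herz_restriction(1)[OF u] herz_restriction(1)[OF v]] by (simp add: S'_def)
  next
    fix c u assume u: "u \<in> amb.A"
    have "rst (\<lambda>x. c * u x) = (\<lambda>x. c * rst u x)" by (auto simp: rst_def)
    then show "S' (\<lambda>x. c * u x) = c * S' u"
      using u amb.scale_mem[OF u] sub.dual_scale[OF S herz_restriction(1)[OF u]] by (simp add: S'_def)
  next
    have "cmod (S' u) \<le> C * amb.N u" if "u \<in> amb.A" for u
      using C(2)[OF herz_restriction(1)[OF that]] mult_left_mono[OF herz_restriction(2)[OF that] C(1)] that by (simp add: S'_def)
    then show "\<exists>C. \<forall>u\<in>amb.A. cmod (S' u) \<le> C * amb.N u" by blast
  qed (simp add: S'_def)
  moreover have ab': "\<forall>n. a n \<in> amb.A \<and> amb.N (a n) \<le> R \<and> b n \<in> amb.A \<and> amb.N (b n) \<le> R"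
    using ab herz_extension order_trans by meson
  moreover have "S' (\<lambda>t. a n t * b m t) = S (\<lambda>t. a n t * b m t)" for n m
  proof -
    have m: "(\<lambda>t. a n t * b m t) \<in> sub.A" using ab by (intro sub.mult_mem) auto
    have "a n t = 0" if "t \<notin> H" for t using sub.herz_out[of "a n" t] ab that by simp
    then have "rst (\<lambda>t. a n t * b m t) = (\<lambda>t. a n t * b m t)" by (auto simp: rst_def)
    then show ?thesis using herz_extension(1)[OF m] by (simp add: S'_def)
  qed
  then have "amb.double_limits S' a b k l" using dl by (simp add: sub.double_limits_def amb.double_limits_def)
  ultimately show "k = l" using reg unfolding amb.arens_regular_iff_double_limits by blast
qed

text \<open>The opposite transfer, for sequences that live on H: the functional is restricted along
  the extension by zero, and the sequences stay in the ball of radius \<open>R\<close> by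
  \<open>herz_supported\<close>.\<close>

lemma double_limits_supported:
  assumes reg: "arens_regular sub.A sub.N" and S: "S \<in> amb.D"
    and ab: "\<forall>n. a n \<in> amb.A \<and> amb.N (a n) \<le> R \<and> b n \<in> amb.A \<and> amb.N (b n) \<le> R"
    and supp: "\<forall>n x. x \<notin> H \<longrightarrow> a n x = 0 \<and> b n x = 0"
    and dl: "amb.double_limits S a b k l"
  shows "k = l"
proof -
  define S' where "S' u = (if u \<in> sub.A then S u else 0)" for u
  obtain C where C: "0 \<le> C" "\<And>u. u \<in> amb.A \<Longrightarrow> cmod (S u) \<le> C * amb.N u" using amb.dual_bound[OF S] by blast
  have "S' \<in> sub.D"
    unfolding dual_sp_def lin_on_def
  proof (intro CollectI conjI ballI allI impI)
    fix u v assume u: "u \<in> sub.A" and v: "v \<in> sub.A"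
    show "S' (\<lambda>x. u x + v x) = S' u + S' v"
      using u v sub.add_mem[OF u v] amb.dual_add[OF S herz_extension(1)[OF u] herz_extension(1)[OF v]] by (simp add: S'_def)
  next
    fix c u assume u: "u \<in> sub.A"
    show "S' (\<lambda>x. c * u x) = c * S' u"
      using u sub.scale_mem[OF u] amb.dual_scale[OF S herz_extension(1)[OF u]] by (simp add: S'_def)
  next
    have "cmod (S' u) \<le> C * sub.N u" if "u \<in> sub.A" for u
      using C(2)[OF herz_extension(1)[OF that]] mult_left_mono[OF herz_extension(2)[OF that] C(1)] that by (simp add: S'_def)
    then show "\<exists>C. \<forall>u\<in>sub.A. cmod (S' u) \<le> C * sub.N u" by blast
  qed (simp add: S'_def)
  moreover have ab': "\<forall>n. a n \<in> sub.A \<and> sub.N (a n) \<le> R \<and> b n \<in> sub.A \<and> sub.N (b n) \<le> R"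
  proof
    fix n
    have "a n \<in> sub.A" "sub.N (a n) \<le> amb.N (a n)" by (rule herz_supported; use ab supp in blast)+
    moreover have "b n \<in> sub.A" "sub.N (b n) \<le> amb.N (b n)" by (rule herz_supported; use ab supp in blast)+
    ultimately show "a n \<in> sub.A \<and> sub.N (a n) \<le> R \<and> b n \<in> sub.A \<and> sub.N (b n) \<le> R"
      using ab order_trans by blast
  qed
  moreover have "S' (\<lambda>t. a n t * b m t) = S (\<lambda>t. a n t * b m t)" for n m
    using sub.mult_mem[of "a n" "b m"] ab' by (simp add: S'_def)
  then have "sub.double_limits S' a b k l" using dl by (simp add: sub.double_limits_def amb.double_limits_def)
  ultimately show "k = l" using reg unfolding sub.arens_regular_iff_double_limits by blast
qed

end

lemma (in group) countable_subgroup_superset: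
  assumes S: "countable S" "S \<subseteq> carrier G"
  shows "\<exists>H. subgroup H G \<and> countable H \<and> S \<subseteq> H"
proof -
  \<comment> \<open>Iterates x y^-1, starting from S with the identity added. The identity makes the
    stages increase, so two elements of the union meet in a common stage, and each stage remains
    countable.\<close>
  define E where "E = rec_nat (insert \<one> S) (\<lambda>_ X. (\<lambda>(x, y). x \<otimes> inv y) ` (X \<times> X))"
  have E0: "E 0 = insert \<one> S" and ES: "E (Suc n) = (\<lambda>(x, y). x \<otimes> inv y) ` (E n \<times> E n)" for n
    by (simp_all add: E_def)
  have Ec: "E n \<subseteq> carrier G" for n
  proof (induction n)
    case (Suc n) then show ?case unfolding ES by (auto dest: subsetD)
  qed (use S in \<open>simp add: E0\<close>)
  have one: "\<one> \<in> E n" for n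
  proof (induction n)
    case (Suc n)
    then show ?case unfolding ES by (intro image_eqI[of _ _ "(\<one>, \<one>)"]) simp_all
  qed (simp add: E0)
  have "E n \<subseteq> E (Suc n)" for n
  proof (rule subsetI)
    fix x assume "x \<in> E n"
    then show "x \<in> E (Suc n)" unfolding ES using one[of n] Ec[of n] by (intro image_eqI[of _ _ "(x, \<one>)"]) auto
  qed
  then have mono: "E m \<subseteq> E n" if "m \<le> n" for m n using that by (rule lift_Suc_mono_le)
  have cE: "countable (E n)" for n
    by (induction n) (use S in \<open>auto simp: E0 ES\<close>)
  have div: "\<exists>k. x \<otimes> inv y \<in> E k" if "x \<in> E m" "y \<in> E n" for x y m n
  proof -
    have "(x, y) \<in> E (max m n) \<times> E (max m n)" using that mono[of m "max m n"] mono[of n "max m n"] by auto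
    then have "x \<otimes> inv y \<in> E (Suc (max m n))" unfolding ES by (intro image_eqI[of _ _ "(x, y)"]) simp_all
    then show ?thesis by (rule exI)
  qed
  define H where "H = (\<Union>n. E n)"
  have HE: "x \<in> H \<longleftrightarrow> (\<exists>n. x \<in> E n)" for x by (simp add: H_def)
  have Hc: "H \<subseteq> carrier G" unfolding H_def using Ec by (intro UN_least)
  have inv: "inv x \<in> H" if x: "x \<in> H" for x
  proof -
    obtain n where n: "x \<in> E n" using x unfolding HE by (elim exE)
    have "\<exists>k. \<one> \<otimes> inv x \<in> E k" by (rule div[OF one[of 0] n])
    moreover have "\<one> \<otimes> inv x = inv x" using x Hc by (intro l_one inv_closed) (rule subsetD)
    ultimately show ?thesis unfolding HE by simp
  qed
  have "subgroup H G"
  proof (rule subgroupI)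
    show "H \<subseteq> carrier G" by (rule Hc)
    show "H \<noteq> {}" using HE one by blast
    show "inv x \<in> H" if "x \<in> H" for x by (rule inv[OF that])
    show "x \<otimes> y \<in> H" if x: "x \<in> H" and y: "y \<in> H" for x y
    proof -
      obtain m where m: "x \<in> E m" using x unfolding HE by (elim exE)
      obtain n where n: "inv y \<in> E n" using inv[OF y] unfolding HE by (elim exE)
      have "inv (inv y) = y" using y Hc by (intro inv_inv) (rule subsetD)
      then show ?thesis using div[OF m n] unfolding HE by simp
    qed
  qed
  moreover have "countable H" unfolding H_def using cE by (intro countable_UN) auto
  moreover have "S \<subseteq> H" unfolding H_def using E0 by blast
  ultimately show ?thesis by (intro exI[of _ H] conjI)
qed

theorem theorem3p1:
  fixes G :: "('a, 'b) monoid_scheme" and T :: "'a topology" and \<mu> :: "'a measure" and p :: real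
  assumes "lc_group G T"
    and "left_haar G T \<mu>"
    and "1 < p"
  shows "herz_arens_regular G \<mu> p \<longleftrightarrow>
           (T = discrete_topology (carrier G)
            \<and> (\<forall>H \<nu>. subgroup H G \<longrightarrow> countable H
                 \<longrightarrow> left_haar (G\<lparr>carrier := H\<rparr>) (subtopology T H) \<nu>
                 \<longrightarrow> herz_arens_regular (G\<lparr>carrier := H\<rparr>) \<nu> p))"
    (is "?reg \<longleftrightarrow> ?discrete \<and> ?subgroups")
proof -
  interpret haar_group G T \<mu> p "conj_exp p"
    using assms by unfold_locales simp_all
  have reg: "?reg \<longleftrightarrow> arens_regular (herz G (count_space (carrier G)) p) (herz_norm G (count_space (carrier G)) p)" if d: ?discrete
    unfolding herz_arens_regular_def herz_discrete[OF d] ..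
  have ds: "discrete_subgroup G H p (conj_exp p)" if "subgroup H G" for H
    using that assms(3) is_group by (simp add: discrete_subgroup_def discrete_subgroup_axioms_def)
  have subreg: "herz_arens_regular (G\<lparr>carrier := H\<rparr>) \<nu> p \<longleftrightarrow>
      arens_regular (herz (G\<lparr>carrier := H\<rparr>) (count_space H) p) (herz_norm (G\<lparr>carrier := H\<rparr>) (count_space H) p)"
    if H: "subgroup H G" and nu: "left_haar (G\<lparr>carrier := H\<rparr>) (discrete_topology H) \<nu>" for H \<nu>
  proof -
    interpret d: discrete_subgroup G H p "conj_exp p" by (rule ds[OF H])
    interpret h: haar_group "G\<lparr>carrier := H\<rparr>" "discrete_topology H" \<nu> p "conj_exp p"
      using d.sub.lc nu assms(3) by unfold_locales simp_all
    have "discrete_topology H = discrete_topology (carrier (G\<lparr>carrier := H\<rparr>))" by simp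
    from h.herz_discrete[OF this] show ?thesis by (simp add: herz_arens_regular_def)
  qed
  have st: "subtopology T H = discrete_topology H" if "subgroup H G" and d: ?discrete for H
  proof -
    have "carrier G \<inter> H = H" using subgroup.subset[OF that(1)] by blast
    then show ?thesis unfolding d subtopology_discrete_topology by (rule arg_cong)
  qed
  show ?thesis
  proof
    assume r: ?reg
    then have d: ?discrete unfolding herz_arens_regular_def by (rule arens_regular_imp_discrete)
    have ?subgroups
    proof (intro allI impI)
      fix H \<nu> assume H: "subgroup H G" and nu: "left_haar (G\<lparr>carrier := H\<rparr>) (subtopology T H) \<nu>"
      interpret d: discrete_subgroup G H p "conj_exp p" by (rule ds[OF H])
      show "herz_arens_regular (G\<lparr>carrier := H\<rparr>) \<nu> p"
        unfolding subreg[OF H nu[unfolded st[OF H d]]]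
        by (rule d.arens_regular_subgroup) (use r reg[OF d] in simp)
    qed
    with d show "?discrete \<and> ?subgroups" ..
  next
    assume ds': "?discrete \<and> ?subgroups"
    then have d: ?discrete and sr: ?subgroups by (rule conjunct1, rule conjunct2)
    \<comment> \<open>The instance H = carrier G supplies the facts about the ambient algebra, such
      as countability of supports, before the countable subgroup has been found.\<close>
    interpret c: discrete_subgroup G "carrier G" p "conj_exp p" by (rule ds[OF subgroup_self])
    show ?reg
      unfolding reg[OF d] c.amb.arens_regular_iff_double_limits
    proof (intro ballI allI impI)
      fix S a b R k l
      assume S: "S \<in> c.amb.D" and ab: "\<forall>n. a n \<in> c.amb.A \<and> c.amb.N (a n) \<le> R \<and> b n \<in> c.amb.A \<and> c.amb.N (b n) \<le> R"
        and dl: "c.amb.double_limits S a b k l"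
      define E where "E = (\<Union>n. {x. a n x \<noteq> 0} \<union> {x. b n x \<noteq> 0})"
      have cE: "countable E"
        unfolding E_def using ab by (intro countable_UN countable_Un c.herz_countable_support) auto
      have EG: "E \<subseteq> carrier G"
      proof (rule subsetI, rule ccontr)
        fix x assume x: "x \<in> E" and nx: "x \<notin> carrier G"
        have "a n x = 0" "b n x = 0" for n using ab c.amb.herz_out[OF _ nx] by simp_all
        then show False using x by (simp add: E_def)
      qed
      obtain H where H: "subgroup H G" "countable H" "E \<subseteq> H"
        using countable_subgroup_superset[OF cE EG] by (elim exE conjE)
      interpret d: discrete_subgroup G H p "conj_exp p" by (rule ds[OF H(1)])
      \<comment> \<open>The assumption on subgroups is applied with counting measure, which is a
        Haar measure for the discrete subspace topology of H.\<close>
      have "herz_arens_regular (G\<lparr>carrier := H\<rparr>) (count_space H) p"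
        by (rule sr[rule_format, OF H(1,2)]) (unfold st[OF H(1) d], rule d.sub.haar)
      then have ra: "arens_regular d.sub.A d.sub.N" unfolding herz_arens_regular_def .
      have supp: "\<forall>n x. x \<notin> H \<longrightarrow> a n x = 0 \<and> b n x = 0" using H(3) unfolding E_def by blast
      show "k = l" by (rule d.double_limits_supported[OF ra S ab supp dl])
    qed
  qed
qed

end
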